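(* Suppose that $\ell\ge r\ge 2$ are integers and $F\in\mathcal{F}^r_{\ell+1}$. Then there exist constants $N_0$ and $c_F>0$ such that for all integers $n\ge N_0$ and all integers $t\in[0,c_Fn]$ we have \[ \mathrm{EX}\left(n,(t+1)H^F_{\ell+1}\right)=\{K_t^r\bowtie T_r(n-t,\ell)\}. \]
   Context: For an $r$-graph (or pattern) $P$ with vertex set $[k]$, a $P$-construction is an $r$-graph on a set $V$ partitioned as $V_1\cup\dots\cup V_k$ whose edges are all $r$-subsets meeting $r$ distinct parts $V_{i_1},\dots,V_{i_r}$ with $\{i_1,\dots,i_r\}\in P$; a $P$-subconstruction is a subgraph of a $P$-construction. The Lagrangian $\lambda(\mathcal{H})=\lim_{n\to\infty}\Lambda(\mathcal{H},n)/\binom{n}{r}$, where $\Lambda(\mathcal{H},n)$ is the maximum number of edges of an $n$-vertex $\mathcal{H}$-construction. $K_\ell^r$ is the complete $r$-graph on $\ell$ vertices. $B(r,\ell+1)$ is the $r$-graph on $[\ell+1]$ with edge set $\{[r]\}\cup\{e\subseteq[2,\ell+1]: |e|=r,\ |e\cap[2,r]|\le 1\}$. $\mathcal{F}^r_{\ell+1}$ is the family of $r$-graphs $F$ on $\ell+1$ vertices such that (a) $\sup\{\lambda(\mathcal{H}):\mathcal{H}\text{ is }F\text{-free and not a }K_\ell^r\text{-subconstruction}\}<\frac{\ell(\ell-1)\cdots(\ell-r+1)}{\ell^r}$, and (b) either $F$ has an isolated vertex or $F$ is (isomorphic to) a subgraph of $B(r,\ell+1)$. For an $r$-graph $F$ on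 $\ell+1$ vertices, its expansion $H^F_{\ell+1}$ is obtained from $F$ by adding, for every pair $\{u,v\}\subseteq V(F)$ not contained in any edge of $F$, an edge $\{u,v\}\cup B_{uv}$ where $B_{uv}$ is a set of $r-2$ new vertices, these sets pairwise disjoint. $T_r(n,\ell)$ is the $r$-graph on $[n]$ partitioned into $\ell$ parts of sizes $\lfloor n/\ell\rfloor$ or $\lceil n/\ell\rceil$, with edges all $r$-sets having at most one vertex in each part. $K_t^r$ is the complete $r$-graph on $t$ vertices; $\mathcal{G}\bowtie\mathcal{H}$ (disjoint vertex sets) consists of the edges of both plus all $r$-subsets meeting both vertex sets. $\mathrm{EX}(n,(t+1)F')$ is the set (up to isomorphism) of $n$-vertex $r$-graphs not containing $t+1$ pairwise vertex-disjoint copies of $F'$ with the maximum number of edges among such. *)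

theory Defs
  imports Complex_Main "HOL-Library.Extended_Real" "HOL-Library.Disjoint_Sets"
begin

text \<open>
  A hypergraph is a pair of vertex set and edge set. The vertex set is carried explicitly, because
  isolated vertices matter here.
\<close>

type_synonym 'a hgraph = "'a set \<times> 'a set set"

abbreviation verts :: "'a hgraph \<Rightarrow> 'a set" where "verts \<equiv> fst"
abbreviation edges :: "'a hgraph \<Rightarrow> 'a set set" where "edges \<equiv> snd"

definition rgraph :: "nat \<Rightarrow> 'a hgraph \<Rightarrow> bool" where
  "rgraph r G \<longleftrightarrow> finite (verts G) \<and> (\<forall>e\<in>edges G. e \<subseteq> verts G \<and> card e = r)"

definition subgraph :: "'a hgraph \<Rightarrow> 'a hgraph \<Rightarrow> bool" where
  "subgraph H G \<longleftrightarrow> verts H \<subseteq> verts G \<and> edges H \<subseteq> edges G"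

definition embeds :: "('a \<Rightarrow> 'b) \<Rightarrow> 'a hgraph \<Rightarrow> 'b hgraph \<Rightarrow> bool" where
  "embeds f F G \<longleftrightarrow>
     inj_on f (verts F) \<and> f ` verts F \<subseteq> verts G \<and> (\<forall>e\<in>edges F. f ` e \<in> edges G)"

definition contains :: "'b hgraph \<Rightarrow> 'a hgraph \<Rightarrow> bool" where
  "contains G F \<longleftrightarrow> (\<exists>f. embeds f F G)"

definition contains_disjoint_copies :: "nat \<Rightarrow> 'a hgraph \<Rightarrow> 'b hgraph \<Rightarrow> bool" where
  "contains_disjoint_copies m F G \<longleftrightarrow>
     (\<exists>f. (\<forall>i<m. embeds (f i) F G) \<and> disjoint_family_on (\<lambda>i. f i ` verts F) {..<m})"

definition isomorphic :: "'a hgraph \<Rightarrow> 'b hgraph \<Rightarrow> bool" where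
  "isomorphic G H \<longleftrightarrow> (\<exists>f. bij_betw f (verts G) (verts H) \<and> edges H = (\<lambda>e. f ` e) ` edges G)"

text \<open>Isomorphism classes of finite hypergraphs on any vertex type are represented over \<open>nat\<close>.\<close>

definition iso_class :: "'a hgraph \<Rightarrow> nat hgraph set" where
  "iso_class G = {H. isomorphic G H}"

text \<open>The parts \<open>V i\<close> of a construction are allowed to be empty.\<close>

definition is_construction :: "nat \<Rightarrow> 'a hgraph \<Rightarrow> 'b hgraph \<Rightarrow> bool" where
  "is_construction r P G \<longleftrightarrow>
     finite (verts G) \<and>
     (\<exists>V. disjoint_family_on V (verts P) \<and> verts G = (\<Union>i\<in>verts P. V i) \<and>
          edges G = {e. e \<subseteq> verts G \<and> card e = r \<and> {i \<in> verts P. e \<inter> V i \<noteq> {}} \<in> edges P})"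

definition is_subconstruction :: "nat \<Rightarrow> 'a hgraph \<Rightarrow> 'b hgraph \<Rightarrow> bool" where
  "is_subconstruction r P H \<longleftrightarrow> (\<exists>G. is_construction r P G \<and> subgraph H G)"

definition max_construction :: "nat \<Rightarrow> 'a hgraph \<Rightarrow> nat \<Rightarrow> nat" where
  "max_construction r P n =
     Max {card (edges G) | G :: nat hgraph. is_construction r P G \<and> card (verts G) = n}"

definition lagrangian :: "nat \<Rightarrow> 'a hgraph \<Rightarrow> real" where
  "lagrangian r P = lim (\<lambda>n. real (max_construction r P n) / real (n choose r))"

definition complete_rgraph :: "nat \<Rightarrow> nat \<Rightarrow> nat hgraph" where
  "complete_rgraph r l = ({1..l}, {e. e \<subseteq> {1..l} \<and> card e = r})"

text \<open>\<open>B_rgraph r l\<close> is the hypergraph $B(r,l)$ on \<open>{1..l}\<close>.\<close>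

definition B_rgraph :: "nat \<Rightarrow> nat \<Rightarrow> nat hgraph" where
  "B_rgraph r l =
     ({1..l}, {{1..r}} \<union> {e. e \<subseteq> {2..l} \<and> card e = r \<and> card (e \<inter> {2..r}) \<le> 1})"

definition has_isolated_vertex :: "'a hgraph \<Rightarrow> bool" where
  "has_isolated_vertex F \<longleftrightarrow> (\<exists>v\<in>verts F. \<forall>e\<in>edges F. v \<notin> e)"

text \<open>
  \<open>F_family r l\<close> is the family $\mathcal{F}^r_l$, with the subscript \<open>l\<close> being the number of
  vertices. The supremum is taken in the extended reals since it may range over the empty set, for
  example if \<open>F\<close> has no edges.
\<close>

definition F_family :: "nat \<Rightarrow> nat \<Rightarrow> 'a hgraph set" where
  "F_family r l = {F. rgraph r F \<and> card (verts F) = l \<and>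
     Sup {ereal (lagrangian r H) | H :: nat hgraph.
            rgraph r H \<and> \<not> contains H F \<and>
            \<not> is_subconstruction r (complete_rgraph r (l - 1)) H}
       < ereal ((\<Prod>i<r. real (l - 1) - real i) / real (l - 1) ^ r) \<and>
     (has_isolated_vertex F \<or> contains (B_rgraph r l) F)}"

text \<open>
  In the expansion, \<open>Inl v\<close> are the original vertices and \<open>Inr ({u, v}, i)\<close> with \<open>i < r - 2\<close>
  are the new vertices forming $B_{uv}$.
\<close>

definition uncovered_pairs :: "'a hgraph \<Rightarrow> 'a set set" where
  "uncovered_pairs F = {p. p \<subseteq> verts F \<and> card p = 2 \<and> (\<forall>e\<in>edges F. \<not> p \<subseteq> e)}"

definition expansion :: "nat \<Rightarrow> 'a hgraph \<Rightarrow> ('a + 'a set \<times> nat) hgraph" where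
  "expansion r F =
     (verts F <+> (uncovered_pairs F \<times> {..<r - 2}),
      (\<lambda>e. Inl ` e) ` edges F \<union>
      (\<lambda>p. Inl ` p \<union> Inr ` ({p} \<times> {..<r - 2})) ` uncovered_pairs F)"

text \<open>The \<open>l\<close> parts of the Turan hypergraph are the residue classes modulo \<open>l\<close> in \<open>{1..n}\<close>.\<close>

definition turan_rgraph :: "nat \<Rightarrow> nat \<Rightarrow> nat \<Rightarrow> nat hgraph" where
  "turan_rgraph r n l =
     ({1..n}, {e. e \<subseteq> {1..n} \<and> card e = r \<and>
                  (\<forall>j<l. card (e \<inter> {v \<in> {1..n}. v mod l = j}) \<le> 1)})"

text \<open>Disjointness of the two vertex sets is enforced by the sum type.\<close>

definition hjoin :: "nat \<Rightarrow> 'a hgraph \<Rightarrow> 'b hgraph \<Rightarrow> ('a + 'b) hgraph" where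
  "hjoin r G H =
     (verts G <+> verts H,
      (\<lambda>e. Inl ` e) ` edges G \<union> (\<lambda>e. Inr ` e) ` edges H \<union>
      {e. e \<subseteq> verts G <+> verts H \<and> card e = r \<and>
          e \<inter> Inl ` verts G \<noteq> {} \<and> e \<inter> Inr ` verts H \<noteq> {}})"

definition copies_free :: "nat \<Rightarrow> nat \<Rightarrow> nat \<Rightarrow> 'a hgraph \<Rightarrow> nat hgraph set" where
  "copies_free r n m F =
     {G. rgraph r G \<and> card (verts G) = n \<and> \<not> contains_disjoint_copies m F G}"

text \<open>\<open>extremal_classes r n m F\<close> is $\mathrm{EX}(n, mF)$ as a set of isomorphism classes.\<close>

definition extremal_classes :: "nat \<Rightarrow> nat \<Rightarrow> nat \<Rightarrow> 'a hgraph \<Rightarrow> nat hgraph set set" where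
  "extremal_classes r n m F =
     iso_class ` {G \<in> copies_free r n m F.
                    \<forall>G'\<in>copies_free r n m F. card (edges G') \<le> card (edges G)}"

end

theory Submission
  imports Defs "HOL-Library.FuncSet" "HOL-Library.Nat_Bijection"
begin

text \<open>
  Call a pair of vertices heavy if no bounded set of other vertices meets all edges through it. A
  copy of \<open>F\<close> whose pairs are all heavy extends greedily to the expansion \<open>H\<close> of \<open>F\<close>. So, after
  deleting the few edges containing a light pair, an \<open>H\<close>-free hypergraph contains no copy of \<open>F\<close>
  all of whose pairs are covered by edges, and this property, unlike \<open>H\<close>-freeness, survives Zykov
  symmetrization. The Lagrangian gap makes a dense symmetrized hypergraph \<open>l\<close>-partite. Undoing the
  symmetrization one clone at a time, with the classification of vertices below, gives stability.

  Condition (b) provides copies of \<open>F\<close> in the complete hypergraph on \<open>l\<close> vertices with one more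
  vertex that is isolated or attached as in \<open>B(r, l + 1)\<close>. Hence in a nearly complete \<open>l\<close>-partite
  \<open>H\<close>-free hypergraph no degree exceeds the Turan degree by much, and two vertices of large degree
  belonging to the same part lie in no common edge. A vertex set that is minimal for exceeding the
  Turan numbers has only vertices of large degree, so this determines the extremal hypergraphs of \<open>H\<close>.

  For \<open>t + 1\<close> disjoint copies, each vertex \<open>v\<close> such that no small set avoiding \<open>v\<close> meets all copies
  of \<open>H\<close> can absorb one copy, so there are at most \<open>t\<close> such vertices; all others have degree at
  most about the Turan degree. Deleting the former and a maximal packing of the remaining copies
  leaves an \<open>H\<close>-free hypergraph, and an edge count forces exactly \<open>t\<close> such vertices and an empty
  packing.
\<close>

section \<open>Transversals and elementary symmetric sums\<close>

text \<open>Let \<open>alpha\<close> and \<open>beta\<close> be the leading coefficients of the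
  Turan number and of its increment. As \<open>beta = r * alpha\<close>, deleting vertices of degree
  about \<open>beta * n^(r-1)\<close> keeps a hypergraph near the Turan density, so in a dense free
  hypergraph vertices of clearly smaller degree are rare. As \<open>beta < 1 / fact (r - 1)\<close>,
  a vertex lying in all possible edges beats a Turan vertex by a fixed proportion, while exchanging
  the vertices of a packed copy for Turan vertices is almost neutral; this is why absorbing vertices
  win.

  The danger in undoing an unbounded number of clonings is that errors add up. One cloning affects
  only edges at one vertex, so the partition found for the clone is still good enough to classify
  the vertices of the original. Sorting them by type gives a new partition whose error depends on
  the number of edges alone, and the same bound survives every step.

  Heaviness is always measured in the full edge set, so the edges completing an expansion may be
  among those deleted.\<close>

definition transv :: "('i \<Rightarrow> 'v set) \<Rightarrow> 'i set \<Rightarrow> 'v set set" where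
  "transv P J = (\<lambda>b. b ` J) ` PiE J P"

text \<open>The edges of the complete partite \<open>k\<close>-graph. Finiteness is demanded because
  infinite sets have \<open>card\<close> 0 as well.\<close>

definition cross :: "('i \<Rightarrow> 'v set) \<Rightarrow> 'i set \<Rightarrow> nat \<Rightarrow> 'v set set" where
  "cross P I k = {e. e \<subseteq> (\<Union>i\<in>I. P i) \<and> card e = k \<and> finite e \<and> (\<forall>i\<in>I. card (e \<inter> P i) \<le> 1)}"

definition esym :: "'i set \<Rightarrow> nat \<Rightarrow> ('i \<Rightarrow> nat) \<Rightarrow> nat" where
  "esym I k x = (\<Sum>J | J \<subseteq> I \<and> card J = k. \<Prod>j\<in>J. x j)"

lemma disjoint_family_onD': "disjoint_family_on P I \<Longrightarrow> i \<in> I \<Longrightarrow> j \<in> I \<Longrightarrow> x \<in> P i \<Longrightarrow> x \<in> P j \<Longrightarrow> i = j"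
  unfolding disjoint_family_on_def by blast

lemma transversal_Int:
  assumes "disjoint_family_on P I" "J \<subseteq> I" "b \<in> PiE J P" "i \<in> I"
  shows "b ` J \<inter> P i = (if i \<in> J then {b i} else {})"
proof -
  have "j = i" if "j \<in> J" "b j \<in> P i" for j
    using disjoint_family_onD'[OF assms(1), of j i "b j"] that assms(2-4) by (auto simp: PiE_iff)
  then show ?thesis using assms(3) by (auto simp: PiE_iff)
qed

lemma inj_on_transversal:
  assumes "disjoint_family_on P J"
  shows "inj_on (\<lambda>b. b ` J) (PiE J P)"
proof (rule inj_onI)
  fix b c assume b: "b \<in> PiE J P" and c: "c \<in> PiE J P" and eq: "b ` J = c ` J"
  have "b j = c j" if "j \<in> J" for j
    using transversal_Int[OF assms order_refl b that] transversal_Int[OF assms order_refl c that] eq that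
    by auto
  with b c show "b = c" by (auto intro: PiE_ext)
qed

lemma transversal_inj:
  assumes "disjoint_family_on P J" "b \<in> PiE J P"
  shows "inj_on b J"
  using assms by (auto intro!: inj_onI simp: PiE_iff dest: disjoint_family_onD')

lemma card_transv:
  assumes "disjoint_family_on P J" "finite J"
  shows "card (transv P J) = (\<Prod>j\<in>J. card (P j))"
  unfolding transv_def by (simp add: card_image inj_on_transversal assms card_PiE)

lemma finite_transv: "finite J \<Longrightarrow> (\<And>j. j \<in> J \<Longrightarrow> finite (P j)) \<Longrightarrow> finite (transv P J)"
  unfolding transv_def by (intro finite_imageI finite_PiE) auto

lemma transvI:
  assumes "f \<subseteq> (\<Union>i\<in>J. P i)" "\<And>i. i \<in> J \<Longrightarrow> card (f \<inter> P i) = 1"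
  shows "f \<in> transv P J"
proof -
  have "\<forall>i\<in>J. \<exists>x. f \<inter> P i = {x}" using assms(2) by (auto simp: card_1_singleton_iff)
  then obtain b where b: "\<And>i. i \<in> J \<Longrightarrow> f \<inter> P i = {b i}" by metis
  have "restrict b J \<in> PiE J P" using b by auto
  moreover have "restrict b J ` J = f"
  proof
    show "restrict b J ` J \<subseteq> f" using b by auto
    show "f \<subseteq> restrict b J ` J"
    proof
      fix x assume x: "x \<in> f"
      with assms(1) obtain i where "i \<in> J" "x \<in> P i" by auto
      with b[of i] x show "x \<in> restrict b J ` J" by auto
    qed
  qed
  ultimately show ?thesis unfolding transv_def by (metis image_eqI)
qed

lemma transvD:
  assumes "f \<in> transv P J" "disjoint_family_on P I" "J \<subseteq> I" "finite J"
  shows "f \<subseteq> (\<Union>i\<in>J. P i)" "card f = card J" "finite f"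
    and "\<And>i. i \<in> I \<Longrightarrow> card (f \<inter> P i) = (if i \<in> J then 1 else 0)"
proof -
  obtain b where b: "b \<in> PiE J P" "f = b ` J" using assms(1) unfolding transv_def by auto
  have dJ: "disjoint_family_on P J" using assms(2,3) by (rule disjoint_family_on_mono[rotated])
  show "f \<subseteq> (\<Union>i\<in>J. P i)" using b by (auto simp: PiE_iff)
  show "card f = card J" using b transversal_inj[OF dJ b(1)] by (simp add: card_image)
  show "finite f" using b assms(4) by simp
  show "card (f \<inter> P i) = (if i \<in> J then 1 else 0)" if "i \<in> I" for i
    using transversal_Int[OF assms(2,3) b(1) that] b(2) by auto
qed

lemma cross_eq_UN_transv:
  assumes "disjoint_family_on P I" "finite I"
  shows "cross P I k = (\<Union>J\<in>{J. J \<subseteq> I \<and> card J = k}. transv P J)"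
proof (intro set_eqI iffI)
  fix e assume e: "e \<in> cross P I k"
  define J where "J = {i\<in>I. e \<inter> P i \<noteq> {}}"
  have fe: "finite e" and sub: "e \<subseteq> (\<Union>i\<in>I. P i)" and one: "\<And>i. i \<in> I \<Longrightarrow> card (e \<inter> P i) \<le> 1" and ce: "card e = k"
    using e unfolding cross_def by auto
  have tr: "e \<in> transv P J"
  proof (rule transvI)
    show "e \<subseteq> (\<Union>i\<in>J. P i)" using sub unfolding J_def by blast
    show "card (e \<inter> P i) = 1" if "i \<in> J" for i
      using that one[of i] fe by (auto simp: J_def le_Suc_eq)
  qed
  have "J \<subseteq> I" by (auto simp: J_def)
  moreover have "card J = k"
    using transvD(2)[OF tr assms(1) \<open>J \<subseteq> I\<close>] finite_subset[OF \<open>J \<subseteq> I\<close> assms(2)] ce by simp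
  ultimately show "e \<in> (\<Union>J\<in>{J. J \<subseteq> I \<and> card J = k}. transv P J)" using tr by auto
next
  fix e assume "e \<in> (\<Union>J\<in>{J. J \<subseteq> I \<and> card J = k}. transv P J)"
  then obtain J where J: "J \<subseteq> I" "card J = k" "e \<in> transv P J" by auto
  note * = transvD[OF J(3) assms(1) J(1) finite_subset[OF J(1) assms(2)]]
  show "e \<in> cross P I k" unfolding cross_def using * J by force
qed

text \<open>A transversal determines its index set, as the set of parts it meets, so the union is
  disjoint. The family of index sets is arbitrary in order to serve both complete partite
  hypergraphs and constructions from a pattern.\<close>

lemma card_UN_transv:
  assumes "disjoint_family_on P I" "finite I" "\<And>i. i \<in> I \<Longrightarrow> finite (P i)" "\<J> \<subseteq> Pow I"
  shows "card (\<Union>J\<in>\<J>. transv P J) = (\<Sum>J\<in>\<J>. \<Prod>j\<in>J. card (P j))"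
proof -
  have fin: "finite J" if "J \<in> \<J>" for J using that assms(2,4) by (auto intro: finite_subset)
  have dis: "transv P J \<inter> transv P K = {}" if "J \<in> \<J>" "K \<in> \<J>" "J \<noteq> K" for J K
  proof (rule ccontr)
    assume "transv P J \<inter> transv P K \<noteq> {}"
    then obtain f where f: "f \<in> transv P J" "f \<in> transv P K" by auto
    have JK: "J \<subseteq> I" "K \<subseteq> I" using \<open>J \<in> \<J>\<close> \<open>K \<in> \<J>\<close> assms(4) by auto
    have "i \<in> J \<longleftrightarrow> i \<in> K" if "i \<in> I" for i
      using transvD(4)[OF f(1) assms(1) JK(1) fin[OF \<open>J \<in> \<J>\<close>] that] transvD(4)[OF f(2) assms(1) JK(2) fin[OF \<open>K \<in> \<J>\<close>] that]
      by (metis zero_neq_one)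
    with \<open>J \<noteq> K\<close> JK show False by blast
  qed
  have "card (\<Union>J\<in>\<J>. transv P J) = (\<Sum>J\<in>\<J>. card (transv P J))"
  proof (rule card_UN_disjoint)
    show "finite \<J>" using assms(2,4) by (meson finite_Pow_iff finite_subset)
    show "\<forall>J\<in>\<J>. finite (transv P J)" using fin assms(3,4) by (blast intro: finite_transv)
    show "\<forall>J\<in>\<J>. \<forall>K\<in>\<J>. J \<noteq> K \<longrightarrow> transv P J \<inter> transv P K = {}" using dis by blast
  qed
  also have "\<dots> = (\<Sum>J\<in>\<J>. \<Prod>j\<in>J. card (P j))"
    by (intro sum.cong refl card_transv fin disjoint_family_on_mono[OF _ assms(1)]) (use assms(4) in auto)
  finally show ?thesis .
qed

lemma card_cross:
  assumes "disjoint_family_on P I" "finite I" "\<And>i. i \<in> I \<Longrightarrow> finite (P i)"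
  shows "card (cross P I k) = esym I k (\<lambda>i. card (P i))"
  unfolding cross_eq_UN_transv[OF assms(1,2)] esym_def
  by (rule card_UN_transv) (use assms in auto)

lemma finite_cross:
  assumes "finite I" "\<And>i. i \<in> I \<Longrightarrow> finite (P i)"
  shows "finite (cross P I k)"
  by (rule finite_subset[of _ "Pow (\<Union>i\<in>I. P i)"]) (use assms in \<open>auto simp: cross_def\<close>)

text \<open>A tuple is recovered from its image on \<open>J\<close> and its restriction to
  \<open>I - J\<close>. This turns a bound on the number of bad edges into a bound on the number of
  tuples that contain one.\<close>

lemma card_tuples_le:
  assumes "disjoint_family_on P I" "finite I" "\<And>i. i \<in> I \<Longrightarrow> finite (P i) \<and> card (P i) \<le> n" "J \<subseteq> I" "finite B"
  shows "card {b \<in> PiE I P. b ` J \<in> B} \<le> card B * n ^ card (I - J)"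
proof -
  let ?h = "\<lambda>b. (b ` J, restrict b (I - J))"
  have "inj_on ?h {b \<in> PiE I P. b ` J \<in> B}"
  proof (rule inj_onI)
    fix b c assume b: "b \<in> {b \<in> PiE I P. b ` J \<in> B}" and c: "c \<in> {b \<in> PiE I P. b ` J \<in> B}" and eq: "?h b = ?h c"
    have b': "restrict b J \<in> PiE J P" "restrict c J \<in> PiE J P" using b c assms(4) by (auto simp: PiE_iff)
    have dJ: "disjoint_family_on P J" using assms(1,4) by (rule disjoint_family_on_mono[rotated])
    have 1: "restrict b J = restrict c J"
      by (rule inj_onD[OF inj_on_transversal[OF dJ] _ b']) (use eq in simp)
    have "b i = c i" if "i \<in> I" for i
    proof (cases "i \<in> J")
      case True then show ?thesis using 1 by (metis restrict_apply')
    next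
      case False then show ?thesis using eq that by (metis DiffI prod.inject restrict_apply')
    qed
    then show "b = c" using b c by (auto intro: PiE_ext)
  qed
  moreover have "?h ` {b \<in> PiE I P. b ` J \<in> B} \<subseteq> B \<times> PiE (I - J) P"
    by (auto simp: PiE_iff split: if_splits)
  moreover have "finite (B \<times> PiE (I - J) P)"
    using assms by (intro finite_cartesian_product finite_PiE) auto
  ultimately have "card {b \<in> PiE I P. b ` J \<in> B} \<le> card (B \<times> PiE (I - J) P)"
    by (meson card_inj_on_le)
  also have "\<dots> = card B * (\<Prod>i\<in>I - J. card (P i))" using assms(2) by (simp add: card_cartesian_product card_PiE)
  also have "(\<Prod>i\<in>I - J. card (P i)) \<le> (\<Prod>i\<in>I - J. n)" by (rule prod_mono) (use assms(3) in auto)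
  finally show ?thesis by simp
qed

text \<open>The reverse direction: a set in \<open>B\<close> and free choices from the sets
  \<open>N i\<close> outside \<open>J\<close> glue to distinct tuples.\<close>

lemma card_tuples_ge:
  assumes "disjoint_family_on P I" "finite I" "\<And>i. i \<in> I \<Longrightarrow> finite (P i)" "J \<subseteq> I"
    and "B \<subseteq> transv P J" "\<And>i. i \<in> I - J \<Longrightarrow> N i \<subseteq> P i"
  shows "card B * (\<Prod>i\<in>I - J. card (N i)) \<le> card {b \<in> PiE I P. b ` J \<in> B \<and> (\<forall>i\<in>I - J. b i \<in> N i)}"
proof -
  let ?S = "{b \<in> PiE I P. b ` J \<in> B \<and> (\<forall>i\<in>I - J. b i \<in> N i)}"
  have "\<forall>f\<in>B. \<exists>b. b \<in> PiE J P \<and> f = b ` J" using assms(5) unfolding transv_def by blast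
  then obtain c where c: "\<And>f. f \<in> B \<Longrightarrow> c f \<in> PiE J P \<and> f = c f ` J" by metis
  let ?g = "\<lambda>(f, d). \<lambda>i. if i \<in> J then c f i else d i"
  have im: "?g (f, d) ` J = f" if "f \<in> B" for f d
  proof -
    have "?g (f, d) ` J = c f ` J" by (intro image_cong) auto
    then show ?thesis using c[OF that] by simp
  qed
  have inj: "inj_on ?g (B \<times> PiE (I - J) N)"
  proof (rule inj_onI, clarsimp)
    fix f d f' d' assume f: "f \<in> B" "f' \<in> B" and d: "d \<in> PiE (I - J) N" "d' \<in> PiE (I - J) N"
      and eq: "(\<lambda>i. if i \<in> J then c f i else d i) = (\<lambda>i. if i \<in> J then c f' i else d' i)"
    have "f = f'" using im[OF f(1), of d] im[OF f(2), of d'] eq by simp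
    moreover have "d i = d' i" if "i \<in> I - J" for i using fun_cong[OF eq, of i] that by simp
    ultimately show "f = f' \<and> d = d'" using d by (auto intro: PiE_ext)
  qed
  have sub: "?g ` (B \<times> PiE (I - J) N) \<subseteq> ?S"
  proof clarify
    fix f d assume f: "f \<in> B" and d: "d \<in> PiE (I - J) N"
    have "(\<lambda>i. if i \<in> J then c f i else d i) \<in> PiE I P"
      using c[OF f] d assms(4) subsetD[OF assms(6)] by (auto simp: PiE_iff extensional_def)
    then show "(\<lambda>i. if i \<in> J then c f i else d i) \<in> PiE I P \<and> (\<lambda>i. if i \<in> J then c f i else d i) ` J \<in> B
       \<and> (\<forall>i\<in>I - J. (if i \<in> J then c f i else d i) \<in> N i)"
      using im[OF f, of d] f d by (auto simp: PiE_iff)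
  qed
  have "finite ?S" by (rule finite_subset[OF _ finite_PiE[of I P]]) (use assms(2,3) in auto)
  from card_inj_on_le[OF inj sub this]
  show ?thesis using assms(2) by (simp add: card_cartesian_product card_PiE)
qed

lemma card_supersets_le:
  assumes "finite V" "A \<subseteq> V" "card A \<le> k" "card V = n"
  shows "card {e. A \<subseteq> e \<and> e \<subseteq> V \<and> card e = k} \<le> n ^ (k - card A)"
proof -
  have "inj_on (\<lambda>e. e - A) {e. A \<subseteq> e \<and> e \<subseteq> V \<and> card e = k}" by (rule inj_onI) auto
  moreover have "(\<lambda>e. e - A) ` {e. A \<subseteq> e \<and> e \<subseteq> V \<and> card e = k} \<subseteq> {f. f \<subseteq> V \<and> card f = k - card A}"
    using assms(1,2) by (auto simp: card_Diff_subset finite_subset)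
  ultimately have "card {e. A \<subseteq> e \<and> e \<subseteq> V \<and> card e = k} \<le> card {f. f \<subseteq> V \<and> card f = k - card A}"
    by (rule card_inj_on_le) (use assms(1) in auto)
  also have "\<dots> = n choose (k - card A)" using assms n_subsets by auto
  also have "\<dots> \<le> n ^ (k - card A)" by (cases "k - card A \<le> n") (auto intro: binomial_le_pow simp: binomial_eq_0)
  finally show ?thesis .
qed

section \<open>Recursions and inequalities for elementary symmetric sums\<close>

lemma esym_insert:
  assumes "finite I" "i \<notin> I"
  shows "esym (insert i I) (Suc k) x = esym I (Suc k) x + x i * esym I k x"
proof -
  let ?A = "{J. J \<subseteq> I \<and> card J = Suc k}" and ?B = "{J. J \<subseteq> I \<and> card J = k}"
  have fin: "finite J" if "J \<subseteq> I" for J using that assms(1) by (rule finite_subset)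
  have eq: "{J. J \<subseteq> insert i I \<and> card J = Suc k} = ?A \<union> insert i ` ?B" (is "?L = _")
  proof
    show "?L \<subseteq> ?A \<union> insert i ` ?B"
    proof
      fix J assume J: "J \<in> ?L"
      show "J \<in> ?A \<union> insert i ` ?B"
      proof (cases "i \<in> J")
        case True
        then have "J = insert i (J - {i})" "J - {i} \<in> ?B" using J assms(1) by (auto simp: card_Diff_singleton)
        then show ?thesis by blast
      next
        case False then show ?thesis using J by auto
      qed
    qed
    show "?A \<union> insert i ` ?B \<subseteq> ?L" using fin assms(2) by (auto simp: card_insert_if)
  qed
  have inj: "inj_on (insert i) ?B" using assms(2) by (intro inj_onI) (auto simp: insert_ident)
  have "esym (insert i I) (Suc k) x = (\<Sum>J\<in>?A. \<Prod>j\<in>J. x j) + (\<Sum>J\<in>insert i ` ?B. \<Prod>j\<in>J. x j)"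
    unfolding esym_def eq using assms by (intro sum.union_disjoint) auto
  also have "(\<Sum>J\<in>insert i ` ?B. \<Prod>j\<in>J. x j) = (\<Sum>J\<in>?B. \<Prod>j\<in>insert i J. x j)"
    using inj by (simp add: sum.reindex)
  also have "\<dots> = (\<Sum>J\<in>?B. x i * (\<Prod>j\<in>J. x j))"
    using assms fin by (intro sum.cong refl prod.insert) auto
  finally show ?thesis by (simp add: esym_def sum_distrib_left)
qed

text \<open>The two variables enter only through their product and their sum, which makes the effect
  of moving weight between two parts explicit.\<close>

lemma esym_pair:
  assumes "finite K" "i \<notin> K" "j \<notin> K" "i \<noteq> j"
  shows "esym (insert i (insert j K)) (Suc (Suc k)) x =
    x i * x j * esym K k x + (x i + x j) * esym K (Suc k) x + esym K (Suc (Suc k)) x"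
  using assms by (simp add: esym_insert algebra_simps)

lemma esym_cong: "(\<And>i. i \<in> I \<Longrightarrow> x i = y i) \<Longrightarrow> esym I k x = esym I k y"
  unfolding esym_def by (intro sum.cong refl prod.cong) auto

lemma esym_mono_set: "finite I \<Longrightarrow> K \<subseteq> I \<Longrightarrow> esym K k x \<le> esym I k x"
  unfolding esym_def by (intro sum_mono2) auto

lemma esym_mono: "(\<And>i. i \<in> I \<Longrightarrow> x i \<le> y i) \<Longrightarrow> esym I k x \<le> esym I k y"
  unfolding esym_def by (intro sum_mono prod_mono) auto

lemma esym_const: "finite I \<Longrightarrow> esym I k (\<lambda>_. q) = (card I choose k) * q ^ k"
proof -
  assume "finite I"
  have "esym I k (\<lambda>_. q) = (\<Sum>J | J \<subseteq> I \<and> card J = k. q ^ k)"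
    unfolding esym_def by (intro sum.cong refl) auto
  then show ?thesis using n_subsets[OF \<open>finite I\<close>] by simp
qed

text \<open>Every product over \<open>k + 1\<close> indices occurs on the right as one index times
  the remaining \<open>k\<close>.\<close>

lemma esym_Suc_le: "finite I \<Longrightarrow> esym I (Suc k) x \<le> (\<Sum>i\<in>I. x i) * esym I k x"
proof (induction I rule: finite_induct)
  case empty
  then show ?case by (auto simp: esym_def)
next
  case (insert i I)
  have "esym (insert i I) (Suc k) x \<le> (\<Sum>i\<in>I. x i) * esym I k x + x i * esym I k x"
    using insert by (simp add: esym_insert)
  also have "\<dots> = (\<Sum>i\<in>insert i I. x i) * esym I k x" using insert by (simp add: algebra_simps)
  also have "\<dots> \<le> (\<Sum>i\<in>insert i I. x i) * esym (insert i I) k x"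
    using insert by (intro mult_left_mono esym_mono_set) auto
  finally show ?case .
qed

lemma esym_reindex:
  assumes "bij_betw \<sigma> I I'"
  shows "esym I k (\<lambda>i. y (\<sigma> i)) = esym I' k y"
proof -
  have inj: "inj_on \<sigma> I" and im: "\<sigma> ` I = I'" using assms by (auto simp: bij_betw_def)
  have b: "bij_betw ((`) \<sigma>) {J. J \<subseteq> I \<and> card J = k} {J. J \<subseteq> I' \<and> card J = k}"
  proof (rule bij_betwI')
    fix J K assume "J \<in> {J. J \<subseteq> I \<and> card J = k}" "K \<in> {J. J \<subseteq> I \<and> card J = k}"
    then show "(\<sigma> ` J = \<sigma> ` K) = (J = K)" using inj_on_image_eq_iff[OF inj] by auto
  next
    fix J assume "J \<in> {J. J \<subseteq> I \<and> card J = k}"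
    then show "\<sigma> ` J \<in> {J. J \<subseteq> I' \<and> card J = k}"
      using im inj by (auto simp: card_image inj_on_subset)
  next
    fix L assume L: "L \<in> {J. J \<subseteq> I' \<and> card J = k}"
    then obtain J where "J \<subseteq> I" "L = \<sigma> ` J" using im by (metis mem_Collect_eq subset_imageE)
    then show "\<exists>J\<in>{J. J \<subseteq> I \<and> card J = k}. L = \<sigma> ` J"
      using L inj by (auto simp: card_image inj_on_subset)
  qed
  have "esym I k (\<lambda>i. y (\<sigma> i)) = (\<Sum>J | J \<subseteq> I \<and> card J = k. \<Prod>j\<in>\<sigma> ` J. y j)"
    unfolding esym_def
    by (intro sum.cong refl) (auto simp: prod.reindex inj_on_subset[OF inj])
  also have "\<dots> = esym I' k y" unfolding esym_def by (rule sum.reindex_bij_betw[OF b])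
  finally show ?thesis .
qed

section \<open>Balanced part sizes\<close>

text \<open>The Turan number: the number of edges of \<open>T_r(n, l)\<close>.\<close>

definition tau :: "nat \<Rightarrow> nat \<Rightarrow> nat \<Rightarrow> nat" where
  "tau l r n = esym {..<l} r (\<lambda>i. n div l + (if i < n mod l then 1 else 0))"

definition balanced :: "nat \<Rightarrow> (nat \<Rightarrow> nat) \<Rightarrow> bool" where
  "balanced l x \<longleftrightarrow> (\<forall>i<l. \<forall>j<l. x i \<le> Suc (x j))"

text \<open>The sum \<open>x i + x j\<close> is unchanged and the product grows by
  \<open>d * (x i - x j - d)\<close>, so by \<open>esym_pair\<close> only the term with both
  variables changes.\<close>

lemma esym_transfer:
  assumes "finite I" "i \<in> I" "j \<in> I" "i \<noteq> j" "x j + d \<le> x i"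
  shows "esym I (Suc (Suc k)) (x(i := x i - d, j := x j + d)) =
    esym I (Suc (Suc k)) x + d * (x i - x j - d) * esym (I - {i, j}) k x"
proof -
  let ?K = "I - {i, j}" and ?y = "x(i := x i - d, j := x j + d)"
  have I: "I = insert i (insert j ?K)" using assms by auto
  have c: "esym ?K m ?y = esym ?K m x" for m by (rule esym_cong) auto
  obtain a where a: "x i = x j + d + a" using assms(5) by (metis le_add_diff_inverse)
  have "esym I (Suc (Suc k)) ?y = ?y i * ?y j * esym ?K k ?y
      + (?y i + ?y j) * esym ?K (Suc k) ?y + esym ?K (Suc (Suc k)) ?y"
    using assms by (subst I, subst esym_pair) auto
  then have "esym I (Suc (Suc k)) ?y = (x j + a) * (x j + d) * esym ?K k x
      + (x i + x j) * esym ?K (Suc k) x + esym ?K (Suc (Suc k)) x"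
    unfolding c using assms(4) a by simp
  moreover have "esym I (Suc (Suc k)) x = x i * x j * esym ?K k x
      + (x i + x j) * esym ?K (Suc k) x + esym ?K (Suc (Suc k)) x"
    using assms by (subst I, subst esym_pair) auto
  ultimately show ?thesis by (simp add: a algebra_simps)
qed

lemma sum_transfer:
  fixes x :: "'i \<Rightarrow> nat"
  assumes "finite I" "i \<in> I" "j \<in> I" "i \<noteq> j" "d \<le> x i"
  shows "sum (x(i := x i - d, j := x j + d)) I = sum x I"
proof -
  have I: "I = insert i (insert j (I - {i, j}))" using assms by auto
  have "sum (x(i := x i - d, j := x j + d)) (I - {i,j}) = sum x (I - {i,j})" by (intro sum.cong) auto
  then show ?thesis using assms by (subst (1 2) I, simp add: sum.insert_remove)
qed

text \<open>With \<open>q\<close> the minimum, every entry is \<open>q\<close> or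
  \<open>q + 1\<close> and at least one is \<open>q\<close>. Hence fewer than \<open>l\<close>
  entries are larger, and \<open>q\<close> and their number are quotient and remainder of
  \<open>n\<close> by \<open>l\<close>.\<close>

lemma balanced_values:
  assumes "0 < l" "balanced l x" "(\<Sum>i<l. x i) = n"
  shows "\<forall>i<l. x i = n div l \<or> x i = Suc (n div l)" "card {i. i < l \<and> x i = Suc (n div l)} = n mod l"
proof -
  define q where "q = Min (x ` {..<l})"
  have q: "q \<le> x i" if "i < l" for i using that by (simp add: q_def)
  have "q \<in> x ` {..<l}" unfolding q_def using assms(1) by (intro Min_in) auto
  then obtain i0 where i0: "i0 < l" "x i0 = q" by auto
  have val: "x i = q \<or> x i = Suc q" if "i < l" for i
    using q[OF that] assms(2) i0 that unfolding balanced_def by (metis le_SucE le_antisym)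
  define A where "A = {i. i < l \<and> x i = Suc q}"
  have "n = (\<Sum>i<l. q + (if i \<in> A then 1 else 0))"
    using val unfolding assms(3)[symmetric] by (intro sum.cong) (auto simp: A_def)
  also have "\<dots> = l * q + card ({..<l} \<inter> A)" by (simp add: sum.distrib sum.If_cases)
  also have "{..<l} \<inter> A = A" by (auto simp: A_def)
  finally have n: "n = l * q + card A" .
  have "i0 \<notin> A" using i0(2) by (simp add: A_def)
  then have "A \<subset> {..<l}" using i0(1) unfolding A_def by blast
  then have "card A < l" using psubset_card_mono[of "{..<l}" A] by simp
  with n have "n div l = q" "n mod l = card A" by simp_all
  with val show "\<forall>i<l. x i = n div l \<or> x i = Suc (n div l)" "card {i. i < l \<and> x i = Suc (n div l)} = n mod l"
    by (auto simp: A_def)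
qed

lemma balanced_perm:
  assumes "0 < l" "balanced l x" "balanced l y" "(\<Sum>i<l. x i) = n" "(\<Sum>i<l. y i) = n"
  obtains \<sigma> where "bij_betw \<sigma> {..<l} {..<l}" "\<And>i. i < l \<Longrightarrow> y (\<sigma> i) = x i"
proof -
  let ?A = "\<lambda>x. {i. i < l \<and> x i = Suc (n div l)}" and ?B = "\<lambda>x. {i. i < l \<and> x i = n div l}"
  note X = balanced_values[OF assms(1,2,4)] and Y = balanced_values[OF assms(1,3,5)]
  have dis: "?A x \<union> ?B x = {..<l}" "?A x \<inter> ?B x = {}" "?A y \<union> ?B y = {..<l}" "?A y \<inter> ?B y = {}"
    using X Y by auto
  have cA: "card (?A x) = card (?A y)" using X Y by simp
  have "card (?A x) + card (?B x) = l" "card (?A y) + card (?B y) = l"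
    using card_Un_disjoint[of "?A x" "?B x"] card_Un_disjoint[of "?A y" "?B y"] dis by simp_all
  with cA have cB: "card (?B x) = card (?B y)" by simp
  obtain f where f: "bij_betw f (?A x) (?A y)" using finite_same_card_bij[OF _ _ cA] by auto
  obtain g where g: "bij_betw g (?B x) (?B y)" using finite_same_card_bij[OF _ _ cB] by auto
  let ?s = "\<lambda>i. if i \<in> ?A x then f i else g i"
  have 1: "bij_betw ?s (?A x) (?A y)" using f by (rule bij_betw_cong[THEN iffD1, rotated]) simp
  have 2: "bij_betw ?s (?B x) (?B y)" using g by (rule bij_betw_cong[THEN iffD1, rotated]) auto
  have "bij_betw ?s {..<l} {..<l}" using bij_betw_combine[OF 1 2 dis(4)] dis by simp
  moreover have "y (?s i) = x i" if "i < l" for i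
    using that X(1) bij_betwE[OF 1] bij_betwE[OF 2] by fastforce
  ultimately show ?thesis using that by blast
qed

lemma balanced_tau_sizes:
  "0 < l \<Longrightarrow> balanced l (\<lambda>i. n div l + (if i < n mod l then 1 else 0))"
  "0 < l \<Longrightarrow> (\<Sum>i<l. n div l + (if i < n mod l then 1 else 0)) = n"
proof -
  assume l: "0 < l"
  have "{..<l} \<inter> {i. i < n mod l} = {..<n mod l}"
    using mod_less_divisor[OF l, of n] by (auto intro: less_trans)
  then show "(\<Sum>i<l. n div l + (if i < n mod l then 1 else 0)) = n"
    by (simp add: sum.distrib sum.If_cases)
qed (auto simp: balanced_def)

lemma esym_balanced:
  assumes "0 < l" "balanced l x" "(\<Sum>i<l. x i) = n"
  shows "esym {..<l} r x = tau l r n"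
proof -
  obtain \<sigma> where s: "bij_betw \<sigma> {..<l} {..<l}"
      "\<And>i. i < l \<Longrightarrow> (\<lambda>i. n div l + (if i < n mod l then 1 else 0)) (\<sigma> i) = x i"
    by (rule balanced_perm[OF assms(1,2) balanced_tau_sizes(1) assms(3) balanced_tau_sizes(2)]) (use assms in auto)
  have "esym {..<l} r x = esym {..<l} r (\<lambda>i. (\<lambda>i. n div l + (if i < n mod l then 1 else 0)) (\<sigma> i))"
    using s(2) by (intro esym_cong) auto
  also have "\<dots> = tau l r n" unfolding tau_def by (rule esym_reindex[OF s(1)])
  finally show ?thesis .
qed

text \<open>If two sizes differ by at least 2, moving one unit from the larger to the smaller lowers
  the sum of squares and does not lower the symmetric sum. The process ends at a balanced vector,
  where the value is \<open>tau\<close>.\<close>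

lemma esym_le_tau:
  assumes "0 < l" "2 \<le> r" "(\<Sum>i<l. x i) = n"
  shows "esym {..<l} r x \<le> tau l r n"
  using assms(3)
proof (induction "\<Sum>i<l. (x i)\<^sup>2" arbitrary: x rule: less_induct)
  case less
  obtain k where r: "r = Suc (Suc k)" using assms(2) by (metis add_2_eq_Suc le_Suc_ex)
  show ?case
  proof (cases "balanced l x")
    case True then show ?thesis using esym_balanced[OF assms(1) True less.prems] by simp
  next
    case False
    then obtain i j where ij: "i < l" "j < l" "x j + 2 \<le> x i" by (auto simp: balanced_def not_le)
    then have ne: "i \<noteq> j" by auto
    let ?y = "x(i := x i - 1, j := x j + 1)"
    have I: "{..<l} = insert i (insert j ({..<l} - {i, j}))" using ij by auto
    have rest: "(\<Sum>m\<in>{..<l} - {i,j}. (?y m)\<^sup>2) = (\<Sum>m\<in>{..<l} - {i,j}. (x m)\<^sup>2)" by (intro sum.cong) auto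
    obtain a where a: "x i = x j + 2 + a" using ij(3) by (metis le_add_diff_inverse)
    have "(\<Sum>m<l. (?y m)\<^sup>2) < (\<Sum>m<l. (x m)\<^sup>2)"
      using rest ne by (subst (1 2) I) (simp add: sum.insert_remove a power2_eq_square algebra_simps)
    moreover have "(\<Sum>m<l. ?y m) = n" using sum_transfer[of "{..<l}" i j 1 x] ij ne less.prems by simp
    ultimately have "esym {..<l} r ?y \<le> tau l r n" by (rule less.hyps)
    then show ?thesis using esym_transfer[of "{..<l}" i j x 1 k] ij ne by (simp add: r)
  qed
qed

text \<open>The sizes after the transfer also obey \<open>esym_le_tau\<close>, so the gain of a
  transfer measures how far the original sizes stay below \<open>tau\<close>.\<close>

lemma esym_transfer_le_tau:
  assumes "2 \<le> r" "(\<Sum>i<l. x i) = n" "i < l" "j < l" "x j + d \<le> x i" "i \<noteq> j"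
  shows "esym {..<l} r x + d * (x i - x j - d) * esym ({..<l} - {i, j}) (r - 2) x \<le> tau l r n"
proof -
  obtain k where r: "r = Suc (Suc k)" using assms(1) by (metis add_2_eq_Suc le_Suc_ex)
  show ?thesis
    using esym_le_tau[of l r "x(i := x i - d, j := x j + d)" n] sum_transfer[of "{..<l}" i j d x]
      esym_transfer[of "{..<l}" i j x d k] assms by (simp add: r)
qed

text \<open>The terms that miss \<open>x i\<close> or \<open>x j\<close> are bounded through
  \<open>esym_Suc_le\<close>. So the factor multiplying the transfer gain is at least a
  \<open>1 / (4 * n^2)\<close> share of the whole sum and the gain cannot be negligible.\<close>

lemma esym_le_rest:
  fixes l :: nat
  assumes "2 \<le> r" "(\<Sum>i<l. x i) = n" "i < l" "j < l" "i \<noteq> j"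
  shows "esym {..<l} r x \<le> 4 * n\<^sup>2 * esym ({..<l} - {i, j}) (r - 2) x"
proof -
  obtain k where r: "r = Suc (Suc k)" using assms(1) by (metis add_2_eq_Suc le_Suc_ex)
  let ?K = "{..<l} - {i, j}"
  have I: "{..<l} = insert i (insert j ?K)" using assms by auto
  have x: "x m \<le> n" if "m < l" for m using that unfolding assms(2)[symmetric] by (intro member_le_sum) auto
  have S: "sum x ?K \<le> n" unfolding assms(2)[symmetric] by (intro sum_mono2) auto
  have 1: "esym ?K (Suc k) x \<le> n * esym ?K k x"
    using esym_Suc_le[of ?K k x] S by (meson finite_Diff finite_lessThan le_trans mult_le_mono1)
  have 2: "esym ?K (Suc (Suc k)) x \<le> n * esym ?K (Suc k) x"
    using esym_Suc_le[of ?K "Suc k" x] S by (meson finite_Diff finite_lessThan le_trans mult_le_mono1)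
  have "esym {..<l} r x = x i * x j * esym ?K k x + (x i + x j) * esym ?K (Suc k) x + esym ?K (Suc (Suc k)) x"
    unfolding r using assms by (subst I, subst esym_pair) auto
  also have "\<dots> \<le> n * n * esym ?K k x + (n + n) * (n * esym ?K k x) + n * (n * esym ?K k x)"
    using x[OF assms(3)] x[OF assms(4)] 1 2
    by (intro add_mono mult_le_mono) (auto intro: le_trans[OF 2])
  also have "\<dots> = 4 * n\<^sup>2 * esym ?K k x" by (simp add: power2_eq_square algebra_simps)
  finally show ?thesis by (simp add: r)
qed

text \<open>In an unbalanced vector a unit transfer would have to gain nothing, so the factor in
  \<open>esym_le_rest\<close> would vanish, and with it the whole sum.\<close>

lemma esym_eq_tau_imp_balanced:
  assumes "2 \<le> r" "(\<Sum>i<l. x i) = n" "esym {..<l} r x = tau l r n" "0 < tau l r n"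
  shows "balanced l x"
proof (rule ccontr)
  assume "\<not> balanced l x"
  then obtain i j where ij: "i < l" "j < l" "x j + 2 \<le> x i" by (auto simp: balanced_def not_le)
  then have ne: "i \<noteq> j" by auto
  have "1 * (x i - x j - 1) * esym ({..<l} - {i, j}) (r - 2) x = 0"
    using esym_transfer_le_tau[OF assms(1,2) ij(1,2) _ ne, of 1] ij assms(3) by simp
  then have "esym ({..<l} - {i, j}) (r - 2) x = 0" using ij(3) by auto
  then show False using esym_le_rest[OF assms(1,2) ij(1,2) ne] assms(3,4) by simp
qed

text \<open>The increment is the degree of the added vertex, a symmetric sum over the other
  \<open>l - 1\<close> parts, each of size \<open>n div l\<close> or one more.\<close>

lemma tau_Suc:
  assumes "0 < l"
  obtains d where "tau l (Suc k) (Suc n) = tau l (Suc k) n + d"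
    "((l - 1) choose k) * (n div l) ^ k \<le> d" "d \<le> ((l - 1) choose k) * Suc (n div l) ^ k"
proof -
  let ?x = "\<lambda>i. n div l + (if i < n mod l then 1 else 0)"
  \<comment> \<open>The first part without an extra vertex; the new vertex goes there and the sizes
    stay balanced.\<close>
  let ?i = "n mod l" and ?I = "{..<l} - {n mod l}"
  let ?y = "?x(?i := Suc (n div l))"
  have i: "?i < l" using assms by simp
  have I: "{..<l} = insert ?i ?I" using i by auto
  have rest: "(\<Sum>i\<in>?I. ?y i) = (\<Sum>i\<in>?I. ?x i)" by (intro sum.cong) auto
  have "(\<Sum>i<l. ?y i) = ?y ?i + (\<Sum>i\<in>?I. ?y i)" "(\<Sum>i<l. ?x i) = ?x ?i + (\<Sum>i\<in>?I. ?x i)"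
    by (rule sum.remove; use i in simp)+
  then have "(\<Sum>i<l. ?y i) = Suc (\<Sum>i<l. ?x i)" unfolding rest by simp
  then have S: "(\<Sum>i<l. ?y i) = Suc n" using balanced_tau_sizes(2)[OF assms] by simp
  have B: "balanced l ?y" by (auto simp: balanced_def)
  have "tau l (Suc k) (Suc n) = esym {..<l} (Suc k) ?y" by (rule esym_balanced[OF assms B S, symmetric])
  also have "\<dots> = esym (insert ?i ?I) (Suc k) ?y" using I by simp
  also have "\<dots> = esym ?I (Suc k) ?y + ?y ?i * esym ?I k ?y" by (rule esym_insert) auto
  also have "\<dots> = esym ?I (Suc k) ?x + Suc (n div l) * esym ?I k ?x"
  proof -
    have "esym ?I m ?y = esym ?I m ?x" for m by (rule esym_cong) auto
    then show ?thesis by simp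
  qed
  finally have 1: "tau l (Suc k) (Suc n) = esym ?I (Suc k) ?x + Suc (n div l) * esym ?I k ?x" .
  have 2: "tau l (Suc k) n = esym ?I (Suc k) ?x + n div l * esym ?I k ?x"
  proof -
    have "tau l (Suc k) n = esym (insert ?i ?I) (Suc k) ?x" using I by (simp add: tau_def)
    also have "\<dots> = esym ?I (Suc k) ?x + ?x ?i * esym ?I k ?x" by (rule esym_insert) auto
    finally show ?thesis by simp
  qed
  have c: "card ?I = l - 1" using i by simp
  have "esym ?I k (\<lambda>_. n div l) \<le> esym ?I k ?x" "esym ?I k ?x \<le> esym ?I k (\<lambda>_. Suc (n div l))"
    by (intro esym_mono; simp)+
  then show ?thesis using that[of "esym ?I k ?x"] 1 2 c by (simp add: esym_const)
qed

lemma tau_bounds: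
  assumes "0 < l"
  shows "(l choose r) * (n div l) ^ r \<le> tau l r n" "tau l r n \<le> (l choose r) * Suc (n div l) ^ r"
proof -
  have "esym {..<l} r (\<lambda>_. n div l) \<le> tau l r n" "tau l r n \<le> esym {..<l} r (\<lambda>_. Suc (n div l))"
    unfolding tau_def by (intro esym_mono; simp)+
  then show "(l choose r) * (n div l) ^ r \<le> tau l r n" "tau l r n \<le> (l choose r) * Suc (n div l) ^ r"
    by (simp_all add: esym_const)
qed

section \<open>Asymptotics of the Turan numbers\<close>

text \<open>The leading coefficient of the Turan number: \<open>tau l r n\<close> is about
  \<open>alpha l r * n^r\<close>.\<close>

definition alpha :: "nat \<Rightarrow> nat \<Rightarrow> real" where
  "alpha l r = real (l choose r) / real l ^ r"

text \<open>The leading coefficient of \<open>tau l r (n + 1) - tau l r n\<close>, and so of the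
  degrees in the Turan hypergraph.\<close>

definition beta :: "nat \<Rightarrow> nat \<Rightarrow> real" where
  "beta l r = real ((l - 1) choose (r - 1)) / real l ^ (r - 1)"

lemma alpha_pos: "r \<le> l \<Longrightarrow> 0 < l \<Longrightarrow> 0 < alpha l r"
  by (simp add: alpha_def)

lemma beta_eq_alpha:
  assumes "2 \<le> r" "r \<le> l"
  shows "beta l r = real r * alpha l r"
proof -
  obtain k m where k: "r = Suc k" and m: "l = Suc m" using assms by (metis Suc_le_D numeral_2_eq_2 le_trans)
  have "real (Suc k) * real (Suc m choose Suc k) = real (Suc m) * real (m choose k)"
    by (metis Suc_times_binomial of_nat_mult)
  then have "real (Suc k) * (real (Suc m choose Suc k) / real (Suc m) ^ Suc k)
      = real (Suc m) * real (m choose k) / (real (Suc m) * real (Suc m) ^ k)"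
    by (metis power_Suc times_divide_eq_right)
  then show ?thesis unfolding beta_def alpha_def k m by simp
qed

text \<open>Identifies the threshold for Lagrangians in condition (a) of the family.\<close>

lemma fact_alpha:
  assumes "r \<le> l"
  shows "(\<Prod>i<r. real l - real i) / real l ^ r = fact r * alpha l r"
proof -
  have "real (l choose r) = (\<Prod>i<r. real l - real i) / fact r"
    by (simp add: binomial_gbinomial gbinomial_prod_rev atLeast0LessThan)
  then show ?thesis by (simp add: alpha_def)
qed

text \<open>From \<open>fact k * (m choose k) \<le> m^k < (m + 1)^k\<close>. Strictness is the whole
  point: a vertex contained in all \<open>r\<close>-sets has degree about
  \<open>n^(r-1) / fact (r - 1)\<close>, which exceeds a Turan degree by a constant factor.\<close>

lemma beta_less:
  assumes "2 \<le> r" "r \<le> l"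
  shows "beta l r < 1 / fact (r - 1)"
proof -
  obtain k m where k: "r = Suc (Suc k)" and m: "l = Suc m"
    using assms by (intro that[of "r - 2" "l - 1"]) auto
  have "(m choose Suc k) * fact (Suc k) \<le> m ^ Suc k" by (rule binomial_fact_pow)
  also have "\<dots> < Suc m ^ Suc k" by (rule power_strict_mono) auto
  finally have "real ((m choose Suc k) * fact (Suc k)) < real (Suc m ^ Suc k)" by linarith
  then have "real (m choose Suc k) * fact (Suc k) < real (Suc m) ^ Suc k"
    by (metis of_nat_fact of_nat_mult of_nat_power)
  then have "real (m choose Suc k) / real (Suc m) ^ Suc k < 1 / fact (Suc k)"
    by (simp add: field_simps del: of_nat_Suc fact_Suc power_Suc)
  then show ?thesis unfolding beta_def k m by simp
qed

lemma div_pow_upper: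
  assumes "0 < l" "0 < \<epsilon>"
  shows "\<exists>N. \<forall>n\<ge>N. real C * real (Suc (n div l)) ^ k \<le> (real C / real l ^ k + \<epsilon>) * real n ^ k"
proof -
  have "(\<lambda>n. real C * (1 / real l + 1 / real n) ^ k) \<longlonglongrightarrow> real C * (1 / real l + 0) ^ k"
    by (intro tendsto_intros lim_1_over_n)
  moreover have "real C * (1 / real l + 0) ^ k < real C / real l ^ k + \<epsilon>"
    using assms by (simp add: power_one_over)
  ultimately have "\<forall>\<^sub>F n in sequentially. real C * (1 / real l + 1 / real n) ^ k < real C / real l ^ k + \<epsilon>"
    by (rule order_tendstoD)
  then obtain N where N: "\<And>n. n \<ge> N \<Longrightarrow> real C * (1 / real l + 1 / real n) ^ k < real C / real l ^ k + \<epsilon>"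
    by (auto simp: eventually_sequentially)
  show ?thesis
  proof (intro exI allI impI)
    fix n assume n: "n \<ge> max N 1"
    have "real (n div l) \<le> real n / real l" by (rule of_nat_div_le_of_nat)
    then have "real (Suc (n div l)) \<le> (1 / real l + 1 / real n) * real n"
      using n by (simp add: distrib_right)
    then have "real C * real (Suc (n div l)) ^ k \<le> real C * ((1 / real l + 1 / real n) * real n) ^ k"
      by (intro mult_left_mono power_mono) auto
    also have "\<dots> = (real C * (1 / real l + 1 / real n) ^ k) * real n ^ k" by (simp add: power_mult_distrib)
    also have "\<dots> \<le> (real C / real l ^ k + \<epsilon>) * real n ^ k"
      using N[of n] n by (intro mult_right_mono) auto
    finally show "real C * real (Suc (n div l)) ^ k \<le> (real C / real l ^ k + \<epsilon>) * real n ^ k" .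
  qed
qed

lemma div_pow_lower:
  assumes "0 < l" "0 < \<epsilon>"
  shows "\<exists>N. \<forall>n\<ge>N. (real C / real l ^ k - \<epsilon>) * real n ^ k \<le> real C * real (n div l) ^ k"
proof -
  have "(\<lambda>n. real C * (1 / real l - 1 / real n) ^ k) \<longlonglongrightarrow> real C * (1 / real l - 0) ^ k"
    by (intro tendsto_intros lim_1_over_n)
  moreover have "real C / real l ^ k - \<epsilon> < real C * (1 / real l - 0) ^ k"
    using assms by (simp add: power_one_over)
  ultimately have "\<forall>\<^sub>F n in sequentially. real C / real l ^ k - \<epsilon> < real C * (1 / real l - 1 / real n) ^ k"
    by (rule order_tendstoD)
  then obtain N where N: "\<And>n. n \<ge> N \<Longrightarrow> real C / real l ^ k - \<epsilon> < real C * (1 / real l - 1 / real n) ^ k"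
    by (auto simp: eventually_sequentially)
  show ?thesis
  proof (intro exI allI impI)
    fix n assume n: "n \<ge> max N l"
    have n0: "0 < n" "l \<le> n" using n assms by auto
    have "n < l * Suc (n div l)" using dividend_less_times_div[OF assms(1), of n] by (simp add: mult.commute)
    then have "real n < real l * (real (n div l) + 1)"
      by (metis of_nat_Suc of_nat_less_iff of_nat_mult add.commute)
    then have "real n / real l \<le> real (n div l) + 1" using assms by (simp add: field_simps)
    moreover have "(1 / real l - 1 / real n) * real n = real n / real l - 1" using n0 by (simp add: field_simps)
    ultimately have "(1 / real l - 1 / real n) * real n \<le> real (n div l)" by linarith
    moreover have "0 \<le> (1 / real l - 1 / real n) * real n" using n0 assms by (simp add: field_simps)
    ultimately have "real C * ((1 / real l - 1 / real n) * real n) ^ k \<le> real C * real (n div l) ^ k"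
      by (intro mult_left_mono power_mono) auto
    moreover have "(real C / real l ^ k - \<epsilon>) * real n ^ k \<le> (real C * (1 / real l - 1 / real n) ^ k) * real n ^ k"
      using N[of n] n by (intro mult_right_mono) auto
    ultimately show "(real C / real l ^ k - \<epsilon>) * real n ^ k \<le> real C * real (n div l) ^ k"
      by (simp add: power_mult_distrib mult.assoc)
  qed
qed

lemma tau_asymp:
  assumes "0 < l" "0 < \<epsilon>"
  shows "\<exists>N. \<forall>n\<ge>N. (alpha l r - \<epsilon>) * real n ^ r \<le> real (tau l r n)
     \<and> real (tau l r n) \<le> (alpha l r + \<epsilon>) * real n ^ r"
proof -
  obtain N M where
    N: "\<And>n. n \<ge> N \<Longrightarrow> real (l choose r) * real (Suc (n div l)) ^ r \<le> (alpha l r + \<epsilon>) * real n ^ r" and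
    M: "\<And>n. n \<ge> M \<Longrightarrow> (alpha l r - \<epsilon>) * real n ^ r \<le> real (l choose r) * real (n div l) ^ r"
    using div_pow_upper[OF assms, of "l choose r" r] div_pow_lower[OF assms, of "l choose r" r]
    unfolding alpha_def by auto
  have "(alpha l r - \<epsilon>) * real n ^ r \<le> real (tau l r n) \<and> real (tau l r n) \<le> (alpha l r + \<epsilon>) * real n ^ r"
    if "n \<ge> max N M" for n
  proof
    have "real (l choose r) * real (n div l) ^ r \<le> real (tau l r n)"
      using tau_bounds(1)[OF assms(1), of r n] by (metis of_nat_le_iff of_nat_mult of_nat_power)
    then show "(alpha l r - \<epsilon>) * real n ^ r \<le> real (tau l r n)" using M[of n] that by simp
    have "real (tau l r n) \<le> real (l choose r) * real (Suc (n div l)) ^ r"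
      using tau_bounds(2)[OF assms(1), of r n] by (metis of_nat_le_iff of_nat_mult of_nat_power)
    then show "real (tau l r n) \<le> (alpha l r + \<epsilon>) * real n ^ r" using N[of n] that by simp
  qed
  then show ?thesis by blast
qed

lemma tau_Suc_asymp:
  assumes "0 < l" "0 < r" "0 < \<epsilon>"
  shows "\<exists>N. \<forall>n\<ge>N. (beta l r - \<epsilon>) * real n ^ (r - 1) \<le> real (tau l r (Suc n)) - real (tau l r n)
     \<and> real (tau l r (Suc n)) - real (tau l r n) \<le> (beta l r + \<epsilon>) * real n ^ (r - 1)"
proof -
  obtain k where k: "r = Suc k" using assms(2) gr0_implies_Suc by blast
  let ?C = "(l - 1) choose k"
  obtain N M where
    N: "\<And>n. n \<ge> N \<Longrightarrow> real ?C * real (Suc (n div l)) ^ k \<le> (beta l r + \<epsilon>) * real n ^ k" and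
    M: "\<And>n. n \<ge> M \<Longrightarrow> (beta l r - \<epsilon>) * real n ^ k \<le> real ?C * real (n div l) ^ k"
    using div_pow_upper[OF assms(1,3), of ?C k] div_pow_lower[OF assms(1,3), of ?C k]
    unfolding beta_def k by auto
  have "(beta l r - \<epsilon>) * real n ^ k \<le> real (tau l r (Suc n)) - real (tau l r n)
     \<and> real (tau l r (Suc n)) - real (tau l r n) \<le> (beta l r + \<epsilon>) * real n ^ k" if n: "n \<ge> max N M" for n
  proof -
    obtain d where d: "tau l (Suc k) (Suc n) = tau l (Suc k) n + d"
      "?C * (n div l) ^ k \<le> d" "d \<le> ?C * Suc (n div l) ^ k" by (rule tau_Suc[OF assms(1)])
    have "real ?C * real (n div l) ^ k \<le> real d" "real d \<le> real ?C * real (Suc (n div l)) ^ k"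
      using d(2,3) by (metis of_nat_le_iff of_nat_mult of_nat_power)+
    moreover have "real (tau l r (Suc n)) - real (tau l r n) = real d" using d(1) by (simp add: k)
    ultimately show ?thesis using N[of n] M[of n] n by simp
  qed
  then have "\<exists>N. \<forall>n\<ge>N. (beta l r - \<epsilon>) * real n ^ k \<le> real (tau l r (Suc n)) - real (tau l r n)
     \<and> real (tau l r (Suc n)) - real (tau l r n) \<le> (beta l r + \<epsilon>) * real n ^ k" by blast
  then show ?thesis by (simp add: k)
qed

text \<open>Telescopes \<open>tau_Suc_asymp\<close> over \<open>j\<close> steps. All increments are
  compared with the same power \<open>n^(r-1)\<close>, which is harmless as long as \<open>j\<close>
  is a small fraction of \<open>n\<close>.\<close>

lemma tau_step_asymp:
  assumes "2 \<le> r" "r \<le> l" "0 < \<epsilon>"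
  shows "\<exists>\<omega>>0. \<exists>N. \<forall>n\<ge>N. \<forall>j. real j \<le> \<omega> * real n \<longrightarrow>
     real j * (beta l r - \<epsilon>) * real n ^ (r - 1) \<le> real (tau l r n) - real (tau l r (n - j))
     \<and> real (tau l r n) - real (tau l r (n - j)) \<le> real j * (beta l r + \<epsilon>) * real n ^ (r - 1)"
proof -
  have l: "0 < l" "0 < r" using assms by auto
  have b: "0 \<le> beta l r" by (simp add: beta_def)
  obtain N where N: "\<And>n. n \<ge> N \<Longrightarrow>
      (beta l r - \<epsilon>/2) * real n ^ (r - 1) \<le> real (tau l r (Suc n)) - real (tau l r n)
     \<and> real (tau l r (Suc n)) - real (tau l r n) \<le> (beta l r + \<epsilon>) * real n ^ (r - 1)"
  proof -
    obtain N1 N2 where "\<And>n. n \<ge> N1 \<Longrightarrow> (beta l r - \<epsilon>/2) * real n ^ (r - 1) \<le> real (tau l r (Suc n)) - real (tau l r n)"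
      "\<And>n. n \<ge> N2 \<Longrightarrow> real (tau l r (Suc n)) - real (tau l r n) \<le> (beta l r + \<epsilon>) * real n ^ (r - 1)"
      using tau_Suc_asymp[OF l, of "\<epsilon>/2"] tau_Suc_asymp[OF l assms(3)] assms(3) by (metis half_gt_zero)
    then show ?thesis using that[of "max N1 N2"] by simp
  qed
  \<comment> \<open>Continuity at 0 yields \<open>\<omega>\<close> such that replacing
    \<open>n\<close> by any \<open>i \<ge> (1 - \<omega>) * n\<close> costs at most the second half
    of \<open>\<epsilon>\<close>.\<close>
  have "((\<lambda>x. (beta l r - \<epsilon>/2) * (1 - x) ^ (r - 1)) \<longlongrightarrow> (beta l r - \<epsilon>/2) * (1 - 0) ^ (r - 1)) (at_right 0)"
    by (intro tendsto_intros)
  then have "\<forall>\<^sub>F x in at_right 0. (beta l r - \<epsilon>/2) * (1 - x) ^ (r - 1) > beta l r - \<epsilon>"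
    by (rule order_tendstoD) (use assms(3) in simp)
  then obtain w where w: "w > 0" "\<And>x. 0 < x \<Longrightarrow> x < w \<Longrightarrow> (beta l r - \<epsilon>/2) * (1 - x) ^ (r - 1) > beta l r - \<epsilon>"
    unfolding eventually_at_right_field by auto
  define \<omega> where "\<omega> = min (w / 2) (1 / 2)"
  have \<omega>: "0 < \<omega>" "\<omega> < 1" "(beta l r - \<epsilon>/2) * (1 - \<omega>) ^ (r - 1) > beta l r - \<epsilon>"
    using w(1) w(2)[of \<omega>] by (auto simp: \<omega>_def)
  have step: "(beta l r - \<epsilon>) * real n ^ (r - 1) \<le> real (tau l r (Suc i)) - real (tau l r i)
     \<and> real (tau l r (Suc i)) - real (tau l r i) \<le> (beta l r + \<epsilon>) * real n ^ (r - 1)"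
    if n: "real n \<ge> 2 * real N" and i: "i < n" "real i \<ge> (1 - \<omega>) * real n" for n i
  proof -
    have "(1 - \<omega>) * real n \<ge> real N"
    proof -
      have "1 / 2 * real n \<le> (1 - \<omega>) * real n" by (intro mult_right_mono) (auto simp: \<omega>_def)
      then show ?thesis using n by linarith
    qed
    then have iN: "i \<ge> N" using i by linarith
    have p: "((1 - \<omega>) * real n) ^ (r - 1) \<le> real i ^ (r - 1)" using \<omega> i by (intro power_mono) auto
    have q: "real i ^ (r - 1) \<le> real n ^ (r - 1)" using i by (intro power_mono) auto
    have "(beta l r - \<epsilon>) * real n ^ (r - 1) \<le> (beta l r - \<epsilon>/2) * real i ^ (r - 1)"
    \<comment> \<open>The sign of the coefficient decides in which direction the monotonicity of the
      power is used.\<close>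
    proof (cases "beta l r \<ge> \<epsilon>/2")
      case True
      have "(beta l r - \<epsilon>) * real n ^ (r - 1) \<le> ((beta l r - \<epsilon>/2) * (1 - \<omega>) ^ (r - 1)) * real n ^ (r - 1)"
        using \<omega>(3) by (intro mult_right_mono) auto
      also have "\<dots> = (beta l r - \<epsilon>/2) * ((1 - \<omega>) * real n) ^ (r - 1)" by (simp add: power_mult_distrib)
      also have "\<dots> \<le> (beta l r - \<epsilon>/2) * real i ^ (r - 1)" using True p by (intro mult_left_mono) auto
      finally show ?thesis .
    next
      case False
      have "(beta l r - \<epsilon>) * real n ^ (r - 1) \<le> (beta l r - \<epsilon>/2) * real n ^ (r - 1)"
        using assms(3) by (intro mult_right_mono) auto
      also have "\<dots> \<le> (beta l r - \<epsilon>/2) * real i ^ (r - 1)" using False q by (intro mult_left_mono_neg) auto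
      finally show ?thesis .
    qed
    moreover have "(beta l r + \<epsilon>) * real i ^ (r - 1) \<le> (beta l r + \<epsilon>) * real n ^ (r - 1)"
      using q b assms(3) by (intro mult_left_mono) auto
    ultimately show ?thesis using N[OF iN] by linarith
  qed
  show ?thesis
  proof (intro exI conjI allI impI)
    show "0 < \<omega>" by (rule \<omega>(1))
    fix n j assume n: "n \<ge> 2 * N" and j: "real j \<le> \<omega> * real n"
    have *: "real j * (beta l r - \<epsilon>) * real n ^ (r - 1) \<le> real (tau l r n) - real (tau l r (n - j))
     \<and> real (tau l r n) - real (tau l r (n - j)) \<le> real j * (beta l r + \<epsilon>) * real n ^ (r - 1)"
      using j
    proof (induction j)
      case (Suc j)
      have jn: "real (Suc j) < real n \<or> n = 0"
      proof -
        have "\<omega> * real n < 1 * real n \<or> n = 0" using \<omega> by (auto intro: mult_strict_right_mono)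
        then show ?thesis using Suc.prems by linarith
      qed
      with Suc.prems have jn: "Suc j < n" by (cases "n = 0") auto
      then have s: "Suc (n - Suc j) = n - j" by simp
      have "real (n - Suc j) \<ge> (1 - \<omega>) * real n" using Suc.prems jn by (simp add: of_nat_diff algebra_simps)
      moreover have "real n \<ge> 2 * real N" using n by linarith
      ultimately have st: "(beta l r - \<epsilon>) * real n ^ (r - 1) \<le> real (tau l r (n - j)) - real (tau l r (n - Suc j))
        \<and> real (tau l r (n - j)) - real (tau l r (n - Suc j)) \<le> (beta l r + \<epsilon>) * real n ^ (r - 1)"
        using step[of n "n - Suc j"] jn s by simp
      have "real j \<le> \<omega> * real n" using Suc.prems by simp
      from Suc.IH[OF this] st show ?case by (simp add: algebra_simps)
    qed simp
    show "real j * (beta l r - \<epsilon>) * real n ^ (r - 1) \<le> real (tau l r n) - real (tau l r (n - j))"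
      "real (tau l r n) - real (tau l r (n - j)) \<le> real j * (beta l r + \<epsilon>) * real n ^ (r - 1)"
      using * by auto
  qed
qed

text \<open>Two sizes differing by more than \<open>\<delta> * n\<close> would allow a transfer
  gaining a fixed proportion of \<open>n^r\<close>, which would push the symmetric sum above the
  asymptotic value of \<open>tau\<close>.\<close>

lemma sizes_near_balanced:
  assumes "2 \<le> r" "r \<le> l" "0 < \<delta>"
  shows "\<exists>\<epsilon>>0. \<exists>N. \<forall>n\<ge>N. \<forall>x. (\<Sum>i<l. x i) = n \<longrightarrow> (alpha l r - \<epsilon>) * real n ^ r \<le> real (esym {..<l} r x)
    \<longrightarrow> (\<forall>i<l. \<bar>real (x i) - real n / real l\<bar> \<le> \<delta> * real n)"
proof -
  have l: "0 < l" using assms by auto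
  have a: "0 < alpha l r" using assms by (intro alpha_pos) auto
  \<comment> \<open>The first bound keeps \<open>alpha - \<epsilon>\<close> above
    \<open>alpha / 2\<close>; the second makes \<open>2 * \<epsilon>\<close> smaller than the
    transfer gain \<open>\<delta>^2 * alpha / 64\<close>.\<close>
  define \<epsilon> where "\<epsilon> = min (alpha l r / 2) (\<delta>\<^sup>2 * alpha l r / 256)"
  have e: "0 < \<epsilon>" "\<epsilon> \<le> alpha l r / 2" "\<epsilon> \<le> \<delta>\<^sup>2 * alpha l r / 256"
    using a assms(3) by (auto simp: \<epsilon>_def)
  obtain N where N: "\<And>n. n \<ge> N \<Longrightarrow> real (tau l r n) \<le> (alpha l r + \<epsilon>) * real n ^ r"
    using tau_asymp[OF l e(1), of r] by blast
  have main: "real (x i) - real (x j) \<le> \<delta> * real n"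
    if n: "n \<ge> max N (max 1 (nat \<lceil>4 / \<delta>\<rceil>))" and S: "(\<Sum>i<l. x i) = n"
      and E: "(alpha l r - \<epsilon>) * real n ^ r \<le> real (esym {..<l} r x)" and ij: "i < l" "j < l" for n x i j
  proof (rule ccontr)
    assume "\<not> real (x i) - real (x j) \<le> \<delta> * real n"
    then have gt: "\<delta> * real n < real (x i) - real (x j)" by simp
    have n0: "0 < n" using n by simp
    have dn: "\<delta> * real n \<ge> 4"
    proof -
      have "4 / \<delta> \<le> real n" using n by linarith
      then show ?thesis using assms(3) by (simp add: field_simps)
    qed
    \<comment> \<open>About half of the guaranteed difference, so that \<open>d\<close> and the
      remaining difference are both of order \<open>\<delta> * n\<close>; the rounding is paid by
      \<open>\<delta> * n \<ge> 4\<close>.\<close>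
    define d where "d = nat \<lfloor>\<delta> * real n / 2\<rfloor>"
    have d: "real d \<le> \<delta> * real n / 2" "real d \<ge> \<delta> * real n / 4" unfolding d_def using dn by linarith+
    have xd: "x j + d \<le> x i"
    proof -
      have "real (x j + d) \<le> real (x i)" using gt d dn by simp
      then show ?thesis by linarith
    qed
    have ne: "i \<noteq> j" using gt dn by auto
    let ?R = "esym ({..<l} - {i, j}) (r - 2) x"
    have 1: "real (esym {..<l} r x) + real d * (real (x i) - real (x j) - real d) * real ?R \<le> real (tau l r n)"
    proof -
      have "real (esym {..<l} r x + d * (x i - x j - d) * ?R) \<le> real (tau l r n)"
        using esym_transfer_le_tau[OF assms(1) S ij xd ne] by (rule of_nat_mono)
      moreover have "real (x i - x j - d) = real (x i) - real (x j) - real d"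
        using xd by (simp add: of_nat_diff)
      ultimately show ?thesis by (simp del: diff_diff_left)
    qed
    have 2: "alpha l r / 2 * real n ^ r \<le> 4 * (real n)\<^sup>2 * real ?R"
    proof -
      have "alpha l r / 2 * real n ^ r \<le> (alpha l r - \<epsilon>) * real n ^ r" using e by (intro mult_right_mono) auto
      also have "\<dots> \<le> real (esym {..<l} r x)" by (rule E)
      also have "\<dots> \<le> real (4 * n\<^sup>2 * ?R)" using esym_le_rest[OF assms(1) S ij ne] by (rule of_nat_mono)
      finally show ?thesis by simp
    qed
    have "(\<delta> * real n / 4) * (\<delta> * real n / 2) \<le> real d * (real (x i) - real (x j) - real d)"
      using d gt dn by (intro mult_mono) auto
    then have "(\<delta> * real n / 4) * (\<delta> * real n / 2) * real ?R \<le> real d * (real (x i) - real (x j) - real d) * real ?R"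
      by (intro mult_right_mono) auto
    moreover have "\<delta>\<^sup>2 / 32 * (alpha l r / 2 * real n ^ r) \<le> \<delta>\<^sup>2 / 32 * (4 * (real n)\<^sup>2 * real ?R)"
      using 2 by (intro mult_left_mono) auto
    ultimately have "\<delta>\<^sup>2 * alpha l r / 64 * real n ^ r \<le> real d * (real (x i) - real (x j) - real d) * real ?R"
      by (simp add: power2_eq_square algebra_simps)
    then have "(alpha l r - \<epsilon>) * real n ^ r + \<delta>\<^sup>2 * alpha l r / 64 * real n ^ r \<le> (alpha l r + \<epsilon>) * real n ^ r"
      using 1 E N[of n] n by simp
    then have "(\<delta>\<^sup>2 * alpha l r / 64) * real n ^ r \<le> (2 * \<epsilon>) * real n ^ r" by (simp add: algebra_simps)
    then have "\<delta>\<^sup>2 * alpha l r / 64 \<le> 2 * \<epsilon>" using n0 by simp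
    moreover have "\<delta>\<^sup>2 * alpha l r > 0" using a assms(3) by simp
    ultimately show False using e(3) by linarith
  qed
  show ?thesis
  proof (rule exI[of _ \<epsilon>], intro conjI e(1), rule exI[of _ "max N (max 1 (nat \<lceil>4 / \<delta>\<rceil>))"], intro allI impI)
    fix n x i assume n: "n \<ge> max N (max 1 (nat \<lceil>4 / \<delta>\<rceil>))" and S: "(\<Sum>i<l. x i) = n"
      and E: "(alpha l r - \<epsilon>) * real n ^ r \<le> real (esym {..<l} r x)" and i: "i < l"
    have Sr: "(\<Sum>j<l. real (x j)) = real n" using S by (metis of_nat_sum)
    \<comment> \<open>Summing the pairwise differences over \<open>j\<close> compares
      \<open>x i\<close> with the mean \<open>n / l\<close>.\<close>
    have "(\<Sum>j<l. real (x i) - real (x j)) \<le> (\<Sum>j<l. \<delta> * real n)"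
      by (intro sum_mono) (use main[OF n S E i] in auto)
    then have u: "real l * real (x i) - real n \<le> real l * (\<delta> * real n)" by (simp add: sum_subtractf Sr)
    have "(\<Sum>j<l. real (x j) - real (x i)) \<le> (\<Sum>j<l. \<delta> * real n)"
      by (intro sum_mono) (use main[OF n S E _ i] in auto)
    then have v: "real n - real l * real (x i) \<le> real l * (\<delta> * real n)" by (simp add: sum_subtractf Sr)
    show "\<bar>real (x i) - real n / real l\<bar> \<le> \<delta> * real n"
      using u v l by (simp add: abs_le_iff field_simps)
  qed
qed

text \<open>Bounds the degree that a vertex avoiding its own part can have when all part sizes are
  close to \<open>n / l\<close>.\<close>

lemma esym_others_upper:
  assumes "2 \<le> r" "r \<le> l" "0 < \<eta>"
  shows "\<exists>\<delta>>0. \<forall>n x i. i < l \<longrightarrow> (\<forall>j<l. \<bar>real (x j) - real n / real l\<bar> \<le> \<delta> * real n) \<longrightarrow>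
    real (esym ({..<l} - {i}) (r - 1) x) \<le> (beta l r + \<eta>) * real n ^ (r - 1)"
proof -
  have l: "0 < l" using assms by auto
  let ?C = "real ((l - 1) choose (r - 1))"
  have "((\<lambda>d. ?C * (1 / real l + d) ^ (r - 1)) \<longlongrightarrow> ?C * (1 / real l + 0) ^ (r - 1)) (at_right 0)"
    by (intro tendsto_intros)
  then have "\<forall>\<^sub>F d in at_right 0. ?C * (1 / real l + d) ^ (r - 1) < beta l r + \<eta>"
    by (rule order_tendstoD) (use assms(3) in \<open>simp add: beta_def power_one_over\<close>)
  then obtain w where w: "w > 0" "\<And>d. 0 < d \<Longrightarrow> d < w \<Longrightarrow> ?C * (1 / real l + d) ^ (r - 1) < beta l r + \<eta>"
    unfolding eventually_at_right_field by auto
  show ?thesis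
  proof (rule exI[of _ "w/2"], intro conjI allI impI)
    show "0 < w / 2" using w by simp
    fix n :: nat and x :: "nat \<Rightarrow> nat" and i assume i: "i < l" and x: "\<forall>j<l. \<bar>real (x j) - real n / real l\<bar> \<le> w / 2 * real n"
    let ?q = "(1 / real l + w/2) * real n"
    have "real (esym ({..<l} - {i}) (r - 1) x) = (\<Sum>J | J \<subseteq> {..<l} - {i} \<and> card J = r - 1. \<Prod>j\<in>J. real (x j))"
      by (simp add: esym_def)
    also have "\<dots> \<le> (\<Sum>J | J \<subseteq> {..<l} - {i} \<and> card J = r - 1. \<Prod>j\<in>J. ?q)"
    proof (intro sum_mono prod_mono conjI)
      fix J j assume "J \<in> {J. J \<subseteq> {..<l} - {i} \<and> card J = r - 1}" "j \<in> J"
      then have "j < l" by auto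
      then have "\<bar>real (x j) - real n / real l\<bar> \<le> w / 2 * real n" using x by blast
      moreover have "?q = real n / real l + w / 2 * real n" by (simp add: algebra_simps)
      ultimately show "real (x j) \<le> ?q" by linarith
    qed auto
    also have "\<dots> = ?C * ?q ^ (r - 1)"
      using n_subsets[of "{..<l} - {i}" "r - 1"] i by simp
    also have "\<dots> = ?C * (1 / real l + w/2) ^ (r - 1) * real n ^ (r - 1)" by (simp add: power_mult_distrib)
    also have "\<dots> \<le> (beta l r + \<eta>) * real n ^ (r - 1)" using w(1) w(2)[of "w/2"] by (intro mult_right_mono) auto
    finally show "real (esym ({..<l} - {i}) (r - 1) x) \<le> (beta l r + \<eta>) * real n ^ (r - 1)" .
  qed
qed

section \<open>Lagrangians\<close>

text \<open>An edge has \<open>r\<close> vertices and meets exactly \<open>r\<close> parts, because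
  edges of the pattern have \<open>r\<close> elements. A sum of \<open>r\<close> positive integers
  equal to \<open>r\<close> has all summands 1.\<close>

lemma construction_edges_eq:
  assumes Q: "rgraph r Q" and V: "disjoint_family_on V (verts Q)" "verts G = (\<Union>i\<in>verts Q. V i)" "finite (verts G)"
    and E: "edges G = {e. e \<subseteq> verts G \<and> card e = r \<and> {i \<in> verts Q. e \<inter> V i \<noteq> {}} \<in> edges Q}"
  shows "edges G = (\<Union>q\<in>edges Q. transv V q)"
proof (intro set_eqI iffI)
  fix e assume "e \<in> edges G"
  then have e: "e \<subseteq> verts G" "card e = r" "{i \<in> verts Q. e \<inter> V i \<noteq> {}} \<in> edges Q" using E by auto
  let ?q = "{i \<in> verts Q. e \<inter> V i \<noteq> {}}"
  have fe: "finite e" using e(1) V(3) by (rule finite_subset)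
  have fq: "finite ?q" using Q by (auto simp: rgraph_def)
  have cq: "card ?q = r" using Q e(3) by (auto simp: rgraph_def)
  have ee: "e = (\<Union>i\<in>?q. e \<inter> V i)" using e(1) unfolding V(2) by blast
  have "card e = (\<Sum>i\<in>?q. card (e \<inter> V i))"
  proof -
    have "card (\<Union>i\<in>?q. e \<inter> V i) = (\<Sum>i\<in>?q. card (e \<inter> V i))"
      using fq fe V(1) by (intro card_UN_disjoint) (auto simp: disjoint_family_on_def)
    then show ?thesis using ee by simp
  qed
  then have s: "(\<Sum>i\<in>?q. card (e \<inter> V i)) = (\<Sum>i\<in>?q. 1)" using e(2) cq by simp
  have ge: "1 \<le> card (e \<inter> V i)" if "i \<in> ?q" for i
    using that fe by (simp add: Suc_le_eq card_gt_0_iff)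
  have "card (e \<inter> V i) = 1" if "i \<in> ?q" for i
  proof (rule ccontr)
    assume "card (e \<inter> V i) \<noteq> 1"
    then have "1 < card (e \<inter> V i)" using ge[OF that] by simp
    then have "(\<Sum>i\<in>?q. 1) < (\<Sum>i\<in>?q. card (e \<inter> V i))"
      using fq ge that by (intro sum_strict_mono_ex1) auto
    then show False using s by simp
  qed
  moreover have "e \<subseteq> (\<Union>i\<in>?q. V i)" using e(1) unfolding V(2) by blast
  ultimately have "e \<in> transv V ?q" by (intro transvI)
  then show "e \<in> (\<Union>q\<in>edges Q. transv V q)" using e(3) by blast
next
  fix e assume "e \<in> (\<Union>q\<in>edges Q. transv V q)"
  then obtain q where q: "q \<in> edges Q" "e \<in> transv V q" by auto
  have qs: "q \<subseteq> verts Q" "card q = r" "finite (verts Q)" using Q q(1) by (auto simp: rgraph_def)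
  have fq: "finite q" using qs by (meson finite_subset)
  note t = transvD[OF q(2) V(1) qs(1) fq]
  have "{i \<in> verts Q. e \<inter> V i \<noteq> {}} = q"
  proof -
    have "e \<inter> V i \<noteq> {} \<longleftrightarrow> i \<in> q" if "i \<in> verts Q" for i
      using t(4)[OF that] t(3) by (auto split: if_splits simp: card_eq_0_iff)
    then show ?thesis using qs(1) by blast
  qed
  then show "e \<in> edges G" using t q qs unfolding E V(2) by auto
qed

lemma card_construction:
  assumes Q: "rgraph r Q" and V: "disjoint_family_on V (verts Q)" "verts G = (\<Union>i\<in>verts Q. V i)" "finite (verts G)"
    and E: "edges G = {e. e \<subseteq> verts G \<and> card e = r \<and> {i \<in> verts Q. e \<inter> V i \<noteq> {}} \<in> edges Q}"
  shows "card (edges G) = (\<Sum>q\<in>edges Q. \<Prod>i\<in>q. card (V i))"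
  unfolding construction_edges_eq[OF assms]
proof (rule card_UN_transv[OF V(1)])
  show "finite (verts Q)" "edges Q \<subseteq> Pow (verts Q)" using Q by (auto simp: rgraph_def)
  show "finite (V i)" if "i \<in> verts Q" for i using V(2,3) that by (auto intro: finite_subset)
qed

lemma construction_exists:
  assumes Q: "rgraph r Q"
  obtains G :: "nat hgraph" where "is_construction r Q G" "card (verts G) = (\<Sum>i\<in>verts Q. x i)"
    "card (edges G) = (\<Sum>q\<in>edges Q. \<Prod>i\<in>q. x i)"
proof -
  have fQ: "finite (verts Q)" using Q by (simp add: rgraph_def)
  obtain h :: "_ \<Rightarrow> nat" where h: "inj_on h (verts Q)" using finite_imp_inj_to_nat_seg[OF fQ] by blast
  define V where "V i = (\<lambda>k. prod_encode (h i, k)) ` {..<x i}" for i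
  have dV: "disjoint_family_on V (verts Q)"
    unfolding disjoint_family_on_def V_def using h by (auto dest: inj_onD)
  have cV: "card (V i) = x i" for i
    unfolding V_def by (subst card_image) (auto intro!: inj_onI)
  define W where "W = (\<Union>i\<in>verts Q. V i)"
  define G where "G = (W, {e. e \<subseteq> W \<and> card e = r \<and> {i \<in> verts Q. e \<inter> V i \<noteq> {}} \<in> edges Q})"
  have fW: "finite W" unfolding W_def V_def using fQ by auto
  have "is_construction r Q G" unfolding is_construction_def
    using dV fW by (intro conjI exI[of _ V]) (auto simp: G_def W_def)
  moreover have "card (verts G) = (\<Sum>i\<in>verts Q. x i)"
  proof -
    have "card W = (\<Sum>i\<in>verts Q. card (V i))" unfolding W_def
      using fQ dV by (intro card_UN_disjoint) (auto simp: disjoint_family_on_def V_def)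
    then show ?thesis by (simp add: G_def cV)
  qed
  moreover have "card (edges G) = (\<Sum>q\<in>edges Q. \<Prod>i\<in>q. card (V i))"
    by (rule card_construction[OF Q dV]) (use fW in \<open>auto simp: G_def W_def\<close>)
  ultimately show ?thesis using that by (simp add: cV)
qed

section \<open>Monotonicity and convergence of the construction densities\<close>

lemma construction_edges_subset:
  "is_construction r Q G \<Longrightarrow> edges G \<subseteq> {e. e \<subseteq> verts G \<and> card e = r}"
  unfolding is_construction_def by auto

lemma construction_finite: "is_construction r Q G \<Longrightarrow> finite (verts G)"
  by (simp add: is_construction_def)

lemma card_construction_le: "is_construction r Q G \<Longrightarrow> card (edges G) \<le> card (verts G) choose r"
  using card_mono[OF _ construction_edges_subset[of r Q G]] n_subsets[of "verts G" r] construction_finite[of r Q G]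
  by auto

lemma finite_construction_sizes:
  "finite {card (edges G) | G :: nat hgraph. is_construction r Q G \<and> card (verts G) = n}"
  by (rule finite_subset[of _ "{..n choose r}"]) (auto dest: card_construction_le)

lemma max_construction_ge:
  fixes G :: "nat hgraph"
  assumes "is_construction r Q G" "card (verts G) = n"
  shows "card (edges G) \<le> max_construction r Q n"
  unfolding max_construction_def using assms by (intro Max_ge finite_construction_sizes) blast

lemma max_construction_attained:
  assumes "rgraph r Q" "verts Q \<noteq> {}"
  obtains G :: "nat hgraph" where "is_construction r Q G" "card (verts G) = n" "card (edges G) = max_construction r Q n"
proof -
  obtain a where a: "a \<in> verts Q" using assms(2) by auto
  have "finite (verts Q)" using assms(1) by (simp add: rgraph_def)
  \<comment> \<open>All vertices in a single part: constructions of every order exist, so the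
    maximum is taken over a nonempty set.\<close>
  then have "(\<Sum>i\<in>verts Q. if i = a then n else 0) = n" using a by simp
  then obtain G :: "nat hgraph" where "is_construction r Q G" "card (verts G) = n"
    by (metis construction_exists[OF assms(1), of "\<lambda>i. if i = a then n else 0"])
  then have "max_construction r Q n \<in> {card (edges G) | G :: nat hgraph. is_construction r Q G \<and> card (verts G) = n}"
    unfolding max_construction_def by (intro Max_in finite_construction_sizes) blast+
  then obtain G :: "nat hgraph" where "max_construction r Q n = card (edges G)"
      "is_construction r Q G" "card (verts G) = n" by blast
  then show ?thesis using that by simp
qed

lemma construction_delete_vertex:
  assumes "is_construction r Q G"
  shows "is_construction r Q (verts G - {v}, {e \<in> edges G. v \<notin> e})"
proof -
  obtain V where V: "finite (verts G)" "disjoint_family_on V (verts Q)" "verts G = (\<Union>i\<in>verts Q. V i)"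
    "edges G = {e. e \<subseteq> verts G \<and> card e = r \<and> {i \<in> verts Q. e \<inter> V i \<noteq> {}} \<in> edges Q}"
    using assms unfolding is_construction_def by auto
  have *: "e \<inter> (V i - {v}) = e \<inter> V i" if "e \<subseteq> verts G - {v}" for e i using that by auto
  have eq: "{e \<in> edges G. v \<notin> e}
      = {e. e \<subseteq> verts G - {v} \<and> card e = r \<and> {i \<in> verts Q. e \<inter> (V i - {v}) \<noteq> {}} \<in> edges Q}"
    unfolding V(4) using * by (auto cong: conj_cong)
  show ?thesis unfolding is_construction_def
    by (intro conjI exI[of _ "\<lambda>i. V i - {v}"]) (use V eq in \<open>auto simp: disjoint_family_on_def\<close>)
qed

lemma sum_card_avoiding:
  assumes "finite V" "\<And>e. e \<in> E \<Longrightarrow> e \<subseteq> V \<and> card e = r"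
  shows "(\<Sum>v\<in>V. card {e \<in> E. v \<notin> e}) = (card V - r) * card E"
proof -
  have fE: "finite E" by (rule finite_subset[of _ "Pow V"]) (use assms in auto)
  have "(\<Sum>v\<in>V. card {e \<in> E. v \<notin> e}) = (\<Sum>v\<in>V. \<Sum>e\<in>E. if v \<notin> e then 1 else 0)"
    using fE by (simp add: sum.If_cases Int_def)
  also have "\<dots> = (\<Sum>e\<in>E. \<Sum>v\<in>V. if v \<notin> e then 1 else 0)" by (rule sum.swap)
  also have "\<dots> = (\<Sum>e\<in>E. card V - r)"
  proof (intro sum.cong refl)
    fix e assume e: "e \<in> E"
    have "V \<inter> {v. v \<notin> e} = V - e" by auto
    moreover have "finite e" "e \<subseteq> V" "card e = r" using assms e by (auto intro: finite_subset)
    ultimately show "(\<Sum>v\<in>V. if v \<notin> e then 1 else 0) = card V - r"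
      using assms(1) by (simp add: sum.If_cases card_Diff_subset)
  qed
  finally show ?thesis by simp
qed

text \<open>Deleting a vertex from a construction leaves a construction, and each edge of an optimal
  one survives exactly \<open>Suc n - r\<close> of the \<open>Suc n\<close> deletions when
  \<open>r \<le> Suc n\<close>.\<close>

lemma max_construction_averaging:
  assumes "rgraph r Q" "verts Q \<noteq> {}"
  shows "(Suc n - r) * max_construction r Q (Suc n) \<le> Suc n * max_construction r Q n"
proof -
  obtain G :: "nat hgraph" where G: "is_construction r Q G" "card (verts G) = Suc n"
    "card (edges G) = max_construction r Q (Suc n)" by (rule max_construction_attained[OF assms])
  have "(Suc n - r) * max_construction r Q (Suc n) = (card (verts G) - r) * card (edges G)"
    by (simp add: G)
  also have "\<dots> = (\<Sum>v\<in>verts G. card {e \<in> edges G. v \<notin> e})"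
    by (rule sum_card_avoiding[symmetric]) (use construction_finite[OF G(1)] construction_edges_subset[OF G(1)] in auto)
  also have "\<dots> \<le> (\<Sum>v\<in>verts G. max_construction r Q n)"
  proof (rule sum_mono)
    fix v assume v: "v \<in> verts G"
    have "card (verts G - {v}) = n" using v G(2) construction_finite[OF G(1)] by simp
    then show "card {e \<in> edges G. v \<notin> e} \<le> max_construction r Q n"
      using max_construction_ge[OF construction_delete_vertex[OF G(1)], of v n] by simp
  qed
  finally show ?thesis using G(2) by simp
qed

text \<open>By averaging the density is nonincreasing from \<open>n = r\<close> on. Convergence has
  to be proved because \<open>lim\<close> says nothing about a divergent sequence.\<close>

lemma max_construction_density_convergent:
  assumes "rgraph r Q" "verts Q \<noteq> {}"
  shows "convergent (\<lambda>n. real (max_construction r Q n) / real (n choose r))"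
proof -
  let ?f = "\<lambda>n. real (max_construction r Q n) / real (n choose r)"
  have "?f (Suc n) \<le> ?f n" if n: "r \<le> n" for n
  proof -
    have abs: "(Suc n - r) * (Suc n choose r) = Suc n * (n choose r)"
      using binomial_absorb_comp[of "Suc n" r] by simp
    have pos: "0 < n choose r" "0 < Suc n choose r" "0 < Suc n - r" using n by auto
    have "(Suc n - r) * max_construction r Q (Suc n) * (n choose r)
       \<le> Suc n * max_construction r Q n * (n choose r)"
      using max_construction_averaging[OF assms, of n] by (rule mult_right_mono) simp
    also have "\<dots> = Suc n * (n choose r) * max_construction r Q n" by (simp only: mult_ac)
    also have "\<dots> = (Suc n - r) * (Suc n choose r) * max_construction r Q n" by (simp only: abs)
    finally have "max_construction r Q (Suc n) * (n choose r) \<le> max_construction r Q n * (Suc n choose r)"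
      using pos(3) by (simp only: mult.assoc mult_le_cancel1) (simp add: mult.commute)
    then have "real (max_construction r Q (Suc n)) * real (n choose r) \<le> real (max_construction r Q n) * real (Suc n choose r)"
      by (metis of_nat_le_iff of_nat_mult)
    then show ?thesis using pos by (simp add: divide_simps del: binomial_Suc_Suc)
  qed
  then have dec: "decseq (\<lambda>n. ?f (n + r))" by (intro decseq_SucI) simp
  have "\<exists>L. (\<lambda>n. ?f (n + r)) \<longlonglongrightarrow> L"
    by (rule decseq_convergent[OF dec, of 0]) auto
  then have "convergent (\<lambda>n. ?f (n + r))" by (simp only: convergent_def)
  then show ?thesis using convergent_ignore_initial_segment[of ?f r] by simp
qed

text \<open>Multiplying all part sizes by a factor scales the vertices linearly and the edges by the
  \<open>r\<close>-th power, so the limit dominates the edge polynomial of the pattern at every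
  integer weight vector.\<close>

lemma lagrangian_ge:
  assumes Q: "rgraph r Q" and n: "(\<Sum>i\<in>verts Q. x i) = n" "0 < n"
  shows "fact r * real (\<Sum>q\<in>edges Q. \<Prod>i\<in>q. x i) \<le> lagrangian r Q * real n ^ r"
proof -
  let ?f = "\<lambda>n. real (max_construction r Q n) / real (n choose r)"
  let ?p = "\<Sum>q\<in>edges Q. \<Prod>i\<in>q. x i"
  have ne: "verts Q \<noteq> {}" using n by auto
  have cq: "card q = r" if "q \<in> edges Q" for q using Q that by (auto simp: rgraph_def)
  have lim: "?f \<longlonglongrightarrow> lagrangian r Q" unfolding lagrangian_def
    using max_construction_density_convergent[OF Q ne] by (simp add: convergent_LIMSEQ_iff)
  \<comment> \<open>The limit is read along multiples of \<open>n\<close>; the factor exceeds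
    \<open>r\<close> so that the binomial coefficient is never zero.\<close>
  have "strict_mono (\<lambda>k. Suc (r + k) * n)" using n(2) by (intro strict_monoI) simp
  then have lim2: "(\<lambda>k. ?f (Suc (r + k) * n)) \<longlonglongrightarrow> lagrangian r Q"
    using LIMSEQ_subseq_LIMSEQ[OF lim] by (simp add: comp_def)
  have ge: "fact r * real ?p / real n ^ r \<le> ?f (Suc (r + k) * n)" for k
  proof -
    let ?k = "Suc (r + k)"
    obtain G :: "nat hgraph" where G: "is_construction r Q G" "card (verts G) = (\<Sum>i\<in>verts Q. ?k * x i)"
      "card (edges G) = (\<Sum>q\<in>edges Q. \<Prod>i\<in>q. ?k * x i)" by (rule construction_exists[OF Q])
    have "(\<Sum>q\<in>edges Q. \<Prod>i\<in>q. ?k * x i) = ?k ^ r * ?p"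
      unfolding sum_distrib_left by (intro sum.cong refl) (simp add: prod.distrib cq del: mult_Suc)
    moreover have "card (verts G) = ?k * n" using G(2) n(1) by (simp only: sum_distrib_left[symmetric])
    ultimately have ge: "?k ^ r * ?p \<le> max_construction r Q (?k * n)"
      using max_construction_ge[OF G(1)] G(3) by metis
    have "r \<le> ?k * n" using n(2) by (cases n) auto
    then have pos: "0 < (?k * n) choose r" by simp
    have "((?k * n) choose r) * fact r \<le> (?k * n) ^ r" by (rule binomial_fact_pow)
    then have le: "real ((?k * n) choose r) * fact r \<le> real ?k ^ r * real n ^ r"
      by (metis of_nat_fact of_nat_le_iff of_nat_mult of_nat_power power_mult_distrib)
    have "fact r * real ?p * real ((?k * n) choose r) \<le> (real ?k ^ r * real n ^ r) * real ?p"
      using mult_right_mono[OF le, of "real ?p"] by (simp only: mult_ac)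
    also have "\<dots> = real (?k ^ r * ?p) * real n ^ r" by simp
    also have "\<dots> \<le> real (max_construction r Q (?k * n)) * real n ^ r"
      using ge by (intro mult_right_mono of_nat_mono) auto
    finally show ?thesis using pos n(2) by (simp add: divide_simps del: mult_Suc of_nat_sum)
  qed
  have "fact r * real ?p / real n ^ r \<le> lagrangian r Q"
    by (rule LIMSEQ_le_const[OF lim2]) (use ge in blast)
  then show ?thesis using n(2) by (simp add: divide_simps del: of_nat_sum)
qed

section \<open>Finding expansions\<close>

definition heavy :: "nat \<Rightarrow> 'v set set \<Rightarrow> 'v \<Rightarrow> 'v \<Rightarrow> bool" where
  "heavy m E u v \<longleftrightarrow> u \<noteq> v \<and>
     (\<forall>W. finite W \<and> card W \<le> m \<and> u \<notin> W \<and> v \<notin> W \<longrightarrow> (\<exists>e\<in>E. u \<in> e \<and> v \<in> e \<and> e \<inter> W = {}))"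

text \<open>Pairs are tested against all of \<open>E\<close>, not against the surviving edges, so
  the deletion need not be iterated.\<close>

definition heavy_edges :: "nat \<Rightarrow> 'v set set \<Rightarrow> 'v set set" where
  "heavy_edges m E = {e \<in> E. \<forall>u\<in>e. \<forall>v\<in>e. u \<noteq> v \<longrightarrow> heavy m E u v}"

text \<open>Pairs inside an edge of \<open>F\<close> are covered by its image anyway, so it suffices
  to ask for edges over the uncovered pairs.\<close>

definition core_free :: "'a hgraph \<Rightarrow> 'v hgraph \<Rightarrow> bool" where
  "core_free F G \<longleftrightarrow>
     \<not> (\<exists>f. embeds f F G \<and> (\<forall>p\<in>uncovered_pairs F. \<exists>e\<in>edges G. f ` p \<subseteq> e))"

lemma heavy_sym: "heavy m E u v \<Longrightarrow> heavy m E v u"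
  unfolding heavy_def by blast

lemma finite_uncovered_pairs: "rgraph r F \<Longrightarrow> finite (uncovered_pairs F)"
  unfolding uncovered_pairs_def rgraph_def by (rule finite_subset[of _ "Pow (verts F)"]) auto

lemma card_verts_expansion:
  assumes "rgraph r F"
  shows "card (verts (expansion r F)) = card (verts F) + card (uncovered_pairs F) * (r - 2)"
  using finite_uncovered_pairs[OF assms] assms
  by (simp add: expansion_def card_Plus rgraph_def card_cartesian_product)

text \<open>The edge added for an uncovered pair covers its image. Thus core-freeness implies
  freeness from the expansion, and results on free hypergraphs apply at every stage of the
  symmetrization.\<close>

lemma core_of_expansion:
  assumes "contains G (expansion r F)"
  shows "\<not> core_free F G"
proof -
  obtain h where h: "embeds h (expansion r F) G" using assms by (auto simp: contains_def)
  define f where "f = h \<circ> Inl"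
  have inj: "inj_on h (verts (expansion r F))" and sub: "h ` verts (expansion r F) \<subseteq> verts G"
    and ed: "\<And>e. e \<in> edges (expansion r F) \<Longrightarrow> h ` e \<in> edges G"
    using h by (auto simp: embeds_def)
  have V: "Inl ` verts F \<subseteq> verts (expansion r F)" by (auto simp: expansion_def)
  have "embeds f F G" unfolding embeds_def
  proof (intro conjI ballI)
    show "inj_on f (verts F)" unfolding f_def
      by (rule comp_inj_on[OF _ inj_on_subset[OF inj V]]) simp
    show "f ` verts F \<subseteq> verts G" using sub V by (auto simp: f_def)
    fix e assume "e \<in> edges F"
    then have "Inl ` e \<in> edges (expansion r F)" by (simp add: expansion_def)
    from ed[OF this] show "f ` e \<in> edges G" by (simp add: f_def image_comp)
  qed
  moreover have "\<exists>e\<in>edges G. f ` p \<subseteq> e" if "p \<in> uncovered_pairs F" for p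
  proof -
    have "Inl ` p \<union> Inr ` ({p} \<times> {..<r - 2}) \<in> edges (expansion r F)"
      using that by (auto simp: expansion_def)
    from ed[OF this] show ?thesis by (rule rev_bexI) (auto simp: f_def)
  qed
  ultimately show ?thesis unfolding core_free_def by blast
qed

text \<open>Expansion edges are chosen greedily. At most one pair, the one in \<open>P0\<close>, may
  be light; for it an edge meeting the core in exactly this pair is supplied from outside.\<close>

lemma contains_expansion_of_heavy:
  assumes G: "rgraph r (V, E)" and F: "rgraph r F" and f: "embeds f F (V, E)" and r: "2 \<le> r"
    and m: "card (verts (expansion r F)) \<le> m"
    and P0: "P0 \<subseteq> {p0}" "\<And>p. p \<in> P0 \<Longrightarrow> p \<in> uncovered_pairs F \<Longrightarrow> \<exists>e\<in>E. e \<inter> f ` verts F = f ` p"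
    and hv: "\<And>p u v. p \<in> uncovered_pairs F - P0 \<Longrightarrow> u \<in> p \<Longrightarrow> v \<in> p \<Longrightarrow> u \<noteq> v \<Longrightarrow> heavy m E (f u) (f v)"
  shows "contains (V, E) (expansion r F)"
proof -
  let ?U = "uncovered_pairs F" and ?C = "f ` verts F"
  have fU: "finite ?U" using F by (rule finite_uncovered_pairs)
  have fV: "finite V" and fF: "finite (verts F)" using G F by (auto simp: rgraph_def)
  have eE: "finite e \<and> e \<subseteq> V \<and> card e = r" if "e \<in> E" for e
    using G that fV by (auto simp: rgraph_def intro: finite_subset)
  have inj: "inj_on f (verts F)" and sub: "?C \<subseteq> V" and ed: "\<And>e. e \<in> edges F \<Longrightarrow> f ` e \<in> E"
    using f by (auto simp: embeds_def)
  have p2: "p \<subseteq> verts F \<and> card p = 2 \<and> finite p" if "p \<in> ?U" for p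
    using that fF by (auto simp: uncovered_pairs_def intro: finite_subset)
  have cfp: "card (f ` p) = 2" if "p \<in> ?U" for p
    using p2[OF that] inj by (metis card_image inj_on_subset)
  have cdiff: "card (e - ?C) = r - 2" if "e \<in> E" "e \<inter> ?C = f ` p" "p \<in> ?U" for e p
  proof -
    have "e - ?C = e - f ` p" using that by auto
    moreover have "f ` p \<subseteq> e" using that by auto
    ultimately show ?thesis using eE[OF that(1)] cfp[OF that(3)] by (simp add: card_Diff_subset finite_subset)
  qed
  define good where "good A g \<longleftrightarrow> (\<forall>p\<in>A. g p \<in> E \<and> g p \<inter> ?C = f ` p) \<and>
      (\<forall>p\<in>A. \<forall>q\<in>A. p \<noteq> q \<longrightarrow> (g p - ?C) \<inter> (g q - ?C) = {})" for A g
  have "\<exists>g. good (A \<union> (P0 \<inter> ?U)) g" if "finite A" "A \<subseteq> ?U - P0" for A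
    using that
  proof (induction A rule: finite_induct)
    \<comment> \<open>The exceptional pair offers no choice of edge, so it is served before all
      heavy pairs.\<close>
    case empty
    have "\<forall>p\<in>P0 \<inter> ?U. \<exists>e. e \<in> E \<and> e \<inter> ?C = f ` p" using P0(2) by blast
    then obtain g where g: "\<And>p. p \<in> P0 \<inter> ?U \<Longrightarrow> g p \<in> E \<and> g p \<inter> ?C = f ` p" by metis
    have "p = q" if "p \<in> P0" "q \<in> P0" for p q using that P0(1) by blast
    then have "good ({} \<union> (P0 \<inter> ?U)) g" unfolding good_def using g by blast
    then show ?case by blast
  next
    case (insert p A)
    then obtain g where g: "good (A \<union> (P0 \<inter> ?U)) g" by auto
    let ?B = "A \<union> (P0 \<inter> ?U)"
    have pU: "p \<in> ?U" "p \<notin> P0" using insert by auto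
    have BU: "?B \<subseteq> ?U" using insert by auto
    obtain u v where uv: "p = {u, v}" "u \<noteq> v" using p2[OF pU(1)] by (auto simp: card_2_iff)
    have uvF: "u \<in> verts F" "v \<in> verts F" using p2[OF pU(1)] uv by auto
    \<comment> \<open>What the next edge must avoid: the rest of the core and all new vertices used
      so far. Their number is at most that of the vertices of the expansion, hence at most
      \<open>m\<close>.\<close>
    define W where "W = (?C - {f u, f v}) \<union> (\<Union>q\<in>?B. g q - ?C)"
    have fB: "finite ?B" using BU fU by (rule finite_subset)
    have fW: "finite W" unfolding W_def using fF fB g eE by (auto simp: good_def)
    have "card (\<Union>q\<in>?B. g q - ?C) \<le> (\<Sum>q\<in>?B. card (g q - ?C))" using fB by (rule card_UN_le)
    also have "\<dots> = (\<Sum>q\<in>?B. r - 2)"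
      using g BU by (intro sum.cong refl cdiff) (auto simp: good_def)
    also have "\<dots> \<le> card ?U * (r - 2)" using card_mono[OF fU BU] by simp
    finally have 1: "card (\<Union>q\<in>?B. g q - ?C) \<le> card ?U * (r - 2)" .
    have "card W \<le> card (?C - {f u, f v}) + card (\<Union>q\<in>?B. g q - ?C)"
      unfolding W_def by (rule card_Un_le)
    also have "card (?C - {f u, f v}) \<le> card ?C" using fF by (intro card_mono) auto
    also have "card ?C = card (verts F)" using inj by (rule card_image)
    finally have "card W \<le> m" using 1 m card_verts_expansion[OF F] by simp
    moreover have "f u \<notin> W" "f v \<notin> W" using uvF by (auto simp: W_def)
    ultimately obtain e where e: "e \<in> E" "f u \<in> e" "f v \<in> e" "e \<inter> W = {}"
      using hv[of p u v] pU uv fW unfolding heavy_def by blast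
    have eC: "e \<inter> ?C = f ` p" using e uvF unfolding uv W_def by auto
    have eg: "(e - ?C) \<inter> (g q - ?C) = {}" if "q \<in> ?B" for q using e(4) that unfolding W_def by blast
    have pB: "p \<notin> ?B" using insert pU by auto
    have "good (insert p A \<union> (P0 \<inter> ?U)) (g(p := e))"
      using g e eC eg pB unfolding good_def by (auto 0 3 simp: Int_commute)
    then show ?case by blast
  qed
  from this[of "?U - P0"] obtain g where "good ((?U - P0) \<union> (P0 \<inter> ?U)) g" using fU by auto
  moreover have "(?U - P0) \<union> (P0 \<inter> ?U) = ?U" by auto
  ultimately have g: "\<And>p. p \<in> ?U \<Longrightarrow> g p \<in> E \<and> g p \<inter> ?C = f ` p"
    and gd: "\<And>p q. p \<in> ?U \<Longrightarrow> q \<in> ?U \<Longrightarrow> p \<noteq> q \<Longrightarrow> (g p - ?C) \<inter> (g q - ?C) = {}"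
    by (auto simp: good_def)
  have "\<exists>h. bij_betw h {..<r - 2} (g p - ?C)" if "p \<in> ?U" for p
    using cdiff[of "g p" p] g[OF that] that eE
    by (metis card_lessThan finite_Diff finite_lessThan finite_same_card_bij)
  then obtain h where h: "\<And>p. p \<in> ?U \<Longrightarrow> bij_betw (h p) {..<r - 2} (g p - ?C)" by metis
  define k where "k x = (case x of Inl v \<Rightarrow> f v | Inr (p, i) \<Rightarrow> h p i)" for x
  have kI: "k (Inl v) = f v" for v by (simp add: k_def)
  have kR: "k (Inr (p, i)) = h p i" for p i by (simp add: k_def)
  have hin: "h p i \<in> g p - ?C" if "p \<in> ?U" "i < r - 2" for p i
    using bij_betwE[OF h[OF that(1)]] that(2) by auto
  have "embeds k (expansion r F) (V, E)" unfolding embeds_def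
  proof (intro conjI ballI)
    show "inj_on k (verts (expansion r F))"
    proof (rule inj_onI)
      fix x y assume x: "x \<in> verts (expansion r F)" and y: "y \<in> verts (expansion r F)" and eq: "k x = k y"
      have X: "(\<exists>v\<in>verts F. x = Inl v) \<or> (\<exists>p\<in>?U. \<exists>i<r - 2. x = Inr (p, i))"
        using x by (auto simp: expansion_def)
      have Y: "(\<exists>v\<in>verts F. y = Inl v) \<or> (\<exists>p\<in>?U. \<exists>i<r - 2. y = Inr (p, i))"
        using y by (auto simp: expansion_def)
      consider (1) v w where "v \<in> verts F" "w \<in> verts F" "x = Inl v" "y = Inl w"
        | (2) v p i where "v \<in> verts F" "p \<in> ?U" "i < r - 2" "x = Inl v" "y = Inr (p, i)"
        | (3) v p i where "v \<in> verts F" "p \<in> ?U" "i < r - 2" "y = Inl v" "x = Inr (p, i)"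
        | (4) p i q j where "p \<in> ?U" "i < r - 2" "q \<in> ?U" "j < r - 2" "x = Inr (p, i)" "y = Inr (q, j)"
        using X Y by blast
      then show "x = y"
      proof cases
        case 1 then show ?thesis using eq inj by (auto simp: kI dest: inj_onD)
      next
        case 2
        then have "h p i = f v" using eq by (simp add: kI kR)
        then show ?thesis using hin[OF 2(2,3)] 2(1) by (metis DiffD2 imageI)
      next
        case 3
        then have "h p i = f v" using eq by (simp add: kI kR)
        then show ?thesis using hin[OF 3(2,3)] 3(1) by (metis DiffD2 imageI)
      next
        case 4
        have e: "h p i = h q j" using eq 4 by (simp add: kR)
        have "p = q" using gd[OF 4(1,3)] hin[OF 4(1,2)] hin[OF 4(3,4)] e by (metis disjoint_iff)
        moreover have "i = j"
          using bij_betw_imp_inj_on[OF h[OF 4(1)]] e 4(2,4) \<open>p = q\<close> by (metis inj_onD lessThan_iff)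
        ultimately show ?thesis using 4 by simp
      qed
    qed
    show "k ` verts (expansion r F) \<subseteq> verts (V, E)"
    proof
      fix y assume "y \<in> k ` verts (expansion r F)"
      then consider (1) v where "v \<in> verts F" "y = f v" | (2) p i where "p \<in> ?U" "i < r - 2" "y = h p i"
        by (auto simp: expansion_def kI kR)
      then show "y \<in> verts (V, E)"
      proof cases
        case 1 then show ?thesis using sub by auto
      next
        case 2
        then have "y \<in> g p" using hin by blast
        then show ?thesis using g[OF 2(1)] eE by auto
      qed
    qed
    fix e assume "e \<in> edges (expansion r F)"
    then consider (1) e' where "e' \<in> edges F" "e = Inl ` e'"
      | (2) p where "p \<in> ?U" "e = Inl ` p \<union> Inr ` ({p} \<times> {..<r - 2})"
      by (auto simp: expansion_def)
    then show "k ` e \<in> edges (V, E)"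
    proof cases
      case 1
      then have "k ` e = f ` e'" by (auto simp: kI image_iff)
      then show ?thesis using ed 1 by simp
    next
      case 2
      have "k ` e = f ` p \<union> h p ` {..<r - 2}"
        unfolding 2(2) image_Un image_image kI by (auto simp: kR image_iff)
      also have "h p ` {..<r - 2} = g p - ?C" using h[OF 2(1)] by (simp add: bij_betw_def)
      also have "f ` p \<union> (g p - ?C) = g p" using g[OF 2(1)] by auto
      finally show ?thesis using g[OF 2(1)] by simp
    qed
  qed
  then show ?thesis by (auto simp: contains_def)
qed

lemma core_free_heavy_edges:
  assumes G: "rgraph r (V, E)" and F: "rgraph r F" and r: "2 \<le> r"
    and m: "card (verts (expansion r F)) \<le> m" and free: "\<not> contains (V, E) (expansion r F)"
  shows "core_free F (V, heavy_edges m E)"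
  unfolding core_free_def
proof (rule notI, elim exE conjE)
  fix f assume f: "embeds f F (V, heavy_edges m E)"
    and cov: "\<forall>p\<in>uncovered_pairs F. \<exists>e\<in>edges (V, heavy_edges m E). f ` p \<subseteq> e"
  have f': "embeds f F (V, E)" using f by (auto simp: embeds_def heavy_edges_def)
  have "contains (V, E) (expansion r F)"
  proof (rule contains_expansion_of_heavy[OF G F f' r m, of "{}"])
    fix p u v assume p: "p \<in> uncovered_pairs F - {}" "u \<in> p" "v \<in> p" "u \<noteq> v"
    then have "u \<in> verts F" "v \<in> verts F" by (auto simp: uncovered_pairs_def)
    then have "f u \<noteq> f v" using f p by (auto simp: embeds_def dest: inj_onD)
    moreover obtain e where "e \<in> heavy_edges m E" "f ` p \<subseteq> e" using cov p by auto
    ultimately show "heavy m E (f u) (f v)" using p by (auto simp: heavy_edges_def)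
  qed auto
  with free show False by simp
qed

text \<open>Every edge through a light pair contains one of at most \<open>m\<close> blocking
  vertices. For \<open>r = 2\<close> there is no room for a third vertex, so there is no such edge.
  Multiplying by \<open>card V\<close> covers both cases without the exponent
  \<open>r - 3\<close>.\<close>

lemma light_pair_codegree:
  assumes G: "rgraph r (V, E)" and r: "2 \<le> r" and uv: "u \<noteq> v" "\<not> heavy m E u v"
  shows "card {e \<in> E. u \<in> e \<and> v \<in> e} * card V \<le> m * card V ^ (r - 2)"
proof -
  have fV: "finite V" using G by (simp add: rgraph_def)
  have eE: "finite e \<and> e \<subseteq> V \<and> card e = r" if "e \<in> E" for e
    using G that fV by (auto simp: rgraph_def intro: finite_subset)
  obtain W where W: "finite W" "card W \<le> m" "u \<notin> W" "v \<notin> W" "\<And>e. e \<in> E \<Longrightarrow> u \<in> e \<Longrightarrow> v \<in> e \<Longrightarrow> e \<inter> W \<noteq> {}"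
    using uv unfolding heavy_def by blast
  show ?thesis
  proof (cases "r = 2")
    case True
    have "{e \<in> E. u \<in> e \<and> v \<in> e} = {}"
    proof (rule ccontr)
      assume "{e \<in> E. u \<in> e \<and> v \<in> e} \<noteq> {}"
      then obtain e where e: "e \<in> E" "u \<in> e" "v \<in> e" by auto
      then have "{u, v} = e" using eE[OF e(1)] uv True by (intro card_seteq) auto
      then show False using W(3-5) e by auto
    qed
    then show ?thesis by (metis card.empty mult_zero_left zero_le)
  next
    case False
    let ?D = "\<lambda>w. {e. {u, v, w} \<subseteq> e \<and> e \<subseteq> V \<and> card e = r}"
    have "{e \<in> E. u \<in> e \<and> v \<in> e} \<subseteq> (\<Union>w\<in>W \<inter> V. ?D w)"
    proof
      fix e assume e: "e \<in> {e \<in> E. u \<in> e \<and> v \<in> e}"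
      then obtain w where "w \<in> e" "w \<in> W" using W(5)[of e] by auto
      with e eE[of e] show "e \<in> (\<Union>w\<in>W \<inter> V. ?D w)" by (intro UN_I[of w]) auto
    qed
    moreover have "finite (\<Union>w\<in>W \<inter> V. ?D w)"
      by (rule finite_subset[of _ "Pow V"]) (use fV in auto)
    ultimately have "card {e \<in> E. u \<in> e \<and> v \<in> e} \<le> card (\<Union>w\<in>W \<inter> V. ?D w)" by (intro card_mono)
    also have "\<dots> \<le> (\<Sum>w\<in>W \<inter> V. card (?D w))" using W(1) by (intro card_UN_le) auto
    also have "\<dots> \<le> (\<Sum>w\<in>W \<inter> V. card V ^ (r - 3))"
    proof (rule sum_mono)
      fix w assume w: "w \<in> W \<inter> V"
      have "u \<noteq> w" "v \<noteq> w" using w W(3,4) by auto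
      then have c3: "card {u, v, w} = 3" using uv(1) by simp
      show "card (?D w) \<le> card V ^ (r - 3)"
      proof (cases "{u, v, w} \<subseteq> V")
        case True
        then show ?thesis using card_supersets_le[OF fV True, of r "card V"] c3 r False by simp
      next
        case False
        then have "?D w = {}" by auto
        then show ?thesis by (metis card.empty zero_le)
      qed
    qed
    also have "\<dots> \<le> m * card V ^ (r - 3)"
      using W(1,2) card_mono[of W "W \<inter> V"] by simp
    finally have "card {e \<in> E. u \<in> e \<and> v \<in> e} * card V \<le> m * card V ^ (r - 3) * card V" by (rule mult_right_mono) simp
    also have "\<dots> = m * card V ^ Suc (r - 3)" by simp
    also have "Suc (r - 3) = r - 2" using r False by simp
    finally show ?thesis .
  qed
qed

text \<open>At most \<open>card V ^ 2\<close> ordered pairs are light, and each has small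
  codegree.\<close>

lemma card_light_edges:
  assumes G: "rgraph r (V, E)" and r: "2 \<le> r"
  shows "card (E - heavy_edges m E) \<le> m * card V ^ (r - 1)"
proof -
  have fV: "finite V" using G by (simp add: rgraph_def)
  have eE: "finite e \<and> e \<subseteq> V \<and> card e = r" if "e \<in> E" for e
    using G that fV by (auto simp: rgraph_def intro: finite_subset)
  show ?thesis
  proof (cases "V = {}")
    case True
    have "E - heavy_edges m E = {}" using eE r True by force
    then show ?thesis by (metis card.empty zero_le)
  next
    case False
    then have n: "0 < card V" using fV by (simp add: card_gt_0_iff)
    let ?P = "{(u, v) \<in> V \<times> V. u \<noteq> v \<and> \<not> heavy m E u v}"
    let ?D = "\<lambda>(u, v). {e \<in> E. u \<in> e \<and> v \<in> e}"
    have fE: "finite E" by (rule finite_subset[of _ "Pow V"]) (use fV eE in auto)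
    have fP: "finite ?P" by (rule finite_subset[of _ "V \<times> V"]) (use fV in auto)
    have "E - heavy_edges m E \<subseteq> (\<Union>p\<in>?P. ?D p)"
    proof
      fix e assume e: "e \<in> E - heavy_edges m E"
      then obtain u v where "u \<in> e" "v \<in> e" "u \<noteq> v" "\<not> heavy m E u v" by (auto simp: heavy_edges_def)
      then show "e \<in> (\<Union>p\<in>?P. ?D p)" using e eE by (intro UN_I[of "(u, v)"]) auto
    qed
    then have "card (E - heavy_edges m E) \<le> card (\<Union>p\<in>?P. ?D p)"
      by (rule card_mono[rotated]) (use fP fE in auto)
    also have "\<dots> \<le> (\<Sum>p\<in>?P. card (?D p))" using fP by (rule card_UN_le)
    finally have "card (E - heavy_edges m E) * card V \<le> (\<Sum>p\<in>?P. card (?D p)) * card V" by (rule mult_right_mono) simp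
    also have "\<dots> = (\<Sum>p\<in>?P. card (?D p) * card V)" by (rule sum_distrib_right)
    also have "\<dots> \<le> (\<Sum>p\<in>?P. m * card V ^ (r - 2))"
      by (rule sum_mono) (use light_pair_codegree[OF G r] in auto)
    also have "\<dots> = card ?P * (m * card V ^ (r - 2))" by simp
    also have "\<dots> \<le> card (V \<times> V) * (m * card V ^ (r - 2))"
      using fV by (intro mult_right_mono card_mono) auto
    also have "\<dots> = m * card V ^ Suc (r - 2) * card V" by (simp add: card_cartesian_product)
    also have "Suc (r - 2) = r - 1" using r by simp
    finally show ?thesis using n by simp
  qed
qed

section \<open>Links, degrees and the placement of the core\<close>

definition link :: "'v set set \<Rightarrow> 'v \<Rightarrow> 'v set set" where
  "link E v = {f. v \<notin> f \<and> insert v f \<in> E}"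

definition degree :: "'v set set \<Rightarrow> 'v \<Rightarrow> nat" where
  "degree E v = card {e \<in> E. v \<in> e}"

lemma degree_eq_card_link: "degree E v = card (link E v)"
proof -
  have "bij_betw (insert v) (link E v) {e \<in> E. v \<in> e}"
  proof (rule bij_betwI')
    fix f g assume "f \<in> link E v" "g \<in> link E v"
    then show "(insert v f = insert v g) = (f = g)" unfolding link_def by (auto simp: insert_ident)
  next
    fix e assume "e \<in> {e \<in> E. v \<in> e}"
    then show "\<exists>f\<in>link E v. e = insert v f"
      by (intro bexI[of _ "e - {v}"]) (auto simp: link_def insert_absorb)
  qed (auto simp: link_def)
  then show ?thesis unfolding degree_def by (simp add: bij_betw_same_card)
qed

text \<open>The labelling \<open>\<phi>\<close> is the only trace of condition (b): an edge using
  label 0 must be \<open>{..<r}\<close>. Both an isolated vertex and an embedding into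
  \<open>B(r, l + 1)\<close> provide it. The number \<open>lam\<close> lies strictly between the
  supremum of condition (a) and the Turan density.\<close>

locale expansion_family =
  fixes r l :: nat and F :: "'a hgraph" and \<phi> :: "'a \<Rightarrow> nat" and lam :: real
  assumes r2: "2 \<le> r" and rl: "r \<le> l" and F: "rgraph r F"
    and \<phi>: "bij_betw \<phi> (verts F) {..l}"
    and edges_F: "\<And>e. e \<in> edges F \<Longrightarrow> \<phi> ` e = {..<r} \<or> \<phi> ` e \<subseteq> {1..l}"
    and lam: "lam < fact r * alpha l r"
    and lagrangian_le: "\<And>Q :: nat hgraph. rgraph r Q \<Longrightarrow> \<not> contains Q F \<Longrightarrow>
      \<not> is_subconstruction r (complete_rgraph r l) Q \<Longrightarrow> lagrangian r Q \<le> lam"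
begin

abbreviation "H \<equiv> expansion r F"
abbreviation "m \<equiv> card (verts (expansion r F))"

lemma l0: "0 < l" "2 \<le> l" using r2 rl by auto

lemma card_verts_F: "card (verts F) = Suc l"
  using \<phi> by (simp add: bij_betw_same_card)

lemma m_ge: "Suc l \<le> m"
  unfolding card_verts_expansion[OF F] card_verts_F by simp

text \<open>The labels \<open>1..l\<close> span a complete hypergraph and label 0 needs just one
  edge. Since \<open>l\<close> is not below \<open>r\<close>, no edge of \<open>F\<close> joins the
  labels 0 and \<open>l\<close>; this is the pair that may be light, with its expansion edge given
  by \<open>last\<close>.\<close>

lemma contains_of_core:
  assumes G: "rgraph r (V, E)" and inj: "inj_on s {..l}" and sub: "s ` {..l} \<subseteq> V"
    and e0: "s ` {..<r} \<in> E" and eJ: "\<And>J. J \<subseteq> {1..l} \<Longrightarrow> card J = r \<Longrightarrow> s ` J \<in> E"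
    and hv: "\<And>i j. i \<le> l \<Longrightarrow> j \<le> l \<Longrightarrow> i \<noteq> j \<Longrightarrow> {i, j} \<noteq> {0, l} \<Longrightarrow> heavy m E (s i) (s j)"
    and last: "\<exists>e\<in>E. e \<inter> s ` {..l} = {s 0, s l}"
  shows "contains (V, E) H"
proof -
  define f where "f = s \<circ> \<phi>"
  have p_inj: "inj_on \<phi> (verts F)" and p_im: "\<phi> ` verts F = {..l}" using \<phi> by (auto simp: bij_betw_def)
  have fim: "f ` verts F = s ` {..l}" unfolding f_def image_comp[symmetric] p_im ..
  define p0 where "p0 = {v \<in> verts F. \<phi> v \<in> {0, l}}"
  have p0: "\<phi> ` p0 = {0, l}"
  proof
    show "{0, l} \<subseteq> \<phi> ` p0"
    proof
      fix i assume i: "i \<in> {0, l}"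
      then have "i \<in> \<phi> ` verts F" using p_im by auto
      then show "i \<in> \<phi> ` p0" using i unfolding p0_def by blast
    qed
  qed (auto simp: p0_def)
  have emb: "embeds f F (V, E)" unfolding embeds_def
  proof (intro conjI ballI)
    show "inj_on f (verts F)" unfolding f_def using p_inj inj p_im by (intro comp_inj_on) auto
    show "f ` verts F \<subseteq> verts (V, E)" using fim sub by simp
    fix e assume e: "e \<in> edges F"
    then have eF: "e \<subseteq> verts F" "card e = r" using F by (auto simp: rgraph_def)
    have c: "card (\<phi> ` e) = r" using eF p_inj by (metis card_image inj_on_subset)
    have "s ` (\<phi> ` e) \<in> E" using edges_F[OF e] e0 eJ c by auto
    then show "f ` e \<in> edges (V, E)" by (simp add: f_def image_comp)
  qed
  show ?thesis
  proof (rule contains_expansion_of_heavy[OF G F emb r2 order_refl, of "{p0}" p0])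
    fix p assume "p \<in> {p0}"
    then have "f ` p = {s 0, s l}" unfolding f_def image_comp[symmetric] using p0 by simp
    then show "\<exists>e\<in>E. e \<inter> f ` verts F = f ` p" using last fim by simp
  next
    fix p u v assume p: "p \<in> uncovered_pairs F - {p0}" "u \<in> p" "v \<in> p" "u \<noteq> v"
    then have pF: "p \<subseteq> verts F" "card p = 2" by (auto simp: uncovered_pairs_def)
    have fp: "finite p" using pF(2) by (metis card.infinite zero_neq_numeral)
    have puv: "p = {u, v}" using p fp pF(2) by (intro card_seteq[symmetric]) auto
    have uv: "u \<in> verts F" "v \<in> verts F" using p pF by auto
    have "{\<phi> u, \<phi> v} \<noteq> {0, l}"
    proof
      assume eq: "{\<phi> u, \<phi> v} = {0, l}"
      have "\<phi> ` p = \<phi> ` p0" using eq p0 puv by simp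
      then have "p = p0" using inj_on_image_eq_iff[OF p_inj pF(1), of p0] by (auto simp: p0_def)
      then show False using p by simp
    qed
    moreover have "\<phi> u \<noteq> \<phi> v" using uv p(4) p_inj by (auto dest: inj_onD)
    moreover have "\<phi> u \<le> l" "\<phi> v \<le> l" using uv p_im by auto
    ultimately show "heavy m E (f u) (f v)" using hv by (simp add: f_def)
  qed simp
qed

end

section \<open>Vertices over an almost complete partite hypergraph\<close>

text \<open>If every part has at least \<open>n / (2 * l)\<close> vertices, there are at least
  \<open>4 * kappa l * n^(l-1)\<close> choices of one vertex from each of \<open>l - 1\<close>
  parts. Three bad sets of relative size at most \<open>kappa l\<close> cannot exhaust them.\<close>

definition kappa :: "nat \<Rightarrow> real" where
  "kappa l = (1 / (2 * real l)) ^ (l - 1) / 4"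

locale partitioned_free = expansion_family r l F \<phi> lam
  for r l :: nat and F :: "'a hgraph" and \<phi> lam +
  fixes V :: "'v set" and E :: "'v set set" and P :: "nat \<Rightarrow> 'v set"
  assumes G: "rgraph r (V, E)" and free: "\<not> contains (V, E) H"
    and P: "disjoint_family_on P {..<l}" and UP: "(\<Union>i<l. P i) = V"
begin

abbreviation "n \<equiv> card V"
abbreviation "I i \<equiv> {..<l} - {i}"

definition complete_tuple :: "(nat \<Rightarrow> 'v) \<Rightarrow> bool" where
  "complete_tuple b \<longleftrightarrow> (\<forall>J. J \<subseteq> {..<l} \<and> card J = r \<longrightarrow> b ` J \<in> heavy_edges m E)"

text \<open>\<open>fits i v b\<close> says that \<open>v\<close> extends the tuple \<open>b\<close>, which misses the \<open>i\<close>-th part, to a complete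
  hypergraph on \<open>l\<close> vertices all of whose pairs can be expanded.\<close>

definition fits :: "nat \<Rightarrow> 'v \<Rightarrow> (nat \<Rightarrow> 'v) \<Rightarrow> bool" where
  "fits i v b \<longleftrightarrow> (\<forall>J. J \<subseteq> I i \<and> card J = r \<longrightarrow> b ` J \<in> E) \<and>
     (\<forall>J. J \<subseteq> I i \<and> card J = r - 1 \<longrightarrow> insert v (b ` J) \<in> E) \<and>
     (\<forall>j\<in>I i. \<forall>k\<in>I i. j \<noteq> k \<longrightarrow> heavy m E (b j) (b k)) \<and> (\<forall>j\<in>I i. heavy m E v (b j))"

abbreviation "\<kappa> \<equiv> kappa l"

definition typical :: "nat \<Rightarrow> 'v \<Rightarrow> bool" where
  "typical i v \<longleftrightarrow> real (card {b \<in> PiE (I i) P. \<not> fits i v b}) \<le> \<kappa> * real n ^ (l - 1)"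

lemma \<kappa>_pos: "0 < \<kappa>" using l0 by (simp add: kappa_def)

lemma finV: "finite V" using G by (simp add: rgraph_def)

lemma edgeD: "e \<in> E \<Longrightarrow> e \<subseteq> V" "e \<in> E \<Longrightarrow> card e = r" "e \<in> E \<Longrightarrow> finite e"
  using G finV by (auto simp: rgraph_def intro: finite_subset)

lemma finE: "finite E"
  by (rule finite_subset[of _ "Pow V"]) (use finV edgeD in auto)

lemma part: "i < l \<Longrightarrow> P i \<subseteq> V" "i < l \<Longrightarrow> finite (P i)" "i < l \<Longrightarrow> card (P i) \<le> n"
proof -
  assume "i < l"
  then show "P i \<subseteq> V" using UP by auto
  then show "finite (P i)" "card (P i) \<le> n" using finV by (auto intro: finite_subset card_mono)
qed

text \<open>As \<open>2 \<le> r \<le> l\<close>, any two indices lie in a common index set of size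
  \<open>r\<close>, and complete tuples are defined through \<open>heavy_edges\<close> rather than
  \<open>E\<close>.\<close>

lemma complete_tuple_heavy:
  assumes "complete_tuple b" "j < l" "k < l" "j \<noteq> k" "b j \<noteq> b k"
  shows "heavy m E (b j) (b k)"
proof -
  have "card {j, k} \<le> r" using assms r2 by simp
  then obtain J where J: "{j, k} \<subseteq> J" "J \<subseteq> {..<l}" "card J = r"
    using exists_subset_between[of "{j, k}" r "{..<l}"] assms rl by auto
  then have "b ` J \<in> heavy_edges m E" using assms(1) by (auto simp: complete_tuple_def)
  then show ?thesis using J assms(5) by (auto simp: heavy_edges_def)
qed

lemma tuple_inj: "b \<in> PiE J P \<Longrightarrow> J \<subseteq> {..<l} \<Longrightarrow> inj_on b J"
  by (rule transversal_inj[OF disjoint_family_on_mono[OF _ P]])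

lemma fits_of_complete_tuple:
  assumes b: "b \<in> PiE {..<l} P" "complete_tuple b" and i: "i < l"
    and c: "\<And>j. j \<in> I i \<Longrightarrow> c j = b j"
  shows "fits i (b i) c"
  unfolding fits_def
proof (intro conjI allI impI ballI)
  have im: "c ` J = b ` J" if "J \<subseteq> I i" for J using c that by (intro image_cong) auto
  fix J assume J: "J \<subseteq> I i \<and> card J = r"
  then have "J \<subseteq> {..<l}" by auto
  with J b(2) im show "c ` J \<in> E" by (auto simp: complete_tuple_def heavy_edges_def)
next
  have im: "c ` J = b ` J" if "J \<subseteq> I i" for J using c that by (intro image_cong) auto
  fix J assume J: "J \<subseteq> I i \<and> card J = r - 1"
  then have f: "finite J" by (meson finite_Diff finite_lessThan finite_subset)
  have "card (insert i J) = r" using J f r2 by (subst card_insert_disjoint) auto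
  moreover have "insert i J \<subseteq> {..<l}" using J i by auto
  ultimately have "b ` insert i J \<in> E" using b(2) unfolding complete_tuple_def heavy_edges_def by blast
  then show "insert (b i) (c ` J) \<in> E" using im[of J] J by simp
next
  have inj: "inj_on b {..<l}" using tuple_inj[OF b(1)] by simp
  fix j k assume jk: "j \<in> I i" "k \<in> I i" "j \<noteq> k"
  then have "b j \<noteq> b k" using inj by (auto dest: inj_onD)
  then show "heavy m E (c j) (c k)" using complete_tuple_heavy[OF b(2), of j k] jk c by simp
next
  have inj: "inj_on b {..<l}" using tuple_inj[OF b(1)] by simp
  fix j assume j: "j \<in> I i"
  then have "b i \<noteq> b j" using inj i by (auto dest: inj_onD)
  then show "heavy m E (b i) (c j)" using complete_tuple_heavy[OF b(2), of i j] j i c by simp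
qed

text \<open>The vertex \<open>x\<close> takes label 0, \<open>y\<close> takes label
  \<open>l\<close>, and the common tuple takes the labels between. The edge \<open>e\<close> is then
  the expansion edge of the pair with labels 0 and \<open>l\<close>, so the possibly light pair
  \<open>x\<close>, \<open>y\<close> does no harm.\<close>

lemma twins_not_in_edge:
  assumes i: "i < l" and xy: "x \<noteq> y" and e: "e \<in> E" "x \<in> e" "y \<in> e"
    and b: "b \<in> PiE (I i) P" "fits i x b" "fits i y b" "b ` I i \<inter> e = {}"
  shows False
proof -
  have "card {1..<l} = card (I i)" using i by simp
  then obtain g where g: "bij_betw g {1..<l} (I i)" using finite_same_card_bij by blast
  define s where "s k = (if k = 0 then x else if k = l then y else b (g k))" for k
  have s0: "s 0 = x" and sl: "s l = y" using l0 by (auto simp: s_def)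
  have sk: "s k = b (g k)" if "k \<in> {1..<l}" for k using that by (auto simp: s_def)
  have gI: "g k \<in> I i" if "k \<in> {1..<l}" for k using bij_betwE[OF g] that by blast
  have g_inj: "inj_on g {1..<l}" using g by (rule bij_betw_imp_inj_on)
  have b_inj: "inj_on b (I i)" by (rule tuple_inj[OF b(1)]) auto
  have split: "{..l} = insert 0 (insert l {1..<l})" using l0 by auto
  have imJ: "s ` J = b ` (g ` J)" if "J \<subseteq> {1..<l}" for J
    unfolding image_image using that sk by (intro image_cong) auto
  have mid: "s ` {1..<l} = b ` I i"
    using imJ[of "{1..<l}"] bij_betw_imp_surj_on[OF g] by simp
  have all: "s ` {..l} = insert x (insert y (b ` I i))" unfolding split image_insert s0 sl mid ..
  have bV: "b ` I i \<subseteq> V" using b(1) part(1) by (auto simp: PiE_iff)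
  have xyb: "x \<notin> b ` I i" "y \<notin> b ` I i" using b(4) e by auto
  have inj: "inj_on s {..l}"
  proof -
    have "card (b ` I i) = l - 1" using b_inj i by (simp add: card_image)
    then have "card (s ` {..l}) = card {..l}" unfolding all using xyb xy l0 by simp
    then show ?thesis by (rule eq_card_imp_inj_on[rotated]) simp
  qed
  have gJ: "g ` J \<subseteq> I i" "card (g ` J) = card J" if "J \<subseteq> {1..<l}" for J
    using bij_betw_imp_surj_on[OF g] image_mono[OF that, of g] card_image[OF inj_on_subset[OF g_inj that]] by simp_all
  have ext: "insert z (s ` J) \<in> E" if "J \<subseteq> {1..<l}" "card J = r - 1" "fits i z b" for J z
    using that gJ[OF that(1)] imJ[OF that(1)] by (auto simp: fits_def)
  have "contains (V, E) H"
  proof (rule contains_of_core[OF G inj])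
    show "s ` {..l} \<subseteq> V" unfolding all using bV e edgeD by auto
    have "{..<r} = insert 0 {1..<r}" using r2 by auto
    then have "s ` {..<r} = insert x (s ` {1..<r})" using s0 by simp
    moreover have "insert x (s ` {1..<r}) \<in> E" using rl by (intro ext b(2)) auto
    ultimately show "s ` {..<r} \<in> E" by simp
    show "s ` J \<in> E" if J: "J \<subseteq> {1..l}" "card J = r" for J
    proof (cases "l \<in> J")
      case True
      have "J - {l} \<subseteq> {1..<l}" using J by (auto simp: subset_iff order.order_iff_strict)
      moreover have "card (J - {l}) = r - 1" using J True by simp
      ultimately have "insert y (s ` (J - {l})) \<in> E" by (intro ext b(3))
      also have "insert y (s ` (J - {l})) = s ` J" using sl True by (metis image_insert insert_Diff)
      finally show ?thesis .
    next
      case False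
      then have J1: "J \<subseteq> {1..<l}" using J by (auto simp: subset_iff order.order_iff_strict)
      then show ?thesis using gJ[OF J1] imJ[OF J1] J b(2) by (auto simp: fits_def)
    qed
    show "heavy m E (s j) (s k)" if jk: "j \<le> l" "k \<le> l" "j \<noteq> k" "{j, k} \<noteq> {0, l}" for j k
    proof -
      have one: "heavy m E (s j) (s k)" if "j \<in> {0, l}" "k \<in> {1..<l}" for j k
        using that b(2,3) gI[of k] sk[of k] s0 sl by (auto simp: fits_def)
      have mm: "heavy m E (s j) (s k)" if "j \<in> {1..<l}" "k \<in> {1..<l}"
      proof -
        have "g j \<noteq> g k" using g_inj that jk(3) by (auto dest: inj_onD)
        then show ?thesis using b(2) gI[OF that(1)] gI[OF that(2)] sk that by (auto simp: fits_def)
      qed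
      have "\<not> (j \<in> {0, l} \<and> k \<in> {0, l})" using jk by auto
      then consider "j \<in> {0, l}" "k \<in> {1..<l}" | "k \<in> {0, l}" "j \<in> {1..<l}" | "j \<in> {1..<l}" "k \<in> {1..<l}"
        using jk by fastforce
      then show ?thesis
      proof cases
        case 1 then show ?thesis by (rule one)
      next
        case 2 then show ?thesis by (rule one[THEN heavy_sym])
      next
        case 3 then show ?thesis by (rule mm)
      qed
    qed
    show "\<exists>e\<in>E. e \<inter> s ` {..l} = {s 0, s l}"
      using e b(4) unfolding all s0 sl by (intro bexI[of _ e]) auto
  qed
  with free show False by simp
qed

text \<open>The vertex \<open>v\<close> takes label 0 and the tuple takes the labels
  \<open>1..l\<close>, with the indices in \<open>J\<close> first, so that the given edge is the
  image of \<open>{..<r}\<close>.\<close>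

lemma no_full_vertex:
  assumes J: "J \<subseteq> {..<l}" "card J = r - 1"
    and b: "b \<in> PiE {..<l} P" "complete_tuple b" "insert v (b ` J) \<in> E"
      "\<And>j. j < l \<Longrightarrow> heavy m E v (b j)"
  shows False
proof -
  have c1: "card {1..<r} = card J" and c2: "card {r..l} = card ({..<l} - J)"
    using J rl r2 by (auto simp: card_Diff_subset finite_subset[OF J(1)])
  obtain g1 where g1: "bij_betw g1 {1..<r} J"
    using finite_same_card_bij[OF _ _ c1] finite_subset[OF J(1)] by auto
  obtain g2 where g2: "bij_betw g2 {r..l} ({..<l} - J)"
    using finite_same_card_bij[OF _ _ c2] by auto
  \<comment> \<open>Labels below \<open>r\<close> go to \<open>J\<close> and the others to its
    complement.\<close>
  define g where "g k = (if k < r then g1 k else g2 k)" for k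
  have gb1: "bij_betw g {1..<r} J" using g1 by (rule bij_betw_cong[THEN iffD1, rotated]) (simp add: g_def)
  have gb2: "bij_betw g {r..l} ({..<l} - J)" using g2 by (rule bij_betw_cong[THEN iffD1, rotated]) (simp add: g_def)
  have "bij_betw g ({1..<r} \<union> {r..l}) (J \<union> ({..<l} - J))" by (rule bij_betw_combine[OF gb1 gb2]) auto
  moreover have "{1..<r} \<union> {r..l} = {1..l}" using r2 rl by auto
  moreover have "J \<union> ({..<l} - J) = {..<l}" using J by auto
  ultimately have g: "bij_betw g {1..l} {..<l}" by simp
  define s where "s k = (if k = 0 then v else b (g k))" for k
  have s0: "s 0 = v" by (simp add: s_def)
  have sk: "s k = b (g k)" if "k \<in> {1..l}" for k using that by (auto simp: s_def)
  have gl: "g k < l" if "k \<in> {1..l}" for k using bij_betwE[OF g] that by blast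
  have g_inj: "inj_on g {1..l}" using g by (rule bij_betw_imp_inj_on)
  have b_inj: "inj_on b {..<l}" by (rule tuple_inj[OF b(1)]) auto
  have split: "{..l} = insert 0 {1..l}" by auto
  have imJ: "s ` K = b ` (g ` K)" if "K \<subseteq> {1..l}" for K
    unfolding image_image using that sk by (intro image_cong) auto
  have mid: "s ` {1..l} = b ` {..<l}" using imJ[of "{1..l}"] g by (simp add: bij_betw_def)
  have all: "s ` {..l} = insert v (b ` {..<l})" unfolding split image_insert s0 mid ..
  have vb: "v \<notin> b ` {..<l}" using b(4) by (auto simp: heavy_def)
  have inj: "inj_on s {..l}"
  proof -
    have "card (s ` {..l}) = card {..l}"
      unfolding all using vb b_inj by (simp add: card_image)
    then show ?thesis by (rule eq_card_imp_inj_on[rotated]) simp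
  qed
  have ne: "s j \<noteq> s k" if "j \<le> l" "k \<le> l" "j \<noteq> k" for j k using inj that by (auto dest: inj_onD)
  have hv: "heavy m E (s j) (s k)" if jk: "j \<le> l" "k \<le> l" "j \<noteq> k" for j k
  proof -
    have one: "heavy m E (s 0) (s k)" if "k \<in> {1..l}" for k
      using b(4)[OF gl[OF that]] sk[OF that] s0 by simp
    have two: "heavy m E (s j) (s k)" if "j \<in> {1..l}" "k \<in> {1..l}"
      unfolding sk[OF that(1)] sk[OF that(2)]
    proof (rule complete_tuple_heavy[OF b(2) gl[OF that(1)] gl[OF that(2)]])
      show "g j \<noteq> g k" using g_inj that jk(3) by (auto dest: inj_onD)
      show "b (g j) \<noteq> b (g k)" using ne[OF jk] sk that by simp
    qed
    have "j = 0 \<or> j \<in> {1..l}" "k = 0 \<or> k \<in> {1..l}" using jk by auto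
    with one two heavy_sym jk(3) show ?thesis by metis
  qed
  have "contains (V, E) H"
  proof (rule contains_of_core[OF G inj])
    show "s ` {..l} \<subseteq> V" unfolding all using b(1) b(3) edgeD(1)[OF b(3)] part(1) by (auto simp: PiE_iff)
    have "{..<r} = insert 0 {1..<r}" using r2 by auto
    then have "s ` {..<r} = insert v (s ` {1..<r})" using s0 by simp
    also have "s ` {1..<r} = b ` g ` {1..<r}" using rl by (intro imJ) auto
    also have "g ` {1..<r} = J" using gb1 by (simp add: bij_betw_def)
    finally show "s ` {..<r} \<in> E" using b(3) by simp
    show "s ` K \<in> E" if K: "K \<subseteq> {1..l}" "card K = r" for K
    proof -
      have "g ` K \<subseteq> {..<l}" using K gl by auto
      moreover have "card (g ` K) = r" using K g_inj by (metis card_image inj_on_subset)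
      ultimately show ?thesis using imJ[OF K(1)] b(2) by (auto simp: complete_tuple_def heavy_edges_def)
    qed
    show "\<exists>e\<in>E. e \<inter> s ` {..l} = {s 0, s l}"
    proof -
      \<comment> \<open>Here all pairs are heavy, so the edge for the pair with labels 0 and
        \<open>l\<close> is obtained by avoiding the rest of the core.\<close>
      let ?W = "s ` {..l} - {s 0, s l}"
      have "card ?W \<le> card (s ` {..l})" by (intro card_mono) auto
      also have "\<dots> \<le> Suc l" using card_image_le[of "{..l}" s] by simp
      finally have "card ?W \<le> m" using m_ge by simp
      then obtain e where "e \<in> E" "s 0 \<in> e" "s l \<in> e" "e \<inter> ?W = {}"
        using hv[of 0 l] l0 unfolding heavy_def by (metis (no_types, lifting) Diff_iff finite_Diff finite_atMost finite_imageI insertI1 insertI2 le0 order_refl less_not_refl)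
      then show ?thesis by (intro bexI[of _ e]) auto
    qed
  qed (rule hv)
  with free show False by simp
qed

end

section \<open>Counting incomplete tuples, atypical vertices and links\<close>

lemma image_in_transv: "b \<in> PiE I P \<Longrightarrow> J \<subseteq> I \<Longrightarrow> b ` J \<in> transv P J"
  unfolding transv_def by (rule image_eqI[of _ _ "restrict b J"]) (auto simp: PiE_iff)

lemma card_Collect_ex_le:
  assumes "finite A" "\<And>a. a \<in> A \<Longrightarrow> finite {x. Q a x}" "\<And>a. a \<in> A \<Longrightarrow> card {x. Q a x} \<le> k"
  shows "card {x. \<exists>a\<in>A. Q a x} \<le> card A * k"
proof -
  have "{x. \<exists>a\<in>A. Q a x} = (\<Union>a\<in>A. {x. Q a x})" by auto
  also have "card \<dots> \<le> (\<Sum>a\<in>A. card {x. Q a x})" by (rule card_UN_le[OF assms(1)])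
  also have "\<dots> \<le> (\<Sum>a\<in>A. k)" by (rule sum_mono) (rule assms(3))
  finally show ?thesis by simp
qed

context partitioned_free
begin

lemma finite_tuples: "finite (PiE (I i) P)" "finite (PiE {..<l} P)"
  using part by (auto intro!: finite_PiE)

lemma disjoint_part: "disjoint_family_on P (I i)"
  by (rule disjoint_family_on_mono[OF _ P]) auto

lemma card_index_subsets: "card {J. J \<subseteq> {..<l} \<and> card J = k} \<le> 2 ^ l"
proof -
  have "card {J. J \<subseteq> {..<l} \<and> card J = k} \<le> card (Pow {..<l})" by (intro card_mono) auto
  then show ?thesis by (simp add: card_Pow)
qed

definition missing :: "'v set set" where
  "missing = cross P {..<l} r - heavy_edges m E"

text \<open>An incomplete tuple shows a missing set at one of at most \<open>2^l\<close> index sets,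
  and each missing set extends to at most \<open>n^(l-r)\<close> tuples.\<close>

lemma card_incomplete_le:
  assumes "real (card missing) \<le> d * real n ^ r"
  shows "real (card {b \<in> PiE {..<l} P. \<not> complete_tuple b}) \<le> 2 ^ l * d * real n ^ l"
proof -
  let ?A = "{J. J \<subseteq> {..<l} \<and> card J = r}"
  have fm: "finite missing" unfolding missing_def by (intro finite_Diff finite_cross) (use part in auto)
  have "{b \<in> PiE {..<l} P. \<not> complete_tuple b} \<subseteq> {b. \<exists>J\<in>?A. b \<in> PiE {..<l} P \<and> b ` J \<in> missing}"
  proof
    fix b assume b: "b \<in> {b \<in> PiE {..<l} P. \<not> complete_tuple b}"
    then obtain J where J: "J \<in> ?A" "b ` J \<notin> heavy_edges m E" by (auto simp: complete_tuple_def)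
    have "b ` J \<in> transv P J" by (rule image_in_transv[where I = "{..<l}"]) (use b J in auto)
    then have "b ` J \<in> missing" using J by (auto simp: missing_def cross_eq_UN_transv[OF P])
    then show "b \<in> {b. \<exists>J\<in>?A. b \<in> PiE {..<l} P \<and> b ` J \<in> missing}" using b J by blast
  qed
  moreover have fin: "finite {b. b \<in> PiE {..<l} P \<and> b ` J \<in> missing}" for J
    by (rule finite_subset[OF _ finite_tuples(2)]) auto
  ultimately have "card {b \<in> PiE {..<l} P. \<not> complete_tuple b} \<le> card {b. \<exists>J\<in>?A. b \<in> PiE {..<l} P \<and> b ` J \<in> missing}"
    by (intro card_mono) (auto intro: finite_subset[OF _ finite_tuples(2)])
  also have "\<dots> \<le> card ?A * (card missing * n ^ (l - r))"
  proof (rule card_Collect_ex_le[OF _ fin])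
    fix J assume J: "J \<in> ?A"
    have "card {b \<in> PiE {..<l} P. b ` J \<in> missing} \<le> card missing * n ^ card ({..<l} - J)"
      using J part fm P by (intro card_tuples_le) auto
    also have "card ({..<l} - J) = l - r" using J by (auto simp: card_Diff_subset finite_subset)
    finally show "card {b. b \<in> PiE {..<l} P \<and> b ` J \<in> missing} \<le> card missing * n ^ (l - r)" by simp
  qed auto
  also have "\<dots> \<le> 2 ^ l * (card missing * n ^ (l - r))" by (intro mult_right_mono card_index_subsets) simp
  finally have "real (card {b \<in> PiE {..<l} P. \<not> complete_tuple b}) \<le> real (2 ^ l * (card missing * n ^ (l - r)))"
    by (rule of_nat_mono)
  also have "\<dots> = 2 ^ l * (real (card missing) * real n ^ (l - r))" by simp
  also have "\<dots> \<le> 2 ^ l * ((d * real n ^ r) * real n ^ (l - r))"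
    using assms by (intro mult_left_mono mult_right_mono) auto
  also have "\<dots> = 2 ^ l * d * real n ^ l" using rl by (simp add: power_add[symmetric])
  finally show ?thesis .
qed

lemma tuple_upd: "i < l \<Longrightarrow> b \<in> PiE (I i) P \<Longrightarrow> z \<in> P i \<Longrightarrow> b(i := z) \<in> PiE {..<l} P"
  by (auto simp: PiE_iff extensional_def)

lemma tuple_upd_inj: "b \<in> PiE (I i) P \<Longrightarrow> c \<in> PiE (I i) P \<Longrightarrow> b(i := y) = c(i := z) \<Longrightarrow> b = c \<and> y = z"
proof
  assume b: "b \<in> PiE (I i) P" and c: "c \<in> PiE (I i) P" and eq: "b(i := y) = c(i := z)"
  show "y = z" using fun_cong[OF eq, of i] by simp
  have "b j = c j" if "j \<in> I i" for j using fun_cong[OF eq, of j] that by simp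
  then show "b = c" using b c by (auto intro: PiE_ext)
qed

text \<open>Each such tuple produces \<open>card (P i)\<close> incomplete full tuples, and
  \<open>card (P i)\<close> is at least \<open>n / (2 * l)\<close>.\<close>

lemma card_unextendable_le:
  assumes d: "real (card missing) \<le> d * real n ^ r" and i: "i < l" and size: "real n \<le> 2 * real l * real (card (P i))"
    and n: "0 < n"
  shows "real (card {b \<in> PiE (I i) P. \<forall>z\<in>P i. \<not> complete_tuple (b(i := z))}) \<le> 2 * real l * 2 ^ l * d * real n ^ (l - 1)"
proof -
  let ?N = "{b \<in> PiE (I i) P. \<forall>z\<in>P i. \<not> complete_tuple (b(i := z))}"
  let ?M = "{b \<in> PiE {..<l} P. \<not> complete_tuple b}"
  have "inj_on (\<lambda>(b, z). b(i := z)) (?N \<times> P i)"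
  proof (rule inj_onI, clarsimp)
    fix b c y z assume "b \<in> PiE (I i) P" "c \<in> PiE (I i) P" "b(i := y) = c(i := z)"
    then show "b = c \<and> y = z" by (rule tuple_upd_inj)
  qed
  moreover have "(\<lambda>(b, z). b(i := z)) ` (?N \<times> P i) \<subseteq> ?M" using tuple_upd[OF i] by auto
  ultimately have "card (?N \<times> P i) \<le> card ?M"
    by (rule card_inj_on_le) (use finite_tuples in auto)
  then have "card ?N * card (P i) \<le> card ?M" by (simp only: card_cartesian_product)
  then have "real (card ?N * card (P i)) \<le> real (card ?M)" by (rule of_nat_mono)
  then have "real (card ?N) * real (card (P i)) \<le> real (card ?M)" by (simp only: of_nat_mult)
  also have "\<dots> \<le> 2 ^ l * d * real n ^ l" by (rule card_incomplete_le[OF d])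
  finally have 1: "real (card ?N) * real (card (P i)) \<le> 2 ^ l * d * real n ^ l" .
  have "real n * real (card ?N) \<le> 2 * real l * real (card (P i)) * real (card ?N)"
    using size by (intro mult_right_mono) auto
  also have "\<dots> = 2 * real l * (real (card ?N) * real (card (P i)))" by simp
  also have "\<dots> \<le> 2 * real l * (2 ^ l * d * real n ^ l)" using 1 by (intro mult_left_mono) auto
  also have "real n ^ l = real n * real n ^ (l - 1)" using l0 by (cases l) auto
  finally have "real n * real (card ?N) \<le> real n * (2 * real l * 2 ^ l * d * real n ^ (l - 1))" by (simp only: mult_ac)
  then show ?thesis using n by (simp only: mult_le_cancel_left_pos of_nat_0_less_iff)
qed

text \<open>Each atypical vertex of part \<open>i\<close> accounts for more than
  \<open>\<kappa> * n^(l-1)\<close> incomplete tuples, since by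
  \<open>fits_of_complete_tuple\<close> it fits every tuple it completes.\<close>

lemma card_atypical_le:
  assumes d: "real (card missing) \<le> d * real n ^ r" and i: "i < l" and n: "0 < n"
  shows "real (card {x \<in> P i. \<not> typical i x}) * \<kappa> \<le> 2 ^ l * d * real n"
proof -
  let ?A = "{x \<in> P i. \<not> typical i x}"
  let ?B = "\<lambda>x. {b \<in> PiE (I i) P. \<not> fits i x b}"
  let ?M = "{b \<in> PiE {..<l} P. \<not> complete_tuple b}"
  have fA: "finite ?A" using part(2)[OF i] by simp
  have "inj_on (\<lambda>(x, b). b(i := x)) (Sigma ?A ?B)"
  proof (rule inj_onI, clarsimp)
    fix b c y z assume "b \<in> PiE (I i) P" "c \<in> PiE (I i) P" "b(i := y) = c(i := z)"
    then have "b = c \<and> y = z" by (rule tuple_upd_inj)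
    then show "y = z \<and> b = c" by simp
  qed
  moreover have "(\<lambda>(x, b). b(i := x)) ` (Sigma ?A ?B) \<subseteq> ?M"
  proof clarify
    fix x b assume x: "x \<in> P i" "\<not> typical i x" and b: "b \<in> PiE (I i) P" "\<not> fits i x b"
    have "\<not> complete_tuple (b(i := x))"
      using fits_of_complete_tuple[OF tuple_upd[OF i b(1) x(1)] _ i, of b] b(2) by auto
    then show "b(i := x) \<in> PiE {..<l} P \<and> \<not> complete_tuple (b(i := x))"
      using tuple_upd[OF i b(1) x(1)] by simp
  qed
  ultimately have "card (Sigma ?A ?B) \<le> card ?M"
    by (rule card_inj_on_le) (use finite_tuples in auto)
  moreover have "card (Sigma ?A ?B) = (\<Sum>x\<in>?A. card (?B x))"
    using fA finite_tuples by (intro card_SigmaI) auto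
  ultimately have "(\<Sum>x\<in>?A. card (?B x)) \<le> card ?M" by (simp only:)
  then have "real (\<Sum>x\<in>?A. card (?B x)) \<le> real (card ?M)" by (rule of_nat_mono)
  also have "\<dots> \<le> 2 ^ l * d * real n ^ l" by (rule card_incomplete_le[OF d])
  finally have 1: "(\<Sum>x\<in>?A. real (card (?B x))) \<le> 2 ^ l * d * real n ^ l" by (simp only: of_nat_sum)
  have "(\<Sum>x\<in>?A. \<kappa> * real n ^ (l - 1)) \<le> (\<Sum>x\<in>?A. real (card (?B x)))"
    by (intro sum_mono) (auto simp: typical_def)
  then have "real (card ?A) * (\<kappa> * real n ^ (l - 1)) \<le> 2 ^ l * d * real n ^ l" using 1 by simp
  also have "real n ^ l = real n * real n ^ (l - 1)" using l0 by (cases l) auto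
  finally have "real n ^ (l - 1) * (real (card ?A) * \<kappa>) \<le> real n ^ (l - 1) * (2 ^ l * d * real n)"
    by (simp only: mult_ac)
  moreover have "0 < real n ^ (l - 1)" using n by simp
  ultimately show ?thesis by (simp only: mult_le_cancel_left_pos)
qed

text \<open>Tuples not fitting \<open>x\<close>, tuples not fitting \<open>y\<close> and tuples
  meeting \<open>e\<close> make up less than three quarters of all tuples; a remaining one
  contradicts \<open>twins_not_in_edge\<close>.\<close>

lemma typical_twins_not_in_edge:
  assumes i: "i < l" and xy: "x \<noteq> y" and e: "e \<in> E" "x \<in> e" "y \<in> e" and t: "typical i x" "typical i y"
    and size: "\<And>j. j < l \<Longrightarrow> real n \<le> 2 * real l * real (card (P j))"
    and n: "real (l * r) < \<kappa> * real n"
  shows False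
proof -
  let ?T = "PiE (I i) P"
  let ?Bx = "{b \<in> ?T. \<not> fits i x b}" and ?By = "{b \<in> ?T. \<not> fits i y b}"
  \<comment> \<open>Meeting \<open>e\<close> is phrased through singletons so that
    \<open>card_tuples_le\<close> applies with \<open>J = {j}\<close>.\<close>
  let ?Be = "{b. \<exists>j\<in>I i. b \<in> ?T \<and> b ` {j} \<in> (\<lambda>z. {z}) ` e}"
  have npos: "0 < real n" by (rule ccontr) (use n in \<open>simp add: not_less del: of_nat_mult\<close>)
  have fe: "finite e" "card e = r" using edgeD e by auto
  have "card ?Be \<le> card (I i) * (r * n ^ (l - 2))"
  proof (rule card_Collect_ex_le)
    fix j assume j: "j \<in> I i"
    show "finite {b. b \<in> ?T \<and> b ` {j} \<in> (\<lambda>z. {z}) ` e}" by (rule finite_subset[OF _ finite_tuples(1)]) auto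
    have "card {b \<in> ?T. b ` {j} \<in> (\<lambda>z. {z}) ` e} \<le> card ((\<lambda>z. {z}) ` e) * n ^ card (I i - {j})"
      using j part fe disjoint_part by (intro card_tuples_le) auto
    also have "card ((\<lambda>z. {z}) ` e) = r" using fe by (subst card_image) auto
    also have "card (I i - {j}) = l - 2" using j i by simp
    finally show "card {b. b \<in> ?T \<and> b ` {j} \<in> (\<lambda>z. {z}) ` e} \<le> r * n ^ (l - 2)" by simp
  qed simp
  also have "\<dots> \<le> l * r * n ^ (l - 2)" using i by simp
  finally have "real (card ?Be) \<le> real (l * r * n ^ (l - 2))" by (rule of_nat_mono)
  also have "\<dots> = real (l * r) * real n ^ (l - 2)" by simp
  also have "\<dots> < \<kappa> * real n * real n ^ (l - 2)" using n npos by (intro mult_strict_right_mono) auto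
  also have "\<kappa> * real n * real n ^ (l - 2) = \<kappa> * real n ^ (l - 1)"
  proof -
    have "l - 1 = Suc (l - 2)" using l0 by simp
    then show ?thesis by simp
  qed
  finally have 3: "real (card ?Be) < \<kappa> * real n ^ (l - 1)" .
  have 12: "real (card ?Bx) \<le> \<kappa> * real n ^ (l - 1)" "real (card ?By) \<le> \<kappa> * real n ^ (l - 1)"
    using t by (auto simp: typical_def)
  have "4 * \<kappa> * real n ^ (l - 1) = (\<Prod>j\<in>I i. real n / (2 * real l))"
    using i by (simp add: kappa_def power_divide)
  also have "\<dots> \<le> (\<Prod>j\<in>I i. real (card (P j)))"
    using size l0 by (intro prod_mono) (auto simp: field_simps)
  also have "\<dots> = real (card ?T)" by (simp add: card_PiE)
  finally have T: "4 * \<kappa> * real n ^ (l - 1) \<le> real (card ?T)" .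
  have "?T - (?Bx \<union> ?By \<union> ?Be) \<noteq> {}"
  proof
    assume "?T - (?Bx \<union> ?By \<union> ?Be) = {}"
    then have "?T \<subseteq> ?Bx \<union> ?By \<union> ?Be" by blast
    moreover have "finite ?Be" by (rule finite_subset[OF _ finite_tuples(1)]) auto
    ultimately have "card ?T \<le> card (?Bx \<union> ?By \<union> ?Be)" using finite_tuples by (intro card_mono) auto
    also have "\<dots> \<le> card ?Bx + card ?By + card ?Be"
      by (meson add_le_mono card_Un_le le_refl order_trans)
    finally have "real (card ?T) \<le> real (card ?Bx) + real (card ?By) + real (card ?Be)" by linarith
    moreover have "0 < \<kappa> * real n ^ (l - 1)" using \<kappa>_pos npos by simp
    ultimately show False using T 3 12 by linarith
  qed
  then obtain b where b: "b \<in> ?T" "fits i x b" "fits i y b" "b \<notin> ?Be" by blast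
  have "b ` I i \<inter> e = {}" using b(1,4) by auto
  then show False using twins_not_in_edge[OF i xy e b(1-3)] by simp
qed

definition good_links :: "nat \<Rightarrow> 'v \<Rightarrow> 'v set set" where
  "good_links i v = {f \<in> cross P (I i) (r - 1). f \<in> link E v \<and> (\<forall>w\<in>f. heavy m E v w)}"

lemma link_sub: "f \<in> link E v \<Longrightarrow> f \<subseteq> V" "f \<in> link E v \<Longrightarrow> card f = r - 1" "f \<in> link E v \<Longrightarrow> finite f"
proof -
  assume f: "f \<in> link E v"
  then have "insert v f \<in> E" "v \<notin> f" by (auto simp: link_def)
  then show "f \<subseteq> V" "finite f" using edgeD(1)[of "insert v f"] edgeD(3)[of "insert v f"] by auto
  then show "card f = r - 1" using edgeD(2)[of "insert v f"] \<open>v \<notin> f\<close> \<open>insert v f \<in> E\<close> by simp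
qed

lemma finite_link: "finite (link E v)"
  by (rule finite_subset[of _ "Pow V"]) (use finV link_sub in auto)

lemma card_link_meeting_le:
  assumes "A \<subseteq> V"
  shows "card {f \<in> link E v. f \<inter> A \<noteq> {}} \<le> card A * n ^ (r - 2)"
proof -
  have "card {f. \<exists>a\<in>A. f \<in> link E v \<and> a \<in> f} \<le> card A * n ^ (r - 2)"
  proof (rule card_Collect_ex_le)
    show "finite A" using assms finV by (rule finite_subset)
    fix a assume a: "a \<in> A"
    show "finite {f. f \<in> link E v \<and> a \<in> f}" using finite_link by simp
    have "card {f. f \<in> link E v \<and> a \<in> f} \<le> card {f. {a} \<subseteq> f \<and> f \<subseteq> V \<and> card f = r - 1}"
      by (rule card_mono) (use finV link_sub in auto)
    also have "\<dots> \<le> n ^ (r - 1 - card {a})" using a assms finV r2 by (intro card_supersets_le) auto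
    finally show "card {f. f \<in> link E v \<and> a \<in> f} \<le> n ^ (r - 2)" by (simp add: numeral_2_eq_2)
  qed
  moreover have "{f. \<exists>a\<in>A. f \<in> link E v \<and> a \<in> f} = {f \<in> link E v. f \<inter> A \<noteq> {}}" by auto
  ultimately show ?thesis by simp
qed

text \<open>At most \<open>n\<close> partners of \<open>v\<close> are light, each with the codegree
  bound of \<open>light_pair_codegree\<close>.\<close>

lemma card_light_link_le:
  assumes n: "0 < n"
  shows "card {f \<in> link E v. \<exists>w\<in>f. \<not> heavy m E v w} \<le> m * n ^ (r - 2)"
proof -
  let ?A = "{w \<in> V. w \<noteq> v \<and> \<not> heavy m E v w}"
  let ?S = "{f \<in> link E v. \<exists>w\<in>f. \<not> heavy m E v w}"
  let ?D = "\<lambda>w. {f. f \<in> link E v \<and> w \<in> f}"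
  have fA: "finite ?A" using finV by simp
  have "?S \<subseteq> (\<Union>w\<in>?A. ?D w)" using link_sub(1) by (auto simp: link_def)
  then have "card ?S \<le> card (\<Union>w\<in>?A. ?D w)" by (rule card_mono[rotated]) (use fA finite_link in auto)
  also have "\<dots> \<le> (\<Sum>w\<in>?A. card (?D w))" using fA by (rule card_UN_le)
  finally have "card ?S * n \<le> (\<Sum>w\<in>?A. card (?D w)) * n" by (rule mult_right_mono) simp
  also have "\<dots> = (\<Sum>w\<in>?A. card (?D w) * n)" by (rule sum_distrib_right)
  also have "\<dots> \<le> (\<Sum>w\<in>?A. m * n ^ (r - 2))"
  proof (rule sum_mono)
    fix w assume w: "w \<in> ?A"
    have "card (?D w) \<le> card {e \<in> E. v \<in> e \<and> w \<in> e}"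
    proof (rule card_inj_on_le)
      show "inj_on (insert v) (?D w)" by (rule inj_onI) (auto simp: link_def insert_ident)
      show "insert v ` ?D w \<subseteq> {e \<in> E. v \<in> e \<and> w \<in> e}" by (auto simp: link_def)
      show "finite {e \<in> E. v \<in> e \<and> w \<in> e}" using finE by simp
    qed
    then have "card (?D w) * n \<le> card {e \<in> E. v \<in> e \<and> w \<in> e} * n" by (rule mult_right_mono) simp
    also have "\<dots> \<le> m * n ^ (r - 2)" using light_pair_codegree[OF G r2, of v w m] w by auto
    finally show "card (?D w) * n \<le> m * n ^ (r - 2)" .
  qed
  also have "\<dots> = card ?A * (m * n ^ (r - 2))" by simp
  also have "\<dots> \<le> n * (m * n ^ (r - 2))" using finV by (intro mult_right_mono card_mono) auto
  finally show ?thesis using n by simp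
qed

end

context partitioned_free
begin

text \<open>If \<open>v\<close> has many heavy partners in every part, a large link would yield the
  configuration excluded by \<open>no_full_vertex\<close>, so its degree is small. Otherwise some
  part has few heavy partners and nearly all of the link avoids it. The three losses of
  \<open>\<rho>\<close> come from light partners, atypical vertices, and this last part or the small
  link.\<close>

lemma vertex_dichotomy:
  assumes d: "real (card missing) \<le> d * real n ^ r" and n: "0 < n"
    and size: "\<And>j. j < l \<Longrightarrow> real n \<le> 2 * real l * real (card (P j))"
    and \<rho>: "0 < \<rho>" "\<rho> \<le> 1"
    and c1: "real (l * r) < \<kappa> * real n" and c2: "real m \<le> \<rho> * real n"
    and c3: "real l * 2 ^ l * d \<le> \<rho> * \<kappa>" and c4: "2 ^ l * 2 ^ l * d < \<rho> * \<rho> ^ l"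
  shows "real (degree E v) \<le> 3 * \<rho> * real n ^ (r - 1) \<or>
    (\<exists>i<l. real (degree E v) \<le> real (card (good_links i v)) + 3 * \<rho> * real n ^ (r - 1))"
proof -
  define A where "A = (\<Union>i<l. {x \<in> P i. \<not> typical i x})"
  have AV: "A \<subseteq> V" using part(1) by (auto simp: A_def)
  have npow: "real n * real n ^ (r - 2) = real n ^ (r - 1)"
  proof -
    have "r - 1 = Suc (r - 2)" using r2 by simp
    then show ?thesis by simp
  qed
  have cA: "real (card A) \<le> \<rho> * real n"
  proof -
    have "card A \<le> (\<Sum>i<l. card {x \<in> P i. \<not> typical i x})" unfolding A_def by (rule card_UN_le) simp
    then have "real (card A) \<le> real (\<Sum>i<l. card {x \<in> P i. \<not> typical i x})" by (rule of_nat_mono)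
    then have "real (card A) * \<kappa> \<le> (\<Sum>i<l. real (card {x \<in> P i. \<not> typical i x})) * \<kappa>"
      using \<kappa>_pos by (simp add: mult_right_mono)
    also have "\<dots> = (\<Sum>i<l. real (card {x \<in> P i. \<not> typical i x}) * \<kappa>)" by (rule sum_distrib_right)
    also have "\<dots> \<le> (\<Sum>i<l. 2 ^ l * d * real n)"
      by (rule sum_mono) (use card_atypical_le[OF d _ n] in auto)
    also have "\<dots> = (real l * 2 ^ l * d) * real n" by simp
    also have "\<dots> \<le> (\<rho> * \<kappa>) * real n" using c3 by (rule mult_right_mono) simp
    also have "\<dots> = (\<rho> * real n) * \<kappa>" by simp
    finally show ?thesis using \<kappa>_pos by (simp only: mult_le_cancel_right_pos)
  qed
  let ?L = "link E v"
  let ?L1 = "{f \<in> ?L. \<exists>w\<in>f. \<not> heavy m E v w}" and ?L2 = "{f \<in> ?L. f \<inter> A \<noteq> {}}"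
  define L3 where "L3 = {f \<in> ?L. (\<forall>w\<in>f. heavy m E v w) \<and> f \<inter> A = {}}"
  have fL3: "finite L3" unfolding L3_def using finite_link by simp
  have "?L \<subseteq> ?L1 \<union> ?L2 \<union> L3" by (auto simp: L3_def)
  then have "card ?L \<le> card (?L1 \<union> ?L2 \<union> L3)" using finite_link fL3 by (intro card_mono) auto
  also have "\<dots> \<le> card ?L1 + card ?L2 + card L3" by (meson add_le_mono card_Un_le le_refl order_trans)
  finally have "real (card ?L) \<le> real (card ?L1) + real (card ?L2) + real (card L3)" by linarith
  moreover have "real (card ?L1) \<le> \<rho> * real n ^ (r - 1)"
  proof -
    have "real (card ?L1) \<le> real (m * n ^ (r - 2))" using card_light_link_le[OF n] by (rule of_nat_mono)
    also have "\<dots> \<le> (\<rho> * real n) * real n ^ (r - 2)" using c2 by (simp add: mult_right_mono)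
    finally show ?thesis using npow by (simp only: mult.assoc)
  qed
  moreover have "real (card ?L2) \<le> \<rho> * real n ^ (r - 1)"
  proof -
    have "real (card ?L2) \<le> real (card A * n ^ (r - 2))" using card_link_meeting_le[OF AV] by (rule of_nat_mono)
    also have "\<dots> \<le> (\<rho> * real n) * real n ^ (r - 2)" using cA by (simp add: mult_right_mono)
    finally show ?thesis using npow by (simp only: mult.assoc)
  qed
  ultimately have L: "real (degree E v) \<le> 2 * \<rho> * real n ^ (r - 1) + real (card L3)"
    unfolding degree_eq_card_link by linarith
  \<comment> \<open>Two link vertices in one part would both be typical for it and would lie in a
    common edge together with \<open>v\<close>.\<close>
  have cr: "L3 \<subseteq> cross P {..<l} (r - 1)"
  proof
    fix f assume f: "f \<in> L3"
    then have fL: "f \<in> ?L" "f \<inter> A = {}" by (auto simp: L3_def)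
    have one: "card (f \<inter> P i) \<le> 1" if i: "i < l" for i
    proof (rule ccontr)
      assume "\<not> card (f \<inter> P i) \<le> 1"
      then obtain x y where xy: "x \<in> f \<inter> P i" "y \<in> f \<inter> P i" "x \<noteq> y"
        using card_le_Suc0_iff_eq[of "f \<inter> P i"] link_sub(3)[OF fL(1)] by auto
      have "typical i x" "typical i y" using xy fL(2) i unfolding A_def by blast+
      moreover have "insert v f \<in> E" using fL(1) by (simp add: link_def)
      ultimately show False using typical_twins_not_in_edge[OF i xy(3), of "insert v f"] xy size c1 by blast
    qed
    have "f \<subseteq> (\<Union>i<l. P i)" using link_sub(1)[OF fL(1)] UP by simp
    then show "f \<in> cross P {..<l} (r - 1)" unfolding cross_def using one link_sub(2,3)[OF fL(1)] by auto
  qed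
  define N where "N i = {w \<in> P i. heavy m E v w}" for i
  show ?thesis
  proof (cases "\<forall>i<l. \<rho> * real n \<le> real (card (N i))")
    case True
    \<comment> \<open>Many link sets over \<open>J\<close>, combined with many heavy partners in
      each part outside \<open>J\<close>, give more tuples than there are incomplete ones, hence a
      complete tuple joined to \<open>v\<close>.\<close>
    have small: "real (card (L3 \<inter> transv P J)) \<le> \<rho> / 2 ^ l * real n ^ (r - 1)"
      if J: "J \<subseteq> {..<l}" "card J = r - 1" for J
    proof (rule ccontr)
      assume "\<not> real (card (L3 \<inter> transv P J)) \<le> \<rho> / 2 ^ l * real n ^ (r - 1)"
      then have big: "\<rho> / 2 ^ l * real n ^ (r - 1) \<le> real (card (L3 \<inter> transv P J))" by simp
      let ?B = "L3 \<inter> transv P J"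
      let ?S = "{b \<in> PiE {..<l} P. b ` J \<in> ?B \<and> (\<forall>i\<in>{..<l} - J. b i \<in> N i)}"
      have cJ: "card ({..<l} - J) = l - (r - 1)" using J by (simp add: card_Diff_subset finite_subset)
      have "(\<rho> * real n) ^ (l - (r - 1)) = (\<Prod>i\<in>{..<l} - J. \<rho> * real n)" using cJ by simp
      also have "\<dots> \<le> (\<Prod>i\<in>{..<l} - J. real (card (N i)))" using True \<rho> by (intro prod_mono) auto
      finally have pr: "(\<rho> * real n) ^ (l - (r - 1)) \<le> (\<Prod>i\<in>{..<l} - J. real (card (N i)))" .
      have "\<rho> / 2 ^ l * real n ^ (r - 1) * (\<rho> * real n) ^ (l - (r - 1))
          \<le> real (card ?B) * (\<Prod>i\<in>{..<l} - J. real (card (N i)))"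
        using big pr \<rho> by (intro mult_mono) auto
      also have "\<dots> = real (card ?B * (\<Prod>i\<in>{..<l} - J. card (N i)))" by simp
      also have "\<dots> \<le> real (card ?S)"
        using J part P by (intro of_nat_mono card_tuples_ge) (auto simp: N_def)
      finally have "\<rho> / 2 ^ l * real n ^ (r - 1) * (\<rho> * real n) ^ (l - (r - 1)) \<le> real (card ?S)" .
      moreover have "\<rho> / 2 ^ l * \<rho> ^ l * real n ^ l \<le> \<rho> / 2 ^ l * real n ^ (r - 1) * (\<rho> * real n) ^ (l - (r - 1))"
      proof -
        \<comment> \<open>Since \<open>\<rho> \<le> 1\<close>, the exponent can be raised to
          \<open>l\<close> and the condition on \<open>d\<close> becomes independent of
          \<open>r\<close>.\<close>
        have "\<rho> ^ l \<le> \<rho> ^ (l - (r - 1))" using \<rho> by (intro power_decreasing) auto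
        then have "\<rho> / 2 ^ l * \<rho> ^ l * real n ^ l \<le> \<rho> / 2 ^ l * \<rho> ^ (l - (r - 1)) * real n ^ l"
          using \<rho> by (intro mult_right_mono mult_left_mono) auto
        moreover have "real n ^ (r - 1) * real n ^ (l - (r - 1)) = real n ^ l" using rl by (simp add: power_add[symmetric])
        moreover have "\<rho> / 2 ^ l * real n ^ (r - 1) * (\<rho> * real n) ^ (l - (r - 1))
            = \<rho> / 2 ^ l * \<rho> ^ (l - (r - 1)) * (real n ^ (r - 1) * real n ^ (l - (r - 1)))"
          by (simp only: power_mult_distrib mult_ac)
        ultimately show ?thesis by (simp only:)
      qed
      moreover have "2 ^ l * d * real n ^ l < \<rho> / 2 ^ l * \<rho> ^ l * real n ^ l"
        using c4 n by (intro mult_strict_right_mono) (auto simp: field_simps)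
      moreover have "real (card {b \<in> PiE {..<l} P. \<not> complete_tuple b}) \<le> 2 ^ l * d * real n ^ l"
        by (rule card_incomplete_le[OF d])
      ultimately have "card {b \<in> PiE {..<l} P. \<not> complete_tuple b} < card ?S" by linarith
      then have "\<not> ?S \<subseteq> {b \<in> PiE {..<l} P. \<not> complete_tuple b}"
        using card_mono[of "{b \<in> PiE {..<l} P. \<not> complete_tuple b}" ?S] finite_tuples by auto
      then obtain b where b: "b \<in> PiE {..<l} P" "complete_tuple b" "b ` J \<in> L3"
        "\<forall>i\<in>{..<l} - J. b i \<in> N i" by blast
      show False
      proof (rule no_full_vertex[OF J b(1,2)])
        show "insert v (b ` J) \<in> E" using b(3) by (simp add: L3_def link_def)
        show "heavy m E v (b j)" if "j < l" for j
          using b(3,4) that by (cases "j \<in> J") (auto simp: L3_def N_def)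
      qed
    qed
    let ?Js = "{J. J \<subseteq> {..<l} \<and> card J = r - 1}"
    have "L3 = (\<Union>J\<in>?Js. L3 \<inter> transv P J)" using cr cross_eq_UN_transv[OF P, of "r - 1"] by auto
    then have "card L3 \<le> (\<Sum>J\<in>?Js. card (L3 \<inter> transv P J))"
      using card_UN_le[of ?Js "\<lambda>J. L3 \<inter> transv P J"] by simp
    then have "real (card L3) \<le> real (\<Sum>J\<in>?Js. card (L3 \<inter> transv P J))" by (rule of_nat_mono)
    also have "\<dots> = (\<Sum>J\<in>?Js. real (card (L3 \<inter> transv P J)))" by simp
    also have "\<dots> \<le> (\<Sum>J\<in>?Js. \<rho> / 2 ^ l * real n ^ (r - 1))" by (rule sum_mono) (use small in auto)
    also have "\<dots> = real (card ?Js) * (\<rho> / 2 ^ l * real n ^ (r - 1))" by simp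
    also have "\<dots> \<le> 2 ^ l * (\<rho> / 2 ^ l * real n ^ (r - 1))"
    proof (rule mult_right_mono)
      have "real (card ?Js) \<le> real (2 ^ l)" using card_index_subsets by (rule of_nat_mono)
      then show "real (card ?Js) \<le> 2 ^ l" by simp
    qed (use \<rho> in simp)
    finally show ?thesis using L by simp
  next
    case False
    then obtain i where i: "i < l" "real (card (N i)) < \<rho> * real n" by auto
    have NV: "N i \<subseteq> V" using part(1)[OF i(1)] by (auto simp: N_def)
    \<comment> \<open>Discarding the sets that meet the few heavy partners in part \<open>i\<close>
      leaves sets avoiding part \<open>i\<close> altogether, because sets with light partners are
      already gone.\<close>
    let ?L4 = "{f \<in> ?L. f \<inter> N i \<noteq> {}}"
    have "L3 \<subseteq> ?L4 \<union> good_links i v"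
    proof
      fix f assume f: "f \<in> L3"
      show "f \<in> ?L4 \<union> good_links i v"
      proof (cases "f \<inter> N i = {}")
        case True
        then have "f \<inter> P i = {}" using f by (auto simp: L3_def N_def)
        then have "f \<in> cross P (I i) (r - 1)" using f cr unfolding cross_def by blast
        then show ?thesis using f by (auto simp: good_links_def L3_def)
      next
        case False then show ?thesis using f by (auto simp: L3_def)
      qed
    qed
    moreover have "finite (good_links i v)" unfolding good_links_def by (rule finite_subset[OF _ finite_link]) auto
    ultimately have "card L3 \<le> card (?L4 \<union> good_links i v)" using finite_link by (intro card_mono) auto
    also have "\<dots> \<le> card ?L4 + card (good_links i v)" by (rule card_Un_le)
    finally have "real (card L3) \<le> real (card ?L4) + real (card (good_links i v))" by linarith
    moreover have "real (card ?L4) \<le> \<rho> * real n ^ (r - 1)"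
    proof -
      have "real (card ?L4) \<le> real (card (N i) * n ^ (r - 2))" using card_link_meeting_le[OF NV] by (rule of_nat_mono)
      also have "\<dots> \<le> (\<rho> * real n) * real n ^ (r - 2)" using i(2) by (simp add: mult_right_mono)
      finally show ?thesis using npow by (simp only: mult.assoc)
    qed
    ultimately have "real (degree E v) \<le> real (card (good_links i v)) + 3 * \<rho> * real n ^ (r - 1)" using L by linarith
    then show ?thesis using i(1) by blast
  qed
qed

lemma card_cross_others: "i < l \<Longrightarrow> card (cross P (I i) (r - 1)) = esym (I i) (r - 1) (\<lambda>j. card (P j))"
  using part by (intro card_cross disjoint_part) auto

lemma finite_cross_others: "finite (cross P (I i) (r - 1))"
  using part by (intro finite_cross) auto

text \<open>Good links cross the parts other than \<open>i\<close>, so they are at most as many as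
  in the complete partite hypergraph.\<close>

lemma degree_upper:
  assumes dich: "real (degree E v) \<le> 3 * \<rho> * real n ^ (r - 1) \<or>
      (\<exists>i<l. real (degree E v) \<le> real (card (good_links i v)) + 3 * \<rho> * real n ^ (r - 1))"
    and \<rho>: "0 < \<rho>" and up: "\<And>i. i < l \<Longrightarrow> real (esym (I i) (r - 1) (\<lambda>j. card (P j))) \<le> (beta l r + \<rho>) * real n ^ (r - 1)"
  shows "real (degree E v) \<le> (beta l r + 4 * \<rho>) * real n ^ (r - 1)"
  using dich
proof (elim disjE exE conjE)
  assume "real (degree E v) \<le> 3 * \<rho> * real n ^ (r - 1)"
  also have "\<dots> \<le> (beta l r + 4 * \<rho>) * real n ^ (r - 1)"
    using \<rho> by (intro mult_right_mono) (auto simp: beta_def)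
  finally show ?thesis .
next
  fix i assume i: "i < l" and le: "real (degree E v) \<le> real (card (good_links i v)) + 3 * \<rho> * real n ^ (r - 1)"
  have "card (good_links i v) \<le> card (cross P (I i) (r - 1))"
    using finite_cross_others by (intro card_mono) (auto simp: good_links_def)
  then have "real (card (good_links i v)) \<le> real (esym (I i) (r - 1) (\<lambda>j. card (P j)))"
    using card_cross_others[OF i] by simp
  with le up[OF i] show ?thesis by (simp add: algebra_simps)
qed

text \<open>A degree this large forces nearly every set crossing the other parts to be a good link.
  A tuple then fails to fit \<open>v\<close> only if it shows one of the few exceptions or has no
  extension to a complete tuple.\<close>

lemma high_degree_typical:
  assumes d: "real (card missing) \<le> d * real n ^ r" and n: "0 < n"
    and size: "\<And>j. j < l \<Longrightarrow> real n \<le> 2 * real l * real (card (P j))"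
    and dich: "real (degree E v) \<le> 3 * \<rho> * real n ^ (r - 1) \<or>
      (\<exists>i<l. real (degree E v) \<le> real (card (good_links i v)) + 3 * \<rho> * real n ^ (r - 1))"
    and \<rho>: "0 < \<rho>" "4 * \<rho> < beta l r"
    and up: "\<And>i. i < l \<Longrightarrow> real (esym (I i) (r - 1) (\<lambda>j. card (P j))) \<le> (beta l r + \<rho>) * real n ^ (r - 1)"
    and deg: "(beta l r - \<rho>) * real n ^ (r - 1) \<le> real (degree E v)"
    and c: "2 ^ l * (5 * \<rho>) + 2 * real l * 2 ^ l * d \<le> \<kappa>"
  shows "\<exists>i<l. typical i v"
proof -
  have "\<not> real (degree E v) \<le> 3 * \<rho> * real n ^ (r - 1)"
  proof
    assume "real (degree E v) \<le> 3 * \<rho> * real n ^ (r - 1)"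
    then have "(beta l r - \<rho>) * real n ^ (r - 1) \<le> 3 * \<rho> * real n ^ (r - 1)" using deg by linarith
    then have "beta l r - \<rho> \<le> 3 * \<rho>" using n by simp
    then show False using \<rho> by simp
  qed
  then obtain i where i: "i < l"
    and le: "real (degree E v) \<le> real (card (good_links i v)) + 3 * \<rho> * real n ^ (r - 1)" using dich by auto
  define X where "X = cross P (I i) (r - 1) - good_links i v"
  have fX: "finite X" unfolding X_def using finite_cross_others by simp
  have "card X = card (cross P (I i) (r - 1)) - card (good_links i v)"
    unfolding X_def using finite_cross_others[of i] by (intro card_Diff_subset) (auto simp: good_links_def intro: finite_subset)
  moreover have "card (good_links i v) \<le> card (cross P (I i) (r - 1))"
    using finite_cross_others by (intro card_mono) (auto simp: good_links_def)
  ultimately have "real (card X) = real (card (cross P (I i) (r - 1))) - real (card (good_links i v))" by simp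
  \<comment> \<open>The crossing sets number at most \<open>beta + \<rho>\<close>, the good links at
    least \<open>beta - \<rho> - 3 * \<rho>\<close>, in units of \<open>n^(r-1)\<close>.\<close>
  then have cX: "real (card X) \<le> 5 * \<rho> * real n ^ (r - 1)"
    using le deg up[OF i] unfolding card_cross_others[OF i] by (simp add: algebra_simps)
  let ?T = "PiE (I i) P" and ?A = "{J. J \<subseteq> I i \<and> card J = r - 1}"
  let ?B1 = "{b. \<exists>J\<in>?A. b \<in> ?T \<and> b ` J \<in> X}"
  let ?B2 = "{b \<in> ?T. \<forall>z\<in>P i. \<not> complete_tuple (b(i := z))}"
  have sub: "{b \<in> ?T. \<not> fits i v b} \<subseteq> ?B1 \<union> ?B2"
  proof (rule subsetI, rule ccontr)
    fix b assume b: "b \<in> {b \<in> ?T. \<not> fits i v b}" and nb: "b \<notin> ?B1 \<union> ?B2"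
    then obtain z where z: "z \<in> P i" "complete_tuple (b(i := z))" by blast
    have bT: "b \<in> ?T" using b by simp
    \<comment> \<open>All conditions of \<open>fits\<close> that do not involve the vertex are
      inherited from \<open>z\<close>.\<close>
    have fz: "fits i z b" using fits_of_complete_tuple[OF tuple_upd[OF i bT z(1)] z(2) i, of b] by simp
    have good: "b ` J \<in> good_links i v" if "J \<subseteq> I i" "card J = r - 1" for J
    proof -
      have "b ` J \<in> transv P J" by (rule image_in_transv[OF bT that(1)])
      then have "b ` J \<in> cross P (I i) (r - 1)" using that by (auto simp: cross_eq_UN_transv[OF disjoint_part])
      moreover have "b ` J \<notin> X" using nb that bT by blast
      ultimately show ?thesis by (simp add: X_def)
    qed
    have "heavy m E v (b j)" if j: "j \<in> I i" for j
    proof -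
      have "card {j} \<le> r - 1" "r - 1 \<le> card (I i)" using r2 rl i by auto
      then obtain J where "{j} \<subseteq> J" "J \<subseteq> I i" "card J = r - 1"
        using exists_subset_between[of "{j}" "r - 1" "I i"] j by auto
      then show ?thesis using good[of J] by (auto simp: good_links_def)
    qed
    moreover have "insert v (b ` J) \<in> E" if "J \<subseteq> I i" "card J = r - 1" for J
      using good[OF that] by (simp add: good_links_def link_def)
    ultimately have "fits i v b" using fz by (simp add: fits_def)
    then show False using b by simp
  qed
  have fB1: "finite {b. b \<in> ?T \<and> b ` J \<in> X}" for J by (rule finite_subset[OF _ finite_tuples(1)]) auto
  have "card ?B1 \<le> card ?A * (card X * n ^ (l - r))"
  proof (rule card_Collect_ex_le[OF _ fB1])
    fix J assume J: "J \<in> ?A"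
    have "card {b \<in> ?T. b ` J \<in> X} \<le> card X * n ^ card (I i - J)"
      using J part fX disjoint_part by (intro card_tuples_le) auto
    also have "card (I i - J) = l - r" using J i r2 by (auto simp: card_Diff_subset finite_subset)
    finally show "card {b. b \<in> ?T \<and> b ` J \<in> X} \<le> card X * n ^ (l - r)" by simp
  qed simp
  also have "card ?A \<le> card {J. J \<subseteq> {..<l} \<and> card J = r - 1}" by (rule card_mono) auto
  also have "\<dots> \<le> 2 ^ l" by (rule card_index_subsets)
  finally have "card ?B1 \<le> 2 ^ l * (card X * n ^ (l - r))" by simp
  then have "real (card ?B1) \<le> real (2 ^ l * (card X * n ^ (l - r)))" by (rule of_nat_mono)
  also have "\<dots> = 2 ^ l * (real (card X) * real n ^ (l - r))" by simp
  also have "\<dots> \<le> 2 ^ l * (5 * \<rho> * real n ^ (r - 1) * real n ^ (l - r))"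
    using cX by (intro mult_left_mono mult_right_mono) auto
  also have "\<dots> = 2 ^ l * (5 * \<rho>) * real n ^ (l - 1)" using rl r2 by (simp add: power_add[symmetric])
  finally have B1: "real (card ?B1) \<le> 2 ^ l * (5 * \<rho>) * real n ^ (l - 1)" .
  have B2: "real (card ?B2) \<le> 2 * real l * 2 ^ l * d * real n ^ (l - 1)"
    by (rule card_unextendable_le[OF d i size[OF i] n])
  have "card {b \<in> ?T. \<not> fits i v b} \<le> card (?B1 \<union> ?B2)"
    using sub by (rule card_mono[rotated]) (auto intro: finite_subset[OF _ finite_tuples(1)])
  also have "\<dots> \<le> card ?B1 + card ?B2" by (rule card_Un_le)
  finally have "real (card {b \<in> ?T. \<not> fits i v b}) \<le> real (card ?B1) + real (card ?B2)" by linarith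
  also have "\<dots> \<le> (2 ^ l * (5 * \<rho>) + 2 * real l * 2 ^ l * d) * real n ^ (l - 1)"
    using B1 B2 by (simp add: algebra_simps)
  also have "\<dots> \<le> \<kappa> * real n ^ (l - 1)" using c by (rule mult_right_mono) simp
  finally show ?thesis using i by (auto simp: typical_def)
qed

end

section \<open>Types of vertices of large degree\<close>

context expansion_family
begin

lemma beta_pos: "0 < beta l r"
  using beta_eq_alpha[OF r2 rl] alpha_pos[OF rl] l0 r2 by simp

text \<open>The type \<open>\<tau> v\<close> of a vertex \<open>v\<close> of large degree is the part to which \<open>v\<close> should belong.\<close>

lemma classification:
  assumes \<eta>: "0 < \<eta>"
  shows "\<exists>\<epsilon>>0. \<exists>N. \<forall>(V :: 'v set) E P.
    rgraph r (V, E) \<longrightarrow> \<not> contains (V, E) H \<longrightarrow> disjoint_family_on P {..<l} \<longrightarrow> (\<Union>i<l. P i) = V \<longrightarrow>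
    N \<le> card V \<longrightarrow> (alpha l r - \<epsilon>) * real (card V) ^ r \<le> real (card (E \<inter> cross P {..<l} r)) \<longrightarrow>
    (\<forall>v. real (degree E v) \<le> (beta l r + \<eta>) * real (card V) ^ (r - 1)) \<and>
    (\<exists>\<tau>. \<forall>e\<in>E. \<forall>x\<in>e. \<forall>y\<in>e. (beta l r - \<epsilon>) * real (card V) ^ (r - 1) \<le> real (degree E x) \<longrightarrow>
      (beta l r - \<epsilon>) * real (card V) ^ (r - 1) \<le> real (degree E y) \<longrightarrow> \<tau> x < l \<and> (x \<noteq> y \<longrightarrow> \<tau> x \<noteq> \<tau> y))"
proof -
  let ?k = "kappa l"
  have k: "0 < ?k" using l0 by (simp add: kappa_def)
  \<comment> \<open>In order: \<open>4 * \<rho> \<le> \<eta>\<close> for the degree bound,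
    \<open>\<rho> \<le> 1\<close> and \<open>4 * \<rho> < beta\<close> for the preceding lemmas, and
    half of the budget \<open>\<kappa>\<close> in \<open>c5\<close>.\<close>
  define \<rho> where "\<rho> = Min {\<eta> / 4, 1, beta l r / 8, ?k / (2 ^ l * 10)}"
  have \<rho>: "0 < \<rho>" "\<rho> \<le> \<eta> / 4" "\<rho> \<le> 1" "\<rho> \<le> beta l r / 8" "\<rho> \<le> ?k / (2 ^ l * 10)"
    using \<eta> beta_pos k by (auto simp: \<rho>_def)
  obtain \<delta>0 where \<delta>0: "\<delta>0 > 0" "\<And>n x i. i < l \<Longrightarrow> (\<forall>j<l. \<bar>real (x j) - real n / real l\<bar> \<le> \<delta>0 * real n) \<Longrightarrow>
      real (esym ({..<l} - {i}) (r - 1) x) \<le> (beta l r + \<rho>) * real n ^ (r - 1)"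
    using esym_others_upper[OF r2 rl \<rho>(1)] by metis
  define \<delta> where "\<delta> = min \<delta>0 (1 / (2 * real l))"
  have \<delta>: "0 < \<delta>" "\<delta> \<le> \<delta>0" "\<delta> \<le> 1 / (2 * real l)" using \<delta>0 l0 by (auto simp: \<delta>_def)
  obtain \<epsilon>1 N1 where e1: "\<epsilon>1 > 0" "\<And>n x. n \<ge> N1 \<Longrightarrow> (\<Sum>i<l. x i) = n \<Longrightarrow>
      (alpha l r - \<epsilon>1) * real n ^ r \<le> real (esym {..<l} r x) \<Longrightarrow>
      (\<forall>i<l. \<bar>real (x i) - real n / real l\<bar> \<le> \<delta> * real n)"
    using sizes_near_balanced[OF r2 rl \<delta>(1)] by metis
  \<comment> \<open>One entry for each of \<open>c3\<close>, \<open>c4\<close> and the other half of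
    \<open>c5\<close>; the extra factor 2 in the second makes \<open>c4\<close> strict.\<close>
  define d where "d = Min {\<rho> * ?k / (real l * 2 ^ l), \<rho> * \<rho> ^ l / (2 ^ l * 2 ^ l * 2), ?k / (4 * real l * 2 ^ l)}"
  have "0 < \<rho> * ?k / (real l * 2 ^ l)" "0 < \<rho> * \<rho> ^ l / (2 ^ l * 2 ^ l * 2)" "0 < ?k / (4 * real l * 2 ^ l)"
    using \<rho>(1) k l0 by auto
  then have d: "0 < d" "d \<le> \<rho> * ?k / (real l * 2 ^ l)" "d \<le> \<rho> * \<rho> ^ l / (2 ^ l * 2 ^ l * 2)"
      "d \<le> ?k / (4 * real l * 2 ^ l)" by (auto simp: d_def)
  have c3: "real l * 2 ^ l * d \<le> \<rho> * ?k" using d(2) l0 by (simp add: field_simps)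
  have c4: "2 ^ l * 2 ^ l * d < \<rho> * \<rho> ^ l"
  proof -
    have "2 ^ l * 2 ^ l * d \<le> \<rho> * \<rho> ^ l / 2" using d(3) by (simp add: field_simps)
    also have "\<dots> < \<rho> * \<rho> ^ l" using \<rho>(1) by simp
    finally show ?thesis .
  qed
  have c5: "2 ^ l * (5 * \<rho>) + 2 * real l * 2 ^ l * d \<le> ?k"
  proof -
    have "2 ^ l * (5 * \<rho>) \<le> ?k / 2" using \<rho>(5) by (simp add: field_simps)
    moreover have "2 * real l * 2 ^ l * d \<le> ?k / 2" using d(4) l0 by (simp add: field_simps)
    ultimately show ?thesis by linarith
  qed
  \<comment> \<open>The missing sets split \<open>d\<close> into thirds: the error of the Turan
    asymptotics, the deficit \<open>\<epsilon>\<close> in crossing edges, and the light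
    edges.\<close>
  define \<epsilon> where "\<epsilon> = Min {\<epsilon>1, d / 3, \<rho>}"
  have \<epsilon>: "0 < \<epsilon>" "\<epsilon> \<le> \<epsilon>1" "\<epsilon> \<le> d / 3" "\<epsilon> \<le> \<rho>" using e1(1) d(1) \<rho>(1) by (auto simp: \<epsilon>_def)
  have "0 < d / 3" using d(1) by simp
  then obtain N2 where N2: "\<And>n. n \<ge> N2 \<Longrightarrow> real (tau l r n) \<le> (alpha l r + d / 3) * real n ^ r"
    using tau_asymp[OF l0(1), of "d / 3" r] by blast
  define N where "N = Max {N1, N2, 1, nat \<lceil>real (l * r) / ?k\<rceil> + 1, nat \<lceil>real m / \<rho>\<rceil>, nat \<lceil>3 * real m / d\<rceil>}"
  show ?thesis
  proof (rule exI[of _ \<epsilon>], intro conjI \<epsilon>(1), rule exI[of _ N], intro allI impI)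
    fix V :: "'v set" and E P
    assume G: "rgraph r (V, E)" and free: "\<not> contains (V, E) H" and P: "disjoint_family_on P {..<l}"
      and UP: "(\<Union>i<l. P i) = V" and nN: "N \<le> card V"
      and cr: "(alpha l r - \<epsilon>) * real (card V) ^ r \<le> real (card (E \<inter> cross P {..<l} r))"
    interpret partitioned_free r l F \<phi> lam V E P
      by unfold_locales (rule G free P UP)+
    have nn: "N1 \<le> n" "N2 \<le> n" "1 \<le> n" "nat \<lceil>real (l * r) / ?k\<rceil> + 1 \<le> n" "nat \<lceil>real m / \<rho>\<rceil> \<le> n"
      "nat \<lceil>3 * real m / d\<rceil> \<le> n" using nN by (auto simp: N_def)
    have n0: "0 < n" using nn(3) by simp
    have c1: "real (l * r) < ?k * real n"
    proof -
      have "real (l * r) / ?k < real n" using nn(4) by linarith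
      then show ?thesis using k by (simp add: field_simps)
    qed
    have c2: "real m \<le> \<rho> * real n"
    proof -
      have "real m / \<rho> \<le> real n" using nn(5) by linarith
      then show ?thesis using \<rho>(1) by (simp add: field_simps)
    qed
    have c2': "real m \<le> d / 3 * real n"
    proof -
      have "3 * real m / d \<le> real n" using nn(6) by linarith
      then show ?thesis using d(1) by (simp add: field_simps)
    qed
    have cc: "card (cross P {..<l} r) = esym {..<l} r (\<lambda>i. card (P i))"
      using part P by (intro card_cross) auto
    have fc: "finite (cross P {..<l} r)" using part by (intro finite_cross) auto
    have S: "(\<Sum>i<l. card (P i)) = n"
      using P part unfolding UP[symmetric] by (subst card_UN_disjoint) (auto simp: disjoint_family_on_def)
    have "card (E \<inter> cross P {..<l} r) \<le> esym {..<l} r (\<lambda>i. card (P i))"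
      unfolding cc[symmetric] using fc by (intro card_mono) auto
    then have "(alpha l r - \<epsilon>) * real n ^ r \<le> real (esym {..<l} r (\<lambda>i. card (P i)))" using cr by linarith
    moreover have "(alpha l r - \<epsilon>1) * real n ^ r \<le> (alpha l r - \<epsilon>) * real n ^ r"
      using \<epsilon>(2) by (intro mult_right_mono) auto
    ultimately have sz: "\<forall>i<l. \<bar>real (card (P i)) - real n / real l\<bar> \<le> \<delta> * real n"
      by (intro e1(2)[OF nn(1) S]) linarith
    have size: "real n \<le> 2 * real l * real (card (P j))" if "j < l" for j
    proof -
      have "real n / real l - real (card (P j)) \<le> \<delta> * real n" using sz that by (simp add: abs_le_iff)
      also have "\<delta> * real n \<le> 1 / (2 * real l) * real n" using \<delta>(3) by (rule mult_right_mono) simp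
      finally show ?thesis using l0 by (simp add: field_simps)
    qed
    have up: "real (esym (I i) (r - 1) (\<lambda>j. card (P j))) \<le> (beta l r + \<rho>) * real n ^ (r - 1)" if "i < l" for i
    proof (rule \<delta>0(2)[OF that], intro allI impI)
      fix j assume "j < l"
      then have "\<bar>real (card (P j)) - real n / real l\<bar> \<le> \<delta> * real n" using sz by blast
      also have "\<dots> \<le> \<delta>0 * real n" using \<delta>(2) by (rule mult_right_mono) simp
      finally show "\<bar>real (card (P j)) - real n / real l\<bar> \<le> \<delta>0 * real n" .
    qed
    have miss: "real (card missing) \<le> d * real n ^ r"
    proof -
      have "missing \<subseteq> (cross P {..<l} r - E) \<union> (E - heavy_edges m E)" by (auto simp: missing_def)
      then have "card missing \<le> card ((cross P {..<l} r - E) \<union> (E - heavy_edges m E))"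
        using fc finE by (intro card_mono) auto
      also have "\<dots> \<le> card (cross P {..<l} r - E) + card (E - heavy_edges m E)" by (rule card_Un_le)
      finally have "real (card missing) \<le> real (card (cross P {..<l} r - E)) + real (card (E - heavy_edges m E))" by linarith
      moreover have "real (card (cross P {..<l} r - E)) = real (card (cross P {..<l} r)) - real (card (E \<inter> cross P {..<l} r))"
        using fc by (simp add: card_Diff_subset_Int Int_commute card_mono of_nat_diff)
      moreover have "real (card (cross P {..<l} r)) \<le> (alpha l r + d / 3) * real n ^ r"
        using esym_le_tau[OF l0(1) r2 S] N2[OF nn(2)] unfolding cc by linarith
      moreover have "(alpha l r - d / 3) * real n ^ r \<le> (alpha l r - \<epsilon>) * real n ^ r"
        using \<epsilon>(3) by (intro mult_right_mono) auto
      moreover have "real (card (E - heavy_edges m E)) \<le> d / 3 * real n ^ r"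
      proof -
        have "real (card (E - heavy_edges m E)) \<le> real (m * n ^ (r - 1))"
          using card_light_edges[OF G r2] by (rule of_nat_mono)
        also have "\<dots> = real m * real n ^ (r - 1)" by simp
        also have "\<dots> \<le> (d / 3 * real n) * real n ^ (r - 1)" using c2' by (rule mult_right_mono) simp
        also have "\<dots> = d / 3 * real n ^ Suc (r - 1)" by simp
        also have "Suc (r - 1) = r" using r2 by simp
        finally show ?thesis .
      qed
      ultimately have "real (card missing) \<le> (alpha l r + d / 3) * real n ^ r - (alpha l r - d / 3) * real n ^ r
         + d / 3 * real n ^ r" using cr by linarith
      then show ?thesis by (simp add: algebra_simps)
    qed
    note dich = vertex_dichotomy[OF miss n0 size \<rho>(1,3) c1 c2 c3 c4]
    show "(\<forall>v. real (degree E v) \<le> (beta l r + \<eta>) * real (card V) ^ (r - 1)) \<and>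
    (\<exists>\<tau>. \<forall>e\<in>E. \<forall>x\<in>e. \<forall>y\<in>e. (beta l r - \<epsilon>) * real (card V) ^ (r - 1) \<le> real (degree E x) \<longrightarrow>
      (beta l r - \<epsilon>) * real (card V) ^ (r - 1) \<le> real (degree E y) \<longrightarrow> \<tau> x < l \<and> (x \<noteq> y \<longrightarrow> \<tau> x \<noteq> \<tau> y))"
    proof (intro conjI allI)
      fix v
      have "real (degree E v) \<le> (beta l r + 4 * \<rho>) * real n ^ (r - 1)" by (rule degree_upper[OF dich \<rho>(1) up])
      also have "\<dots> \<le> (beta l r + \<eta>) * real n ^ (r - 1)" using \<rho>(2) by (intro mult_right_mono) auto
      finally show "real (degree E v) \<le> (beta l r + \<eta>) * real n ^ (r - 1)" .
    next
      have "\<exists>i. (beta l r - \<epsilon>) * real n ^ (r - 1) \<le> real (degree E v) \<longrightarrow> i < l \<and> typical i v" for v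
      proof (cases "(beta l r - \<epsilon>) * real n ^ (r - 1) \<le> real (degree E v)")
        case True
        have "(beta l r - \<rho>) * real n ^ (r - 1) \<le> (beta l r - \<epsilon>) * real n ^ (r - 1)"
          using \<epsilon>(4) by (intro mult_right_mono) auto
        then have "(beta l r - \<rho>) * real n ^ (r - 1) \<le> real (degree E v)" using True by linarith
        then have "\<exists>i<l. typical i v"
          using \<rho>(1,4) beta_pos by (intro high_degree_typical[OF miss n0 size dich \<rho>(1) _ up _ c5]) auto
        then show ?thesis by blast
      qed auto
      then obtain \<tau> where t: "\<And>v. (beta l r - \<epsilon>) * real n ^ (r - 1) \<le> real (degree E v) \<Longrightarrow> \<tau> v < l \<and> typical (\<tau> v) v"
        by metis
      show "\<exists>\<tau>. \<forall>e\<in>E. \<forall>x\<in>e. \<forall>y\<in>e. (beta l r - \<epsilon>) * real n ^ (r - 1) \<le> real (degree E x) \<longrightarrow>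
        (beta l r - \<epsilon>) * real n ^ (r - 1) \<le> real (degree E y) \<longrightarrow> \<tau> x < l \<and> (x \<noteq> y \<longrightarrow> \<tau> x \<noteq> \<tau> y)"
      proof (intro exI[of _ \<tau>] ballI impI conjI notI)
        fix e x y assume e: "e \<in> E" "x \<in> e" "y \<in> e" and dx: "(beta l r - \<epsilon>) * real n ^ (r - 1) \<le> real (degree E x)"
          and dy: "(beta l r - \<epsilon>) * real n ^ (r - 1) \<le> real (degree E y)"
        show "\<tau> x < l" using t[OF dx] by simp
        assume "x \<noteq> y" "\<tau> x = \<tau> y"
        then show False
          using typical_twins_not_in_edge[of "\<tau> x" x y e, OF _ _ e] t[OF dx] t[OF dy] size c1 by auto
      qed
    qed
  qed
qed

end

section \<open>Symmetrization\<close>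

definition uncov :: "'v set set \<Rightarrow> 'v \<Rightarrow> 'v \<Rightarrow> bool" where
  "uncov E u v \<longleftrightarrow> (\<forall>e\<in>E. \<not> (u \<in> e \<and> v \<in> e))"

definition clone :: "'v set set \<Rightarrow> 'v \<Rightarrow> 'v \<Rightarrow> 'v set set" where
  "clone E u v = {e \<in> E. v \<notin> e} \<union> insert v ` link E u"

text \<open>Ordered pairs including the diagonal, so the cardinality is the sum of the squares of
  the sizes of the twin classes.\<close>

definition twins :: "'v set \<Rightarrow> 'v set set \<Rightarrow> ('v \<times> 'v) set" where
  "twins V E = {(x, y) \<in> V \<times> V. link E x = link E y}"

lemma link_uncov: "uncov E u v \<Longrightarrow> f \<in> link E u \<Longrightarrow> v \<notin> f"
  unfolding uncov_def link_def by auto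

lemma twins_uncov: "link E x = link E y \<Longrightarrow> x \<noteq> y \<Longrightarrow> uncov E x y"
  unfolding uncov_def
proof (intro ballI notI)
  fix e assume eq: "link E x = link E y" and ne: "x \<noteq> y" and e: "e \<in> E" "x \<in> e \<and> y \<in> e"
  from e have "e - {x} \<in> link E x" by (simp add: link_def insert_absorb)
  with eq have "e - {x} \<in> link E y" by (simp only:)
  then have "y \<notin> e - {x}" by (simp add: link_def)
  with e ne show False by auto
qed

lemma clone_rgraph:
  assumes G: "rgraph r (V, E)" and v: "v \<in> V" and uv: "u \<noteq> v" "uncov E u v"
  shows "rgraph r (V, clone E u v)"
  unfolding rgraph_def
proof (intro conjI ballI)
  show "finite (verts (V, clone E u v))" using G by (simp add: rgraph_def)
  have V: "finite V" using G by (simp add: rgraph_def)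
  fix e assume "e \<in> edges (V, clone E u v)"
  then consider "e \<in> E" | f where "f \<in> link E u" "e = insert v f" by (auto simp: clone_def)
  then have "e \<subseteq> V \<and> card e = r"
  proof cases
    case 1 then show ?thesis using G by (auto simp: rgraph_def)
  next
    case 2
    then have f: "u \<notin> f" "insert u f \<in> E" "v \<notin> f" using link_uncov[OF uv(2)] by (auto simp: link_def)
    then have "insert u f \<subseteq> V" "card (insert u f) = r" using G by (auto simp: rgraph_def)
    moreover have "finite f" using \<open>insert u f \<subseteq> V\<close> V by (auto intro: finite_subset)
    ultimately show ?thesis using f 2 v by auto
  qed
  then show "e \<subseteq> verts (V, clone E u v)" "card e = r" by auto
qed

text \<open>Folding the new vertex back onto \<open>u\<close> maps edges of the clone to old edges,
  and no edge of the clone contains both vertices.\<close>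

lemma clone_merge:
  assumes uv: "uncov E u v" and e: "e \<in> clone E u v"
  shows "(\<lambda>z. if z = v then u else z) ` e \<in> E" "\<not> (u \<in> e \<and> v \<in> e \<and> u \<noteq> v)"
proof -
  from e consider "e \<in> E" "v \<notin> e" | f where "f \<in> link E u" "e = insert v f" by (auto simp: clone_def)
  then have "(\<lambda>z. if z = v then u else z) ` e \<in> E \<and> \<not> (u \<in> e \<and> v \<in> e \<and> u \<noteq> v)"
  proof cases
    case 1
    then have "(\<lambda>z. if z = v then u else z) ` e = e" by force
    then show ?thesis using 1 by simp
  next
    case 2
    then have v: "v \<notin> f" using link_uncov[OF uv] by blast
    then have "(\<lambda>z. if z = v then u else z) ` f = f" by force
    then have "(\<lambda>z. if z = v then u else z) ` e = insert u f" unfolding 2(2) image_insert by simp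
    moreover have "insert u f \<in> E" "u \<notin> f" using 2(1) by (auto simp: link_def)
    ultimately show ?thesis using 2(2) by simp
  qed
  then show "(\<lambda>z. if z = v then u else z) ` e \<in> E" "\<not> (u \<in> e \<and> v \<in> e \<and> u \<noteq> v)" by auto
qed

text \<open>In a forbidden configuration every two vertices lie in a common edge, so it cannot use
  both \<open>u\<close> and \<open>v\<close>. The folding map is therefore injective on it and
  carries it back to the old hypergraph.\<close>

lemma clone_core_free:
  assumes F: "rgraph r F" and cf: "core_free F (V, E)" and u: "u \<in> V" and uv: "u \<noteq> v" "uncov E u v"
  shows "core_free F (V, clone E u v)"
  unfolding core_free_def
proof (rule notI, elim exE conjE)
  fix f assume f: "embeds f F (V, clone E u v)"
    and cov: "\<forall>p\<in>uncovered_pairs F. \<exists>e\<in>edges (V, clone E u v). f ` p \<subseteq> e"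
  let ?\<pi> = "\<lambda>z. if z = v then u else z"
  have inj: "inj_on f (verts F)" and ed: "\<And>e. e \<in> edges F \<Longrightarrow> f ` e \<in> clone E u v" and fV: "f ` verts F \<subseteq> V"
    using f by (auto simp: embeds_def)
  have pair: "\<exists>e\<in>clone E u v. f x \<in> e \<and> f y \<in> e" if xy: "x \<in> verts F" "y \<in> verts F" "x \<noteq> y" for x y
  proof (cases "{x, y} \<in> uncovered_pairs F")
    case True
    from bspec[OF cov True] show ?thesis by auto
  next
    case False
    then obtain e where e: "e \<in> edges F" "{x, y} \<subseteq> e"
      using xy unfolding uncovered_pairs_def by auto
    show ?thesis by (rule bexI[OF _ ed[OF e(1)]]) (use e(2) in auto)
  qed
  have "embeds (?\<pi> \<circ> f) F (V, E)" unfolding embeds_def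
  proof (intro conjI ballI)
    show "inj_on (?\<pi> \<circ> f) (verts F)"
    proof (rule inj_onI, rule ccontr)
      fix x y assume xy: "x \<in> verts F" "y \<in> verts F" "(?\<pi> \<circ> f) x = (?\<pi> \<circ> f) y" "x \<noteq> y"
      have "f x \<noteq> f y" using inj_onD[OF inj _ xy(1,2)] xy(4) by blast
      then have "(f x = u \<and> f y = v) \<or> (f x = v \<and> f y = u)" using xy(3) by (simp add: comp_def split: if_splits)
      then show False using pair[OF xy(1,2,4)] clone_merge(2)[OF uv(2)] uv(1) by blast
    qed
    show "(?\<pi> \<circ> f) ` verts F \<subseteq> verts (V, E)" using fV u by auto
    fix e assume "e \<in> edges F"
    from clone_merge(1)[OF uv(2) ed[OF this]] show "(?\<pi> \<circ> f) ` e \<in> edges (V, E)" by (simp only: image_comp snd_conv)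
  qed
  moreover have "\<exists>e\<in>edges (V, E). (?\<pi> \<circ> f) ` p \<subseteq> e" if p: "p \<in> uncovered_pairs F" for p
  proof -
    obtain e where e: "e \<in> clone E u v" "f ` p \<subseteq> e" using bspec[OF cov p] by auto
    have "(?\<pi> \<circ> f) ` p \<subseteq> ?\<pi> ` e" using image_mono[OF e(2), of ?\<pi>] by (simp only: image_comp)
    then show ?thesis using clone_merge(1)[OF uv(2) e(1)] unfolding snd_conv by (rule rev_bexI[rotated])
  qed
  ultimately show False using cf unfolding core_free_def by blast
qed

lemma card_clone:
  assumes fin: "finite E" and uv: "uncov E u v"
  shows "card (clone E u v) + degree E v = card E + degree E u"
proof -
  have inj: "inj_on (insert v) (link E u)"
    by (rule inj_onI) (use link_uncov[OF uv] in \<open>auto simp: insert_ident\<close>)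
  have fl: "finite (link E u)"
  proof (rule finite_imageD)
    show "finite (insert u ` link E u)" by (rule finite_subset[OF _ fin]) (auto simp: link_def)
    show "inj_on (insert u) (link E u)" by (rule inj_onI) (auto simp: link_def insert_ident)
  qed
  have "card (clone E u v) = card {e \<in> E. v \<notin> e} + card (insert v ` link E u)"
    unfolding clone_def using fin fl by (intro card_Un_disjoint) auto
  also have "card (insert v ` link E u) = degree E u" by (simp add: card_image inj degree_eq_card_link)
  finally have 1: "card (clone E u v) = card {e \<in> E. v \<notin> e} + degree E u" .
  have "E = {e \<in> E. v \<notin> e} \<union> {e \<in> E. v \<in> e}" by auto
  then have "card E = card {e \<in> E. v \<notin> e} + card {e \<in> E. v \<in> e}"
    using card_Un_disjoint[of "{e \<in> E. v \<notin> e}" "{e \<in> E. v \<in> e}"] fin by auto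
  then show ?thesis using 1 by (simp add: degree_def)
qed

lemma link_clone_self:
  assumes "uncov E u v"
  shows "link (clone E u v) v = link E u"
proof (intro set_eqI iffI)
  fix f assume "f \<in> link (clone E u v) v"
  then have f: "v \<notin> f" "insert v f \<in> clone E u v" by (auto simp: link_def)
  then obtain g where "g \<in> link E u" "insert v f = insert v g" by (auto simp: clone_def)
  then show "f \<in> link E u" using f(1) link_uncov[OF assms] by (metis insert_ident)
next
  fix f assume "f \<in> link E u"
  then show "f \<in> link (clone E u v) v" using link_uncov[OF assms] by (auto simp: link_def clone_def)
qed

lemma link_clone_twin:
  assumes uv: "uncov E u v" and x: "link E x = link E u" "x \<noteq> v"
  shows "link (clone E u v) x = link E u"
proof (intro set_eqI iffI)
  fix f assume "f \<in> link (clone E u v) x"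
  then have f: "x \<notin> f" "insert x f \<in> clone E u v" by (auto simp: link_def)
  from f(2) consider "insert x f \<in> E" | g where "g \<in> link E u" "insert x f = insert v g" by (auto simp: clone_def)
  then show "f \<in> link E u"
  proof cases
    case 1 then show ?thesis using f(1) x(1) by (auto simp: link_def)
  next
    case 2
    then have "x \<in> g" using x(2) by auto
    moreover have "g \<in> link E x" using 2 x(1) by simp
    ultimately show ?thesis by (simp add: link_def)
  qed
next
  fix f assume f: "f \<in> link E u"
  then have "f \<in> link E x" "v \<notin> f" using x link_uncov[OF uv] by auto
  then show "f \<in> link (clone E u v) x" using x(2) by (auto simp: link_def clone_def)
qed

text \<open>Twins other than \<open>v\<close> stay twins; one inclusion suffices by symmetry. A new
  edge through \<open>v\<close> and \<open>x\<close> copies an old edge through \<open>u\<close> and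
  \<open>x\<close>, in which \<open>x\<close> may be exchanged for its twin
  \<open>y\<close>.\<close>

lemma link_clone_mono:
  assumes uv: "uncov E u v" and xy: "link E x = link E y" "x \<noteq> v" "y \<noteq> v"
  shows "link (clone E u v) x \<subseteq> link (clone E u v) y"
proof (cases "link E x = link E u")
  case True
  then show ?thesis using link_clone_twin[OF uv True xy(2)] link_clone_twin[OF uv _ xy(3)] xy(1) by simp
next
  case False
  then have xu: "x \<noteq> u" "y \<noteq> u" using xy by auto
  show ?thesis
  proof
    fix f assume "f \<in> link (clone E u v) x"
    then have f: "x \<notin> f" "insert x f \<in> clone E u v" by (auto simp: link_def)
    from f(2) consider "insert x f \<in> E" "v \<notin> insert x f" | g where "g \<in> link E u" "insert x f = insert v g"
      by (auto simp: clone_def)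
    then show "f \<in> link (clone E u v) y"
    proof cases
      case 1
      then have "f \<in> link E y" using f(1) xy(1) by (auto simp: link_def)
      then show ?thesis using 1 xy(3) by (auto simp: link_def clone_def)
    next
      case 2
      have g: "u \<notin> g" "insert u g \<in> E" "v \<notin> g" using 2(1) link_uncov[OF uv] by (auto simp: link_def)
      have xg: "x \<in> g" using 2(2) xy(2) by auto
      have feq: "f = insert v (g - {x})"
      proof -
        have "insert x f - {x} = insert v g - {x}" using 2(2) by simp
        then show ?thesis using f(1) xy(2) by auto
      qed
      let ?h = "insert u (g - {x})"
      have "insert x ?h = insert u g" using xg by auto
      then have "?h \<in> link E x" using g xu by (auto simp: link_def)
      then have "?h \<in> link E y" using xy(1) by simp
      then have h: "y \<notin> ?h" "insert y ?h \<in> E" by (auto simp: link_def)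
      have "insert y (g - {x}) \<in> link E u" using g(1) xu h(2) by (auto simp: link_def insert_commute)
      then have "insert v (insert y (g - {x})) \<in> clone E u v" by (auto simp: clone_def)
      moreover have "insert v (insert y (g - {x})) = insert y f" unfolding feq by (rule insert_commute)
      moreover have "y \<notin> f" using h(1) xy(3) feq by auto
      ultimately show ?thesis by (simp add: link_def)
    qed
  qed
qed

text \<open>Moving \<open>v\<close> out of a class of size \<open>a\<close> loses at most
  \<open>2 * a - 1\<close> pairs, and joining a class of size \<open>b \<ge> a\<close> creates at
  least \<open>2 * b\<close>.\<close>

lemma card_twins_clone:
  assumes fin: "finite V" and u: "u \<in> V" "v \<in> V" and uv: "u \<noteq> v" "uncov E u v" "link E u \<noteq> link E v"
    and le: "card {y \<in> V. link E y = link E v} \<le> card {y \<in> V. link E y = link E u}"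
  shows "card (twins V E) < card (twins V (clone E u v))"
proof -
  let ?cu = "{y \<in> V. link E y = link E u}" and ?cv = "{y \<in> V. link E y = link E v}"
  let ?T0 = "{(x, y) \<in> twins V E. x \<noteq> v \<and> y \<noteq> v}"
  have fT: "finite (twins V E)" "finite (twins V (clone E u v))"
    by (rule finite_subset[of _ "V \<times> V"], use fin in \<open>auto simp: twins_def\<close>)+
  have fT0: "finite ?T0" by (rule finite_subset[OF _ fT(1)]) auto
  have fc: "finite ?cu" "finite ?cv" using fin by auto
  have "twins V E \<subseteq> ?T0 \<union> {v} \<times> ?cv \<union> (?cv - {v}) \<times> {v}" by (auto simp: twins_def)
  then have "card (twins V E) \<le> card (?T0 \<union> {v} \<times> ?cv \<union> (?cv - {v}) \<times> {v})"
    using fT0 fc by (intro card_mono) auto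
  also have "\<dots> \<le> card ?T0 + card ({v} \<times> ?cv) + card ((?cv - {v}) \<times> {v})"
    by (meson add_le_mono card_Un_le le_refl order_trans)
  also have "\<dots> = card ?T0 + card ?cv + (card ?cv - 1)"
    using u(2) fc by (simp add: card_cartesian_product)
  finally have 1: "card (twins V E) \<le> card ?T0 + card ?cv + (card ?cv - 1)" .
  have sub: "?T0 \<union> ({v} \<times> ?cu \<union> ?cu \<times> {v}) \<subseteq> twins V (clone E u v)"
  proof (intro Un_least subsetI)
    fix p assume "p \<in> ?T0"
    then obtain x y where p: "p = (x, y)" "x \<in> V" "y \<in> V" "link E x = link E y" "x \<noteq> v" "y \<noteq> v"
      by (auto simp: twins_def)
    have "link (clone E u v) x = link (clone E u v) y"
      using link_clone_mono[OF uv(2), of x y] link_clone_mono[OF uv(2), of y x] p by auto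
    then show "p \<in> twins V (clone E u v)" using p by (auto simp: twins_def)
  next
    fix p assume "p \<in> {v} \<times> ?cu"
    then obtain y where y: "p = (v, y)" "y \<in> V" "link E y = link E u" by auto
    then have "y \<noteq> v" using uv(3) by auto
    then show "p \<in> twins V (clone E u v)"
      using link_clone_self[OF uv(2)] link_clone_twin[OF uv(2) y(3)] y u by (auto simp: twins_def)
  next
    fix p assume "p \<in> ?cu \<times> {v}"
    then obtain y where y: "p = (y, v)" "y \<in> V" "link E y = link E u" by auto
    then have "y \<noteq> v" using uv(3) by auto
    then show "p \<in> twins V (clone E u v)"
      using link_clone_self[OF uv(2)] link_clone_twin[OF uv(2) y(3)] y u by (auto simp: twins_def)
  qed
  have vcu: "v \<notin> ?cu" using uv(3) by auto
  have "card ?T0 + (card ?cu + card ?cu) = card ?T0 + card ({v} \<times> ?cu \<union> ?cu \<times> {v})"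
    using fc vcu by (subst card_Un_disjoint) (auto simp: card_cartesian_product)
  also have "\<dots> = card (?T0 \<union> ({v} \<times> ?cu \<union> ?cu \<times> {v}))"
    using fT0 fc by (subst card_Un_disjoint) auto
  also have "\<dots> \<le> card (twins V (clone E u v))" using sub fT(2) by (intro card_mono)
  finally have 2: "card ?T0 + (card ?cu + card ?cu) \<le> card (twins V (clone E u v))" .
  have "0 < card ?cv" using u(2) fc by (auto simp: card_gt_0_iff)
  then show ?thesis using 1 2 le by linarith
qed

text \<open>Cloning the vertex of larger degree, and on a tie the one with the larger twin class,
  raises first the edge count and then the number of twin pairs, so it terminates. The property is
  carried back from the clone to the original.\<close>

lemma symmetrization_induct [consumes 3, case_names symmetrized clone]:
  assumes F: "rgraph r F" and G: "rgraph r (V, E)" "core_free F (V, E)"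
    and base: "\<And>E. rgraph r (V, E) \<Longrightarrow> core_free F (V, E) \<Longrightarrow>
      (\<And>u v. u \<in> V \<Longrightarrow> v \<in> V \<Longrightarrow> u \<noteq> v \<Longrightarrow> uncov E u v \<Longrightarrow> link E u = link E v) \<Longrightarrow> Q E"
    and step: "\<And>E u v. rgraph r (V, E) \<Longrightarrow> core_free F (V, E) \<Longrightarrow> u \<in> V \<Longrightarrow> v \<in> V \<Longrightarrow> u \<noteq> v \<Longrightarrow> uncov E u v \<Longrightarrow>
      rgraph r (V, clone E u v) \<Longrightarrow> core_free F (V, clone E u v) \<Longrightarrow> card E \<le> card (clone E u v) \<Longrightarrow>
      Q (clone E u v) \<Longrightarrow> Q E"
  shows "Q E"
proof -
  have fV: "finite V" using G(1) by (simp add: rgraph_def)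
  let ?n = "card V"
  \<comment> \<open>The lexicographic order as one number: there are at most \<open>?n * ?n\<close>
    twin pairs, so one more edge outweighs any loss of them.\<close>
  define M where "M E = card E * Suc (?n * ?n) + card (twins V E)" for E
  have fE: "finite E" if "rgraph r (V, E)" for E
    by (rule finite_subset[of _ "Pow V"]) (use that in \<open>auto simp: rgraph_def\<close>)
  have tw: "card (twins V E) \<le> ?n * ?n" for E
    using card_mono[of "V \<times> V" "twins V E"] fV by (auto simp: twins_def card_cartesian_product)
  have bound: "M E \<le> 2 ^ ?n * Suc (?n * ?n) + ?n * ?n" if "rgraph r (V, E)" for E
  proof -
    have "card E \<le> card (Pow V)" by (rule card_mono) (use that in \<open>auto simp: rgraph_def\<close>)
    then have "card E \<le> 2 ^ ?n" by (simp add: card_Pow fV)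
    then show ?thesis unfolding M_def using tw by (intro add_mono mult_right_mono) auto
  qed
  show ?thesis using G
  proof (induction "2 ^ ?n * Suc (?n * ?n) + ?n * ?n - M E" arbitrary: E rule: less_induct)
    case less
    show ?case
    proof (cases "\<forall>u\<in>V. \<forall>v\<in>V. u \<noteq> v \<and> uncov E u v \<longrightarrow> link E u = link E v")
      case True
      then show ?thesis using base less.prems by blast
    next
      case False
      then obtain a b where ab: "a \<in> V" "b \<in> V" "a \<noteq> b" "uncov E a b" "link E a \<noteq> link E b" by blast
      let ?c = "\<lambda>x. card {y \<in> V. link E y = link E x}"
      have ba: "uncov E b a" using ab(4) by (auto simp: uncov_def)
      have "\<exists>u v. u \<in> V \<and> v \<in> V \<and> u \<noteq> v \<and> uncov E u v \<and> link E u \<noteq> link E v \<and>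
        (degree E v < degree E u \<or> degree E v = degree E u \<and> ?c v \<le> ?c u)"
      proof -
        consider "degree E b < degree E a" | "degree E a < degree E b"
          | "degree E b = degree E a" "?c b \<le> ?c a" | "degree E b = degree E a" "?c a \<le> ?c b" by linarith
        then show ?thesis
        proof cases
          case 1 then show ?thesis using ab by (intro exI[of _ a] exI[of _ b]) auto
        next
          case 2 then show ?thesis using ab ba by (intro exI[of _ b] exI[of _ a]) auto
        next
          case 3 then show ?thesis using ab by (intro exI[of _ a] exI[of _ b]) auto
        next
          case 4 then show ?thesis using ab ba by (intro exI[of _ b] exI[of _ a]) auto
        qed
      qed
      then obtain u v where uv: "u \<in> V" "v \<in> V" "u \<noteq> v" "uncov E u v" "link E u \<noteq> link E v"
        and d: "degree E v < degree E u \<or> degree E v = degree E u \<and> ?c v \<le> ?c u" by blast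
      have G': "rgraph r (V, clone E u v)" by (rule clone_rgraph[OF less.prems(1) uv(2,3,4)])
      have cf': "core_free F (V, clone E u v)" by (rule clone_core_free[OF F less.prems(2) uv(1,3,4)])
      have cc: "card (clone E u v) + degree E v = card E + degree E u"
        by (rule card_clone[OF fE[OF less.prems(1)] uv(4)])
      have "M E < M (clone E u v)"
        using d
      proof
        assume "degree E v < degree E u"
        then have "Suc (card E) * Suc (?n * ?n) \<le> card (clone E u v) * Suc (?n * ?n)"
          using cc by (intro mult_right_mono) auto
        then show ?thesis using tw[of E] unfolding M_def mult_Suc by linarith
      next
        assume "degree E v = degree E u \<and> ?c v \<le> ?c u"
        then show ?thesis using cc card_twins_clone[OF fV uv] unfolding M_def by simp
      qed
      then have "Q (clone E u v)" using bound[OF G'] by (intro less.hyps G' cf') linarith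
      moreover have "card E \<le> card (clone E u v)" using cc d by linarith
      ultimately show ?thesis using step[OF less.prems uv(1-4) G' cf'] by blast
    qed
  qed
qed

section \<open>Structure and density of symmetrized hypergraphs\<close>

context expansion_family
begin

text \<open>Representatives of the twin classes are pairwise covered, and the hypergraph lies in the
  blow-up of its restriction to them. With at most \<open>l\<close> classes it is
  \<open>l\<close>-partite; with more, the restriction is \<open>F\<close>-free but no
  subconstruction, so the Lagrangian gap applies. The restriction lives on vertices of
  \<open>V\<close>, hence the type \<open>nat\<close>.\<close>

lemma symmetrized_structure:
  fixes V :: "nat set"
  assumes G: "rgraph r (V, E)" and cf: "core_free F (V, E)"
    and sym: "\<And>u v. u \<in> V \<Longrightarrow> v \<in> V \<Longrightarrow> u \<noteq> v \<Longrightarrow> uncov E u v \<Longrightarrow> link E u = link E v"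
  shows "(\<exists>P. disjoint_family_on P {..<l} \<and> (\<Union>i<l. P i) = V \<and> E \<subseteq> cross P {..<l} r) \<or>
    fact r * real (card E) \<le> lam * real (card V) ^ r"
proof -
  have fV: "finite V" using G by (simp add: rgraph_def)
  have eE: "e \<subseteq> V" "card e = r" "finite e" if "e \<in> E" for e
    using G that fV by (auto simp: rgraph_def intro: finite_subset)
  define rep where "rep x = (SOME y. y \<in> V \<and> link E y = link E x)" for x
  have rep: "rep x \<in> V" "link E (rep x) = link E x" if "x \<in> V" for x
  proof -
    have "rep x \<in> V \<and> link E (rep x) = link E x" unfolding rep_def by (rule someI[of _ x]) (simp add: that)
    then show "rep x \<in> V" "link E (rep x) = link E x" by auto
  qed
  have rep_eq: "rep x = rep y" if "link E x = link E y" for x y using that by (simp add: rep_def)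
  define R where "R = rep ` V"
  have RV: "R \<subseteq> V" using rep by (auto simp: R_def)
  have repR: "rep x = x" if x: "x \<in> R" for x
  proof -
    obtain y where "y \<in> V" "x = rep y" using x by (auto simp: R_def)
    then show ?thesis using rep_eq[OF rep(2)] by simp
  qed
  have R_cov: "\<exists>e\<in>E. x \<in> e \<and> y \<in> e" if xy: "x \<in> R" "y \<in> R" "x \<noteq> y" for x y
  proof (rule ccontr)
    assume "\<not> (\<exists>e\<in>E. x \<in> e \<and> y \<in> e)"
    then have "uncov E x y" by (auto simp: uncov_def)
    then have "link E x = link E y" using sym xy RV by auto
    then have "x = y" using rep_eq repR xy by metis
    then show False using xy by simp
  qed
  have edge_inj: "inj_on rep e" if e: "e \<in> E" for e
  proof (rule inj_onI, rule ccontr)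
    fix x y assume xy: "x \<in> e" "y \<in> e" "rep x = rep y" "x \<noteq> y"
    then have "link E x = link E y" using rep(2) eE(1)[OF e] by (metis subsetD)
    then have "uncov E x y" using xy(4) by (rule twins_uncov)
    then show False using e xy by (auto simp: uncov_def)
  qed
  \<comment> \<open>Vertices of an edge are exchanged for their representatives one at a time, each
    having the same link.\<close>
  have edge_rep: "rep ` e \<in> E" if e: "e \<in> E" for e
  proof -
    have "(e - A) \<union> rep ` A \<in> E" if "finite A" "A \<subseteq> e" for A
      using that
    proof (induction A rule: finite_induct)
      case empty then show ?case using e by simp
    next
      case (insert x A)
      let ?e = "(e - A) \<union> rep ` A"
      have eI: "?e \<in> E" using insert by simp
      have x: "x \<in> e" "x \<in> V" "x \<in> ?e" using insert eE(1)[OF e] by auto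
      show ?case
      proof (cases "rep x = x")
        case True
        then have "(e - insert x A) \<union> rep ` insert x A = ?e" using x by auto
        then show ?thesis using eI by simp
      next
        case False
        have xA: "x \<notin> rep ` A"
        proof
          assume "x \<in> rep ` A"
          then obtain a where a: "a \<in> A" "x = rep a" by auto
          then have "rep x = rep a" using repR[of x] insert.prems eE(1)[OF e] by (auto simp: R_def)
          then have "x = a" using edge_inj[OF e] x a insert.prems by (auto dest: inj_onD)
          then show False using a insert.hyps by simp
        qed
        have "?e - {x} \<in> link E x" using eI x by (simp add: link_def insert_absorb)
        then have "?e - {x} \<in> link E (rep x)" using rep(2)[OF x(2)] by simp
        then have "insert (rep x) (?e - {x}) \<in> E" by (simp add: link_def)
        moreover have "insert (rep x) (?e - {x}) = (e - insert x A) \<union> rep ` insert x A" using xA by auto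
        ultimately show ?thesis by simp
      qed
    qed
    from this[of e] show ?thesis using eE(3)[OF e] by simp
  qed
  show ?thesis
  proof (cases "card R \<le> l")
    case True
    have fR: "finite R" using RV fV by (rule finite_subset)
    obtain g where g: "inj_on g R" "g ` R \<subseteq> {..<l}"
      using card_le_inj[of R "{..<l}"] fR True by auto
    define P where "P i = {x \<in> V. g (rep x) = i}" for i
    have "disjoint_family_on P {..<l}" by (auto simp: disjoint_family_on_def P_def)
    moreover have "(\<Union>i<l. P i) = V" using g(2) by (auto simp: P_def R_def)
    moreover have "E \<subseteq> cross P {..<l} r"
    proof
      fix e assume e: "e \<in> E"
      have "card (e \<inter> P i) \<le> 1" for i
      proof -
        have "x = y" if xy: "x \<in> e \<inter> P i" "y \<in> e \<inter> P i" for x y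
        proof -
          have "rep x \<in> R" "rep y \<in> R" "g (rep x) = g (rep y)" using xy by (auto simp: P_def R_def)
          then have "rep x = rep y" using g(1) by (auto dest: inj_onD)
          then show ?thesis using edge_inj[OF e] xy by (auto dest: inj_onD)
        qed
        then show ?thesis using eE(3)[OF e] by (auto simp: card_le_Suc0_iff_eq)
      qed
      moreover have "e \<subseteq> (\<Union>i<l. P i)" using \<open>(\<Union>i<l. P i) = V\<close> eE(1)[OF e] by simp
      ultimately show "e \<in> cross P {..<l} r" using eE[OF e] by (simp add: cross_def)
    qed
    ultimately show ?thesis by blast
  next
    case False
    have fR: "finite R" using RV fV by (rule finite_subset)
    define Q where "Q = (R, {e \<in> E. e \<subseteq> R})"
    have Q: "rgraph r Q" using fR eE by (auto simp: Q_def rgraph_def)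
    have nF: "\<not> contains Q F"
    \<comment> \<open>Any two representatives lie in a common edge of \<open>E\<close>, so every
      copy of \<open>F\<close> on them is a forbidden core.\<close>
    proof
      assume "contains Q F"
      then obtain f where f: "embeds f F Q" by (auto simp: contains_def)
      have f': "embeds f F (V, E)" using f RV by (auto simp: embeds_def Q_def)
      have "\<exists>e\<in>edges (V, E). f ` p \<subseteq> e" if p: "p \<in> uncovered_pairs F" for p
      proof -
        obtain x y where xy: "p = {x, y}" "x \<noteq> y" "x \<in> verts F" "y \<in> verts F"
          using p by (auto simp: uncovered_pairs_def card_2_iff)
        have "f x \<in> R" "f y \<in> R" using f xy by (auto simp: embeds_def Q_def)
        moreover have "f x \<noteq> f y" using f xy by (auto simp: embeds_def dest: inj_onD)
        ultimately show ?thesis using R_cov xy(1) by auto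
      qed
      then show False using cf f' unfolding core_free_def by blast
    qed
    have nS: "\<not> is_subconstruction r (complete_rgraph r l) Q"
    proof
      assume "is_subconstruction r (complete_rgraph r l) Q"
      then obtain G' where G': "is_construction r (complete_rgraph r l) G'" "subgraph Q G'"
        by (auto simp: is_subconstruction_def)
      obtain W where W: "finite (verts G')" "disjoint_family_on W (verts (complete_rgraph r l))"
        "verts G' = (\<Union>i\<in>verts (complete_rgraph r l). W i)"
        "edges G' = {e. e \<subseteq> verts G' \<and> card e = r \<and>
          {i \<in> verts (complete_rgraph r l). e \<inter> W i \<noteq> {}} \<in> edges (complete_rgraph r l)}"
        using G'(1) unfolding is_construction_def by blast
      have K: "rgraph r (complete_rgraph r l)" by (auto simp: rgraph_def complete_rgraph_def)
      have vK: "verts (complete_rgraph r l) = {1..l}" by (simp add: complete_rgraph_def)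
      note ed = construction_edges_eq[OF K W(2,3,1,4)]
      have "R \<subseteq> (\<Union>i\<in>{1..l}. W i)" using G'(2) W(3) by (simp add: subgraph_def Q_def vK)
      then have "\<forall>x\<in>R. \<exists>i. i \<in> {1..l} \<and> x \<in> W i" by blast
      then obtain h where h: "\<And>x. x \<in> R \<Longrightarrow> h x \<in> {1..l} \<and> x \<in> W (h x)" by metis
      have "\<not> inj_on h R"
      proof
        assume "inj_on h R"
        then have "card R \<le> card {1..l}" using h by (intro card_inj_on_le[of h]) auto
        then show False using False by simp
      qed
      then obtain x y where xy: "x \<in> R" "y \<in> R" "x \<noteq> y" "h x = h y" by (auto simp: inj_on_def)
      \<comment> \<open>Two of more than \<open>l\<close> representatives share a part. The edge
        covering them may leave \<open>R\<close>, but its image under \<open>rep\<close> lies in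
        \<open>Q\<close> and still contains both.\<close>
      obtain e where e: "e \<in> E" "x \<in> e" "y \<in> e" using R_cov xy by blast
      have "rep ` e \<in> edges Q" using edge_rep[OF e(1)] eE(1)[OF e(1)] by (auto simp: Q_def R_def)
      then have "rep ` e \<in> edges G'" using G'(2) by (auto simp: subgraph_def)
      then obtain q where q: "q \<in> edges (complete_rgraph r l)" "rep ` e \<in> transv W q" using ed by auto
      have "q \<subseteq> {1..l}" using q by (auto simp: complete_rgraph_def)
      then have "card (rep ` e \<inter> W (h x)) \<le> 1"
        using transvD(4)[OF q(2) W(2)[unfolded vK], of "h x"] h[OF xy(1)] finite_subset[of q "{1..l}"] by auto
      moreover have "{x, y} \<subseteq> rep ` e \<inter> W (h x)"
      proof -
        have "rep x \<in> rep ` e" "rep y \<in> rep ` e" using e by auto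
        then have "x \<in> rep ` e" "y \<in> rep ` e" unfolding repR[OF xy(1)] repR[OF xy(2)] .
        then show ?thesis using h[OF xy(1)] h[OF xy(2)] xy(4) by simp
      qed
      then have "card {x, y} \<le> card (rep ` e \<inter> W (h x))" using eE(3)[OF e(1)] by (intro card_mono) auto
      ultimately show False using xy(3) by simp
    qed
    have lag: "lagrangian r Q \<le> lam" by (rule lagrangian_le[OF Q nF nS])
    \<comment> \<open>The twin classes serve as the parts of the blow-up of \<open>Q\<close>; their
      sizes are the weights fed into \<open>lagrangian_ge\<close>.\<close>
    define C where "C q = {y \<in> V. rep y = q}" for q
    have dC: "disjoint_family_on C R" by (auto simp: disjoint_family_on_def C_def)
    have fC: "finite (C q)" for q using fV by (simp add: C_def)
    have UC: "(\<Union>q\<in>R. C q) = V" by (auto simp: C_def R_def)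
    have sumC: "(\<Sum>q\<in>verts Q. card (C q)) = card V"
      using dC fC fR unfolding UC[symmetric] by (subst card_UN_disjoint) (auto simp: disjoint_family_on_def Q_def)
    have "V \<noteq> {}" using False by (auto simp: R_def)
    then have "0 < card V" using fV by (simp add: card_gt_0_iff)
    have "E \<subseteq> (\<Union>q\<in>edges Q. transv C q)"
    proof
      fix e assume e: "e \<in> E"
      have "rep ` e \<in> edges Q" using edge_rep[OF e] eE(1)[OF e] by (auto simp: Q_def R_def)
      moreover have "e \<in> transv C (rep ` e)"
      proof (rule transvI)
        show "e \<subseteq> (\<Union>q\<in>rep ` e. C q)" using eE(1)[OF e] by (auto simp: C_def)
        fix q assume "q \<in> rep ` e"
        then obtain x where x: "x \<in> e" "q = rep x" by auto
        have "e \<inter> C q = {x}" using x edge_inj[OF e] eE(1)[OF e] by (auto simp: C_def dest: inj_onD)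
        then show "card (e \<inter> C q) = 1" by simp
      qed
      ultimately show "e \<in> (\<Union>q\<in>edges Q. transv C q)" by blast
    qed
    moreover have "finite (\<Union>q\<in>edges Q. transv C q)"
    proof (rule finite_subset)
      show "(\<Union>q\<in>edges Q. transv C q) \<subseteq> Pow V" using UC by (auto simp: transv_def PiE_iff Q_def)
    qed (use fV in simp)
    ultimately have "card E \<le> card (\<Union>q\<in>edges Q. transv C q)" by (rule card_mono[rotated])
    also have "\<dots> = (\<Sum>q\<in>edges Q. \<Prod>i\<in>q. card (C i))"
      by (rule card_UN_transv[OF dC fR fC]) (auto simp: Q_def)
    finally have "fact r * real (card E) \<le> fact r * real (\<Sum>q\<in>edges Q. \<Prod>i\<in>q. card (C i))"
      by (intro mult_left_mono of_nat_mono) auto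
    also have "\<dots> \<le> lagrangian r Q * real (card V) ^ r" by (rule lagrangian_ge[OF Q sumC \<open>0 < card V\<close>])
    also have "\<dots> \<le> lam * real (card V) ^ r" using lag by (intro mult_right_mono) auto
    finally show ?thesis by blast
  qed
qed

lemma partite_card_le_tau:
  assumes "disjoint_family_on P {..<l}" "(\<Union>i<l. P i) = V" "finite V" "E \<subseteq> cross P {..<l} r"
  shows "card E \<le> tau l r (card V)"
proof -
  have fP: "finite (P i)" if "i < l" for i using assms(2,3) that by (auto intro: finite_subset)
  have "card E \<le> card (cross P {..<l} r)" using fP assms(4) by (intro card_mono finite_cross) auto
  also have "\<dots> = esym {..<l} r (\<lambda>i. card (P i))" using fP assms(1) by (intro card_cross) auto
  also have "\<dots> \<le> tau l r (card V)"
    using assms(1) fP unfolding assms(2)[symmetric]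
    by (intro esym_le_tau l0 r2, subst card_UN_disjoint) (auto simp: disjoint_family_on_def)
  finally show ?thesis .
qed

lemma core_free_density:
  fixes V :: "nat set"
  assumes G: "rgraph r (V, E)" and cf: "core_free F (V, E)"
  shows "real (card E) \<le> max (real (tau l r (card V))) (lam / fact r * real (card V) ^ r)"
  using F G cf
proof (induction E rule: symmetrization_induct)
  case (symmetrized E)
  from symmetrized_structure[OF symmetrized] show ?case
  proof
    assume "\<exists>P. disjoint_family_on P {..<l} \<and> (\<Union>i<l. P i) = V \<and> E \<subseteq> cross P {..<l} r"
    then obtain P where "disjoint_family_on P {..<l}" "(\<Union>i<l. P i) = V" "E \<subseteq> cross P {..<l} r" by blast
    then have "card E \<le> tau l r (card V)"
      using symmetrized(1) by (intro partite_card_le_tau[of P]) (auto simp: rgraph_def)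
    then show ?thesis by simp
  next
    assume "fact r * real (card E) \<le> lam * real (card V) ^ r"
    then have "real (card E) \<le> lam / fact r * real (card V) ^ r" by (simp add: field_simps)
    then show ?thesis by simp
  qed
next
  case (clone E u v)
  then show ?case by linarith
qed

end

section \<open>Density and stability of hypergraphs without the expansion\<close>

lemma contains_mono: "contains (V', E') F \<Longrightarrow> V' \<subseteq> V \<Longrightarrow> E' \<subseteq> E \<Longrightarrow> contains (V, E) F"
  unfolding contains_def embeds_def by auto blast

text \<open>Second-order counterpart of the Bernoulli inequality, for the density left after
  deleting a fraction \<open>y\<close> of the vertices.\<close>

lemma one_minus_power_le:
  fixes y :: real
  assumes "0 \<le> y" "y \<le> 1"
  shows "(1 - y) ^ k \<le> 1 - real k * y + (real k)\<^sup>2 * y\<^sup>2"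
proof (induction k)
  case (Suc k)
  have "(1 - y) ^ Suc k \<le> (1 - y) * (1 - real k * y + (real k)\<^sup>2 * y\<^sup>2)"
    using Suc assms by (simp add: mult_left_mono)
  also have "\<dots> = 1 - real (Suc k) * y + (real k + (real k)\<^sup>2) * y\<^sup>2 - (real k)\<^sup>2 * y ^ 3"
    by (simp add: algebra_simps power2_eq_square power3_eq_cube)
  also have "\<dots> \<le> 1 - real (Suc k) * y + (real (Suc k))\<^sup>2 * y\<^sup>2"
  proof -
    have "(real k + (real k)\<^sup>2) * y\<^sup>2 \<le> (real (Suc k))\<^sup>2 * y\<^sup>2"
      by (intro mult_right_mono) (auto simp: power2_eq_square algebra_simps)
    moreover have "0 \<le> (real k)\<^sup>2 * y ^ 3" using assms by simp
    ultimately show ?thesis by linarith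
  qed
  finally show ?case .
qed simp

lemma card_edges_meeting_le:
  assumes "finite E" "finite Z"
  shows "card {e \<in> E. e \<inter> Z \<noteq> {}} \<le> (\<Sum>v\<in>Z. degree E v)"
proof -
  have "{e \<in> E. e \<inter> Z \<noteq> {}} \<subseteq> (\<Union>v\<in>Z. {e \<in> E. v \<in> e})" by auto
  then have "card {e \<in> E. e \<inter> Z \<noteq> {}} \<le> card (\<Union>v\<in>Z. {e \<in> E. v \<in> e})"
    by (rule card_mono[rotated]) (use assms in auto)
  also have "\<dots> \<le> (\<Sum>v\<in>Z. card {e \<in> E. v \<in> e})" by (rule card_UN_le[OF assms(2)])
  finally show ?thesis by (simp add: degree_def)
qed

lemma card_edges_split:
  assumes "finite E"
  shows "card E = card {e \<in> E. e \<inter> Z = {}} + card {e \<in> E. e \<inter> Z \<noteq> {}}"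
proof -
  have "E = {e \<in> E. e \<inter> Z = {}} \<union> {e \<in> E. e \<inter> Z \<noteq> {}}" by auto
  then show ?thesis
    using card_Un_disjoint[of "{e \<in> E. e \<inter> Z = {}}" "{e \<in> E. e \<inter> Z \<noteq> {}}"] assms by auto
qed

lemma degree_le_pow:
  assumes "rgraph r (V, E)" "1 \<le> r"
  shows "degree E v \<le> card V ^ (r - 1)"
proof (cases "v \<in> V")
  case True
  have V: "finite V" using assms by (simp add: rgraph_def)
  have "degree E v \<le> card {e. {v} \<subseteq> e \<and> e \<subseteq> V \<and> card e = r}"
    unfolding degree_def by (rule card_mono) (use assms V in \<open>auto simp: rgraph_def\<close>)
  also have "\<dots> \<le> card V ^ (r - card {v})" using True V assms by (intro card_supersets_le) auto
  finally show ?thesis by simp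
next
  case False
  then have "{e \<in> E. v \<in> e} = {}" using assms by (auto simp: rgraph_def)
  then show ?thesis unfolding degree_def by (metis card.empty zero_le)
qed

lemma rgraph_finite_edges: "rgraph r (V, E) \<Longrightarrow> finite E"
  by (rule finite_subset[of _ "Pow V"]) (auto simp: rgraph_def)

lemma cross_of_types:
  assumes e: "e \<subseteq> V" "finite e" "card e = k" and t: "\<And>x. x \<in> e \<Longrightarrow> t x < l"
    "\<And>x y. x \<in> e \<Longrightarrow> y \<in> e \<Longrightarrow> x \<noteq> y \<Longrightarrow> t x \<noteq> t y"
  shows "e \<in> cross (\<lambda>i. {x \<in> V. t x = i}) {..<l} k"
proof -
  have "card (e \<inter> {x \<in> V. t x = i}) \<le> 1" for i
    using e(2) t(2) by (auto simp: card_le_Suc0_iff_eq)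
  then show ?thesis using e t(1) by (auto simp: cross_def)
qed

context expansion_family
begin

text \<open>Only \<open>O(n^(r-1))\<close> edges contain a light pair, and the rest is core-free. As
  \<open>lam / fact r < alpha\<close>, the Turan term dominates in
  \<open>core_free_density\<close>.\<close>

lemma free_density:
  assumes e: "0 < \<epsilon>"
  shows "\<exists>N. \<forall>(V :: nat set) E. rgraph r (V, E) \<longrightarrow> \<not> contains (V, E) H \<longrightarrow> N \<le> card V \<longrightarrow>
    real (card E) \<le> (alpha l r + \<epsilon>) * real (card V) ^ r"
proof -
  have e2: "0 < \<epsilon> / 2" using e by simp
  obtain N1 where N1: "\<And>n. n \<ge> N1 \<Longrightarrow> real (tau l r n) \<le> (alpha l r + \<epsilon> / 2) * real n ^ r"
    using tau_asymp[OF l0(1) e2, of r] by blast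
  show ?thesis
  proof (rule exI[of _ "max N1 (nat \<lceil>2 * real m / \<epsilon>\<rceil>)"], intro allI impI)
    fix V :: "nat set" and E assume G: "rgraph r (V, E)" and free: "\<not> contains (V, E) H"
      and n: "max N1 (nat \<lceil>2 * real m / \<epsilon>\<rceil>) \<le> card V"
    let ?n = "card V"
    have mn: "real m \<le> \<epsilon> / 2 * real ?n"
    proof -
      have "2 * real m / \<epsilon> \<le> real ?n" using n by linarith
      then show ?thesis using e by (simp add: field_simps)
    qed
    have cf: "core_free F (V, heavy_edges m E)" by (rule core_free_heavy_edges[OF G F r2 order_refl free])
    have G': "rgraph r (V, heavy_edges m E)" using G by (auto simp: rgraph_def heavy_edges_def)
    have "lam / fact r < alpha l r" using lam by (simp add: field_simps)
    then have "lam / fact r * real ?n ^ r \<le> (alpha l r + \<epsilon> / 2) * real ?n ^ r"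
      using e by (intro mult_right_mono) auto
    then have 1: "real (card (heavy_edges m E)) \<le> (alpha l r + \<epsilon> / 2) * real ?n ^ r"
      using core_free_density[OF G' cf] N1[of ?n] n by linarith
    have "real (card (E - heavy_edges m E)) \<le> real (m * ?n ^ (r - 1))"
      using card_light_edges[OF G r2] by (rule of_nat_mono)
    also have "\<dots> = real m * real ?n ^ (r - 1)" by simp
    also have "\<dots> \<le> (\<epsilon> / 2 * real ?n) * real ?n ^ (r - 1)" using mn by (rule mult_right_mono) simp
    also have "\<dots> = \<epsilon> / 2 * real ?n ^ Suc (r - 1)" by simp
    also have "Suc (r - 1) = r" using r2 by simp
    finally have 2: "real (card (E - heavy_edges m E)) \<le> \<epsilon> / 2 * real ?n ^ r" .
    have "E \<subseteq> heavy_edges m E \<union> (E - heavy_edges m E)" by auto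
    then have "card E \<le> card (heavy_edges m E \<union> (E - heavy_edges m E))"
      using rgraph_finite_edges[OF G] rgraph_finite_edges[OF G'] by (intro card_mono) auto
    also have "\<dots> \<le> card (heavy_edges m E) + card (E - heavy_edges m E)" by (rule card_Un_le)
    finally have "real (card E) \<le> real (card (heavy_edges m E)) + real (card (E - heavy_edges m E))" by linarith
    then show "real (card E) \<le> (alpha l r + \<epsilon>) * real ?n ^ r" using 1 2 by (simp add: algebra_simps)
  qed
qed

text \<open>Deleting a fraction \<open>y\<close> of low-degree vertices would leave a free
  hypergraph that is too dense: because \<open>beta = r * alpha\<close> the linear terms cancel, and
  the surplus \<open>y * c\<close> beats the quadratic error.\<close>

lemma few_low_degree_vertices:
  assumes c: "0 < c" and d: "0 < d"
  shows "\<exists>\<epsilon>>0. \<exists>N. \<forall>(V :: nat set) E. rgraph r (V, E) \<longrightarrow> \<not> contains (V, E) H \<longrightarrow> N \<le> card V \<longrightarrow>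
    (alpha l r - \<epsilon>) * real (card V) ^ r \<le> real (card E) \<longrightarrow>
    real (card {v \<in> V. real (degree E v) < (beta l r - c) * real (card V) ^ (r - 1)}) \<le> d * real (card V)"
proof -
  let ?\<alpha> = "alpha l r"
  have a: "0 < ?\<alpha>" using alpha_pos[OF rl] l0 by simp
  have ab: "beta l r = real r * ?\<alpha>" by (rule beta_eq_alpha[OF r2 rl])
  \<comment> \<open>The bound \<open>1 / 4\<close> keeps at least half of the vertices; the last
    entry keeps the quadratic error below \<open>y * c / 4\<close> for
    \<open>y \<le> 2 * d'\<close>.\<close>
  define d' where "d' = Min {d, 1 / 4, c / (8 * ?\<alpha> * (real r)\<^sup>2)}"
  have "0 < c / (8 * ?\<alpha> * (real r)\<^sup>2)" using a c r2 by simp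
  then have d': "0 < d'" "d' \<le> d" "d' \<le> 1 / 4" "d' \<le> c / (8 * ?\<alpha> * (real r)\<^sup>2)" using d by (auto simp: d'_def)
  define \<epsilon> where "\<epsilon> = d' * c / 8"
  have \<epsilon>: "0 < \<epsilon>" using d' c by (simp add: \<epsilon>_def)
  obtain N0 where N0: "\<And>(V :: nat set) E. rgraph r (V, E) \<Longrightarrow> \<not> contains (V, E) H \<Longrightarrow> N0 \<le> card V \<Longrightarrow>
    real (card E) \<le> (?\<alpha> + \<epsilon>) * real (card V) ^ r" using free_density[OF \<epsilon>] by blast
  show ?thesis
  proof (rule exI[of _ \<epsilon>], intro conjI \<epsilon>, rule exI[of _ "max (2 * N0) (nat \<lceil>1 / d'\<rceil>)"], intro allI impI, rule ccontr)
    fix V :: "nat set" and E assume G: "rgraph r (V, E)" and free: "\<not> contains (V, E) H"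
      and n: "max (2 * N0) (nat \<lceil>1 / d'\<rceil>) \<le> card V" and E: "(?\<alpha> - \<epsilon>) * real (card V) ^ r \<le> real (card E)"
      and big: "\<not> real (card {v \<in> V. real (degree E v) < (beta l r - c) * real (card V) ^ (r - 1)}) \<le> d * real (card V)"
    let ?n = "card V" and ?Z = "{v \<in> V. real (degree E v) < (beta l r - c) * real (card V) ^ (r - 1)}"
    have fV: "finite V" using G by (simp add: rgraph_def)
    have fE: "finite E" by (rule rgraph_finite_edges[OF G])
    have dn: "1 \<le> d' * real ?n"
    proof -
      have "1 / d' \<le> real ?n" using n by linarith
      then show ?thesis using d'(1) by (simp add: field_simps)
    qed
    have n0: "0 < real ?n" using dn d'(1) by (cases "?n = 0") auto
    \<comment> \<open>Only about \<open>d' * n\<close> of the low-degree vertices are deleted, since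
      for a larger fraction the quadratic term could win.\<close>
    define z where "z = nat \<lceil>d' * real ?n\<rceil>"
    have z: "d' * real ?n \<le> real z" "real z \<le> 2 * d' * real ?n" unfolding z_def using dn by linarith+
    have "d' * real ?n \<le> d * real ?n" using d'(2) by (rule mult_right_mono) simp
    then have "z \<le> card ?Z" using big unfolding z_def by linarith
    then obtain Z where Z: "Z \<subseteq> ?Z" "card Z = z" by (meson obtain_subset_with_card_n)
    have fZ: "finite Z" using Z(1) fV by (auto intro: finite_subset)
    define y where "y = real z / real ?n"
    have y: "d' \<le> y" "y \<le> 2 * d'" using z n0 by (simp_all add: y_def field_simps)
    have zy: "real z = y * real ?n" using n0 by (simp add: y_def)
    define V' E' where "V' = V - Z" and "E' = {e \<in> E. e \<inter> Z = {}}"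
    have cV': "card V' = ?n - z" unfolding V'_def using Z fZ by (subst card_Diff_subset) auto
    have zn: "2 * z \<le> ?n"
    proof -
      have "2 * d' * real ?n \<le> 1 / 2 * real ?n" using d'(3) by (intro mult_right_mono) auto
      then show ?thesis using z(2) by linarith
    qed
    have rV': "real (card V') = (1 - y) * real ?n" using cV' zn zy by (simp add: of_nat_diff algebra_simps)
    have G': "rgraph r (V', E')" using G by (auto simp: rgraph_def V'_def E'_def)
    have free': "\<not> contains (V', E') H" using free contains_mono[of V' E' H V E] by (auto simp: V'_def E'_def)
    have "2 * N0 \<le> ?n" using n by simp
    then have "N0 \<le> card V'" using cV' zn by linarith
    then have up: "real (card E') \<le> (?\<alpha> + \<epsilon>) * ((1 - y) * real ?n) ^ r" using N0[OF G' free'] rV' by simp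
    have np: "real ?n * real ?n ^ (r - 1) = real ?n ^ r" using r2 by (cases r) auto
    have "card E \<le> card E' + (\<Sum>v\<in>Z. degree E v)"
      using card_edges_split[OF fE, of Z] card_edges_meeting_le[OF fE fZ] by (simp add: E'_def)
    then have "real (card E) \<le> real (card E' + (\<Sum>v\<in>Z. degree E v))" by (rule of_nat_mono)
    also have "\<dots> = real (card E') + (\<Sum>v\<in>Z. real (degree E v))" by simp
    also have "(\<Sum>v\<in>Z. real (degree E v)) \<le> (\<Sum>v\<in>Z. (beta l r - c) * real ?n ^ (r - 1))"
      by (rule sum_mono) (use Z(1) in \<open>auto intro: less_imp_le\<close>)
    also have "\<dots> = y * (beta l r - c) * (real ?n * real ?n ^ (r - 1))" using Z(2) zy by simp
    also have "\<dots> = y * (beta l r - c) * real ?n ^ r" unfolding np ..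
    finally have "(?\<alpha> - \<epsilon>) * real ?n ^ r \<le> (?\<alpha> + \<epsilon>) * (1 - y) ^ r * real ?n ^ r + y * (beta l r - c) * real ?n ^ r"
      using E up by (simp add: power_mult_distrib mult.assoc)
    then have "(?\<alpha> - \<epsilon>) * real ?n ^ r \<le> ((?\<alpha> + \<epsilon>) * (1 - y) ^ r + y * (beta l r - c)) * real ?n ^ r"
      by (simp only: distrib_right)
    then have 1: "?\<alpha> - \<epsilon> \<le> (?\<alpha> + \<epsilon>) * (1 - y) ^ r + y * (beta l r - c)" using n0 by simp
    have y1: "0 \<le> y" "y \<le> 1" "0 < y" using y d' by linarith+
    have "(?\<alpha> + \<epsilon>) * (1 - y) ^ r = ?\<alpha> * (1 - y) ^ r + \<epsilon> * (1 - y) ^ r" by (simp add: algebra_simps)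
    also have "\<epsilon> * (1 - y) ^ r \<le> \<epsilon> * 1" using \<epsilon> y1 by (intro mult_left_mono power_le_one) auto
    also have "?\<alpha> * (1 - y) ^ r \<le> ?\<alpha> * (1 - real r * y + (real r)\<^sup>2 * y\<^sup>2)"
      using a y1 by (intro mult_left_mono one_minus_power_le) auto
    finally have "(?\<alpha> + \<epsilon>) * (1 - y) ^ r \<le> ?\<alpha> * (1 - real r * y + (real r)\<^sup>2 * y\<^sup>2) + \<epsilon>" by simp
    \<comment> \<open>Substituting \<open>beta = r * alpha\<close> cancels \<open>alpha\<close> and
      the terms linear in \<open>y\<close> except \<open>y * c\<close>.\<close>
    then have 2: "y * c \<le> 2 * \<epsilon> + ?\<alpha> * (real r)\<^sup>2 * y * y" using 1 unfolding ab by (simp add: algebra_simps power2_eq_square)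
    have "?\<alpha> * (real r)\<^sup>2 * y \<le> c / 4"
    proof -
      have "8 * ?\<alpha> * (real r)\<^sup>2 * d' \<le> c" using d'(4) a r2 by (simp add: field_simps)
      moreover have "?\<alpha> * (real r)\<^sup>2 * y \<le> ?\<alpha> * (real r)\<^sup>2 * (2 * d')" using y(2) a by (intro mult_left_mono) auto
      ultimately show ?thesis by linarith
    qed
    then have "?\<alpha> * (real r)\<^sup>2 * y * y \<le> c / 4 * y" using y1 by (intro mult_right_mono) auto
    also have "\<dots> = y * c / 4" by simp
    finally have "?\<alpha> * (real r)\<^sup>2 * y * y \<le> y * c / 4" .
    moreover have "2 * \<epsilon> \<le> y * c / 4" unfolding \<epsilon>_def using y(1) c by simp
    moreover have "0 < y * c" using y1 c by simp
    ultimately show False using 2 by linarith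
  qed
qed

lemma core_free_imp_free: "core_free F (V, E) \<Longrightarrow> \<not> contains (V, E) H"
  using core_of_expansion by blast

text \<open>Going back from a clone loses at most \<open>n^(r-1)\<close> crossing edges, which still
  permits the classification. Since all but few vertices have large degree, the types define a new
  partition for the original with the original error, so nothing accumulates.\<close>

lemma core_free_stability:
  assumes e0: "0 < \<epsilon>0"
  shows "\<exists>\<epsilon>>0. \<exists>N. \<forall>(V :: nat set) E. rgraph r (V, E) \<longrightarrow> core_free F (V, E) \<longrightarrow> N \<le> card V \<longrightarrow>
    (alpha l r - \<epsilon>) * real (card V) ^ r \<le> real (card E) \<longrightarrow>
    (\<exists>P. disjoint_family_on P {..<l} \<and> (\<Union>i<l. P i) = V \<and>
      (alpha l r - \<epsilon>0) * real (card V) ^ r \<le> real (card (E \<inter> cross P {..<l} r)))"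
proof -
  let ?\<alpha> = "alpha l r"
  obtain \<epsilon>c Nc where ec: "0 < \<epsilon>c" and cl: "\<And>(V :: nat set) E P. rgraph r (V, E) \<Longrightarrow> \<not> contains (V, E) H \<Longrightarrow>
    disjoint_family_on P {..<l} \<Longrightarrow> (\<Union>i<l. P i) = V \<Longrightarrow> Nc \<le> card V \<Longrightarrow>
    (?\<alpha> - \<epsilon>c) * real (card V) ^ r \<le> real (card (E \<inter> cross P {..<l} r)) \<Longrightarrow>
    (\<exists>\<tau>. \<forall>e\<in>E. \<forall>x\<in>e. \<forall>y\<in>e. (beta l r - \<epsilon>c) * real (card V) ^ (r - 1) \<le> real (degree E x) \<longrightarrow>
      (beta l r - \<epsilon>c) * real (card V) ^ (r - 1) \<le> real (degree E y) \<longrightarrow> \<tau> x < l \<and> (x \<noteq> y \<longrightarrow> \<tau> x \<noteq> \<tau> y))"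
    using classification[OF zero_less_one, where 'v = nat] by - (elim exE conjE, rule that, assumption, (drule spec)+, (drule mp, assumption)+, erule conjunct2)
  define \<epsilon>1 where "\<epsilon>1 = min \<epsilon>0 \<epsilon>c"
  have e1: "0 < \<epsilon>1" "\<epsilon>1 \<le> \<epsilon>0" "\<epsilon>1 \<le> \<epsilon>c" using e0 ec by (auto simp: \<epsilon>1_def)
  have e14: "0 < \<epsilon>1 / 4" using e1 by simp
  obtain \<epsilon>3 N3 where e3: "0 < \<epsilon>3" and low: "\<And>(V :: nat set) E. rgraph r (V, E) \<Longrightarrow> \<not> contains (V, E) H \<Longrightarrow> N3 \<le> card V \<Longrightarrow>
    (?\<alpha> - \<epsilon>3) * real (card V) ^ r \<le> real (card E) \<Longrightarrow>
    real (card {v \<in> V. real (degree E v) < (beta l r - \<epsilon>c) * real (card V) ^ (r - 1)}) \<le> \<epsilon>1 / 4 * real (card V)"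
    using few_low_degree_vertices[OF ec e14] by - (elim exE conjE, rule that, assumption, (drule spec)+, (drule mp, assumption)+, assumption)
  define q where "q = lam / fact r"
  have gap: "0 < ?\<alpha> - q" using lam by (simp add: q_def field_simps)
  \<comment> \<open>The bounds serve the count of low-degree vertices, the restored error of the new
    partition, and the exclusion of the Lagrangian alternative for symmetrized hypergraphs.\<close>
  define \<epsilon> where "\<epsilon> = Min {\<epsilon>3, \<epsilon>1 / 4, (?\<alpha> - q) / 2}"
  have \<epsilon>: "0 < \<epsilon>" "\<epsilon> \<le> \<epsilon>3" "\<epsilon> \<le> \<epsilon>1 / 4" "\<epsilon> \<le> (?\<alpha> - q) / 2"
  proof -
    show "0 < \<epsilon>" unfolding \<epsilon>_def using e3 e14 gap by (subst Min_gr_iff) auto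
    show "\<epsilon> \<le> \<epsilon>3" "\<epsilon> \<le> \<epsilon>1 / 4" "\<epsilon> \<le> (?\<alpha> - q) / 2"
      unfolding \<epsilon>_def by (rule Min_le; simp)+
  qed
  define N where "N = Max {Nc, N3, 1, nat \<lceil>2 / \<epsilon>1\<rceil>}"
  show ?thesis
  proof (rule exI[of _ \<epsilon>], intro conjI \<epsilon>(1), rule exI[of _ N], intro allI impI)
    fix V :: "nat set" and E assume G: "rgraph r (V, E)" and cf: "core_free F (V, E)"
      and nN: "N \<le> card V" and E: "(?\<alpha> - \<epsilon>) * real (card V) ^ r \<le> real (card E)"
    let ?n = "card V"
    have nn: "Nc \<le> ?n" "N3 \<le> ?n" "1 \<le> ?n" "nat \<lceil>2 / \<epsilon>1\<rceil> \<le> ?n" using nN by (auto simp: N_def)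
    have n0: "0 < real ?n" using nn(3) by simp
    have np: "real ?n * real ?n ^ (r - 1) = real ?n ^ r" using r2 by (cases r) auto
    have small: "real ?n ^ (r - 1) \<le> \<epsilon>1 / 2 * real ?n ^ r"
    proof -
      have "2 / \<epsilon>1 \<le> real ?n" using nn(4) by linarith
      then have "1 \<le> \<epsilon>1 / 2 * real ?n" using e1(1) by (simp add: field_simps)
      then have "1 * real ?n ^ (r - 1) \<le> (\<epsilon>1 / 2 * real ?n) * real ?n ^ (r - 1)" by (rule mult_right_mono) simp
      then show ?thesis using np by (simp add: mult.assoc)
    qed
    \<comment> \<open>The invariant has error \<open>\<epsilon>1 / 2\<close>: undoing a cloning
      worsens it to \<open>\<epsilon>1\<close>, still within \<open>\<epsilon>c\<close>, and
      re-sorting by types brings it back.\<close>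
    have "(?\<alpha> - \<epsilon>) * real ?n ^ r \<le> real (card E) \<longrightarrow>
      (\<exists>P. disjoint_family_on P {..<l} \<and> (\<Union>i<l. P i) = V \<and>
        (?\<alpha> - \<epsilon>1 / 2) * real ?n ^ r \<le> real (card (E \<inter> cross P {..<l} r)))"
      using F G cf
    proof (induction E rule: symmetrization_induct)
      case (symmetrized E)
      show ?case
      proof
        assume E: "(?\<alpha> - \<epsilon>) * real ?n ^ r \<le> real (card E)"
        have "\<not> fact r * real (card E) \<le> lam * real ?n ^ r"
        proof
          assume "fact r * real (card E) \<le> lam * real ?n ^ r"
          then have "real (card E) \<le> q * real ?n ^ r" by (simp add: q_def field_simps)
          then have "(?\<alpha> - \<epsilon>) * real ?n ^ r \<le> q * real ?n ^ r" using E by linarith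
          moreover have "0 < real ?n ^ r" using n0 by simp
          ultimately have "?\<alpha> - \<epsilon> \<le> q" by (simp only: mult_le_cancel_right_pos)
          moreover have "2 * \<epsilon> \<le> ?\<alpha> - q" using \<epsilon>(4) by simp
          ultimately show False using gap by linarith
        qed
        then obtain P where P: "disjoint_family_on P {..<l}" "(\<Union>i<l. P i) = V" "E \<subseteq> cross P {..<l} r"
          using symmetrized_structure[OF symmetrized] by blast
        then have "E \<inter> cross P {..<l} r = E" by auto
        moreover have "(?\<alpha> - \<epsilon>1 / 2) * real ?n ^ r \<le> (?\<alpha> - \<epsilon>) * real ?n ^ r"
          using \<epsilon>(3) e1(1) by (intro mult_right_mono) auto
        ultimately show "\<exists>P. disjoint_family_on P {..<l} \<and> (\<Union>i<l. P i) = V \<and>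
          (?\<alpha> - \<epsilon>1 / 2) * real ?n ^ r \<le> real (card (E \<inter> cross P {..<l} r))"
          using P E by (intro exI[of _ P]) auto
      qed
    next
      case (clone E u v)
      show ?case
      proof
        assume E: "(?\<alpha> - \<epsilon>) * real ?n ^ r \<le> real (card E)"
        let ?E = "clone E u v"
        have fE: "finite E" "finite ?E" using clone(1,7) by (auto intro: rgraph_finite_edges)
        have "(?\<alpha> - \<epsilon>) * real ?n ^ r \<le> real (card ?E)" using E clone(9) by linarith
        then obtain P where P: "disjoint_family_on P {..<l}" "(\<Union>i<l. P i) = V"
          "(?\<alpha> - \<epsilon>1 / 2) * real ?n ^ r \<le> real (card (?E \<inter> cross P {..<l} r))" using clone(10) by blast
        \<comment> \<open>The clone adds edges only at \<open>v\<close>, so at most one full degree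
          of crossing edges is lost.\<close>
        have "?E \<inter> cross P {..<l} r \<subseteq> (E \<inter> cross P {..<l} r) \<union> {e \<in> ?E. v \<in> e}" by (auto simp: clone_def)
        then have "card (?E \<inter> cross P {..<l} r) \<le> card ((E \<inter> cross P {..<l} r) \<union> {e \<in> ?E. v \<in> e})"
          using fE by (intro card_mono) auto
        also have "\<dots> \<le> card (E \<inter> cross P {..<l} r) + degree ?E v" unfolding degree_def by (rule card_Un_le)
        also have "degree ?E v \<le> ?n ^ (r - 1)" using r2 by (intro degree_le_pow[OF clone(7)]) simp
        finally have "real (card (?E \<inter> cross P {..<l} r)) \<le> real (card (E \<inter> cross P {..<l} r) + ?n ^ (r - 1))"
          by (simp only: of_nat_le_iff add_le_cancel_left)
        then have "(?\<alpha> - \<epsilon>1 / 2) * real ?n ^ r \<le> real (card (E \<inter> cross P {..<l} r)) + \<epsilon>1 / 2 * real ?n ^ r"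
          using P(3) small by simp
        then have "(?\<alpha> - \<epsilon>1) * real ?n ^ r \<le> real (card (E \<inter> cross P {..<l} r))" by (simp add: algebra_simps)
        moreover have "(?\<alpha> - \<epsilon>c) * real ?n ^ r \<le> (?\<alpha> - \<epsilon>1) * real ?n ^ r" using e1(3) by (intro mult_right_mono) auto
        ultimately have "(?\<alpha> - \<epsilon>c) * real ?n ^ r \<le> real (card (E \<inter> cross P {..<l} r))" by linarith
        from cl[OF clone(1) core_free_imp_free[OF clone(2)] P(1,2) nn(1) this]
        obtain \<tau> where \<tau>: "\<And>e x y. e \<in> E \<Longrightarrow> x \<in> e \<Longrightarrow> y \<in> e \<Longrightarrow> (beta l r - \<epsilon>c) * real ?n ^ (r - 1) \<le> real (degree E x) \<Longrightarrow>
            (beta l r - \<epsilon>c) * real ?n ^ (r - 1) \<le> real (degree E y) \<Longrightarrow> \<tau> x < l \<and> (x \<noteq> y \<longrightarrow> \<tau> x \<noteq> \<tau> y)" by blast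
        define Z where "Z = {v \<in> V. real (degree E v) < (beta l r - \<epsilon>c) * real ?n ^ (r - 1)}"
        have ZV: "Z \<subseteq> V" "finite Z" using clone(1) by (auto simp: Z_def rgraph_def)
        have "(?\<alpha> - \<epsilon>3) * real ?n ^ r \<le> (?\<alpha> - \<epsilon>) * real ?n ^ r" using \<epsilon>(2) by (intro mult_right_mono) auto
        then have cZ: "real (card Z) \<le> \<epsilon>1 / 4 * real ?n"
          unfolding Z_def using low[OF clone(1) core_free_imp_free[OF clone(2)] nn(2)] E by linarith
        \<comment> \<open>Vertices without a valid type get the default 0, so that the parts cover
          \<open>V\<close>. Edges avoiding \<open>Z\<close> contain only vertices with a valid
          type.\<close>
        define t where "t x = (if \<tau> x < l then \<tau> x else 0)" for x
        let ?P = "\<lambda>i. {x \<in> V. t x = i}"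
        have "{e \<in> E. e \<inter> Z = {}} \<subseteq> E \<inter> cross ?P {..<l} r"
        proof
          fix e assume e: "e \<in> {e \<in> E. e \<inter> Z = {}}"
          have eV: "e \<subseteq> V" "card e = r" "finite e" using e clone(1) by (auto simp: rgraph_def intro: finite_subset)
          have hi: "(beta l r - \<epsilon>c) * real ?n ^ (r - 1) \<le> real (degree E x)" if "x \<in> e" for x
            using that e eV(1) unfolding Z_def by force
          have "\<tau> x < l \<and> (x \<noteq> y \<longrightarrow> \<tau> x \<noteq> \<tau> y)" if "x \<in> e" "y \<in> e" for x y
            using \<tau>[of e x y] hi that e by blast
          then have "e \<in> cross ?P {..<l} r"
            using l0(1) by (intro cross_of_types[OF eV(1,3,2)]) (auto simp: t_def)
          then show "e \<in> E \<inter> cross ?P {..<l} r" using e by simp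
        qed
        then have "card {e \<in> E. e \<inter> Z = {}} \<le> card (E \<inter> cross ?P {..<l} r)" using fE by (intro card_mono) auto
        moreover have "card {e \<in> E. e \<inter> Z \<noteq> {}} \<le> card Z * ?n ^ (r - 1)"
        proof -
          have "(\<Sum>v\<in>Z. degree E v) \<le> (\<Sum>v\<in>Z. ?n ^ (r - 1))"
            using r2 by (intro sum_mono degree_le_pow[OF clone(1)]) simp
          then show ?thesis using card_edges_meeting_le[OF fE(1) ZV(2)] by simp
        qed
        ultimately have "card E \<le> card (E \<inter> cross ?P {..<l} r) + card Z * ?n ^ (r - 1)"
          using card_edges_split[OF fE(1), of Z] by linarith
        then have "real (card E) \<le> real (card (E \<inter> cross ?P {..<l} r) + card Z * ?n ^ (r - 1))" by (rule of_nat_mono)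
        then have "real (card E) \<le> real (card (E \<inter> cross ?P {..<l} r)) + real (card Z) * real ?n ^ (r - 1)" by simp
        moreover have "real (card Z) * real ?n ^ (r - 1) \<le> (\<epsilon>1 / 4 * real ?n) * real ?n ^ (r - 1)"
          using cZ by (rule mult_right_mono) simp
        moreover have "(\<epsilon>1 / 4 * real ?n) * real ?n ^ (r - 1) = \<epsilon>1 / 4 * real ?n ^ r" using np by (simp add: mult.assoc)
        ultimately have "(?\<alpha> - \<epsilon>) * real ?n ^ r \<le> real (card (E \<inter> cross ?P {..<l} r)) + \<epsilon>1 / 4 * real ?n ^ r"
          using E by linarith
        moreover have "(?\<alpha> - \<epsilon>1 / 4) * real ?n ^ r \<le> (?\<alpha> - \<epsilon>) * real ?n ^ r" using \<epsilon>(3) by (intro mult_right_mono) auto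
        ultimately have "(?\<alpha> - \<epsilon>1 / 2) * real ?n ^ r \<le> real (card (E \<inter> cross ?P {..<l} r))" by (simp add: algebra_simps)
        moreover have "disjoint_family_on ?P {..<l}" by (auto simp: disjoint_family_on_def)
        moreover have "(\<Union>i<l. ?P i) = V" using l0(1) by (auto simp: t_def)
        ultimately show "\<exists>P. disjoint_family_on P {..<l} \<and> (\<Union>i<l. P i) = V \<and>
          (?\<alpha> - \<epsilon>1 / 2) * real ?n ^ r \<le> real (card (E \<inter> cross P {..<l} r))" by (intro exI[of _ ?P]) auto
      qed
    qed
    then obtain P where "disjoint_family_on P {..<l}" "(\<Union>i<l. P i) = V"
      "(?\<alpha> - \<epsilon>1 / 2) * real ?n ^ r \<le> real (card (E \<inter> cross P {..<l} r))" using E by blast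
    moreover have "(?\<alpha> - \<epsilon>0) * real ?n ^ r \<le> (?\<alpha> - \<epsilon>1 / 2) * real ?n ^ r" using e1 by (intro mult_right_mono) auto
    ultimately show "\<exists>P. disjoint_family_on P {..<l} \<and> (\<Union>i<l. P i) = V \<and>
      (?\<alpha> - \<epsilon>0) * real ?n ^ r \<le> real (card (E \<inter> cross P {..<l} r))" by (intro exI[of _ P]) auto
  qed
qed

text \<open>Stability is applied to the core-free subhypergraph of heavy edges, and the partition
  obtained is then used to classify the vertices with respect to all of \<open>E\<close>.\<close>

lemma free_classification:
  assumes \<eta>: "0 < \<eta>"
  shows "\<exists>\<epsilon>>0. \<exists>N. \<forall>(V :: nat set) E. rgraph r (V, E) \<longrightarrow> \<not> contains (V, E) H \<longrightarrow> N \<le> card V \<longrightarrow>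
    (alpha l r - \<epsilon>) * real (card V) ^ r \<le> real (card E) \<longrightarrow>
    (\<forall>v. real (degree E v) \<le> (beta l r + \<eta>) * real (card V) ^ (r - 1)) \<and>
    (\<exists>\<tau>. \<forall>e\<in>E. \<forall>x\<in>e. \<forall>y\<in>e. (beta l r - \<epsilon>) * real (card V) ^ (r - 1) \<le> real (degree E x) \<longrightarrow>
      (beta l r - \<epsilon>) * real (card V) ^ (r - 1) \<le> real (degree E y) \<longrightarrow> \<tau> x < l \<and> (x \<noteq> y \<longrightarrow> \<tau> x \<noteq> \<tau> y))"
proof -
  let ?\<alpha> = "alpha l r"
  obtain \<epsilon>c Nc where ec: "0 < \<epsilon>c" and cl: "\<And>(V :: nat set) E P. rgraph r (V, E) \<Longrightarrow> \<not> contains (V, E) H \<Longrightarrow>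
    disjoint_family_on P {..<l} \<Longrightarrow> (\<Union>i<l. P i) = V \<Longrightarrow> Nc \<le> card V \<Longrightarrow>
    (?\<alpha> - \<epsilon>c) * real (card V) ^ r \<le> real (card (E \<inter> cross P {..<l} r)) \<Longrightarrow>
    (\<forall>v. real (degree E v) \<le> (beta l r + \<eta>) * real (card V) ^ (r - 1)) \<and>
    (\<exists>\<tau>. \<forall>e\<in>E. \<forall>x\<in>e. \<forall>y\<in>e. (beta l r - \<epsilon>c) * real (card V) ^ (r - 1) \<le> real (degree E x) \<longrightarrow>
      (beta l r - \<epsilon>c) * real (card V) ^ (r - 1) \<le> real (degree E y) \<longrightarrow> \<tau> x < l \<and> (x \<noteq> y \<longrightarrow> \<tau> x \<noteq> \<tau> y))"
    using classification[OF \<eta>, where 'v = nat] by - (elim exE conjE, rule that, assumption, (drule spec)+, (drule mp, assumption)+, assumption)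
  obtain \<epsilon>s Ns where es: "0 < \<epsilon>s" and st: "\<And>(V :: nat set) E. rgraph r (V, E) \<Longrightarrow> core_free F (V, E) \<Longrightarrow> Ns \<le> card V \<Longrightarrow>
    (?\<alpha> - \<epsilon>s) * real (card V) ^ r \<le> real (card E) \<Longrightarrow>
    (\<exists>P. disjoint_family_on P {..<l} \<and> (\<Union>i<l. P i) = V \<and>
      (?\<alpha> - \<epsilon>c) * real (card V) ^ r \<le> real (card (E \<inter> cross P {..<l} r)))"
    using core_free_stability[OF ec] by - (elim exE conjE, rule that, assumption, (drule spec)+, (drule mp, assumption)+, assumption)
  define \<epsilon> where "\<epsilon> = min \<epsilon>c (\<epsilon>s / 2)"
  have \<epsilon>: "0 < \<epsilon>" "\<epsilon> \<le> \<epsilon>c" "\<epsilon> \<le> \<epsilon>s / 2" using ec es by (auto simp: \<epsilon>_def)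
  show ?thesis
  proof (rule exI[of _ \<epsilon>], intro conjI \<epsilon>(1), rule exI[of _ "max Nc (max Ns (nat \<lceil>2 * real m / \<epsilon>s\<rceil>))"], intro allI impI)
    fix V :: "nat set" and E assume G: "rgraph r (V, E)" and free: "\<not> contains (V, E) H"
      and n: "max Nc (max Ns (nat \<lceil>2 * real m / \<epsilon>s\<rceil>)) \<le> card V"
      and E: "(?\<alpha> - \<epsilon>) * real (card V) ^ r \<le> real (card E)"
    let ?n = "card V" and ?E = "heavy_edges m E"
    have np: "real ?n * real ?n ^ (r - 1) = real ?n ^ r" using r2 by (cases r) auto
    have mn: "real m \<le> \<epsilon>s / 2 * real ?n"
    proof -
      have "2 * real m / \<epsilon>s \<le> real ?n" using n by linarith
      then show ?thesis using es by (simp add: field_simps)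
    qed
    have fE: "finite E" by (rule rgraph_finite_edges[OF G])
    have sub: "?E \<subseteq> E" by (auto simp: heavy_edges_def)
    have cf: "core_free F (V, ?E)" by (rule core_free_heavy_edges[OF G F r2 order_refl free])
    have G': "rgraph r (V, ?E)" using G by (auto simp: rgraph_def heavy_edges_def)
    have "real (card (E - ?E)) \<le> real (m * ?n ^ (r - 1))"
      using card_light_edges[OF G r2] by (rule of_nat_mono)
    also have "\<dots> = real m * real ?n ^ (r - 1)" by simp
    also have "\<dots> \<le> (\<epsilon>s / 2 * real ?n) * real ?n ^ (r - 1)" using mn by (rule mult_right_mono) simp
    also have "\<dots> = \<epsilon>s / 2 * real ?n ^ r" using np by (simp add: mult.assoc)
    finally have "real (card (E - ?E)) \<le> \<epsilon>s / 2 * real ?n ^ r" .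
    moreover have "real (card (E - ?E)) = real (card E) - real (card ?E)"
      using sub fE by (simp add: card_Diff_subset finite_subset card_mono of_nat_diff)
    moreover have "(?\<alpha> - \<epsilon>s / 2) * real ?n ^ r \<le> (?\<alpha> - \<epsilon>) * real ?n ^ r" using \<epsilon>(3) by (intro mult_right_mono) auto
    ultimately have "(?\<alpha> - \<epsilon>s) * real ?n ^ r \<le> real (card ?E)" using E by (simp add: algebra_simps)
    from st[OF G' cf _ this] obtain P where P: "disjoint_family_on P {..<l}" "(\<Union>i<l. P i) = V"
      "(?\<alpha> - \<epsilon>c) * real ?n ^ r \<le> real (card (?E \<inter> cross P {..<l} r))" using n by auto
    have "card (?E \<inter> cross P {..<l} r) \<le> card (E \<inter> cross P {..<l} r)" using sub fE by (intro card_mono) auto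
    then have "(?\<alpha> - \<epsilon>c) * real ?n ^ r \<le> real (card (E \<inter> cross P {..<l} r))" using P(3) by linarith
    note c = cl[OF G free P(1,2) _ this]
    have "(beta l r - \<epsilon>c) * real ?n ^ (r - 1) \<le> (beta l r - \<epsilon>) * real ?n ^ (r - 1)"
      using \<epsilon>(2) by (intro mult_right_mono) auto
    then have le: "(beta l r - \<epsilon>) * real ?n ^ (r - 1) \<le> x \<Longrightarrow> (beta l r - \<epsilon>c) * real ?n ^ (r - 1) \<le> x" for x by linarith
    have "Nc \<le> ?n" using n by simp
    from c[OF this] obtain \<tau> where "\<forall>v. real (degree E v) \<le> (beta l r + \<eta>) * real ?n ^ (r - 1)"
      and \<tau>: "\<forall>e\<in>E. \<forall>x\<in>e. \<forall>y\<in>e. (beta l r - \<epsilon>c) * real ?n ^ (r - 1) \<le> real (degree E x) \<longrightarrow>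
      (beta l r - \<epsilon>c) * real ?n ^ (r - 1) \<le> real (degree E y) \<longrightarrow> \<tau> x < l \<and> (x \<noteq> y \<longrightarrow> \<tau> x \<noteq> \<tau> y)" by blast
    then show "(\<forall>v. real (degree E v) \<le> (beta l r + \<eta>) * real ?n ^ (r - 1)) \<and>
      (\<exists>\<tau>. \<forall>e\<in>E. \<forall>x\<in>e. \<forall>y\<in>e. (beta l r - \<epsilon>) * real ?n ^ (r - 1) \<le> real (degree E x) \<longrightarrow>
      (beta l r - \<epsilon>) * real ?n ^ (r - 1) \<le> real (degree E y) \<longrightarrow> \<tau> x < l \<and> (x \<noteq> y \<longrightarrow> \<tau> x \<noteq> \<tau> y))"
      using le by (intro conjI exI[of _ \<tau>]) (auto intro!: le)
  qed
qed

end

section \<open>The exact Turan theorem for the expansion\<close>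

lemma sum_card_parts:
  fixes l :: nat
  assumes "disjoint_family_on P {..<l}" "(\<Union>i<l. P i) = V" "finite V"
  shows "(\<Sum>i<l. card (P i)) = card V"
proof -
  have "finite (P i)" if "i < l" for i using assms(2) that by (intro finite_subset[OF _ assms(3)]) auto
  then show ?thesis
    using assms(1) unfolding assms(2)[symmetric] by (subst card_UN_disjoint) (auto simp: disjoint_family_on_def)
qed

context expansion_family
begin

text \<open>The hypergraph is reduced to a minimal vertex set \<open>A\<close> on which the number of edges beats the
  Turan number by an amount growing with the number of removed vertices; minimality forces a large
  minimum degree on \<open>A\<close>.\<close>

lemma free_turan:
  "\<exists>N. \<forall>(V :: nat set) E. rgraph r (V, E) \<longrightarrow> \<not> contains (V, E) H \<longrightarrow> N \<le> card V \<longrightarrow>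
    tau l r (card V) \<le> card E \<longrightarrow>
    card E = tau l r (card V) \<and> (\<exists>P. disjoint_family_on P {..<l} \<and> (\<Union>i<l. P i) = V \<and>
      E = cross P {..<l} r \<and> balanced l (\<lambda>i. card (P i)))"
proof -
  let ?\<alpha> = "alpha l r"
  have a: "0 < ?\<alpha>" using alpha_pos[OF rl] l0 by simp
  obtain \<epsilon> Nc where e: "0 < \<epsilon>" and cl: "\<And>(V :: nat set) E. rgraph r (V, E) \<Longrightarrow> \<not> contains (V, E) H \<Longrightarrow> Nc \<le> card V \<Longrightarrow>
    (?\<alpha> - \<epsilon>) * real (card V) ^ r \<le> real (card E) \<Longrightarrow>
    (\<exists>\<tau>. \<forall>e\<in>E. \<forall>x\<in>e. \<forall>y\<in>e. (beta l r - \<epsilon>) * real (card V) ^ (r - 1) \<le> real (degree E x) \<longrightarrow>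
      (beta l r - \<epsilon>) * real (card V) ^ (r - 1) \<le> real (degree E y) \<longrightarrow> \<tau> x < l \<and> (x \<noteq> y \<longrightarrow> \<tau> x \<noteq> \<tau> y))"
    using free_classification[OF zero_less_one]
    by - (elim exE conjE, rule that, assumption, (drule spec)+, (drule mp, assumption)+, erule conjunct2)
  \<comment> \<open>The degrees in \<open>A\<close> fall short of \<open>beta\<close> by at most
    \<open>3 * c\<close>: one \<open>c\<close> from the Turan increment and two from the surplus
    term.\<close>
  define c where "c = \<epsilon> / 4"
  have c: "0 < c" using e by (simp add: c_def)
  \<comment> \<open>By the Bernoulli inequality a set missing at most \<open>\<omega> * n\<close>
    vertices retains at least half of \<open>n^(r-1)\<close>.\<close>
  define \<omega> where "\<omega> = 1 / (2 * real r)"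
  have \<omega>: "0 < \<omega>" "\<omega> \<le> 1 / 4" using r2 by (auto simp: \<omega>_def field_simps)
  \<comment> \<open>The bounds give, in order, \<open>n - card A \<le> \<omega> * n\<close>, the
    edge density needed for the classification, and a positive Turan number.\<close>
  define \<epsilon>5 where "\<epsilon>5 = Min {\<omega> * c / 2, \<epsilon>, ?\<alpha> / 2}"
  have e5: "0 < \<epsilon>5" unfolding \<epsilon>5_def using \<omega>(1) c e a by (subst Min_gr_iff) auto
  have e5': "\<epsilon>5 \<le> \<omega> * c / 2" "\<epsilon>5 \<le> \<epsilon>" "\<epsilon>5 \<le> ?\<alpha> / 2" unfolding \<epsilon>5_def by (rule Min_le; simp)+
  obtain Nd where Nd: "\<And>(V :: nat set) E. rgraph r (V, E) \<Longrightarrow> \<not> contains (V, E) H \<Longrightarrow> Nd \<le> card V \<Longrightarrow>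
    real (card E) \<le> (?\<alpha> + \<epsilon>5) * real (card V) ^ r" using free_density[OF e5] by blast
  obtain Nt where Nt: "\<And>n. n \<ge> Nt \<Longrightarrow> (?\<alpha> - \<epsilon>5) * real n ^ r \<le> real (tau l r n)"
    using tau_asymp[OF l0(1) e5, of r] by blast
  obtain \<omega>' Ns where w': "0 < \<omega>'" and Ns: "\<And>n j. n \<ge> Ns \<Longrightarrow> real j \<le> \<omega>' * real n \<Longrightarrow>
     real j * (beta l r - c) * real n ^ (r - 1) \<le> real (tau l r n) - real (tau l r (n - j))"
    using tau_step_asymp[OF r2 rl c] by blast
  define K where "K = Max {Nc, Nd, Nt, Ns, nat \<lceil>1 / \<omega>'\<rceil>, 1}"
  have K: "Nc \<le> K" "Nd \<le> K" "Nt \<le> K" "Ns \<le> K" "nat \<lceil>1 / \<omega>'\<rceil> \<le> K" "1 \<le> K"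
    unfolding K_def by (rule Max_ge; simp)+
  \<comment> \<open>Large enough that a set with fewer than \<open>K\<close> vertices, which spans
    fewer than \<open>2^K + 1\<close> edges, cannot carry the required surplus.\<close>
  define N where "N = max (2 * K) (K + nat \<lceil>2 ^ K / c\<rceil> + 1)"
  show ?thesis
  proof (rule exI[of _ N], intro allI impI)
    fix V :: "nat set" and E assume G: "rgraph r (V, E)" and free: "\<not> contains (V, E) H"
      and nN: "N \<le> card V" and E: "tau l r (card V) \<le> card E"
    let ?n = "card V"
    have fV: "finite V" using G by (simp add: rgraph_def)
    have n2K: "2 * K \<le> ?n" and nK: "K + nat \<lceil>2 ^ K / c\<rceil> + 1 \<le> ?n" using nN by (auto simp: N_def)
    have n1: "1 \<le> real ?n" using n2K K(6) by linarith
    define EA where "EA A = {e \<in> E. e \<subseteq> A}" for A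
    define good where "good A \<longleftrightarrow> A \<subseteq> V \<and>
      real (tau l r (card A)) + (real ?n - real (card A)) * c * real ?n ^ (r - 1) \<le> real (card (EA A))" for A
    have "EA V = E" using G by (auto simp: EA_def rgraph_def)
    then have "good V" using E by (simp add: good_def)
    then obtain A where A: "good A" "\<And>B. good B \<Longrightarrow> card A \<le> card B"
      by (metis arg_min_nat_lemma)
    let ?a = "card A" and ?E = "EA A"
    have AV: "A \<subseteq> V" and gA: "real (tau l r ?a) + (real ?n - real ?a) * c * real ?n ^ (r - 1) \<le> real (card ?E)"
      using A(1) by (auto simp: good_def)
    have fA: "finite A" using AV fV by (rule finite_subset)
    have an: "?a \<le> ?n" using AV fV by (intro card_mono)
    have GA: "rgraph r (A, ?E)" using G fA by (auto simp: rgraph_def EA_def)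
    have freeA: "\<not> contains (A, ?E) H" using free contains_mono[of A ?E H V E] AV by (auto simp: EA_def)
    have fEA: "finite ?E" by (rule rgraph_finite_edges[OF GA])
    have np: "real ?n * real ?n ^ (r - 1) = real ?n ^ r" using r2 by (cases r) auto
    have aK: "K \<le> ?a"
    proof (rule ccontr)
      assume "\<not> K \<le> ?a"
      then have lt: "?a \<le> K" "?a < K" by auto
      have "card ?E \<le> card (Pow A)" using fA by (intro card_mono) (auto simp: EA_def)
      then have "real (card ?E) \<le> real (2 ^ ?a)" by (simp only: of_nat_le_iff card_Pow[OF fA])
      also have "\<dots> \<le> 2 ^ K" using lt(1) by (simp add: power_increasing)
      finally have 1: "real (card ?E) \<le> 2 ^ K" .
      have "real ?n - real ?a > 2 ^ K / c"
      proof -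
        have "2 ^ K / c \<le> real (nat \<lceil>2 ^ K / c\<rceil>)" by linarith
        then show ?thesis using nK lt by linarith
      qed
      then have "2 ^ K < (real ?n - real ?a) * c" using c by (simp add: field_simps)
      also have "\<dots> \<le> (real ?n - real ?a) * c * real ?n ^ (r - 1)"
        using mult_left_mono[OF one_le_power[OF n1, of "r - 1"], of "(real ?n - real ?a) * c"] an c by simp
      finally show False using gA 1 by linarith
    qed
    have a1: "1 \<le> real ?a" using aK K(6) by linarith
    have "real (card ?E) \<le> (?\<alpha> + \<epsilon>5) * real ?a ^ r" using Nd[OF GA freeA] aK K by simp
    moreover have ta: "(?\<alpha> - \<epsilon>5) * real ?a ^ r \<le> real (tau l r ?a)" using Nt aK K by simp
    \<comment> \<open>The surplus is at most the gap between the upper density bound and the Turan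
      number, so \<open>A\<close> is almost all of \<open>V\<close>.\<close>
    ultimately have "(real ?n - real ?a) * c * real ?n ^ (r - 1) \<le> 2 * \<epsilon>5 * real ?a ^ r"
      using gA by (simp add: algebra_simps)
    also have "\<dots> \<le> 2 * \<epsilon>5 * real ?n ^ r" using e5 an by (intro mult_left_mono power_mono) auto
    also have "\<dots> = (2 * \<epsilon>5 * real ?n) * real ?n ^ (r - 1)" using np by (simp add: mult.assoc)
    finally have "(real ?n - real ?a) * c * real ?n ^ (r - 1) \<le> 2 * \<epsilon>5 * real ?n * real ?n ^ (r - 1)" .
    moreover have "0 < real ?n ^ (r - 1)" using n1 by simp
    ultimately have "(real ?n - real ?a) * c \<le> 2 * \<epsilon>5 * real ?n" by (simp only: mult_le_cancel_right_pos)
    also have "2 * \<epsilon>5 * real ?n \<le> (\<omega> * c) * real ?n" using e5'(1) by (intro mult_right_mono) auto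
    finally have "(real ?n - real ?a) * c \<le> (\<omega> * real ?n) * c" by (simp add: mult_ac)
    then have "real ?n - real ?a \<le> \<omega> * real ?n" using c by (simp only: mult_le_cancel_right_pos)
    then have "(1 - \<omega>) * real ?n \<le> real ?a" by (simp add: algebra_simps)
    then have "((1 - \<omega>) * real ?n) ^ (r - 1) \<le> real ?a ^ (r - 1)" using \<omega> by (intro power_mono) auto
    moreover have "1 / 2 \<le> (1 - \<omega>) ^ (r - 1)"
    proof -
      have "1 + real (r - 1) * (- \<omega>) \<le> (1 + (- \<omega>)) ^ (r - 1)" by (rule Bernoulli_inequality) (use \<omega> in simp)
      moreover have "real (r - 1) * \<omega> \<le> 1 / 2" using r2 by (simp add: \<omega>_def field_simps)
      ultimately show ?thesis by simp
    qed
    then have "1 / 2 * real ?n ^ (r - 1) \<le> (1 - \<omega>) ^ (r - 1) * real ?n ^ (r - 1)" by (rule mult_right_mono) simp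
    ultimately have half: "real ?n ^ (r - 1) \<le> 2 * real ?a ^ (r - 1)" by (simp add: power_mult_distrib)
    \<comment> \<open>By minimality \<open>A - {v}\<close> violates the inequality that
      \<open>A\<close> satisfies; the difference is a lower bound for the degree of
      \<open>v\<close>.\<close>
    have deg: "(beta l r - \<epsilon>) * real ?a ^ (r - 1) \<le> real (degree ?E v)" if v: "v \<in> A" for v
    proof -
      have "card (A - {v}) < ?a" using v fA by (intro psubset_card_mono) auto
      then have "\<not> good (A - {v})" using A(2)[of "A - {v}"] by linarith
      then have "real (card (EA (A - {v}))) < real (tau l r (card (A - {v}))) +
          (real ?n - real (card (A - {v}))) * c * real ?n ^ (r - 1)" using AV by (auto simp: good_def)
      moreover have "card (A - {v}) = ?a - 1" using v by simp
      moreover have "real (?a - 1) = real ?a - 1" using a1 by (simp add: of_nat_diff)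
      ultimately have 1: "real (card (EA (A - {v}))) < real (tau l r (?a - 1)) +
          (real ?n - real ?a) * c * real ?n ^ (r - 1) + c * real ?n ^ (r - 1)" by (simp add: algebra_simps)
      have "EA (A - {v}) = {e \<in> ?E. e \<inter> {v} = {}}" by (auto simp: EA_def)
      moreover have "{e \<in> ?E. v \<in> e} = {e \<in> ?E. e \<inter> {v} \<noteq> {}}" by auto
      ultimately have "card ?E = card (EA (A - {v})) + degree ?E v"
        unfolding degree_def using card_edges_split[OF fEA, of "{v}"] by simp
      then have 2: "real (card ?E) = real (card (EA (A - {v}))) + real (degree ?E v)" by simp
      have "real 1 \<le> \<omega>' * real ?a"
      proof -
        have "1 / \<omega>' \<le> real ?a" using aK K(5) by linarith
        then show ?thesis using w' by (simp add: field_simps)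
      qed
      then have 3: "(beta l r - c) * real ?a ^ (r - 1) \<le> real (tau l r ?a) - real (tau l r (?a - 1))"
        using Ns[of ?a 1] aK K by simp
      have "c * real ?n ^ (r - 1) \<le> c * (2 * real ?a ^ (r - 1))" using half c by (intro mult_left_mono) auto
      moreover have "(beta l r - \<epsilon>) * real ?a ^ (r - 1) \<le> (beta l r - 3 * c) * real ?a ^ (r - 1)"
        using e by (intro mult_right_mono) (auto simp: c_def)
      moreover have "(beta l r - 3 * c) * real ?a ^ (r - 1) = (beta l r - c) * real ?a ^ (r - 1) - c * (2 * real ?a ^ (r - 1))"
        by (simp add: algebra_simps)
      ultimately show ?thesis using 1 2 3 gA by linarith
    qed
    have "(?\<alpha> - \<epsilon>) * real ?a ^ r \<le> (?\<alpha> - \<epsilon>5) * real ?a ^ r" using e5'(2) by (intro mult_right_mono) auto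
    moreover have "0 \<le> (real ?n - real ?a) * c * real ?n ^ (r - 1)" using an c by simp
    ultimately have "(?\<alpha> - \<epsilon>) * real ?a ^ r \<le> real (card ?E)" using ta gA by linarith
    moreover have "Nc \<le> ?a" using aK K by simp
    ultimately obtain \<tau> where \<tau>: "\<And>e x y. e \<in> ?E \<Longrightarrow> x \<in> e \<Longrightarrow> y \<in> e \<Longrightarrow> (beta l r - \<epsilon>) * real ?a ^ (r - 1) \<le> real (degree ?E x) \<Longrightarrow>
      (beta l r - \<epsilon>) * real ?a ^ (r - 1) \<le> real (degree ?E y) \<Longrightarrow> \<tau> x < l \<and> (x \<noteq> y \<longrightarrow> \<tau> x \<noteq> \<tau> y)"
      using cl[OF GA freeA] by blast
    define t where "t x = (if \<tau> x < l then \<tau> x else 0)" for x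
    let ?P = "\<lambda>i. {x \<in> A. t x = i}"
    have cr: "?E \<subseteq> cross ?P {..<l} r"
    proof
      fix e assume e: "e \<in> ?E"
      have eA: "e \<subseteq> A" "card e = r" "finite e" using e GA fA by (auto simp: rgraph_def intro: finite_subset)
      have "\<tau> x < l \<and> (x \<noteq> y \<longrightarrow> \<tau> x \<noteq> \<tau> y)" if "x \<in> e" "y \<in> e" for x y
        using \<tau>[OF e that] deg that eA(1) by blast
      then show "e \<in> cross ?P {..<l} r"
        using l0(1) by (intro cross_of_types[OF eA(1,3,2)]) (auto simp: t_def)
    qed
    have dP: "disjoint_family_on ?P {..<l}" by (auto simp: disjoint_family_on_def)
    have UP: "(\<Union>i<l. ?P i) = A" using l0(1) by (auto simp: t_def)
    have le: "card ?E \<le> tau l r ?a" by (rule partite_card_le_tau[OF dP UP fA cr])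
    \<comment> \<open>An \<open>l\<close>-partite hypergraph cannot exceed the Turan number, so the
      surplus is zero, which forces \<open>A = V\<close>.\<close>
    then have "(real ?n - real ?a) * c * real ?n ^ (r - 1) \<le> 0" using gA by linarith
    then have "(real ?n - real ?a) * (c * real ?n ^ (r - 1)) \<le> 0" by (simp only: mult.assoc)
    moreover have "0 < c * real ?n ^ (r - 1)" using c n1 by simp
    ultimately have "real ?n - real ?a \<le> 0"
      using mult_pos_pos[of "real ?n - real ?a" "c * real ?n ^ (r - 1)"] by linarith
    then have "A = V" using AV fV an by (intro card_subset_eq) auto
    then have E': "?E = E" using \<open>EA V = E\<close> by simp
    have eq: "card E = tau l r ?n" using le E by (simp add: \<open>A = V\<close> \<open>EA V = E\<close>)
    have S: "(\<Sum>i<l. card (?P i)) = ?n"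
      using sum_card_parts[OF dP UP fA] by (simp add: \<open>A = V\<close>)
    have fc: "finite (cross ?P {..<l} r)" using fA by (intro finite_cross) auto
    have cc: "card (cross ?P {..<l} r) = esym {..<l} r (\<lambda>i. card (?P i))" using dP fA by (intro card_cross) auto
    have ge: "card E \<le> card (cross ?P {..<l} r)" using cr fc unfolding E' by (intro card_mono)
    have le2: "card (cross ?P {..<l} r) \<le> tau l r ?n" unfolding cc by (rule esym_le_tau[OF l0(1) r2 S])
    have Ec: "E = cross ?P {..<l} r" using cr fc ge le2 eq unfolding E' by (intro card_subset_eq) auto
    have "0 < real (tau l r ?n)"
    proof -
      have "0 < (?\<alpha> - \<epsilon>5) * real ?n ^ r" using e5'(3) a n1 by (intro mult_pos_pos) auto
      then show ?thesis using ta \<open>A = V\<close> by simp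
    qed
    then have "balanced l (\<lambda>i. card (?P i))"
      using eq Ec cc by (intro esym_eq_tau_imp_balanced[OF r2 S]) auto
    then show "card E = tau l r ?n \<and> (\<exists>P. disjoint_family_on P {..<l} \<and> (\<Union>i<l. P i) = V \<and>
      E = cross P {..<l} r \<and> balanced l (\<lambda>i. card (P i)))"
      using eq dP UP Ec \<open>A = V\<close> by (intro conjI exI[of _ ?P]) auto
  qed
qed

end

section \<open>The extremal hypergraphs\<close>

text \<open>An intrinsic form of the claimed extremal hypergraph on an arbitrary vertex type: the
  edges of the complete part and of the join together are exactly the \<open>r\<close>-sets meeting
  \<open>T\<close>.\<close>

definition turan_join :: "nat \<Rightarrow> nat \<Rightarrow> nat \<Rightarrow> nat \<Rightarrow> 'v hgraph \<Rightarrow> bool" where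
  "turan_join r l t n G \<longleftrightarrow> finite (verts G) \<and> card (verts G) = n \<and>
     (\<exists>T P. T \<subseteq> verts G \<and> card T = t \<and> disjoint_family_on P {..<l} \<and> (\<Union>i<l. P i) = verts G - T \<and>
        balanced l (\<lambda>i. card (P i)) \<and>
        edges G = {e. e \<subseteq> verts G \<and> card e = r \<and> e \<inter> T \<noteq> {}} \<union> cross P {..<l} r)"

lemma turan_joinE:
  assumes "turan_join r l t n G"
  obtains T P where "finite (verts G)" "card (verts G) = n" "T \<subseteq> verts G" "card T = t"
    "disjoint_family_on P {..<l}" "(\<Union>i<l. P i) = verts G - T" "balanced l (\<lambda>i. card (P i))"
    "edges G = {e. e \<subseteq> verts G \<and> card e = r \<and> e \<inter> T \<noteq> {}} \<union> cross P {..<l} r"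
  using assms unfolding turan_join_def by - (elim conjE exE, (rule that; assumption))

definition join_size :: "nat \<Rightarrow> nat \<Rightarrow> nat \<Rightarrow> nat \<Rightarrow> nat" where
  "join_size r l t n = (n choose r) - ((n - t) choose r) + tau l r (n - t)"

lemma card_meeting:
  assumes "finite V" "T \<subseteq> V"
  shows "card {e. e \<subseteq> V \<and> card e = r \<and> e \<inter> T \<noteq> {}} = (card V choose r) - ((card V - card T) choose r)"
proof -
  let ?A = "{e. e \<subseteq> V \<and> card e = r \<and> e \<inter> T \<noteq> {}}" and ?B = "{e. e \<subseteq> V - T \<and> card e = r}"
  have "{e. e \<subseteq> V \<and> card e = r} = ?A \<union> ?B" by auto
  moreover have "?A \<inter> ?B = {}" by auto
  moreover have "finite ?A" "finite ?B" using assms(1) by auto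
  ultimately have "card {e. e \<subseteq> V \<and> card e = r} = card ?A + card ?B" by (simp add: card_Un_disjoint)
  moreover have "card ?B = (card V - card T) choose r"
    using n_subsets[of "V - T" r] assms by (simp add: card_Diff_subset finite_subset)
  ultimately show ?thesis using n_subsets[OF assms(1), of r] by simp
qed

lemma card_cross_balanced:
  assumes "disjoint_family_on P {..<l}" "(\<Union>i<l. P i) = V" "finite V" "balanced l (\<lambda>i. card (P i))" "0 < l"
  shows "card (cross P {..<l} r) = tau l r (card V)"
proof -
  have f: "finite (P i)" if "i < l" for i using assms(2) that by (intro finite_subset[OF _ assms(3)]) auto
  have "card (cross P {..<l} r) = esym {..<l} r (\<lambda>i. card (P i))" using f assms(1) by (intro card_cross) auto
  then show ?thesis using esym_balanced[OF assms(5,4) sum_card_parts[OF assms(1-3)]] by simp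
qed

lemma card_turan_join:
  assumes "turan_join r l t n G" "0 < l"
  shows "card (edges G) = join_size r l t n"
proof -
  obtain T P where V: "finite (verts G)" "card (verts G) = n" and T: "T \<subseteq> verts G" "card T = t"
    and P: "disjoint_family_on P {..<l}" "(\<Union>i<l. P i) = verts G - T" "balanced l (\<lambda>i. card (P i))"
    and E: "edges G = {e. e \<subseteq> verts G \<and> card e = r \<and> e \<inter> T \<noteq> {}} \<union> cross P {..<l} r"
    by (rule turan_joinE[OF assms(1)])
  have fT: "finite T" using T V by (auto intro: finite_subset)
  have cVT: "card (verts G - T) = n - t" using T V fT by (simp add: card_Diff_subset)
  have sub: "cross P {..<l} r \<subseteq> Pow (verts G - T)" using P(2) by (auto simp: cross_def)
  have "card (edges G) = card {e. e \<subseteq> verts G \<and> card e = r \<and> e \<inter> T \<noteq> {}} + card (cross P {..<l} r)"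
    unfolding E
  proof (rule card_Un_disjoint)
    show "finite (cross P {..<l} r)" by (rule finite_subset[OF sub]) (use V in simp)
    show "{e. e \<subseteq> verts G \<and> card e = r \<and> e \<inter> T \<noteq> {}} \<inter> cross P {..<l} r = {}" using sub by blast
  qed (use V in simp)
  then show ?thesis
    using card_meeting[OF V(1) T(1)] card_cross_balanced[OF P(1,2) _ P(3) assms(2)] V T cVT
    by (simp add: join_size_def)
qed

text \<open>The sets \<open>T\<close>, \<open>T'\<close> are matched by any bijection, and the parts
  through a permutation respecting sizes from \<open>balanced_perm\<close>.\<close>

lemma turan_join_isomorphic:
  fixes G :: "'v hgraph" and G' :: "'w hgraph"
  assumes G: "turan_join r l t n G" and G': "turan_join r l t n G'" and l: "0 < l"
  shows "isomorphic G G'"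
proof -
  obtain T P where V: "finite (verts G)" "card (verts G) = n" and T: "T \<subseteq> verts G" "card T = t"
    and P: "disjoint_family_on P {..<l}" "(\<Union>i<l. P i) = verts G - T" "balanced l (\<lambda>i. card (P i))"
    and E: "edges G = {e. e \<subseteq> verts G \<and> card e = r \<and> e \<inter> T \<noteq> {}} \<union> cross P {..<l} r"
    by (rule turan_joinE[OF G])
  obtain T' P' where V': "finite (verts G')" "card (verts G') = n" and T': "T' \<subseteq> verts G'" "card T' = t"
    and P': "disjoint_family_on P' {..<l}" "(\<Union>i<l. P' i) = verts G' - T'" "balanced l (\<lambda>i. card (P' i))"
    and E': "edges G' = {e. e \<subseteq> verts G' \<and> card e = r \<and> e \<inter> T' \<noteq> {}} \<union> cross P' {..<l} r"
    by (rule turan_joinE[OF G'])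
  have fT: "finite T" "finite T'" using T V T' V' by (auto intro: finite_subset)
  have fP: "finite (P i)" "finite (P' i)" if "i < l" for i
  proof -
    have "P i \<subseteq> verts G" "P' i \<subseteq> verts G'" using P(2) P'(2) that by blast+
    then show "finite (P i)" "finite (P' i)" using V(1) V'(1) by (auto intro: finite_subset)
  qed
  have "(\<Sum>i<l. card (P i)) = card (verts G - T)" by (rule sum_card_parts[OF P(1,2)]) (use V in simp)
  then have S: "(\<Sum>i<l. card (P i)) = n - t" using V T fT by (simp add: card_Diff_subset)
  have "(\<Sum>i<l. card (P' i)) = card (verts G' - T')" by (rule sum_card_parts[OF P'(1,2)]) (use V' in simp)
  then have S': "(\<Sum>i<l. card (P' i)) = n - t" using V' T' fT by (simp add: card_Diff_subset)
  have "\<exists>\<sigma>. bij_betw \<sigma> {..<l} {..<l} \<and> (\<forall>i<l. card (P' (\<sigma> i)) = card (P i))"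
  proof (rule balanced_perm[OF l P(3) P'(3) S S'])
    fix \<sigma> assume "bij_betw \<sigma> {..<l} {..<l}" "\<And>i. i < l \<Longrightarrow> card (P' (\<sigma> i)) = card (P i)"
    then show ?thesis by (intro exI[of _ \<sigma>]) simp
  qed
  then obtain \<sigma> where \<sigma>: "bij_betw \<sigma> {..<l} {..<l}" "\<And>i. i < l \<Longrightarrow> card (P' (\<sigma> i)) = card (P i)" by auto
  have \<sigma>l: "\<sigma> i < l" if "i < l" for i using bij_betwE[OF \<sigma>(1)] that by blast
  obtain g where g: "bij_betw g T T'" using finite_same_card_bij[OF fT] T T' by auto
  have "\<exists>h. bij_betw h (P i) (P' (\<sigma> i))" if "i < l" for i
    using finite_same_card_bij[OF fP(1)[OF that] fP(2)[OF \<sigma>l[OF that]]] \<sigma>(2)[OF that] by simp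
  then obtain h where h: "\<And>i. i < l \<Longrightarrow> bij_betw (h i) (P i) (P' (\<sigma> i))" by metis
  define f where "f x = (if x \<in> T then g x else h (THE i. i < l \<and> x \<in> P i) x)" for x
  have fT': "f x = g x" if "x \<in> T" for x using that by (simp add: f_def)
  have fP': "f x = h i x" if "i < l" "x \<in> P i" for i x
  proof -
    have "x \<notin> T" using that P(2) by blast
    moreover have "(THE i. i < l \<and> x \<in> P i) = i"
      using that disjoint_family_onD'[OF P(1)] by (intro the_equality) auto
    ultimately show ?thesis by (simp add: f_def)
  qed
  have imT: "f ` T = T'" using g fT' by (auto simp: bij_betw_def)
  have imP: "f ` P i = P' (\<sigma> i)" if "i < l" for i
    using bij_betw_imp_surj_on[OF h[OF that]] fP'[OF that] by (metis image_cong)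
  have VT: "verts G = T \<union> (\<Union>i<l. P i)" "verts G' = T' \<union> (\<Union>i<l. P' i)" using T P(2) T' P'(2) by auto
  have im: "f ` verts G = verts G'"
  proof -
    have "f ` (\<Union>i<l. P i) = (\<Union>i<l. P' (\<sigma> i))" unfolding image_UN using imP by auto
    also have "\<dots> = (\<Union>i\<in>\<sigma> ` {..<l}. P' i)" by simp
    also have "\<sigma> ` {..<l} = {..<l}" using \<sigma>(1) by (simp add: bij_betw_def)
    finally show ?thesis unfolding VT image_Un imT by simp
  qed
  have inj: "inj_on f (verts G)" by (rule eq_card_imp_inj_on[OF V(1)]) (simp add: im V V')
  have sub: "(\<lambda>e. f ` e) ` edges G \<subseteq> edges G'"
  proof clarify
    fix e assume "e \<in> edges G"
    then consider "e \<subseteq> verts G" "card e = r" "e \<inter> T \<noteq> {}" | "e \<in> cross P {..<l} r" unfolding E by auto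
    then show "f ` e \<in> edges G'"
    proof cases
      case 1
      have "f ` e \<subseteq> verts G'" using 1(1) im by auto
      moreover have "card (f ` e) = r" using 1 inj by (metis card_image inj_on_subset)
      moreover have "f ` e \<inter> T' \<noteq> {}" using 1(3) imT by auto
      ultimately show ?thesis by (auto simp: E')
    next
      case 2
      have e: "e \<subseteq> (\<Union>i<l. P i)" "card e = r" "finite e" "\<And>i. i < l \<Longrightarrow> card (e \<inter> P i) \<le> 1"
        using 2 by (auto simp: cross_def)
      have eV: "e \<subseteq> verts G" using e(1) VT(1) by auto
      have "f ` e \<subseteq> (\<Union>i<l. P' i)"
      proof
        fix y assume "y \<in> f ` e"
        then obtain x i where "x \<in> e" "y = f x" "i < l" "x \<in> P i" using e(1) by auto
        then show "y \<in> (\<Union>i<l. P' i)" using imP \<sigma>l by blast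
      qed
      moreover have "card (f ` e) = r" using e(2) inj eV by (metis card_image inj_on_subset)
      moreover have "card (f ` e \<inter> P' j) \<le> 1" if j: "j < l" for j
      proof -
        have "a = b" if ab: "a \<in> f ` e \<inter> P' j" "b \<in> f ` e \<inter> P' j" for a b
        proof -
          obtain x i where x: "x \<in> e" "a = f x" "i < l" "x \<in> P i" using ab(1) e(1) by auto
          obtain y k where y: "y \<in> e" "b = f y" "k < l" "y \<in> P k" using ab(2) e(1) by auto
          have "a \<in> P' (\<sigma> i)" "b \<in> P' (\<sigma> k)" using x y imP by auto
          then have "\<sigma> i = j" "\<sigma> k = j"
            using disjoint_family_onD'[OF P'(1)] ab \<sigma>l x(3) y(3) j by auto
          then have "i = k" using bij_betw_imp_inj_on[OF \<sigma>(1)] x(3) y(3) by (auto dest: inj_onD)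
          then have "x = y" using e(4)[OF x(3)] e(3) x y card_le_Suc0_iff_eq[of "e \<inter> P i"] by auto
          then show ?thesis using x y by simp
        qed
        then show ?thesis using e(3) by (auto simp: card_le_Suc0_iff_eq)
      qed
      ultimately have "f ` e \<in> cross P' {..<l} r" using e(3) by (simp add: cross_def)
      then show ?thesis by (simp add: E')
    qed
  qed
  have EV: "edges G \<subseteq> Pow (verts G)" unfolding E VT(1) by (auto simp: cross_def)
  have E'V: "edges G' \<subseteq> Pow (verts G')" unfolding E' VT(2) by (auto simp: cross_def)
  \<comment> \<open>Edges map to edges injectively and both sides have \<open>join_size\<close>
    edges, so the inclusion is an equality.\<close>
  have "inj_on (\<lambda>e. f ` e) (edges G)" using inj_on_subset[OF inj_on_image_Pow[OF inj] EV] .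
  then have "card ((\<lambda>e. f ` e) ` edges G) = card (edges G')"
    using card_turan_join[OF G l] card_turan_join[OF G' l] by (simp add: card_image)
  then have "(\<lambda>e. f ` e) ` edges G = edges G'"
    using sub by (intro card_subset_eq finite_subset[OF E'V]) (use V' in auto)
  then show ?thesis unfolding isomorphic_def using inj im by (intro exI[of _ f]) (auto simp: bij_betw_def)
qed

lemma isomorphic_trans: "isomorphic G G' \<Longrightarrow> isomorphic G' G'' \<Longrightarrow> isomorphic G G''"
proof -
  assume "isomorphic G G'" "isomorphic G' G''"
  then obtain f g where f: "bij_betw f (verts G) (verts G')" "edges G' = (\<lambda>e. f ` e) ` edges G"
    and g: "bij_betw g (verts G') (verts G'')" "edges G'' = (\<lambda>e. g ` e) ` edges G'" by (auto simp: isomorphic_def)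
  have "bij_betw (g \<circ> f) (verts G) (verts G'')" using f(1) g(1) by (rule bij_betw_trans)
  moreover have "edges G'' = (\<lambda>e. (g \<circ> f) ` e) ` edges G" unfolding g(2) f(2) by (simp add: image_image)
  ultimately show ?thesis by (auto simp: isomorphic_def)
qed

text \<open>Shifting down by a suitable \<open>d < l\<close> moves class \<open>i\<close> into class
  \<open>j\<close>. Only elements not exceeding \<open>d\<close> are lost, and the only candidate is
  \<open>i\<close> itself.\<close>

lemma balanced_residues: "balanced l (\<lambda>i. card {v \<in> {1..N}. v mod l = i})"
  unfolding balanced_def
proof (intro allI impI)
  fix i j assume ij: "i < l" "j < l"
  let ?A = "{v \<in> {1..N}. v mod l = i}" and ?B = "{v \<in> {1..N}. v mod l = j}"
  define d where "d = (if j \<le> i then i - j else i + l - j)"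
  have d: "d < l" using ij by (auto simp: d_def)
  let ?A1 = "{v \<in> ?A. d < v}" and ?A2 = "{v \<in> ?A. v \<le> d}"
  have "?A = ?A1 \<union> ?A2" by auto
  then have "card ?A = card (?A1 \<union> ?A2)" by (rule arg_cong)
  also have "\<dots> \<le> card ?A1 + card ?A2" by (rule card_Un_le)
  finally have "card ?A \<le> card ?A1 + card ?A2" .
  moreover have "card ?A2 \<le> card {i}" using d by (intro card_mono) auto
  moreover have "card ?A1 \<le> card ?B"
  proof (rule card_inj_on_le)
    show "inj_on (\<lambda>v. v - d) ?A1" by (rule inj_onI) auto
    show "(\<lambda>v. v - d) ` ?A1 \<subseteq> ?B"
    proof clarify
      fix v assume v: "v \<in> {1..N}" "d < v" "i = v mod l"
      define w where "w = v - d"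
      have vw: "v = w + d" using v(2) by (simp add: w_def)
      define s where "s = w mod l"
      have s: "s < l" using ij by (simp add: s_def)
      have "(s + d) mod l = i" unfolding s_def v(3) vw by (simp add: mod_add_left_eq)
      moreover have "(s + d) mod l = (if s + d < l then s + d else s + d - l)" using s d by (simp add: mod_if)
      ultimately have "s = j" using s d ij unfolding d_def by (auto split: if_splits)
      then show "v - d \<in> {1..N} \<and> (v - d) mod l = j" using v by (auto simp: s_def w_def)
    qed
  qed simp
  ultimately show "card ?A \<le> Suc (card ?B)" by simp
qed

lemma turan_join_hjoin:
  assumes r: "2 \<le> r" and l: "0 < l" and t: "t \<le> n"
  shows "turan_join r l t n (hjoin r (complete_rgraph r t) (turan_rgraph r (n - t) l))"
proof -
  let ?G = "hjoin r (complete_rgraph r t) (turan_rgraph r (n - t) l)"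
  let ?T = "Inl ` {1..t} :: (nat + nat) set"
  let ?P = "\<lambda>i. Inr ` {v \<in> {1..n - t}. v mod l = i} :: (nat + nat) set"
  have V: "verts ?G = {1..t} <+> {1..n - t}" by (simp add: hjoin_def complete_rgraph_def turan_rgraph_def)
  have "(\<Union>i<l. {v \<in> {1..n - t}. v mod l = i}) = {1..n - t}" using l by auto
  then have U: "(\<Union>i<l. ?P i) = Inr ` {1..n - t}" by (simp only: image_UN[symmetric])
  have cr: "cross ?P {..<l} r = (\<lambda>e. Inr ` e) ` edges (turan_rgraph r (n - t) l)"
  proof (intro set_eqI iffI)
    fix e assume e: "e \<in> cross ?P {..<l} r"
    define e' where "e' = {v. Inr v \<in> e}"
    have "e \<subseteq> Inr ` {1..n - t}" using e U by (auto simp: cross_def)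
    then have ee: "e = Inr ` e'" "e' \<subseteq> {1..n - t}" by (auto simp: e'_def)
    have "card e' = r" using e ee(1) by (auto simp: cross_def card_image)
    moreover have "card (e' \<inter> {v \<in> {1..n - t}. v mod l = j}) \<le> 1" if "j < l" for j
    proof -
      have "e \<inter> ?P j = Inr ` (e' \<inter> {v \<in> {1..n - t}. v mod l = j})" unfolding ee(1) by (simp add: image_Int)
      moreover have "card (e \<inter> ?P j) \<le> 1" using e that by (auto simp: cross_def)
      ultimately show ?thesis by (simp add: card_image)
    qed
    ultimately show "e \<in> (\<lambda>e. Inr ` e) ` edges (turan_rgraph r (n - t) l)"
      using ee by (auto simp: turan_rgraph_def)
  next
    fix e :: "(nat + nat) set" assume "e \<in> (\<lambda>e. Inr ` e) ` edges (turan_rgraph r (n - t) l)"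
    then obtain e' where e': "e = Inr ` e'" "e' \<subseteq> {1..n - t}" "card e' = r"
      "\<And>j. j < l \<Longrightarrow> card (e' \<inter> {v \<in> {1..n - t}. v mod l = j}) \<le> 1" by (auto simp: turan_rgraph_def)
    have "card (e \<inter> ?P j) \<le> 1" if "j < l" for j
    proof -
      have "e \<inter> ?P j = Inr ` (e' \<inter> {v \<in> {1..n - t}. v mod l = j})" unfolding e'(1) by (simp add: image_Int)
      then show ?thesis using e'(4)[OF that] by (simp add: card_image)
    qed
    moreover have "finite e" "card e = r" using e' by (auto simp: card_image intro: finite_subset)
    ultimately show "e \<in> cross ?P {..<l} r" unfolding cross_def U using e' by auto
  qed
  have "edges ?G = {e. e \<subseteq> verts ?G \<and> card e = r \<and> e \<inter> ?T \<noteq> {}} \<union> cross ?P {..<l} r"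
  proof -
    have 1: "edges ?G = (\<lambda>e. Inl ` e) ` {e. e \<subseteq> {1..t} \<and> card e = r} \<union> cross ?P {..<l} r \<union>
      {e. e \<subseteq> {1..t} <+> {1..n - t} \<and> card e = r \<and> e \<inter> ?T \<noteq> {} \<and> e \<inter> Inr ` {1..n - t} \<noteq> {}}"
      unfolding cr by (simp add: hjoin_def complete_rgraph_def turan_rgraph_def)
    have 2: "(\<lambda>e. Inl ` e) ` {e. e \<subseteq> {1..t} \<and> card e = r} =
      {e. e \<subseteq> {1..t} <+> {1..n - t} \<and> card e = r \<and> e \<inter> ?T \<noteq> {} \<and> e \<inter> Inr ` {1..n - t} = {}}" (is "?L = ?R")
    proof (intro set_eqI iffI)
      fix e assume "e \<in> ?L"
      then obtain e' where "e = Inl ` e'" "e' \<subseteq> {1..t}" "card e' = r" by auto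
      moreover have "e' \<noteq> {}" using \<open>card e' = r\<close> r by auto
      ultimately show "e \<in> ?R" by (auto simp: card_image)
    next
      fix e assume e: "e \<in> ?R"
      define e' where "e' = {v. Inl v \<in> e}"
      have "e \<subseteq> Inl ` {1..t}" using e unfolding Plus_def by blast
      then have "e = Inl ` e'" "e' \<subseteq> {1..t}" by (auto simp: e'_def)
      then show "e \<in> ?L" using e by (auto simp: card_image)
    qed
    show ?thesis unfolding 1 2 V by blast
  qed
  moreover have "card (verts ?G) = n" unfolding V using t by (simp add: card_Plus)
  moreover have "disjoint_family_on ?P {..<l}" by (auto simp: disjoint_family_on_def)
  moreover have "(\<Union>i<l. ?P i) = verts ?G - ?T" unfolding U V by auto
  moreover have "balanced l (\<lambda>i. card (?P i))" using balanced_residues[of l "n - t"] by (simp add: card_image)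
  moreover have "card ?T = t" by (simp add: card_image)
  moreover have "?T \<subseteq> verts ?G" unfolding V by auto
  moreover have "finite (verts ?G)" unfolding V by simp
  ultimately show ?thesis unfolding turan_join_def by (intro conjI exI[of _ ?T] exI[of _ ?P]) auto
qed

lemma turan_join_exists:
  assumes l: "0 < l" and t: "t \<le> n"
  obtains G :: "nat hgraph" where "turan_join r l t n G"
proof -
  let ?T = "{n - t<..n}" and ?P = "\<lambda>i. {v \<in> {1..n - t}. v mod l = i}"
  let ?G = "({1..n}, {e. e \<subseteq> {1..n} \<and> card e = r \<and> e \<inter> ?T \<noteq> {}} \<union> cross ?P {..<l} r)"
  have "(\<Union>i<l. ?P i) = {1..n} - ?T" using l by auto
  then have "turan_join r l t n ?G" unfolding turan_join_def using balanced_residues t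
    by (intro conjI exI[of _ ?T] exI[of _ ?P]) (auto simp: disjoint_family_on_def)
  then show ?thesis using that by blast
qed

lemma turan_join_rgraph: "turan_join r l t n G \<Longrightarrow> rgraph r G"
  unfolding turan_join_def rgraph_def by (auto simp: cross_def)

section \<open>Disjoint copies\<close>

abbreviation remove_verts :: "'v hgraph \<Rightarrow> 'v set \<Rightarrow> 'v hgraph" where
  "remove_verts G W \<equiv> (verts G - W, {e \<in> edges G. e \<inter> W = {}})"

lemma embeds_remove_mono: "embeds f F (remove_verts G W) \<Longrightarrow> W' \<subseteq> W \<Longrightarrow> embeds f F (remove_verts G W')"
  unfolding embeds_def fst_conv snd_conv by blast

text \<open>The copy is not asked to contain \<open>v\<close>. Failure supplies a small set that
  leaves \<open>v\<close> in place and destroys all copies, so degree bounds for free hypergraphs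
  apply to \<open>v\<close>.\<close>

definition rich :: "nat \<Rightarrow> 'a hgraph \<Rightarrow> 'v hgraph \<Rightarrow> 'v \<Rightarrow> bool" where
  "rich K F G v \<longleftrightarrow> (\<forall>W. finite W \<and> card W \<le> K \<and> v \<notin> W \<longrightarrow> contains (remove_verts G W) F)"

text \<open>The vertices of \<open>T\<close> are released one by one. The earlier copies avoid the
  vertex being released, so its richness yields a further copy disjoint from them.\<close>

lemma disjoint_copies_add_rich:
  assumes fF: "finite (verts F)" and T: "finite T" "\<And>v. v \<in> T \<Longrightarrow> rich K F G v"
    and k: "contains_disjoint_copies k F (remove_verts G T)"
    and K: "(k + card T) * card (verts F) + card T \<le> K"
  shows "contains_disjoint_copies (k + card T) F G"
proof -
  have "contains_disjoint_copies (k + card A) F (remove_verts G (T - A))" if "finite A" "A \<subseteq> T" for A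
    using that
  proof (induction A rule: finite_induct)
    case empty then show ?case using k by simp
  next
    case (insert v A)
    let ?k = "k + card A"
    obtain f where f: "\<And>i. i < ?k \<Longrightarrow> embeds (f i) F (remove_verts G (T - A))"
      and dis: "disjoint_family_on (\<lambda>i. f i ` verts F) {..<?k}"
      using insert by (auto simp: contains_disjoint_copies_def)
    \<comment> \<open>The earlier copies and the vertices still to be released must be avoided; the
      latter keep the next steps possible.\<close>
    define W where "W = (\<Union>i<?k. f i ` verts F) \<union> (T - insert v A)"
    have "card (\<Union>i<?k. f i ` verts F) \<le> (\<Sum>i<?k. card (f i ` verts F))" by (rule card_UN_le) simp
    also have "\<dots> \<le> (\<Sum>i<?k. card (verts F))" by (intro sum_mono card_image_le fF)
    finally have 1: "card (\<Union>i<?k. f i ` verts F) \<le> ?k * card (verts F)" by simp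
    have "card W \<le> card (\<Union>i<?k. f i ` verts F) + card (T - insert v A)" unfolding W_def by (rule card_Un_le)
    also have "\<dots> \<le> ?k * card (verts F) + card T" using 1 T(1) by (intro add_mono card_mono) auto
    also have "\<dots> \<le> (k + card T) * card (verts F) + card T"
      using card_mono[OF T(1), of A] insert.prems by (intro add_mono mult_right_mono) auto
    finally have "card W \<le> K" using K by linarith
    moreover have "finite W" unfolding W_def using T(1) fF by auto
    moreover have "v \<notin> W"
    proof -
      have "v \<in> T - A" using insert by auto
      then have "v \<notin> f i ` verts F" if "i < ?k" for i using f[OF that] by (auto simp: embeds_def)
      then show ?thesis by (auto simp: W_def)
    qed
    ultimately obtain g where g: "embeds g F (remove_verts G W)"
      using T(2)[of v] insert.prems by (auto simp: rich_def contains_def)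
    let ?f = "f(?k := g)"
    have "embeds (?f i) F (remove_verts G (T - insert v A))" if "i < Suc ?k" for i
    proof (cases "i = ?k")
      case True
      then show ?thesis using embeds_remove_mono[OF g] by (simp add: W_def)
    next
      case False
      then show ?thesis using embeds_remove_mono[OF f, of i "T - insert v A"] that by auto
    qed
    moreover have "disjoint_family_on (\<lambda>i. ?f i ` verts F) {..<Suc ?k}"
      unfolding disjoint_family_on_def
    proof (intro ballI impI)
      have gW: "g ` verts F \<inter> W = {}" using g unfolding embeds_def fst_conv by blast
      have gd: "g ` verts F \<inter> f i ` verts F = {}" if "i < ?k" for i
        using gW that unfolding W_def by blast
      fix i j assume ij: "i \<in> {..<Suc ?k}" "j \<in> {..<Suc ?k}" "i \<noteq> j"
      then consider "i < ?k" "j < ?k" | "i = ?k" "j < ?k" | "i < ?k" "j = ?k" by force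
      then show "?f i ` verts F \<inter> ?f j ` verts F = {}"
      proof cases
        case 1 then show ?thesis using dis ij(3) by (simp add: disjoint_family_on_def)
      next
        case 2 then show ?thesis using gd[of j] by simp
      next
        case 3 then show ?thesis using gd[of i] by (simp add: Int_commute)
      qed
    qed
    ultimately have "contains_disjoint_copies (Suc ?k) F (remove_verts G (T - insert v A))"
      unfolding contains_disjoint_copies_def by blast
    then show ?case using insert.hyps by simp
  qed
  from this[OF T(1) order_refl] show ?thesis by simp
qed

text \<open>\<open>X\<close> is the union of a largest family of disjoint copies; a copy outside
  \<open>X\<close> would enlarge the family.\<close>

lemma maximal_packing:
  assumes fF: "finite (verts F)" and no: "\<not> contains_disjoint_copies (Suc k) F G"
  obtains q X where "q \<le> k" "finite X" "card X \<le> q * card (verts F)" "X \<subseteq> verts G"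
    "\<not> contains (remove_verts G X) F"
proof -
  have "\<exists>q\<le>k. contains_disjoint_copies q F G \<and> \<not> contains_disjoint_copies (Suc q) F G"
  proof (rule ccontr)
    assume c: "\<not> ?thesis"
    have "contains_disjoint_copies q F G" if "q \<le> Suc k" for q
      using that
    proof (induction q)
      case 0 show ?case by (auto simp: contains_disjoint_copies_def disjoint_family_on_def)
    next
      case (Suc q) then show ?case using c by auto
    qed
    then show False using no by blast
  qed
  then obtain q where q: "q \<le> k" "contains_disjoint_copies q F G" "\<not> contains_disjoint_copies (Suc q) F G" by blast
  then obtain f where f: "\<And>i. i < q \<Longrightarrow> embeds (f i) F G" and dis: "disjoint_family_on (\<lambda>i. f i ` verts F) {..<q}"
    by (auto simp: contains_disjoint_copies_def)
  define X where "X = (\<Union>i<q. f i ` verts F)"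
  have "card X \<le> (\<Sum>i<q. card (f i ` verts F))" unfolding X_def by (rule card_UN_le) simp
  also have "\<dots> \<le> (\<Sum>i<q. card (verts F))" by (intro sum_mono card_image_le fF)
  finally have "card X \<le> q * card (verts F)" by simp
  moreover have "X \<subseteq> verts G" using f by (auto simp: X_def embeds_def)
  moreover have "\<not> contains (remove_verts G X) F"
  proof
    assume "contains (remove_verts G X) F"
    then obtain g where g: "embeds g F (remove_verts G X)" by (auto simp: contains_def)
    let ?f = "f(q := g)"
    have "embeds g F G" using g by (auto simp: embeds_def)
    then have "embeds (?f i) F G" if "i < Suc q" for i using f that by (auto simp: less_Suc_eq)
    moreover have "disjoint_family_on (\<lambda>i. ?f i ` verts F) {..<Suc q}"
      unfolding disjoint_family_on_def
    proof (intro ballI impI)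
      have gX: "g ` verts F \<inter> X = {}" using g unfolding embeds_def fst_conv by blast
      have gd: "g ` verts F \<inter> f i ` verts F = {}" if "i < q" for i
        using gX that unfolding X_def by blast
      fix i j assume ij: "i \<in> {..<Suc q}" "j \<in> {..<Suc q}" "i \<noteq> j"
      then consider "i < q" "j < q" | "i = q" "j < q" | "i < q" "j = q" by force
      then show "?f i ` verts F \<inter> ?f j ` verts F = {}"
      proof cases
        case 1 then show ?thesis using dis ij(3) by (simp add: disjoint_family_on_def)
      next
        case 2 then show ?thesis using gd[of j] by simp
      next
        case 3 then show ?thesis using gd[of i] by (simp add: Int_commute)
      qed
    qed
    ultimately show False using q(3) unfolding contains_disjoint_copies_def by blast
  qed
  moreover have "finite X" using fF by (simp add: X_def)
  ultimately show ?thesis using that q(1) by blast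
qed

context expansion_family
begin

text \<open>Every two of the \<open>l + 1\<close> original vertices of the expansion lie in a common
  edge, so they do not fit into \<open>l\<close> parts and each copy must use a vertex of
  \<open>T\<close>.\<close>

lemma turan_join_no_copies:
  assumes "turan_join r l t n G"
  shows "\<not> contains_disjoint_copies (Suc t) H G"
proof
  assume "contains_disjoint_copies (Suc t) H G"
  then obtain f where f: "\<And>i. i < Suc t \<Longrightarrow> embeds (f i) H G"
    and dis: "disjoint_family_on (\<lambda>i. f i ` verts H) {..<Suc t}" by (auto simp: contains_disjoint_copies_def)
  obtain T P where V: "finite (verts G)" "card (verts G) = n" and T: "T \<subseteq> verts G" "card T = t"
    and P: "disjoint_family_on P {..<l}" "(\<Union>i<l. P i) = verts G - T" "balanced l (\<lambda>i. card (P i))"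
    and E: "edges G = {e. e \<subseteq> verts G \<and> card e = r \<and> e \<inter> T \<noteq> {}} \<union> cross P {..<l} r"
    by (rule turan_joinE[OF assms])
  have meet: "\<exists>x. x \<in> f i ` verts H \<inter> T" if i: "i < Suc t" for i
  proof (rule ccontr)
    assume no: "\<not> (\<exists>x. x \<in> f i ` verts H \<inter> T)"
    have inj: "inj_on (f i) (verts H)" and im: "f i ` verts H \<subseteq> verts G" and ed: "\<And>e. e \<in> edges H \<Longrightarrow> f i ` e \<in> edges G"
      using f[OF i] by (auto simp: embeds_def)
    have VH: "Inl v \<in> verts H" if "v \<in> verts F" for v using that by (simp add: expansion_def InlI)
    have "\<forall>v\<in>verts F. \<exists>j. j < l \<and> f i (Inl v) \<in> P j"
    proof
      fix v assume "v \<in> verts F"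
      then have "f i (Inl v) \<in> verts G - T" using VH im no by blast
      then show "\<exists>j. j < l \<and> f i (Inl v) \<in> P j" using P(2) by blast
    qed
    then obtain c where c: "\<And>v. v \<in> verts F \<Longrightarrow> c v < l \<and> f i (Inl v) \<in> P (c v)" by metis
    have "\<not> inj_on c (verts F)"
    proof
      assume "inj_on c (verts F)"
      then have "card (verts F) \<le> card {..<l}" using c by (intro card_inj_on_le[of c]) auto
      then show False using card_verts_F by simp
    qed
    then obtain v w where vw: "v \<in> verts F" "w \<in> verts F" "v \<noteq> w" "c v = c w" by (auto simp: inj_on_def)
    have "\<exists>e\<in>edges H. Inl v \<in> e \<and> Inl w \<in> e"
    proof (cases "{v, w} \<in> uncovered_pairs F")
      case True
      then have "Inl ` {v, w} \<union> Inr ` ({{v, w}} \<times> {..<r - 2}) \<in> edges H"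
        unfolding expansion_def snd_conv by (intro UnI2 imageI)
      then show ?thesis by (rule rev_bexI) simp
    next
      case False
      then obtain e where e: "e \<in> edges F" "{v, w} \<subseteq> e" using vw unfolding uncovered_pairs_def by auto
      then have "Inl ` e \<in> edges H" by (simp add: expansion_def)
      then show ?thesis by (rule rev_bexI) (use e in auto)
    qed
    then obtain e where e: "e \<in> edges H" "Inl v \<in> e" "Inl w \<in> e" by blast
    have "e \<subseteq> verts H"
    proof -
      have "edges F \<subseteq> Pow (verts F)" using F by (auto simp: rgraph_def)
      then show ?thesis using e(1) by (auto simp: expansion_def uncovered_pairs_def)
    qed
    then have "f i ` e \<inter> T = {}" using no by blast
    then have "f i ` e \<in> cross P {..<l} r" using ed[OF e(1)] E by auto
    then have "card (f i ` e \<inter> P (c v)) \<le> 1" "finite (f i ` e)" using c[OF vw(1)] by (auto simp: cross_def)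
    moreover have "{f i (Inl v), f i (Inl w)} \<subseteq> f i ` e \<inter> P (c v)" using e c[OF vw(1)] c[OF vw(2)] vw(4) by auto
    ultimately have "card {f i (Inl v), f i (Inl w)} \<le> 1" using card_mono by (meson finite_Int le_trans)
    moreover have "f i (Inl v) \<noteq> f i (Inl w)" using inj VH vw by (auto dest: inj_onD)
    ultimately show False by simp
  qed
  then obtain x where x: "\<And>i. i < Suc t \<Longrightarrow> x i \<in> f i ` verts H \<inter> T" by metis
  have "inj_on x {..<Suc t}"
  proof (rule inj_onI, rule ccontr)
    fix i j assume ij: "i \<in> {..<Suc t}" "j \<in> {..<Suc t}" "x i = x j" "i \<noteq> j"
    then have "f i ` verts H \<inter> f j ` verts H = {}" using dis by (simp add: disjoint_family_on_def)
    moreover have "x i \<in> f i ` verts H" "x i \<in> f j ` verts H" using x[of i] x[of j] ij by auto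
    ultimately show False by blast
  qed
  then have "card {..<Suc t} \<le> card T"
    using x finite_subset[OF T(1) V(1)] by (intro card_inj_on_le[of x]) auto
  then show False using T(2) by simp
qed

end

section \<open>The edge count for disjoint copies\<close>

lemma binomial_mono_left: "a choose j \<le> (a + k) choose j"
proof (induction k)
  case (Suc k)
  have "(a + k) choose j \<le> Suc (a + k) choose j" by (cases j) auto
  then show ?case using Suc by simp
qed simp

text \<open>Iterated Pascal rule; it bounds from below the edges gained from \<open>k\<close>
  further vertices joined to everything.\<close>

lemma binomial_add_ge: "k * (a choose j) + (a choose Suc j) \<le> (a + k) choose Suc j"
proof (induction k)
  case (Suc k)
  have "Suc k * (a choose j) + (a choose Suc j) \<le> ((a + k) choose j) + ((a + k) choose Suc j)"
    using Suc binomial_mono_left[of a j k] by simp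
  then show ?case by simp
qed simp

lemma binomial_ge_pow:
  assumes "k \<le> a"
  shows "(real a - real k) ^ k / fact k \<le> real (a choose k)"
proof -
  have "real (a choose k) = (\<Prod>i<k. real a - real i) / fact k"
    by (simp add: binomial_gbinomial gbinomial_prod_rev atLeast0LessThan)
  moreover have "(\<Prod>i<k. real a - real k) \<le> (\<Prod>i<k. real a - real i)"
    using assms by (intro prod_mono) auto
  ultimately show ?thesis by (simp add: divide_right_mono)
qed

lemma card_edges_through_meeting_le:
  assumes G: "rgraph r (V, E)" and r: "2 \<le> r" and W: "finite W" "v \<notin> W"
  shows "card {e \<in> E. v \<in> e \<and> e \<inter> W \<noteq> {}} \<le> card W * card V ^ (r - 2)"
proof -
  have fV: "finite V" and eE: "\<And>e. e \<in> E \<Longrightarrow> e \<subseteq> V \<and> card e = r" using G by (auto simp: rgraph_def)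
  have fE: "finite E" by (rule rgraph_finite_edges[OF G])
  let ?D = "\<lambda>w. {e \<in> E. v \<in> e \<and> w \<in> e}"
  have "{e \<in> E. v \<in> e \<and> e \<inter> W \<noteq> {}} \<subseteq> (\<Union>w\<in>W. ?D w)" by auto
  then have "card {e \<in> E. v \<in> e \<and> e \<inter> W \<noteq> {}} \<le> card (\<Union>w\<in>W. ?D w)"
    by (rule card_mono[rotated]) (use W(1) fE in auto)
  also have "\<dots> \<le> (\<Sum>w\<in>W. card (?D w))" by (rule card_UN_le[OF W(1)])
  also have "\<dots> \<le> (\<Sum>w\<in>W. card V ^ (r - 2))"
  proof (rule sum_mono)
    fix w assume w: "w \<in> W"
    show "card (?D w) \<le> card V ^ (r - 2)"
    proof (cases "v \<in> V \<and> w \<in> V")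
      case True
      have "v \<noteq> w" using w W(2) by auto
      then have c: "card {v, w} = 2" by simp
      have "card (?D w) \<le> card {e. {v, w} \<subseteq> e \<and> e \<subseteq> V \<and> card e = r}"
        using eE fV by (intro card_mono) auto
      also have "\<dots> \<le> card V ^ (r - card {v, w})" using True fV r c by (intro card_supersets_le) auto
      finally show ?thesis using c by simp
    next
      case False
      then have "?D w = {}" using eE by blast
      then show ?thesis by (metis card.empty zero_le)
    qed
  qed
  finally show ?thesis by simp
qed

context expansion_family
begin

lemma bounded_degree:
  assumes \<eta>: "0 < \<eta>"
  obtains \<epsilon> N where "0 < \<epsilon>" "\<And>(V :: nat set) E v. rgraph r (V, E) \<Longrightarrow> \<not> contains (V, E) H \<Longrightarrow> N \<le> card V \<Longrightarrow>
    (alpha l r - \<epsilon>) * real (card V) ^ r \<le> real (card E) \<Longrightarrow>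
    real (degree E v) \<le> (beta l r + \<eta>) * real (card V) ^ (r - 1)"
  using free_classification[OF \<eta>]
  by - (elim exE conjE, rule that, assumption, (drule spec)+, (drule mp, assumption)+, drule conjunct1, erule spec)

text \<open>The edge count: removing \<open>k\<close> disjoint copies of \<open>H\<close> without rich vertices costs far fewer
  edges than \<open>k\<close> rich vertices would contribute.\<close>

lemma extremal_structure:
  "\<exists>(N :: nat) c. 0 < c \<and> (\<forall>n t (G :: nat hgraph). N \<le> n \<longrightarrow> real t \<le> c * real n \<longrightarrow>
    rgraph r G \<longrightarrow> card (verts G) = n \<longrightarrow> \<not> contains_disjoint_copies (Suc t) H G \<longrightarrow>
    join_size r l t n \<le> card (edges G) \<longrightarrow>
    card (edges G) = join_size r l t n \<and> turan_join r l t n G)"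
proof -
  let ?\<alpha> = "alpha l r" and ?\<beta> = "beta l r" and ?M = "real m"
  have a0: "0 < ?\<alpha>" using alpha_pos[OF rl] l0 by simp
  have b0: "0 < ?\<beta>" by (rule beta_pos)
  \<comment> \<open>The advantage, per \<open>n^(r-1)\<close>, of a vertex in all possible edges
    over a Turan vertex.\<close>
  define \<gamma> where "\<gamma> = 1 / fact (r - 1) - ?\<beta>"
  have \<gamma>: "0 < \<gamma>" using beta_less[OF r2 rl] by (simp add: \<gamma>_def)
  \<comment> \<open>The final comparison fails once \<open>(2 + 4 * m) * \<eta> < \<gamma>\<close>;
    the bound by \<open>beta\<close> keeps \<open>beta - \<eta>\<close> nonnegative.\<close>
  define \<eta> where "\<eta> = min (\<gamma> / (2 * (2 + 4 * ?M))) ?\<beta>"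
  have \<eta>: "0 < \<eta>" "\<eta> \<le> ?\<beta>" "\<eta> \<le> \<gamma> / (2 * (2 + 4 * ?M))" using \<gamma> b0 by (auto simp: \<eta>_def add_pos_nonneg)
  have \<eta>': "(2 + 4 * ?M) * \<eta> < \<gamma>"
  proof -
    have "0 < 2 + 4 * ?M" by (simp add: add_pos_nonneg)
    then have "2 * ((2 + 4 * ?M) * \<eta>) \<le> \<gamma>" using \<eta>(3) by (simp add: field_simps)
    then show ?thesis using \<gamma> by linarith
  qed
  obtain \<epsilon>f Nf where ef: "0 < \<epsilon>f" and bd: "\<And>(V :: nat set) E v. rgraph r (V, E) \<Longrightarrow> \<not> contains (V, E) H \<Longrightarrow> Nf \<le> card V \<Longrightarrow>
    (?\<alpha> - \<epsilon>f) * real (card V) ^ r \<le> real (card E) \<Longrightarrow> real (degree E v) \<le> (?\<beta> + \<eta>) * real (card V) ^ (r - 1)"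
  proof (rule bounded_degree[OF \<eta>(1)])
    fix \<epsilon> N assume "0 < \<epsilon>" and "\<And>(V :: nat set) E v. rgraph r (V, E) \<Longrightarrow> \<not> contains (V, E) H \<Longrightarrow> N \<le> card V \<Longrightarrow>
      (?\<alpha> - \<epsilon>) * real (card V) ^ r \<le> real (card E) \<Longrightarrow> real (degree E v) \<le> (?\<beta> + \<eta>) * real (card V) ^ (r - 1)"
    then show thesis by (rule that)
  qed
  define \<epsilon> where "\<epsilon> = min \<epsilon>f ?\<alpha>"
  have \<epsilon>: "0 < \<epsilon>" "\<epsilon> \<le> \<epsilon>f" "\<epsilon> \<le> ?\<alpha>" using ef a0 by (auto simp: \<epsilon>_def)
  have e4: "0 < \<epsilon> / 4" using \<epsilon> by simp
  obtain \<omega> Ns where w0: "0 < \<omega>" and st: "\<And>n j. n \<ge> Ns \<Longrightarrow> real j \<le> \<omega> * real n \<Longrightarrow>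
     real j * (?\<beta> - \<eta>) * real n ^ (r - 1) \<le> real (tau l r n) - real (tau l r (n - j))
     \<and> real (tau l r n) - real (tau l r (n - j)) \<le> real j * (?\<beta> + \<eta>) * real n ^ (r - 1)"
    using tau_step_asymp[OF r2 rl \<eta>(1)]
    by - (elim exE conjE, rule that, assumption, (drule spec, drule mp, assumption)+, assumption)
  obtain Na where Na: "\<And>n. n \<ge> Na \<Longrightarrow> (?\<alpha> - \<epsilon> / 4) * real n ^ r \<le> real (tau l r n)"
    using tau_asymp[OF l0(1) e4, of r] by blast
  obtain Nt where Nt: "\<And>(V :: nat set) E. rgraph r (V, E) \<Longrightarrow> \<not> contains (V, E) H \<Longrightarrow> Nt \<le> card V \<Longrightarrow>
    tau l r (card V) \<le> card E \<Longrightarrow>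
    card E = tau l r (card V) \<and> (\<exists>P. disjoint_family_on P {..<l} \<and> (\<Union>i<l. P i) = V \<and>
      E = cross P {..<l} r \<and> balanced l (\<lambda>i. card (P i)))"
    using free_turan by - (elim exE, rule that, (drule spec)+, (drule mp, assumption)+, assumption)
  \<comment> \<open>With \<open>c = \<mu> / B\<close>, each of these summands times \<open>c\<close>
    is at most \<open>\<mu>\<close>: the first controls \<open>K\<close>, the second the powers lost
    by removing up to \<open>c * n\<close> vertices, the third, together with the first, the edge
    density after deleting a blocking set.\<close>
  define B where "B = 4 * (?M + 1) + (?\<beta> + 2) * real r + 2 * (?\<beta> + \<eta>)"
  have Bpos: "1 \<le> B" "0 \<le> (?\<beta> + 2) * real r" "0 \<le> 2 * (?\<beta> + \<eta>)" "0 \<le> 4 * (?M + 1)"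
    using b0 \<eta>(1) by (auto simp: B_def intro!: add_increasing2 add_nonneg_nonneg mult_nonneg_nonneg)
  define \<mu> where "\<mu> = min 1 (min \<omega> (min \<eta> \<epsilon>))"
  have \<mu>: "0 < \<mu>" "\<mu> \<le> 1" "\<mu> \<le> \<omega>" "\<mu> \<le> \<eta>" "\<mu> \<le> \<epsilon>" using w0 \<eta>(1) \<epsilon>(1) by (auto simp: \<mu>_def)
  define c where "c = \<mu> / B"
  have c: "0 < c" using \<mu> Bpos(1) by (simp add: c_def)
  have cB: "c * B = \<mu>" using Bpos(1) by (simp add: c_def)
  have cB1: "c * (4 * (?M + 1)) \<le> \<mu>" "c * ((?\<beta> + 2) * real r) \<le> \<mu>" "c * (4 * (?M + 1) + 2 * (?\<beta> + \<eta>)) \<le> \<mu>"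
    unfolding cB[symmetric] using c Bpos by (auto simp: B_def intro!: mult_left_mono)
  have c14: "c * 4 \<le> \<mu>"
  proof -
    have "c * 4 \<le> c * (4 * (?M + 1))" using c by (intro mult_left_mono) auto
    then show ?thesis using cB1(1) by linarith
  qed
  define N where "N = Max {2 * Ns, 2 * Nf, 2 * Nt, Na, nat \<lceil>1 / c\<rceil>, nat \<lceil>real r / c\<rceil>}"
  have NN: "2 * Ns \<le> N" "2 * Nf \<le> N" "2 * Nt \<le> N" "Na \<le> N" "nat \<lceil>1 / c\<rceil> \<le> N" "nat \<lceil>real r / c\<rceil> \<le> N"
    unfolding N_def by (rule Max_ge; simp)+
  show ?thesis
  proof (rule exI[of _ N], rule exI[of _ c], intro conjI c allI impI)
    fix n t :: nat and G :: "nat hgraph"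
    assume nN: "N \<le> n" and t: "real t \<le> c * real n" and G': "rgraph r G" and cV: "card (verts G) = n"
      and no: "\<not> contains_disjoint_copies (Suc t) H G" and big: "join_size r l t n \<le> card (edges G)"
    define V E where "V = verts G" and "E = edges G"
    have GVE: "G = (V, E)" by (simp add: V_def E_def)
    have G: "rgraph r (V, E)" using G' GVE by simp
    have cV: "card V = n" using cV by (simp add: V_def)
    have fV: "finite V" using G by (simp add: rgraph_def)
    have fE: "finite E" by (rule rgraph_finite_edges[OF G])
    have eE: "e \<subseteq> V" "card e = r" if "e \<in> E" for e using G that by (auto simp: rgraph_def)
    have big: "join_size r l t n \<le> card E" using big by (simp add: E_def)
    let ?x = "real n" and ?X = "real n ^ (r - 1)"
    have cx1: "1 \<le> c * ?x"
    proof -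
      have "1 / c \<le> ?x" using NN(5) nN by linarith
      then show ?thesis using c by (simp add: field_simps)
    qed
    have cxr: "real r \<le> c * ?x"
    proof -
      have "real r / c \<le> ?x" using NN(6) nN by linarith
      then show ?thesis using c by (simp add: field_simps)
    qed
    have x0: "0 < ?x" using cx1 c by (cases "n = 0") auto
    have X0: "0 < ?X" using x0 by simp
    have xX: "?x * ?X = ?x ^ r" using r2 by (cases r) auto
    have cxM: "c * ?x * (4 * (?M + 1)) \<le> \<mu> * ?x" using mult_right_mono[OF cB1(1), of ?x] by (simp add: mult_ac)
    have cx4: "c * ?x * 4 \<le> \<mu> * ?x" using mult_right_mono[OF c14, of ?x] by (simp add: mult_ac)
    have \<mu>x: "\<mu> * ?x \<le> ?x" "\<mu> * ?x \<le> \<omega> * ?x" using \<mu> x0 by (auto intro!: mult_right_mono)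
    have tn: "t \<le> n"
    proof -
      have "real t \<le> ?x" using t cx4 \<mu>x(1) cx1 by linarith
      then show ?thesis by simp
    qed
    \<comment> \<open>Room for \<open>t + 1\<close> copies of \<open>H\<close> and for
      \<open>t + 1\<close> rich vertices, as \<open>disjoint_copies_add_rich\<close>
      requires.\<close>
    define K where "K = Suc t * Suc m"
    have K: "real K \<le> 2 * (c * ?x) * (?M + 1)"
    proof -
      have "real K = (real t + 1) * (?M + 1)" by (simp add: K_def algebra_simps)
      also have "\<dots> \<le> (2 * (c * ?x)) * (?M + 1)" using t cx1 by (intro mult_right_mono) auto
      finally show ?thesis .
    qed
    have K2: "2 * real K \<le> ?x" using K cxM \<mu>x(1) by (simp add: algebra_simps)
    have KX: "real K * ?X \<le> 2 * c * (?M + 1) * ?x ^ r"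
    proof -
      have "real K * ?X \<le> 2 * (c * ?x) * (?M + 1) * ?X" using K by (rule mult_right_mono) simp
      also have "\<dots> = 2 * c * (?M + 1) * (?x * ?X)" by (simp add: mult_ac)
      finally show ?thesis using xX by simp
    qed
    \<comment> \<open>Only the Turan part of \<open>join_size\<close> is kept; with
      \<open>t \<le> c * n\<close> its density is already close to \<open>alpha\<close>.\<close>
    have join_low: "(?\<alpha> - \<epsilon> / 4 - c * (?\<beta> + \<eta>)) * ?x ^ r \<le> real (card E)"
    proof -
      have "real t \<le> \<omega> * ?x" using t cx4 \<mu>x(2) cx1 by linarith
      moreover have "Ns \<le> n" using NN(1) nN by linarith
      ultimately have "real (tau l r n) - real (tau l r (n - t)) \<le> real t * (?\<beta> + \<eta>) * ?X" using st by blast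
      also have "\<dots> \<le> (c * ?x) * (?\<beta> + \<eta>) * ?X" using t b0 \<eta>(1) by (intro mult_right_mono) auto
      also have "\<dots> = c * (?\<beta> + \<eta>) * (?x * ?X)" by (simp add: mult_ac)
      finally have "real (tau l r n) - c * (?\<beta> + \<eta>) * ?x ^ r \<le> real (tau l r (n - t))" using xX by simp
      moreover have "(?\<alpha> - \<epsilon> / 4) * ?x ^ r \<le> real (tau l r n)" using Na NN(4) nN by simp
      moreover have "tau l r (n - t) \<le> card E" using big unfolding join_size_def by linarith
      ultimately have "(?\<alpha> - \<epsilon> / 4) * ?x ^ r - c * (?\<beta> + \<eta>) * ?x ^ r \<le> real (card E)" by linarith
      then show ?thesis by (simp add: left_diff_distrib)
    qed
    \<comment> \<open>Removing the blocking set leaves a dense free hypergraph containing all edges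
      at \<open>v\<close> that avoid the set; the others number at most
      \<open>K * n^(r-2)\<close>.\<close>
    have deg: "real (degree E v) \<le> (?\<beta> + 2 * \<eta>) * ?X" if v: "\<not> rich K H G v" for v
    proof -
      obtain W where W: "finite W" "card W \<le> K" "v \<notin> W" "\<not> contains (remove_verts G W) H"
        using v by (auto simp: rich_def)
      define V' E' where "V' = V - W" and "E' = {e \<in> E. e \<inter> W = {}}"
      have free: "\<not> contains (V', E') H" using W(4) by (simp add: V'_def E'_def V_def E_def)
      have G'': "rgraph r (V', E')" using G by (auto simp: rgraph_def V'_def E'_def)
      have "n \<le> card V' + card W"
        using card_mono[of "V' \<union> W" V] card_Un_le[of V' W] fV W(1) cV by (auto simp: V'_def)
      then have "2 * Nf \<le> 2 * card V'" using K2 W(2) NN(2) nN by linarith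
      then have nf: "Nf \<le> card V'" by simp
      have V'n: "card V' \<le> n" unfolding cV[symmetric] V'_def using fV by (intro card_mono) auto
      have "(\<Sum>w\<in>W. degree E w) \<le> (\<Sum>w\<in>W. n ^ (r - 1))"
        using degree_le_pow[OF G] r2 cV by (intro sum_mono) auto
      also have "\<dots> \<le> K * n ^ (r - 1)" using W(2) by simp
      finally have "card E \<le> card E' + K * n ^ (r - 1)"
        using card_edges_split[OF fE, of W] card_edges_meeting_le[OF fE W(1)] by (simp add: E'_def)
      then have "real (card E) \<le> real (card E' + K * n ^ (r - 1))" by (rule of_nat_mono)
      then have "real (card E) \<le> real (card E') + real K * ?X" by simp
      then have 1: "(?\<alpha> - \<epsilon> / 4 - c * (?\<beta> + \<eta>)) * ?x ^ r - 2 * c * (?M + 1) * ?x ^ r \<le> real (card E')"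
        using join_low KX by linarith
      have "\<epsilon> / 4 + c * (?\<beta> + \<eta>) + 2 * c * (?M + 1) \<le> \<epsilon>"
      proof -
        have "2 * (c * (?\<beta> + \<eta>) + 2 * c * (?M + 1)) = c * (4 * (?M + 1) + 2 * (?\<beta> + \<eta>))" by (simp add: algebra_simps)
        then have "2 * (c * (?\<beta> + \<eta>) + 2 * c * (?M + 1)) \<le> \<epsilon>" using cB1(3) \<mu>(5) by linarith
        moreover have "\<epsilon> / 4 + y \<le> \<epsilon>" if "2 * y \<le> \<epsilon>" for y using that \<epsilon>(1) by simp
        ultimately show ?thesis unfolding add.assoc by blast
      qed
      then have "(?\<alpha> - \<epsilon>) * ?x ^ r \<le> (?\<alpha> - \<epsilon> / 4 - c * (?\<beta> + \<eta>) - 2 * c * (?M + 1)) * ?x ^ r"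
        by (intro mult_right_mono) auto
      also have "\<dots> = (?\<alpha> - \<epsilon> / 4 - c * (?\<beta> + \<eta>)) * ?x ^ r - 2 * c * (?M + 1) * ?x ^ r" by (rule left_diff_distrib)
      finally have 2: "(?\<alpha> - \<epsilon>) * ?x ^ r \<le> real (card E')" using 1 by linarith
      have "(?\<alpha> - \<epsilon>f) * real (card V') ^ r \<le> (?\<alpha> - \<epsilon>) * real (card V') ^ r"
        using \<epsilon>(2) by (intro mult_right_mono) auto
      also have "\<dots> \<le> (?\<alpha> - \<epsilon>) * ?x ^ r" using \<epsilon>(3) V'n by (intro mult_left_mono power_mono) auto
      finally have "(?\<alpha> - \<epsilon>f) * real (card V') ^ r \<le> real (card E')" using 2 by linarith
      from bd[OF G'' free nf this] have "real (degree E' v) \<le> (?\<beta> + \<eta>) * real (card V') ^ (r - 1)" .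
      also have "\<dots> \<le> (?\<beta> + \<eta>) * ?X" using V'n b0 \<eta>(1) by (intro mult_left_mono power_mono) auto
      finally have 3: "real (degree E' v) \<le> (?\<beta> + \<eta>) * ?X" .
      have "{e \<in> E. v \<in> e} = {e \<in> E'. v \<in> e} \<union> {e \<in> E. v \<in> e \<and> e \<inter> W \<noteq> {}}" by (auto simp: E'_def)
      then have d1: "degree E v \<le> degree E' v + card {e \<in> E. v \<in> e \<and> e \<inter> W \<noteq> {}}"
        unfolding degree_def by (simp only: card_Un_le)
      have d2: "card {e \<in> E. v \<in> e \<and> e \<inter> W \<noteq> {}} \<le> card W * n ^ (r - 2)"
        using card_edges_through_meeting_le[OF G r2 W(1,3)] cV by simp
      have d3: "card W * n ^ (r - 2) \<le> K * n ^ (r - 2)" using W(2) by simp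
      have "degree E v \<le> degree E' v + K * n ^ (r - 2)" using d1 d2 d3 by linarith
      then have "real (degree E v) \<le> real (degree E' v + K * n ^ (r - 2))" by (rule of_nat_mono)
      then have 4: "real (degree E v) \<le> real (degree E' v) + real K * ?x ^ (r - 2)" by simp
      have "real K * ?x ^ (r - 2) \<le> \<eta> * ?x * ?x ^ (r - 2)"
      proof (rule mult_right_mono)
        have "2 * real K \<le> \<mu> * ?x" using K cxM by (simp add: algebra_simps)
        also have "\<dots> \<le> \<eta> * ?x" using \<mu>(4) by (rule mult_right_mono) simp
        finally show "real K \<le> \<eta> * ?x" by simp
      qed simp
      also have "\<dots> = \<eta> * ?x ^ Suc (r - 2)" by simp
      also have "Suc (r - 2) = r - 1" using r2 by simp
      finally show ?thesis using 3 4 by (simp add: algebra_simps)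
    qed
    have fH: "finite (verts H)"
      using finite_uncovered_pairs[OF F] F by (simp add: expansion_def rgraph_def)
    define T where "T = {v \<in> V. rich K H G v}"
    have TV: "T \<subseteq> V" "finite T" using fV by (auto simp: T_def)
    have sT: "card T \<le> t"
    proof (rule ccontr)
      assume "\<not> card T \<le> t"
      then obtain T' where T': "T' \<subseteq> T" "card T' = Suc t" by (meson not_less_eq_eq obtain_subset_with_card_n)
      have fT': "finite T'" using T'(1) TV(2) by (rule finite_subset)
      have "contains_disjoint_copies (0 + card T') H G"
      proof (rule disjoint_copies_add_rich[OF fH fT'])
        show "rich K H G v" if "v \<in> T'" for v using that T'(1) by (auto simp: T_def)
        show "contains_disjoint_copies 0 H (remove_verts G T')"
          by (auto simp: contains_disjoint_copies_def disjoint_family_on_def)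
        show "(0 + card T') * m + card T' \<le> K" by (simp add: T'(2) K_def)
      qed
      then show False using no T'(2) by simp
    qed
    \<comment> \<open>The number of copies still permitted after each rich vertex has absorbed one;
      the goal is \<open>k = 0\<close>.\<close>
    define k where "k = t - card T"
    have noT: "\<not> contains_disjoint_copies (Suc k) H (remove_verts G T)"
    proof
      assume "contains_disjoint_copies (Suc k) H (remove_verts G T)"
      then have "contains_disjoint_copies (Suc k + card T) H G"
      proof (rule disjoint_copies_add_rich[OF fH TV(2), rotated])
        show "rich K H G v" if "v \<in> T" for v using that by (auto simp: T_def)
        have "Suc k + card T = Suc t" using sT by (simp add: k_def)
        then show "(Suc k + card T) * m + card T \<le> K" using sT by (simp add: K_def)
      qed
      then show False using no sT by (simp add: k_def)
    qed
    obtain q X where q: "q \<le> k" "finite X" "card X \<le> q * m" "X \<subseteq> V - T"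
      and freeR0: "\<not> contains (remove_verts (remove_verts G T) X) H"
      using maximal_packing[OF fH noT] by (auto simp: V_def)
    define R ER where "R = V - T - X" and "ER = {e \<in> E. e \<inter> T = {} \<and> e \<inter> X = {}}"
    have freeR: "\<not> contains (R, ER) H"
      using freeR0 by (simp add: R_def ER_def V_def E_def conj_assoc cong: conj_cong)
    have GR: "rgraph r (R, ER)" using G by (auto simp: rgraph_def R_def ER_def)
    define s p where "s = card T" and "p = card X"
    have pk: "p \<le> k * m" using q(1,3) unfolding p_def by (meson le_trans mult_le_mono1)
    have cR: "card R = n - s - p"
      using TV q(2,4) fV cV by (simp add: R_def s_def p_def card_Diff_subset)
    have sk: "s + k = t" using sT by (simp add: k_def s_def)
    have rk: "real k \<le> c * ?x" "real s \<le> c * ?x" using t sk by linarith+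
    have rp: "real p \<le> real k * ?M" using pk by (metis of_nat_le_iff of_nat_mult)
    have kM: "real k * ?M \<le> c * ?x * ?M" using rk(1) by (rule mult_right_mono) simp
    have c44: "c * ?x * (4 * (?M + 1)) = 4 * (c * ?x * ?M) + 4 * (c * ?x)" by (simp add: algebra_simps)
    have small: "4 * (c * ?x * ?M) + 4 * (c * ?x) \<le> \<mu> * ?x" using cxM c44 by simp
    have "2 * (a + b) \<le> x" if "a \<le> u" "b \<le> v" "4 * v + 4 * u \<le> w" "w \<le> x" "0 < x" for a b u v w x :: real
      using that by argo
    then have sp: "2 * (real s + real p) \<le> ?x" using rk(2) order_trans[OF rp kM] small \<mu>x(1) x0 by blast
    then have "real (2 * (s + p)) \<le> real n" by simp
    then have sp': "2 * (s + p) \<le> n" by (simp only: of_nat_le_iff)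
    then have "n = card R + (s + p)" using cR by simp
    then have nR: "Nt \<le> card R" using sp' NN(3) nN by presburger
    have leR: "card ER \<le> tau l r (card R)" using Nt[OF GR freeR nR] by linarith
    let ?E1 = "{e \<in> E. e \<inter> T \<noteq> {}}" and ?E2 = "{e \<in> E. e \<inter> X \<noteq> {}}" and ?A = "{e. e \<subseteq> V \<and> card e = r \<and> e \<inter> T \<noteq> {}}"
    have fA: "finite ?A" using fV by simp
    have E1A: "?E1 \<subseteq> ?A" using eE by auto
    have cA: "card ?A = (n choose r) - ((n - s) choose r)"
      using card_meeting[OF fV TV(1)] cV by (simp add: s_def)
    have E1: "card ?E1 \<le> card ?A" by (rule card_mono[OF fA E1A])
    have "E \<subseteq> ?E1 \<union> ?E2 \<union> ER" by (auto simp: ER_def)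
    then have "card E \<le> card (?E1 \<union> ?E2 \<union> ER)" using fE by (intro card_mono) (auto simp: ER_def)
    also have "\<dots> \<le> card ?E1 + card ?E2 + card ER" by (meson add_le_mono card_Un_le le_refl order_trans)
    finally have cE: "card E \<le> card ?E1 + card ?E2 + card ER" .
    have k0: "k = 0"
    proof (rule ccontr)
      assume "k \<noteq> 0"
      then have kpos: "0 < real k" by simp
      define n1 where "n1 = n - s"
      have n1: "n1 - k = n - t" "n1 - p = card R" "real n1 = ?x - real s" "n1 \<le> n"
        using sk tn cR by (auto simp: n1_def)
      have n1x: "(1 - c) * ?x \<le> real n1" using n1(3) rk(2) by (simp add: algebra_simps)
      have n1h: "?x \<le> 2 * real n1" using sp n1(3) of_nat_0_le_iff[of p] by (simp add: algebra_simps)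
      have c1: "c \<le> 1 / 4" using c14 \<mu>(2) by linarith
      have rc: "real r * c \<le> 1" "?\<beta> * (real r * c) \<le> \<eta>" "2 * (real r * c) \<le> \<eta>"
      proof -
        have e: "c * ((?\<beta> + 2) * real r) = ?\<beta> * (real r * c) + 2 * (real r * c)" by (simp add: algebra_simps)
        have "0 \<le> ?\<beta> * (real r * c)" "0 \<le> real r * c" using b0 c by auto
        then show "real r * c \<le> 1" "?\<beta> * (real r * c) \<le> \<eta>" "2 * (real r * c) \<le> \<eta>"
          using cB1(2) \<mu>(2,4) e by linarith+
      qed
      have n1X: "(1 - real r * c) * ?X \<le> real n1 ^ (r - 1)"
      proof -
        have "1 + real (r - 1) * (- c) \<le> (1 + (- c)) ^ (r - 1)" by (rule Bernoulli_inequality) (use c1 in simp)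
        moreover have "real (r - 1) * c \<le> real r * c" using c by (intro mult_right_mono) auto
        ultimately have "1 - real r * c \<le> (1 - c) ^ (r - 1)" by simp
        then have "(1 - real r * c) * ?X \<le> (1 - c) ^ (r - 1) * ?X" by (rule mult_right_mono) simp
        also have "\<dots> = ((1 - c) * ?x) ^ (r - 1)" by (simp add: power_mult_distrib)
        also have "\<dots> \<le> real n1 ^ (r - 1)" using n1x c1 by (intro power_mono) auto
        finally show ?thesis .
      qed
      have \<omega>n1: "\<omega> * ?x \<le> 2 * (\<omega> * real n1)" using mult_left_mono[OF n1h, of \<omega>] w0 by simp
      have Nsn1: "Ns \<le> n1" using n1h NN(1) nN by linarith
      have pw: "real p \<le> \<omega> * real n1" using rp kM small \<mu>x(2) \<omega>n1 cx1 by linarith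
      have kw: "real k \<le> \<omega> * real n1"
      proof -
        have "0 \<le> c * ?x * ?M" using c by simp
        then show ?thesis using rk(1) small \<mu>x(2) \<omega>n1 cx1 by linarith
      qed
      \<comment> \<open>Both Turan numbers are compared with the one on \<open>n1 = n - s\<close>
        vertices: \<open>R\<close> has \<open>p\<close> vertices fewer, the target configuration
        \<open>k\<close> fewer.\<close>
      have t1: "real p * (?\<beta> - \<eta>) * real n1 ^ (r - 1) \<le> real (tau l r n1) - real (tau l r (card R))"
        using st[OF Nsn1 pw] n1(2) by simp
      have t2: "real (tau l r n1) - real (tau l r (n - t)) \<le> real k * (?\<beta> + \<eta>) * real n1 ^ (r - 1)"
        using st[OF Nsn1 kw] n1(1) by simp
      have "real n1 ^ (r - 1) \<le> ?X" using n1(4) by (intro power_mono) auto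
      then have "real k * (?\<beta> + \<eta>) * real n1 ^ (r - 1) \<le> real k * (?\<beta> + \<eta>) * ?X"
        using b0 \<eta>(1) by (intro mult_left_mono) auto
      then have t2': "real (tau l r n1) - real (tau l r (n - t)) \<le> real k * (?\<beta> + \<eta>) * ?X" using t2 by linarith
      have "(?\<beta> - 2 * \<eta>) * ?X \<le> (?\<beta> - \<eta>) * ((1 - real r * c) * ?X)"
      proof -
        have "(?\<beta> - \<eta>) * (1 - real r * c) = ?\<beta> - \<eta> - ?\<beta> * (real r * c) + \<eta> * (real r * c)" by (simp add: algebra_simps)
        moreover have "0 \<le> \<eta> * (real r * c)" using \<eta>(1) c by simp
        ultimately have "?\<beta> - 2 * \<eta> \<le> (?\<beta> - \<eta>) * (1 - real r * c)" using rc(2) by linarith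
        then have "(?\<beta> - 2 * \<eta>) * ?X \<le> ((?\<beta> - \<eta>) * (1 - real r * c)) * ?X" by (rule mult_right_mono) simp
        then show ?thesis by (simp only: mult.assoc)
      qed
      also have "\<dots> \<le> (?\<beta> - \<eta>) * real n1 ^ (r - 1)" using n1X \<eta>(2) by (intro mult_left_mono) auto
      finally have "real p * ((?\<beta> - 2 * \<eta>) * ?X) \<le> real p * ((?\<beta> - \<eta>) * real n1 ^ (r - 1))" by (rule mult_left_mono) simp
      then have t1': "real p * ((?\<beta> - 2 * \<eta>) * ?X) \<le> real (tau l r n1) - real (tau l r (card R))"
        using t1 by (simp only: mult.assoc)
      have "card ?E2 \<le> (\<Sum>v\<in>X. degree E v)" by (rule card_edges_meeting_le[OF fE q(2)])
      then have "real (card ?E2) \<le> real (\<Sum>v\<in>X. degree E v)" by (rule of_nat_mono)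
      also have "\<dots> = (\<Sum>v\<in>X. real (degree E v))" by simp
      also have "\<dots> \<le> (\<Sum>v\<in>X. (?\<beta> + 2 * \<eta>) * ?X)"
        using q(4) by (intro sum_mono deg) (auto simp: T_def)
      also have "\<dots> = real p * ((?\<beta> + 2 * \<eta>) * ?X)" by (simp add: p_def)
      finally have E2: "real (card ?E2) \<le> real p * ((?\<beta> + 2 * \<eta>) * ?X)" .
      obtain j where j: "r = Suc j" using r2 by (cases r) auto
      have bin: "(n1 choose r) \<le> (n choose r)" "((n - t) choose r) \<le> (n choose r)"
        using binomial_mono_left[of n1 r "n - n1"] binomial_mono_left[of "n - t" r t] n1(4) tn by auto
      have "real (card E) \<le> real (card ?E1 + card ?E2 + card ER)" using cE by (rule of_nat_mono)
      moreover have "real (card ?E1) \<le> real (n choose r) - real (n1 choose r)"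
        using E1 bin(1) unfolding cA n1_def[symmetric] by (simp add: of_nat_diff)
      moreover have "real (card ER) \<le> real (tau l r (card R))" using leR by simp
      moreover have "real (n choose r) - real ((n - t) choose r) + real (tau l r (n - t)) \<le> real (card E)"
        using big bin(2) unfolding join_size_def by linarith
      ultimately have main: "real (n1 choose r) - real ((n - t) choose r)
          \<le> real p * ((?\<beta> + 2 * \<eta>) * ?X) + real (tau l r (card R)) - real (tau l r (n - t))"
        using E2 by simp
      have "n - t + k = n1" using sk tn by (simp add: n1_def)
      \<comment> \<open>The target has \<open>k\<close> more full vertices, each worth at least
        \<open>(n - t) choose (r - 1)\<close> edges.\<close>
      then have "k * ((n - t) choose j) + ((n - t) choose r) \<le> n1 choose r"
        using binomial_add_ge[of k "n - t" j] unfolding j by (simp only:)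
      then have "real (k * ((n - t) choose j) + ((n - t) choose r)) \<le> real (n1 choose r)" by (rule of_nat_mono)
      then have low1: "real k * real ((n - t) choose j) \<le> real (n1 choose r) - real ((n - t) choose r)" by simp
      have jn: "j \<le> n - t" "(1 - 2 * c) * ?x \<le> real (n - t) - real j"
      proof -
        have a: "real (n - t) = ?x - real t" using tn by simp
        show b: "(1 - 2 * c) * ?x \<le> real (n - t) - real j" using a t cxr j by (simp add: algebra_simps)
        have "0 \<le> (1 - 2 * c) * ?x" using c1 by simp
        then show "j \<le> n - t" using b by linarith
      qed
      have "(1 / fact j - \<eta>) * ?X \<le> real ((n - t) choose j)"
      proof -
        have "1 + real j * (- (2 * c)) \<le> (1 + (- (2 * c))) ^ j" by (rule Bernoulli_inequality) (use c1 in simp)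
        moreover have "real j * c \<le> real r * c" using c j by (intro mult_right_mono) auto
        ultimately have "1 - \<eta> \<le> (1 - 2 * c) ^ j" using rc(3) by simp
        moreover have "1 / fact j - \<eta> \<le> (1 - \<eta>) / (fact j :: real)"
        proof -
          have "\<eta> / fact j \<le> \<eta> / 1" using \<eta>(1) fact_ge_1[of j] by (intro divide_left_mono) auto
          then show ?thesis by (simp add: diff_divide_distrib)
        qed
        ultimately have "1 / fact j - \<eta> \<le> (1 - 2 * c) ^ j / fact j"
          by (meson divide_right_mono fact_ge_zero order_trans)
        then have "(1 / fact j - \<eta>) * ?X \<le> (1 - 2 * c) ^ j / fact j * ?X" by (rule mult_right_mono) simp
        also have "\<dots> = ((1 - 2 * c) * ?x) ^ j / fact j" using j by (simp add: power_mult_distrib)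
        also have "\<dots> \<le> (real (n - t) - real j) ^ j / fact j"
          using jn(2) c1 by (intro divide_right_mono power_mono) auto
        also have "\<dots> \<le> real ((n - t) choose j)" by (rule binomial_ge_pow[OF jn(1)])
        finally show ?thesis .
      qed
      then have "real k * ((1 / fact j - \<eta>) * ?X) \<le> real k * real ((n - t) choose j)" by (rule mult_left_mono) simp
      then have low: "real k * ((1 / fact j - \<eta>) * ?X)
          \<le> real p * ((?\<beta> + 2 * \<eta>) * ?X) - real p * ((?\<beta> - 2 * \<eta>) * ?X) + real k * (?\<beta> + \<eta>) * ?X"
        using low1 main t1' t2' by linarith
      \<comment> \<open>The \<open>beta\<close> terms cancel: a vertex of \<open>X\<close> exceeds
        the Turan increment it replaces by at most \<open>4 * \<eta>\<close>, and
        \<open>p \<le> k * m\<close>.\<close>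
      have "real p * ((?\<beta> + 2 * \<eta>) * ?X) - real p * ((?\<beta> - 2 * \<eta>) * ?X) = real p * (4 * \<eta> * ?X)" by (simp add: algebra_simps)
      also have "\<dots> \<le> real k * ?M * (4 * \<eta> * ?X)" using rp \<eta>(1) by (intro mult_right_mono) auto
      finally have "real k * ((1 / fact j - \<eta>) * ?X) \<le> real k * ?M * (4 * \<eta> * ?X) + real k * (?\<beta> + \<eta>) * ?X"
        using low by linarith
      then have "(real k * ?X) * (1 / fact j - \<eta>) \<le> (real k * ?X) * (4 * ?M * \<eta> + (?\<beta> + \<eta>))"
        by (simp add: algebra_simps)
      moreover have "0 < real k * ?X" using kpos X0 by simp
      ultimately have "1 / fact j - \<eta> \<le> 4 * ?M * \<eta> + (?\<beta> + \<eta>)" by (simp only: mult_le_cancel_left_pos)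
      moreover have "1 / fact j = \<gamma> + ?\<beta>" by (simp add: \<gamma>_def j)
      ultimately show False using \<eta>' by (simp add: algebra_simps)
    qed
    have X0: "X = {}" using pk k0 q(2) by (simp add: p_def)
    have st: "s = t" using sk k0 by simp
    have cE2: "?E2 = {}" using X0 by simp
    have cR': "card R = n - t" using cR X0 st by (simp add: p_def)
    have "card E \<le> card ?E1 + card ER" using cE by (simp add: cE2)
    moreover have "join_size r l t n = card ?A + tau l r (card R)" unfolding join_size_def cA cR' st ..
    \<comment> \<open>With \<open>X\<close> empty both parts of the count are at most their targets
      while the total reaches the sum, so both are attained.\<close>
    ultimately have eqs: "card ?E1 = card ?A" "card ER = tau l r (card R)" "card E = join_size r l t n"
      using E1 leR big by linarith+
    have EA: "?E1 = ?A" by (rule card_subset_eq[OF fA E1A eqs(1)])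
    obtain P where P: "disjoint_family_on P {..<l}" "(\<Union>i<l. P i) = R" "ER = cross P {..<l} r"
      "balanced l (\<lambda>i. card (P i))" using Nt[OF GR freeR nR] eqs(2) by auto
    have "E = ?E1 \<union> ER" by (auto simp: ER_def X0)
    then have "E = ?A \<union> cross P {..<l} r" unfolding EA P(3)[symmetric] .
    moreover have "R = V - T" by (simp add: R_def X0)
    ultimately have "turan_join r l t n (V, E)"
      unfolding turan_join_def using fV cV TV(1) st P(1,2,4)
      by (intro conjI exI[of _ T] exI[of _ P]) (auto simp: s_def)
    then show "card (edges G) = join_size r l t n" "turan_join r l t n G" using eqs(3) GVE by auto
  qed
qed

lemma extremal_classes_eq:
  "\<exists>(N0 :: nat) (c :: real). c > 0 \<and> (\<forall>(n :: nat) (t :: nat). n \<ge> N0 \<and> real t \<le> c * real n \<longrightarrow>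
     extremal_classes r n (t + 1) H
       = {iso_class (hjoin r (complete_rgraph r t) (turan_rgraph r (n - t) l))})"
proof -
  obtain N c where c: "0 < c" and str: "\<And>n t (G :: nat hgraph). N \<le> n \<Longrightarrow> real t \<le> c * real n \<Longrightarrow>
    rgraph r G \<Longrightarrow> card (verts G) = n \<Longrightarrow> \<not> contains_disjoint_copies (Suc t) H G \<Longrightarrow>
    join_size r l t n \<le> card (edges G) \<Longrightarrow> card (edges G) = join_size r l t n \<and> turan_join r l t n G"
    using extremal_structure
    by - (elim exE conjE, rule that, assumption, (drule spec)+, (drule mp, assumption)+, assumption)
  show ?thesis
  \<comment> \<open>Capping \<open>c\<close> at 1 guarantees \<open>t \<le> n\<close>.\<close>
  proof (rule exI[of _ N], rule exI[of _ "min c 1"], intro conjI allI impI)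
    show "min c 1 > 0" using c by simp
    fix n t :: nat assume "n \<ge> N \<and> real t \<le> min c 1 * real n"
    then have n: "N \<le> n" and t: "real t \<le> min c 1 * real n" by auto
    have "min c 1 * real n \<le> c * real n" "min c 1 * real n \<le> 1 * real n" by (rule mult_right_mono; simp)+
    then have tc: "real t \<le> c * real n" and tn: "t \<le> n" using t by linarith+
    let ?K = "hjoin r (complete_rgraph r t) (turan_rgraph r (n - t) l)"
    let ?F = "copies_free r n (t + 1) H"
    let ?S = "{G \<in> ?F. \<forall>G'\<in>?F. card (edges G') \<le> card (edges G)}"
    have K: "turan_join r l t n ?K" by (rule turan_join_hjoin[OF r2 l0(1) tn])
    \<comment> \<open>The join lives on a sum type, whereas competitors have vertices in
      \<open>nat\<close>; this isomorphic copy attains the maximum.\<close>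
    obtain G0 :: "nat hgraph" where G0: "turan_join r l t n G0" by (rule turan_join_exists[OF l0(1) tn]) blast
    have G0F: "G0 \<in> ?F"
      using turan_join_rgraph[OF G0] turan_join_no_copies[OF G0] G0 by (auto simp: copies_free_def turan_join_def)
    have le: "card (edges G) \<le> join_size r l t n" if G: "G \<in> ?F" for G
    proof (rule ccontr)
      assume "\<not> ?thesis"
      moreover have "rgraph r G" "card (verts G) = n" "\<not> contains_disjoint_copies (Suc t) H G"
        using G by (auto simp: copies_free_def)
      ultimately show False using str[OF n tc, of G] by linarith
    qed
    have G0S: "G0 \<in> ?S" using G0F le card_turan_join[OF G0 l0(1)] by auto
    have iso: "iso_class G = iso_class ?K" if G: "G \<in> ?S" for G
    proof -
      have GF: "rgraph r G" "card (verts G) = n" "\<not> contains_disjoint_copies (Suc t) H G"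
        using G by (auto simp: copies_free_def)
      have "card (edges G0) \<le> card (edges G)" using G G0F by blast
      then have "turan_join r l t n G" using str[OF n tc GF] card_turan_join[OF G0 l0(1)] by simp
      then have i: "isomorphic G ?K" "isomorphic ?K G"
        using turan_join_isomorphic K l0(1) by blast+
      have eq: "isomorphic G Q \<longleftrightarrow> isomorphic ?K Q" for Q :: "nat hgraph"
        using isomorphic_trans[OF i(1), of Q] isomorphic_trans[OF i(2), of Q] by auto
      show ?thesis unfolding iso_class_def by (rule Collect_cong[OF eq])
    qed
    show "extremal_classes r n (t + 1) H = {iso_class ?K}"
      unfolding extremal_classes_def
    proof
      show "iso_class ` ?S \<subseteq> {iso_class ?K}" using iso by blast
      show "{iso_class ?K} \<subseteq> iso_class ` ?S" using iso[OF G0S] G0S by (metis (no_types, lifting) empty_subsetI image_eqI insert_subset)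
    qed
  qed
qed

end

section \<open>From membership in the family to the labelling and the theorem\<close>

lemma B_rgraph_labelling:
  assumes F: "rgraph r F" "card (verts F) = Suc l"
    and iso: "has_isolated_vertex F \<or> contains (B_rgraph r (Suc l)) F"
  obtains \<phi> where "bij_betw \<phi> (verts F) {..l}" "\<And>e. e \<in> edges F \<Longrightarrow> \<phi> ` e = {..<r} \<or> \<phi> ` e \<subseteq> {1..l}"
  using iso
proof
  assume "has_isolated_vertex F"
  then obtain v where v: "v \<in> verts F" "\<And>e. e \<in> edges F \<Longrightarrow> v \<notin> e" by (auto simp: has_isolated_vertex_def)
  have fF: "finite (verts F)" using F by (simp add: rgraph_def)
  have "card (verts F - {v}) = card {1..l}" using F(2) v(1) by simp
  then obtain g where g: "bij_betw g (verts F - {v}) {1..l}" using finite_same_card_bij[of "verts F - {v}" "{1..l}"] fF by auto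
  \<comment> \<open>The isolated vertex receives label 0, which then occurs in no edge.\<close>
  let ?\<phi> = "g(v := 0)"
  have "bij_betw ?\<phi> (verts F - {v}) {1..l}" using g by (rule bij_betw_cong[THEN iffD1, rotated]) auto
  moreover have "bij_betw ?\<phi> {v} {0}" by (simp add: bij_betw_def)
  ultimately have "bij_betw ?\<phi> ((verts F - {v}) \<union> {v}) ({1..l} \<union> {0})" by (rule bij_betw_combine) auto
  moreover have "(verts F - {v}) \<union> {v} = verts F" "{1..l} \<union> {0} = {..l}" using v(1) by auto
  ultimately have b: "bij_betw ?\<phi> (verts F) {..l}" by simp
  have "?\<phi> ` e \<subseteq> {1..l}" if e: "e \<in> edges F" for e
  proof -
    have "e \<subseteq> verts F - {v}" using F(1) e v(2)[OF e] by (auto simp: rgraph_def)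
    then show ?thesis using g by (auto simp: bij_betw_def)
  qed
  then show ?thesis using that[OF b] by blast
next
  assume "contains (B_rgraph r (Suc l)) F"
  then obtain f where f: "embeds f F (B_rgraph r (Suc l))" by (auto simp: contains_def)
  have inj: "inj_on f (verts F)" and sub: "f ` verts F \<subseteq> {1..Suc l}"
    and "\<And>e. e \<in> edges F \<Longrightarrow> f ` e \<in> edges (B_rgraph r (Suc l))"
    using f by (simp_all add: embeds_def B_rgraph_def)
  then have ed: "f ` e = {1..r} \<or> f ` e \<subseteq> {2..Suc l}" if "e \<in> edges F" for e
    using that unfolding B_rgraph_def by (simp add: Un_iff) blast
  have "f ` verts F = {1..Suc l}" using sub inj F(2) by (intro card_subset_eq) (auto simp: card_image)
  then have bf: "bij_betw f (verts F) {1..Suc l}" using inj by (simp add: bij_betw_def)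
  \<comment> \<open>The embedding is onto by cardinality; lowering labels by one turns
    \<open>{1..r}\<close> into \<open>{..<r}\<close> and \<open>{2..Suc l}\<close> into
    \<open>{1..l}\<close>.\<close>
  have bp: "bij_betw (\<lambda>i. i - 1) {1..Suc l} {..l}" by (rule bij_betw_byWitness[of _ Suc]) auto
  have "bij_betw ((\<lambda>i. i - 1) \<circ> f) (verts F) {..l}" by (rule bij_betw_trans[OF bf bp])
  moreover have "((\<lambda>i. i - 1) \<circ> f) ` e = {..<r} \<or> ((\<lambda>i. i - 1) \<circ> f) ` e \<subseteq> {1..l}" if e: "e \<in> edges F" for e
    using ed[OF e]
  proof
    assume "f ` e = {1..r}"
    then have "((\<lambda>i. i - 1) \<circ> f) ` e = (\<lambda>i. i - 1) ` {1..r}" by (simp only: image_comp[symmetric])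
    also have "\<dots> = {..<r}"
    proof (intro set_eqI iffI)
      fix i assume "i \<in> {..<r}"
      then show "i \<in> (\<lambda>i. i - 1) ` {1..r}" by (intro image_eqI[of _ _ "Suc i"]) auto
    qed auto
    finally show ?thesis by simp
  next
    assume "f ` e \<subseteq> {2..Suc l}"
    then have "((\<lambda>i. i - 1) \<circ> f) ` e \<subseteq> (\<lambda>i. i - 1) ` {2..Suc l}" unfolding image_comp[symmetric] by (rule image_mono)
    also have "\<dots> \<subseteq> {1..l}" by auto
    finally show ?thesis by simp
  qed
  ultimately show ?thesis using that by blast
qed

theorem theorem2p8:
  fixes r l :: nat and F :: "'a hgraph"
  assumes "r \<ge> 2" and "l \<ge> r" and "F \<in> F_family r (l + 1)"
  shows "\<exists>(N0 :: nat) (c :: real). c > 0 \<and>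
           (\<forall>(n :: nat) (t :: nat). n \<ge> N0 \<and> real t \<le> c * real n \<longrightarrow>
              extremal_classes r n (t + 1) (expansion r F)
                = {iso_class (hjoin r (complete_rgraph r t) (turan_rgraph r (n - t) l))})"
proof -
  let ?S = "{ereal (lagrangian r Q) | Q :: nat hgraph.
    rgraph r Q \<and> \<not> contains Q F \<and> \<not> is_subconstruction r (complete_rgraph r l) Q}"
  have F: "rgraph r F" "card (verts F) = Suc l" "has_isolated_vertex F \<or> contains (B_rgraph r (Suc l)) F"
    and S: "Sup ?S < ereal ((\<Prod>i<r. real l - real i) / real l ^ r)"
    using assms(3) unfolding F_family_def by auto
  \<comment> \<open>A real number strictly in between is chosen because the supremum itself may be
    minus infinity.\<close>
  obtain lam where lam: "Sup ?S < ereal lam" "ereal lam < ereal ((\<Prod>i<r. real l - real i) / real l ^ r)"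
    using ereal_dense2[OF S] by blast
  obtain \<phi> where \<phi>: "bij_betw \<phi> (verts F) {..l}" "\<And>e. e \<in> edges F \<Longrightarrow> \<phi> ` e = {..<r} \<or> \<phi> ` e \<subseteq> {1..l}"
    by (rule B_rgraph_labelling[OF F]) blast
  interpret expansion_family r l F \<phi> lam
  proof
    show "lam < fact r * alpha l r" using lam(2) fact_alpha[OF assms(2)] by simp
    fix Q :: "nat hgraph"
    assume "rgraph r Q" "\<not> contains Q F" "\<not> is_subconstruction r (complete_rgraph r l) Q"
    then have "ereal (lagrangian r Q) \<in> ?S" by blast
    then have "ereal (lagrangian r Q) \<le> Sup ?S" by (rule Sup_upper)
    then have "ereal (lagrangian r Q) \<le> ereal lam" using lam(1) by (meson less_imp_le order_trans)
    then show "lagrangian r Q \<le> lam" by simp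
  qed (use assms F \<phi> in auto)
  show ?thesis by (rule extremal_classes_eq)
qed

end
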